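(* Let $\Bbbk$ be a field of characteristic $0$. Let $\mathfrak{S}\mathit{Sym}$ be the Malvenuto-Reutenauer Hopf algebra of permutations over $\Bbbk$ with its monomial basis $\{M_w\}$, let $\mathrm{gr}(\mathfrak{S}\mathit{Sym})$ be the Hopf algebra associated to its coradical filtration, and let $\mathrm{gr}(\mathfrak{S}\mathit{Sym})^*$ be its graded dual with respect to the grading in which a permutation of $n$ letters has degree $n$, with dual basis $\{M_w^*\}$. Let $\mathcal{H}_{HO}$ be the Grossman-Larson Hopf algebra of heap-ordered trees over $\Bbbk$, graded by one less than the number of nodes, and let $\mathbf{e}:\mathcal{H}_{HO}\to\mathcal{H}_{HO}$ be its first Eulerian idempotent. Then there is an isomorphism of graded Hopf algebras $$\Phi:\mathrm{gr}(\mathfrak{S}\mathit{Sym})^*\to\mathcal{H}_{HO}$$ uniquely determined by $$\Phi(M_w^* )=\mathbf{e}\bigl(\phi(w)\bigr)$$ for all $\backslash$-irreducible permutations $w$, where $\phi$ is the bijection from permutations to heap-ordered trees described in the context.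
   Context: **Permutations.** Permutations are written as words $w(1)\cdots w(n)$. For permutations $u$ of $[p]$ and $v$ of $[q]$, $u\backslash v$ is the permutation of $[p+q]$ obtained by listing the values of $u$, each incremented by $q$, followed by the values of $v$. A permutation of $[n]$, $n\ge1$, is $\backslash$-irreducible if it is not $u\backslash v$ with $u,v$ both nonempty. Every permutation $w$ has a unique decomposition $w=w_1\backslash\cdots\backslash w_k$ into $\backslash$-irreducible ones; $k$ is its number of irreducible components ($k=0$ for the empty permutation). **The Hopf algebra $\mathfrak{S}\mathit{Sym}$.** It has a linear basis $F_w$ indexed by all permutations $w\in S_n$, $n\ge0$. Product: for $u\in S_p$, $v\in S_q$, $F_u\cdot F_v$ is the sum of $F_w$ over all $\binom{p+q}{p}$ shuffles $w$ of the words $u(1)\cdots u(p)$ and $(v(1)+p)\cdots(v(q)+p)$. Coproduct: $\Delta(F_w)=\sum_{p=0}^nF_{\mathrm{st}(w(1)\cdots w(p))}\otimes F_{\mathrm{st}(w(p+1)\cdots w(n))}$, where $\mathrm{st}$ is standardization. Unit $F_\emptyset$; counit the coefficient of $F_\emptyset$. It is a Hopf algebra graded by $n$. The weak order on $S_n$ is: $u\le v$ iff $\mathrm{Inv}(u)\subseteq\mathrm{Inv}(v)$, where $\mathrm{Inv}(u)=\{(i,j): i<j,\ u(i)>u(j)\}$. With $\mu$ the Möbius function of this poset, the monomial basis is $M_u:=\sum_{v\ge u}\mu(u,v)F_v$. **Coradical filtration and associated graded.** For a Hopf algebra $H$ which is connected as a coalgebra, $F^0(H)=\Bbbk\cdot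 1$, and $F^k(H)$ consists of those $h\in H$ such that every term of $\Delta^{(k)}(h)\in H^{\otimes(k+1)}$ has a tensor factor from $F^0(H)$, i.e. $\Delta^{(k)}(h)\in\sum_{i=0}^{k}H^{\otimes i}\otimes F^0(H)\otimes H^{\otimes(k-i)}$. Then $\mathrm{gr}(H)=\bigoplus_{k\ge0}F^k(H)/F^{k-1}(H)$ (with $F^{-1}(H)=0$), with the induced product and coproduct, is a Hopf algebra. Known facts: $\mathfrak{S}\mathit{Sym}$ is a cofree graded coalgebra, with $\Delta(M_w)=\sum_{w=u\backslash v}M_u\otimes M_v$; $F^k(\mathfrak{S}\mathit{Sym})$ is spanned by the $M_w$ for which $w$ has at most $k$ irreducible components. Hence the classes of the $M_w$ (in $F^k/F^{k-1}$, $k$ the number of irreducible components of $w$), still denoted $M_w$, form a basis of $\mathrm{gr}(\mathfrak{S}\mathit{Sym})$. $\mathrm{gr}(\mathfrak{S}\mathit{Sym})$ is a graded Hopf algebra with finite-dimensional components for the grading in which $M_w$, $w\in S_n$, has degree $n$; its graded dual is taken with respect to this grading, and $\{M_w^*\}$ is the basis dual to $\{M_w\}$. **Heap-ordered trees and $\mathcal{H}_{HO}$.** An ordered tree is a finite rooted tree with a left-to-right linear order on the children of each node; it is planted if its root has exactly one child. The planted components $x_1,\dots,x_k$ of $x$, listed from left to right, are the branches at the root of $x$ (each including the root). A heap-ordered tree is an ordered tree $x$ with a bijective labeling of its set of nodes $\mathrm{Nod}(x)$ by $\{0,1,\dots,n\}$ such that the root has label $0$, labels increase from a node to any of its children, and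 labels decrease from left to right among the children of each node. For heap-ordered trees $x,y$, $x$ with $k$ planted components, and $f:[k]=\{1,\dots,k\}\to\mathrm{Nod}(y)$, $x\,\#_f\,y$ is obtained by identifying the root of each $x_i$ with the node $f(i)$ of $y$ (keeping the order of components attached to the same node and placing them to the left of the children of that node in $y$), keeping the labels of $y$ and incrementing the (non-root) labels of $x$ by the highest label of $y$. For $S\subseteq[k]$, $x_S$ is the tree obtained by erasing the branches at the root of $x$ not indexed by $S$ and standardizing the labels (the root keeps label $0$, the $i$-th smallest remaining non-root label is replaced by $i$); $S^c=[k]\setminus S$. $\mathcal{H}_{HO}$ is the vector space with basis the heap-ordered trees, with $$x\cdot y=\sum_{f:[k]\to\mathrm{Nod}(y)}x\,\#_f\,y,\qquad \Delta(x)=\sum_{S\subseteq[k]}x_S\otimes x_{S^c}.$$ It is a graded connected cocommutative Hopf algebra, the degree being one less than the number of nodes. **The bijection $\phi$** from permutations of $[n]$ to heap-ordered trees with $n+1$ nodes: given $u$, set $u(0)=0$. Start with a root labeled $0$ (step $0$). For $i=1,\dots,n$ successively (step $i$), draw a new node labeled $u(i)$ as a child of the node drawn in step $j$, where $j\in\{0,\dots,i-1\}$ is the maximum index with $u(i)>u(j)$, placing it to the right of any previous children of that node. **First Eulerian idempotent.** For a graded connected Hopf algebra $H$ over a field of characteristic $0$, let $1\in\mathrm{End}(H)$ denote the composite of counit and unit (the unit for the convolution product $\ast$). Then $\mathbf{e}:=\log(\mathrm{id})=\sum_{n\ge1}\frac{(-1)^{n+1}}{n}(\mathrm{id}-1)^{\ast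 n}$, a well-defined linear endomorphism of $H$ (the sum is finite on each element). *)

theory Defs
  imports Complex_Main "HOL-Library.Poly_Mapping" "HOL-Library.FuncSet"
begin

section \<open>Vector spaces with a basis, and tensors\<close>

text \<open>The vector space with basis \<open>'b\<close> is \<open>'b \<Rightarrow>\<^sub>0 'k\<close>; the basis vector of \<open>b\<close> is
  \<open>Poly_Mapping.single b 1\<close>.  The multiplication that Poly_Mapping puts on this type is not used.\<close>

definition smul :: "'k::field \<Rightarrow> ('b \<Rightarrow>\<^sub>0 'k) \<Rightarrow> ('b \<Rightarrow>\<^sub>0 'k)" where
  "smul c x = Poly_Mapping.map ((*) c) x"

abbreviation bas :: "'b \<Rightarrow> ('b \<Rightarrow>\<^sub>0 'k::field)" where
  "bas b \<equiv> Poly_Mapping.single b 1"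

text \<open>Linear extension of \<open>f\<close> from basis vectors; \<open>s\<close> is the scalar multiplication of the target.\<close>

definition lin_ext :: "('k::field \<Rightarrow> 'v \<Rightarrow> 'v::ab_group_add) \<Rightarrow> ('b \<Rightarrow> 'v) \<Rightarrow> ('b \<Rightarrow>\<^sub>0 'k) \<Rightarrow> 'v" where
  "lin_ext s f x = (\<Sum>b\<in>Poly_Mapping.keys x. s (Poly_Mapping.lookup x b) (f b))"

lemma lookup_smul [simp]: "Poly_Mapping.lookup (smul c x) b = c * Poly_Mapping.lookup x b"
  by (simp add: smul_def Poly_Mapping.map.rep_eq when_def)

lemma vector_space_smul: "vector_space (smul :: 'k::field \<Rightarrow> ('b \<Rightarrow>\<^sub>0 'k) \<Rightarrow> _)"
  by unfold_locales
    (auto intro!: poly_mapping_eqI simp: lookup_add algebra_simps)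

interpretation smul: vector_space "smul :: 'k::field \<Rightarrow> ('b \<Rightarrow>\<^sub>0 'k) \<Rightarrow> _"
  by (rule vector_space_smul)

lemma lin_ext_superset:
  assumes "vector_space s" "finite A" "Poly_Mapping.keys x \<subseteq> A"
  shows "lin_ext s f x = (\<Sum>b\<in>A. s (Poly_Mapping.lookup x b) (f b))"
proof -
  interpret vector_space s by fact
  show ?thesis
    unfolding lin_ext_def using assms(2,3)
    by (intro sum.mono_neutral_left) (auto simp: in_keys_iff)
qed

lemma lin_ext_add:
  assumes "vector_space s"
  shows "lin_ext s f (x + y) = lin_ext s f x + lin_ext s f y"
proof -
  interpret vector_space s by fact
  let ?A = "Poly_Mapping.keys x \<union> Poly_Mapping.keys y"
  have "lin_ext s f z = (\<Sum>b\<in>?A. s (Poly_Mapping.lookup z b) (f b))" if "z \<in> {x, y, x + y}" for z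
    using that Poly_Mapping.keys_add[of x y] by (intro lin_ext_superset[OF assms]) auto
  then show ?thesis
    by (simp add: lookup_add scale_left_distrib sum.distrib)
qed

lemma lin_ext_smul:
  assumes "vector_space s"
  shows "lin_ext s f (smul c x) = s c (lin_ext s f x)"
proof -
  interpret vector_space s by fact
  have "Poly_Mapping.keys (smul c x) \<subseteq> Poly_Mapping.keys x"
    by (auto simp: in_keys_iff)
  then show ?thesis
    by (simp add: lin_ext_superset[OF assms, of "Poly_Mapping.keys x"] scale_sum_right)
qed

lemma lin_ext_single [simp]:
  assumes "vector_space s"
  shows "lin_ext s f (Poly_Mapping.single b c) = s c (f b)"
proof -
  interpret vector_space s by fact
  show ?thesis by (simp add: lin_ext_superset[OF assms, of "{b}"])
qed

lemma lin_ext_diff: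
  assumes "vector_space s"
  shows "lin_ext s f (x - y) = lin_ext s f x - lin_ext s f y"
  using lin_ext_add[OF assms, of f "x - y" y] by simp

text \<open>An element of \<open>V\<^sup>\<otimes>\<^sup>n\<close> is represented by a formal linear combination of words of length \<open>n\<close>
  over \<open>V\<close>, the word \<open>[v\<^sub>1, \<dots>, v\<^sub>n]\<close> standing for \<open>v\<^sub>1 \<otimes> \<dots> \<otimes> v\<^sub>n\<close>.  Two formal combinations
  represent the same tensor iff their difference lies in the span of the multilinearity
  relations.  (Words over \<open>V\<close> are used, not words over a basis of \<open>V\<close>.)\<close>

type_synonym ('v, 'k) tensor = "'v list \<Rightarrow>\<^sub>0 'k"

definition tensor_rel :: "('k::field \<Rightarrow> 'v \<Rightarrow> 'v::ab_group_add) \<Rightarrow> ('v, 'k) tensor set" where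
  "tensor_rel s = module.span smul
     ({bas (xs @ (a + b) # ys) - bas (xs @ a # ys) - bas (xs @ b # ys) | xs a b ys. True}
      \<union> {bas (xs @ s c a # ys) - smul c (bas (xs @ a # ys)) | xs c a ys. True})"

definition tensor_eq :: "('k::field \<Rightarrow> 'v \<Rightarrow> 'v::ab_group_add) \<Rightarrow> ('v, 'k) tensor \<Rightarrow> ('v, 'k) tensor \<Rightarrow> bool" where
  "tensor_eq s t u \<longleftrightarrow> t - u \<in> tensor_rel s"

definition tensor_map :: "('v \<Rightarrow> 'w) \<Rightarrow> ('v, 'k::field) tensor \<Rightarrow> ('w, 'k) tensor" where
  "tensor_map f = lin_ext smul (\<lambda>l. bas (map f l))"

section \<open>Hopf algebra data\<close>

text \<open>The structure maps of a graded Hopf algebra whose underlying vector space is the whole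
  type \<open>'v\<close>.  The coproduct returns a representative of a tensor in \<open>V \<otimes> V\<close>; \<open>hdeg n\<close> is the
  homogeneous component of degree \<open>n\<close>.\<close>

record (overloaded) ('v, 'k) hopf =
  hscale :: "'k::field \<Rightarrow> 'v::ab_group_add \<Rightarrow> 'v"
  hmult :: "'v \<Rightarrow> 'v \<Rightarrow> 'v"
  hone :: "'v"
  hcomult :: "'v \<Rightarrow> ('v, 'k) tensor"
  hcounit :: "'v \<Rightarrow> 'k"
  hdeg :: "nat \<Rightarrow> 'v set"

definition graded_hopf_iso ::
  "('v::ab_group_add, 'k::field) hopf \<Rightarrow> ('w::ab_group_add, 'k) hopf \<Rightarrow> ('v \<Rightarrow> 'w) \<Rightarrow> bool" where
  "graded_hopf_iso A B \<Phi> \<longleftrightarrow>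
     Vector_Spaces.linear (hscale A) (hscale B) \<Phi> \<and> bij \<Phi> \<and>
     \<Phi> (hone A) = hone B \<and>
     (\<forall>x y. \<Phi> (hmult A x y) = hmult B (\<Phi> x) (\<Phi> y)) \<and>
     (\<forall>x. hcounit B (\<Phi> x) = hcounit A x) \<and>
     (\<forall>x. tensor_eq (hscale B) (tensor_map \<Phi> (hcomult A x)) (hcomult B (\<Phi> x))) \<and>
     (\<forall>n. \<Phi> ` hdeg A n = hdeg B n)"

definition convolution ::
  "('v::ab_group_add, 'k::field) hopf \<Rightarrow> ('v \<Rightarrow> 'v) \<Rightarrow> ('v \<Rightarrow> 'v) \<Rightarrow> 'v \<Rightarrow> 'v" where
  "convolution H f g x = lin_ext (hscale H) (\<lambda>l. hmult H (f (l ! 0)) (g (l ! 1))) (hcomult H x)"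

definition conv_unit :: "('v::ab_group_add, 'k::field) hopf \<Rightarrow> 'v \<Rightarrow> 'v" where
  "conv_unit H x = hscale H (hcounit H x) (hone H)"

fun conv_power :: "('v::ab_group_add, 'k::field) hopf \<Rightarrow> ('v \<Rightarrow> 'v) \<Rightarrow> nat \<Rightarrow> 'v \<Rightarrow> 'v" where
  "conv_power H f 0 = conv_unit H"
| "conv_power H f (Suc n) = convolution H f (conv_power H f n)"

text \<open>\<open>Sum_any\<close> is the sum over the finitely many indices with a nonzero term.
  The index \<open>n\<close> below is one less than the exponent.\<close>

definition eulerian_idem :: "('v::ab_group_add, 'k::field_char_0) hopf \<Rightarrow> 'v \<Rightarrow> 'v" where
  "eulerian_idem H x =
     Sum_any (\<lambda>n. hscale H ((- 1) ^ n / of_nat (Suc n))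
                    (conv_power H (\<lambda>y. y - conv_unit H y) (Suc n) x))"

text \<open>\<open>iter_comult H k\<close> is \<open>\<Delta>\<^sup>(\<^sup>k\<^sup>) : H \<rightarrow> H\<^sup>\<otimes>\<^sup>(\<^sup>k\<^sup>+\<^sup>1\<^sup>)\<close>; each step applies \<open>\<Delta>\<close> to the first factor.\<close>

fun iter_comult :: "('v::ab_group_add, 'k::field) hopf \<Rightarrow> nat \<Rightarrow> 'v \<Rightarrow> ('v, 'k) tensor" where
  "iter_comult H 0 x = bas [x]"
| "iter_comult H (Suc k) x =
     lin_ext smul (\<lambda>l. lin_ext smul (\<lambda>p. bas (p @ tl l)) (hcomult H (hd l))) (iter_comult H k x)"

definition coradical0 :: "('v::ab_group_add, 'k::field) hopf \<Rightarrow> 'v set" where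
  "coradical0 H = {hscale H c (hone H) | c. True}"

definition coradical :: "('v::ab_group_add, 'k::field) hopf \<Rightarrow> nat \<Rightarrow> 'v set" where
  "coradical H k = (if k = 0 then coradical0 H else
     {h. \<exists>t \<in> module.span smul {bas l | l. length l = k + 1 \<and> (\<exists>i\<le>k. l ! i \<in> coradical0 H)}.
           tensor_eq (hscale H) (iter_comult H k h) t})"

text \<open>\<open>coradical_pred H k\<close> is \<open>F\<^sup>k\<^sup>-\<^sup>1(H)\<close>, with \<open>F\<^sup>-\<^sup>1(H) = 0\<close>.\<close>

definition coradical_pred :: "('v::ab_group_add, 'k::field) hopf \<Rightarrow> nat \<Rightarrow> 'v set" where
  "coradical_pred H k = (case k of 0 \<Rightarrow> {0} | Suc j \<Rightarrow> coradical H j)"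

section \<open>Permutations\<close>

typedef perm = "{w :: nat list. distinct w \<and> set w = {1..length w}}"
  by (rule exI[of _ "[]"]) simp

abbreviation word :: "perm \<Rightarrow> nat list" where "word \<equiv> Rep_perm"

definition psize :: "perm \<Rightarrow> nat" where "psize w = length (word w)"

definition perm_empty :: perm where "perm_empty = Abs_perm []"

definition backslash :: "perm \<Rightarrow> perm \<Rightarrow> perm" where
  "backslash u v = Abs_perm (map (\<lambda>x. x + psize v) (word u) @ word v)"

definition perm_irreducible :: "perm \<Rightarrow> bool" where
  "perm_irreducible w \<longleftrightarrow>
     psize w \<ge> 1 \<and> \<not> (\<exists>u v. u \<noteq> perm_empty \<and> v \<noteq> perm_empty \<and> w = backslash u v)"

definition num_components :: "perm \<Rightarrow> nat" where
  "num_components w = (THE k. \<exists>ws. length ws = k \<and> (\<forall>u\<in>set ws. perm_irreducible u)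
                                  \<and> w = foldr backslash ws perm_empty)"

definition standardize :: "nat list \<Rightarrow> nat list" where
  "standardize xs = map (\<lambda>x. card {y \<in> set xs. y \<le> x}) xs"

text \<open>Positions in inversions are counted from \<open>0\<close>.\<close>

definition inversions :: "perm \<Rightarrow> (nat \<times> nat) set" where
  "inversions w = {(i, j). i < j \<and> j < psize w \<and> word w ! i > word w ! j}"

definition weak_le :: "perm \<Rightarrow> perm \<Rightarrow> bool" where
  "weak_le u v \<longleftrightarrow> psize u = psize v \<and> inversions u \<subseteq> inversions v"

definition weak_less :: "perm \<Rightarrow> perm \<Rightarrow> bool" where
  "weak_less u v \<longleftrightarrow> weak_le u v \<and> \<not> weak_le v u"

lemma finite_inversions: "finite (inversions w)"
  by (rule finite_subset[of _ "{..<psize w} \<times> {..<psize w}"]) (auto simp: inversions_def)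

function mobius :: "perm \<Rightarrow> perm \<Rightarrow> int" where
  "mobius u v = (if u = v then 1
                 else if weak_less u v then - (\<Sum>z | weak_le u z \<and> weak_less z v. mobius u z)
                 else 0)"
  by auto
termination
proof (relation "Wellfounded.measure (\<lambda>(u, v). card (inversions v))", goal_cases)
  case 1
  show ?case by (rule wf_measure)
next
  case (2 u v z)
  then have "weak_less z v" by blast
  then have "inversions z \<subset> inversions v"
    unfolding weak_less_def weak_le_def less_le_not_le by metis
  then show ?case
    by (simp add: psubset_card_mono finite_inversions)
qed

declare mobius.simps [simp del]

section \<open>The Malvenuto--Reutenauer Hopf algebra\<close>

definition F_mult :: "perm \<Rightarrow> perm \<Rightarrow> (perm \<Rightarrow>\<^sub>0 'k::field)" where
  "F_mult u v = (\<Sum>w \<in> shuffles (word u) (map (\<lambda>x. x + psize u) (word v)). bas (Abs_perm w))"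

definition F_comult :: "perm \<Rightarrow> (perm \<Rightarrow>\<^sub>0 'k::field, 'k) tensor" where
  "F_comult w = (\<Sum>p\<le>psize w. bas [bas (Abs_perm (standardize (take p (word w)))),
                                    bas (Abs_perm (standardize (drop p (word w))))])"

definition SSym :: "(perm \<Rightarrow>\<^sub>0 'k::field, 'k) hopf" where
  "SSym = \<lparr> hscale = smul,
            hmult = (\<lambda>x y. lin_ext smul (\<lambda>u. lin_ext smul (\<lambda>v. F_mult u v) y) x),
            hone = bas perm_empty,
            hcomult = lin_ext smul F_comult,
            hcounit = (\<lambda>x. Poly_Mapping.lookup x perm_empty),
            hdeg = (\<lambda>n. module.span smul {bas w | w. psize w = n}) \<rparr>"

definition M_SSym :: "perm \<Rightarrow> (perm \<Rightarrow>\<^sub>0 'k::field)" where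
  "M_SSym u = (\<Sum>v | weak_le u v. smul (of_int (mobius u v)) (bas v))"

lemma tensor_rel_step:
  fixes H :: "('v::ab_group_add, 'k::field) hopf"
  assumes comult_add: "\<And>a b. hcomult H (a + b) = hcomult H a + hcomult H b"
    and comult_scale: "\<And>c a. hcomult H (hscale H c a) = smul c (hcomult H a)"
    and t: "t \<in> tensor_rel (hscale H)"
  shows "lin_ext smul (\<lambda>l. lin_ext smul (\<lambda>p. bas (p @ tl l)) (hcomult H (hd l))) t
           \<in> tensor_rel (hscale H)" (is "?D t \<in> ?R")
proof -
  note vs = vector_space_smul
  have sub: "smul.subspace ?R"
    unfolding tensor_rel_def by (rule smul.subspace_span)
  have R_add: "bas (xs @ (a + b) # ys) - bas (xs @ a # ys) - bas (xs @ b # ys) \<in> ?R" for xs a b ys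
    unfolding tensor_rel_def by (rule smul.span_base) blast
  have R_scale: "bas (xs @ hscale H c a # ys) - smul c (bas (xs @ a # ys)) \<in> ?R" for xs c a ys
    unfolding tensor_rel_def by (rule smul.span_base) blast
  have R_sum: "lin_ext smul f x \<in> ?R" if "\<And>p. f p \<in> ?R" for f and x :: "'v list \<Rightarrow>\<^sub>0 'k"
    unfolding lin_ext_def
    using that by (intro smul.subspace_sum smul.subspace_scale sub)
  have ext_diff: "lin_ext smul f x - lin_ext smul g x = lin_ext smul (\<lambda>p. f p - g p) x"
    for f g :: "'v list \<Rightarrow> ('v, 'k) tensor" and x
    by (simp add: lin_ext_def sum_subtractf smul.scale_right_diff_distrib)
  have ext_scale: "smul c (lin_ext smul f x) = lin_ext smul (\<lambda>p. smul c (f p)) x"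
    for c and f :: "'v list \<Rightarrow> ('v, 'k) tensor" and x
    by (simp add: lin_ext_def smul.scale_sum_right mult.commute)
  have "smul.subspace {t. ?D t \<in> ?R}"
    by (rule smul.subspaceI)
      (simp_all add: lin_ext_add[OF vs] lin_ext_smul[OF vs] sub smul.subspace_0 smul.subspace_add
        smul.subspace_scale lin_ext_def[of _ _ 0])
  moreover have "?D (bas (xs @ (a + b) # ys) - bas (xs @ a # ys) - bas (xs @ b # ys)) \<in> ?R"
    for xs a b ys
  proof (cases xs)
    case Nil
    then show ?thesis
      by (simp add: lin_ext_diff[OF vs] lin_ext_single[OF vs] comult_add lin_ext_add[OF vs]
          sub smul.subspace_0)
  next
    case (Cons x zs)
    have "bas (p @ zs @ (a + b) # ys) - bas (p @ zs @ a # ys) - bas (p @ zs @ b # ys) \<in> ?R" for p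
      using R_add[of "p @ zs" a b ys] by simp
    then show ?thesis
      by (simp add: Cons lin_ext_diff[OF vs] lin_ext_single[OF vs] ext_diff R_sum)
  qed
  moreover have "?D (bas (xs @ hscale H c a # ys) - smul c (bas (xs @ a # ys))) \<in> ?R"
    for xs c a ys
  proof (cases xs)
    case Nil
    then show ?thesis
      by (simp add: lin_ext_diff[OF vs] lin_ext_single[OF vs] comult_scale lin_ext_smul[OF vs]
          sub smul.subspace_0)
  next
    case (Cons x zs)
    have "bas (p @ zs @ hscale H c a # ys) - smul c (bas (p @ zs @ a # ys)) \<in> ?R" for p
      using R_scale[of "p @ zs" c a ys] by simp
    then show ?thesis
      by (simp add: Cons lin_ext_diff[OF vs] lin_ext_single[OF vs] lin_ext_smul[OF vs]
          ext_diff ext_scale R_sum)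
  qed
  ultimately have "tensor_rel (hscale H) \<subseteq> {t. ?D t \<in> ?R}"
    by (subst tensor_rel_def, intro smul.span_minimal) auto
  with t show ?thesis by blast
qed

lemma iter_comult_linear:
  fixes H :: "('v::ab_group_add, 'k::field) hopf"
  assumes comult_add: "\<And>a b. hcomult H (a + b) = hcomult H a + hcomult H b"
    and comult_scale: "\<And>c a. hcomult H (hscale H c a) = smul c (hcomult H a)"
  shows "tensor_eq (hscale H) (iter_comult H k (x + y)) (iter_comult H k x + iter_comult H k y)"
    and "tensor_eq (hscale H) (iter_comult H k (hscale H c x)) (smul c (iter_comult H k x))"
proof -
  note vs = vector_space_smul
  show "tensor_eq (hscale H) (iter_comult H k (x + y)) (iter_comult H k x + iter_comult H k y)"
  proof (induction k)
    case 0
    have "bas ([] @ (x + y) # []) - bas ([] @ x # []) - bas ([] @ y # []) \<in> tensor_rel (hscale H)"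
      unfolding tensor_rel_def by (rule smul.span_base) blast
    then show ?case by (simp add: tensor_eq_def algebra_simps)
  next
    case (Suc k)
    from tensor_rel_step[of H, OF comult_add comult_scale Suc[unfolded tensor_eq_def]]
    show ?case
      by (simp only: tensor_eq_def iter_comult.simps lin_ext_diff[OF vs] lin_ext_add[OF vs])
  qed
  show "tensor_eq (hscale H) (iter_comult H k (hscale H c x)) (smul c (iter_comult H k x))"
  proof (induction k)
    case 0
    have "bas ([] @ hscale H c x # []) - smul c (bas ([] @ x # [])) \<in> tensor_rel (hscale H)"
      unfolding tensor_rel_def by (rule smul.span_base) blast
    then show ?case by (simp add: tensor_eq_def)
  next
    case (Suc k)
    from tensor_rel_step[of H, OF comult_add comult_scale Suc[unfolded tensor_eq_def]]
    show ?case
      by (simp only: tensor_eq_def iter_comult.simps lin_ext_diff[OF vs] lin_ext_smul[OF vs])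
  qed
qed

lemma subspace_coradical:
  fixes H :: "('v::ab_group_add, 'k::field) hopf"
  assumes vs: "vector_space (hscale H)"
    and comult_add: "\<And>a b. hcomult H (a + b) = hcomult H a + hcomult H b"
    and comult_scale: "\<And>c a. hcomult H (hscale H c a) = smul c (hcomult H a)"
  shows "module.subspace (hscale H) (coradical H k)"
proof -
  interpret V: vector_space "hscale H" by fact
  have sub: "smul.subspace (tensor_rel (hscale H))"
    unfolding tensor_rel_def by (rule smul.subspace_span)
  note lin = iter_comult_linear[of H, OF comult_add comult_scale, unfolded tensor_eq_def]
  show ?thesis
  proof (cases "k = 0")
    case True
    then have iff0: "h \<in> coradical H k \<longleftrightarrow> (\<exists>c. h = hscale H c (hone H))" for h
      by (simp add: coradical_def coradical0_def)
    show ?thesis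
    proof (rule V.subspaceI)
      show "0 \<in> coradical H k"
        unfolding iff0 by (rule exI[of _ 0]) simp
      show "x + y \<in> coradical H k" if "x \<in> coradical H k" "y \<in> coradical H k" for x y
        using that unfolding iff0 by (metis V.scale_left_distrib)
      show "hscale H c x \<in> coradical H k" if "x \<in> coradical H k" for c x
        using that unfolding iff0 by (metis V.scale_scale)
    qed
  next
    case False
    let ?T = "smul.span {bas l | l. length l = k + 1 \<and> (\<exists>i\<le>k. l ! i \<in> coradical0 H)}
                :: ('v, 'k) tensor set"
    have iff: "h \<in> coradical H k \<longleftrightarrow>
        (\<exists>t\<in>?T. iter_comult H k h - t \<in> tensor_rel (hscale H))" for h
      using False by (simp add: coradical_def tensor_eq_def)
    show ?thesis
    proof (rule V.subspaceI)
      have "iter_comult H k (hscale H 0 0) - smul 0 (iter_comult H k 0) \<in> tensor_rel (hscale H)"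
        by (rule lin(2))
      then show "0 \<in> coradical H k"
        unfolding iff by (intro bexI[of _ 0]) (auto simp: smul.span_zero)
    next
      fix x y assume "x \<in> coradical H k" "y \<in> coradical H k"
      then obtain t u where t: "t \<in> ?T" "iter_comult H k x - t \<in> tensor_rel (hscale H)"
        and u: "u \<in> ?T" "iter_comult H k y - u \<in> tensor_rel (hscale H)"
        unfolding iff by blast
      have "(iter_comult H k (x + y) - (iter_comult H k x + iter_comult H k y))
          + ((iter_comult H k x - t) + (iter_comult H k y - u)) \<in> tensor_rel (hscale H)"
        by (intro smul.subspace_add sub lin(1) t u)
      then show "x + y \<in> coradical H k"
        unfolding iff using smul.span_add[OF t(1) u(1)]
        by (intro bexI[of _ "t + u"]) (simp_all add: algebra_simps)
    next
      fix c x assume "x \<in> coradical H k"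
      then obtain t where t: "t \<in> ?T" "iter_comult H k x - t \<in> tensor_rel (hscale H)"
        unfolding iff by blast
      have "(iter_comult H k (hscale H c x) - smul c (iter_comult H k x))
          + smul c (iter_comult H k x - t) \<in> tensor_rel (hscale H)"
        by (intro smul.subspace_add smul.subspace_scale sub lin(2) t)
      then show "hscale H c x \<in> coradical H k"
        unfolding iff using smul.span_scale[OF t(1), of c]
        by (intro bexI[of _ "smul c t"]) (simp_all add: smul.scale_right_diff_distrib)
    qed
  qed
qed

lemma subspace_coradical_SSym:
  "module.subspace smul (coradical (SSym :: (perm \<Rightarrow>\<^sub>0 'k::field, 'k) hopf) k)"
  using subspace_coradical[of "SSym :: (perm \<Rightarrow>\<^sub>0 'k, 'k) hopf" k]
  by (simp add: SSym_def vector_space_smul lin_ext_add lin_ext_smul)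

lemma subspace_coradical_pred_SSym:
  "module.subspace smul (coradical_pred (SSym :: (perm \<Rightarrow>\<^sub>0 'k::field, 'k) hopf) k)"
  by (cases k) (simp_all add: coradical_pred_def subspace_coradical_SSym)

section \<open>The associated graded Hopf algebra\<close>

text \<open>The direct sum of the \<open>F\<^sup>k/F\<^sup>k\<^sup>-\<^sup>1\<close>: families \<open>x\<close> with \<open>x\<^sub>k \<in> F\<^sup>k\<close> (the domain of the partial
  equivalence relation) modulo families with \<open>x\<^sub>k \<in> F\<^sup>k\<^sup>-\<^sup>1\<close>.\<close>

definition gr_rel ::
  "(nat \<Rightarrow>\<^sub>0 (perm \<Rightarrow>\<^sub>0 'k::field)) \<Rightarrow> (nat \<Rightarrow>\<^sub>0 (perm \<Rightarrow>\<^sub>0 'k)) \<Rightarrow> bool" where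
  "gr_rel x y \<longleftrightarrow> (\<forall>k. Poly_Mapping.lookup x k \<in> coradical SSym k \<and>
                         Poly_Mapping.lookup y k \<in> coradical SSym k \<and>
                         Poly_Mapping.lookup x k - Poly_Mapping.lookup y k \<in> coradical_pred SSym k)"

lemma part_equivp_gr_rel: "part_equivp (gr_rel :: _ \<Rightarrow> (nat \<Rightarrow>\<^sub>0 (perm \<Rightarrow>\<^sub>0 'k::field)) \<Rightarrow> bool)"
proof (rule part_equivpI)
  note sub = subspace_coradical_pred_SSym[where 'k = 'k]
  show "\<exists>x. gr_rel x (x :: nat \<Rightarrow>\<^sub>0 (perm \<Rightarrow>\<^sub>0 'k))"
    by (rule exI[of _ 0])
      (simp add: gr_rel_def smul.subspace_0 subspace_coradical_SSym sub)
  show "symp (gr_rel :: _ \<Rightarrow> (nat \<Rightarrow>\<^sub>0 (perm \<Rightarrow>\<^sub>0 'k)) \<Rightarrow> bool)"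
  proof (rule sympI)
    fix x y :: "nat \<Rightarrow>\<^sub>0 (perm \<Rightarrow>\<^sub>0 'k)" assume "gr_rel x y"
    then show "gr_rel y x"
      unfolding gr_rel_def using smul.subspace_neg[OF sub] by fastforce
  qed
  show "transp (gr_rel :: _ \<Rightarrow> (nat \<Rightarrow>\<^sub>0 (perm \<Rightarrow>\<^sub>0 'k)) \<Rightarrow> bool)"
  proof (rule transpI)
    fix x y z :: "nat \<Rightarrow>\<^sub>0 (perm \<Rightarrow>\<^sub>0 'k)" assume "gr_rel x y" "gr_rel y z"
    then show "gr_rel x z"
      unfolding gr_rel_def using smul.subspace_add[OF sub] by fastforce
  qed
qed

quotient_type (overloaded) 'k gr = "nat \<Rightarrow>\<^sub>0 (perm \<Rightarrow>\<^sub>0 'k::field)" / partial: gr_rel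
  by (rule part_equivp_gr_rel)

lemma gr_rel_add: "gr_rel x x' \<Longrightarrow> gr_rel y y' \<Longrightarrow> gr_rel (x + y) (x' + y')"
  unfolding gr_rel_def lookup_add
  by (simp add: smul.subspace_add subspace_coradical_SSym add_diff_add
      smul.subspace_add[OF subspace_coradical_pred_SSym])

lemma gr_rel_uminus: "gr_rel x x' \<Longrightarrow> gr_rel (- x) (- x')"
  unfolding gr_rel_def
  by (simp add: smul.subspace_neg subspace_coradical_SSym)
    (metis minus_diff_eq minus_diff_minus smul.subspace_neg subspace_coradical_pred_SSym)

definition fam_scale :: "'k \<Rightarrow> (nat \<Rightarrow>\<^sub>0 (perm \<Rightarrow>\<^sub>0 'k::field)) \<Rightarrow> (nat \<Rightarrow>\<^sub>0 (perm \<Rightarrow>\<^sub>0 'k))" where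
  "fam_scale c = Poly_Mapping.map (smul c)"

lemma lookup_fam_scale [simp]:
  "Poly_Mapping.lookup (fam_scale c x) k = smul c (Poly_Mapping.lookup x k)"
  by (simp add: fam_scale_def Poly_Mapping.map.rep_eq when_def)

lemma gr_rel_scale: "gr_rel x x' \<Longrightarrow> gr_rel (fam_scale c x) (fam_scale c x')"
  unfolding gr_rel_def
  by (simp add: smul.subspace_scale subspace_coradical_SSym
      smul.subspace_scale[OF subspace_coradical_pred_SSym] flip: smul.scale_right_diff_distrib)

lemma gr_rel_zero: "gr_rel 0 0"
  by (simp add: gr_rel_def smul.subspace_0 subspace_coradical_SSym subspace_coradical_pred_SSym)

instantiation gr :: (field) ab_group_add
begin

lift_definition zero_gr :: "'a gr" is 0
  by (rule gr_rel_zero)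

lift_definition plus_gr :: "'a gr \<Rightarrow> 'a gr \<Rightarrow> 'a gr" is "(+)"
  by (rule gr_rel_add)

lift_definition uminus_gr :: "'a gr \<Rightarrow> 'a gr" is uminus
  by (rule gr_rel_uminus)

definition minus_gr :: "'a gr \<Rightarrow> 'a gr \<Rightarrow> 'a gr" where
  "minus_gr x y = x + - y"

instance
proof
  fix a b c :: "'a gr"
  show "a + b + c = a + (b + c)"
    by transfer (metis (no_types) add.assoc gr_rel_add)
  show "a + b = b + a"
    by transfer (metis (no_types) add.commute gr_rel_add)
  show "0 + a = a" by transfer simp
  show "- a + a = 0"
    by transfer (simp add: gr_rel_zero)
  show "a - b = a + - b" by (simp add: minus_gr_def)
qed

end

lift_definition gr_scale :: "'k::field \<Rightarrow> 'k gr \<Rightarrow> 'k gr" is fam_scale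
  by (rule gr_rel_scale)

lemma vector_space_gr_scale: "vector_space (gr_scale :: 'k::field \<Rightarrow> 'k gr \<Rightarrow> 'k gr)"
proof
  fix a b :: 'k and x y :: "'k gr"
  have dist_r: "fam_scale a (u + v) = fam_scale a u + fam_scale a v" for a :: 'k and u v
    by (rule poly_mapping_eqI) (simp add: lookup_add smul.scale_right_distrib)
  have dist_l: "fam_scale (a + b) u = fam_scale a u + fam_scale b u" for a b :: 'k and u
    by (rule poly_mapping_eqI) (simp add: lookup_add smul.scale_left_distrib)
  have assoc: "fam_scale a (fam_scale b u) = fam_scale (a * b) u" for a b :: 'k and u
    by (rule poly_mapping_eqI) simp
  have one: "fam_scale 1 u = u" for u :: "nat \<Rightarrow>\<^sub>0 (perm \<Rightarrow>\<^sub>0 'k)"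
    by (rule poly_mapping_eqI) simp
  show "gr_scale a (x + y) = gr_scale a x + gr_scale a y"
    by transfer (metis (no_types) dist_r gr_rel_add gr_rel_scale)
  show "gr_scale (a + b) x = gr_scale a x + gr_scale b x"
    by transfer (metis (no_types) dist_l gr_rel_add gr_rel_scale)
  show "gr_scale a (gr_scale b x) = gr_scale (a * b) x"
    by transfer (metis (no_types) assoc gr_rel_scale)
  show "gr_scale 1 x = x"
    by transfer (simp add: one)
qed

text \<open>The class in \<open>F\<^sup>k/F\<^sup>k\<^sup>-\<^sup>1\<close> of an element of \<open>F\<^sup>k\<close>, as an element of the direct sum;
  meaningful only for \<open>h \<in> coradical SSym k\<close>.\<close>

definition gr_class :: "nat \<Rightarrow> (perm \<Rightarrow>\<^sub>0 'k::field) \<Rightarrow> 'k gr" where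
  "gr_class k h = abs_gr (Poly_Mapping.single k h)"

text \<open>The induced operations, computed on the representative family \<open>rep_gr x\<close>;
  they do not depend on the representative.\<close>

definition gr_mult :: "'k::field gr \<Rightarrow> 'k gr \<Rightarrow> 'k gr" where
  "gr_mult x y =
     (\<Sum>i\<in>Poly_Mapping.keys (rep_gr x). \<Sum>j\<in>Poly_Mapping.keys (rep_gr y).
        gr_class (i + j) (hmult SSym (Poly_Mapping.lookup (rep_gr x) i) (Poly_Mapping.lookup (rep_gr y) j)))"

text \<open>\<open>h \<in> F\<^sup>k\<close> has \<open>\<Delta>(h) = \<Sum>\<^sub>i s\<^sub>i\<close> with \<open>s\<^sub>i\<close> in the image of \<open>F\<^sup>i \<otimes> F\<^sup>k\<^sup>-\<^sup>i\<close>; the coproduct of the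
  class of \<open>h\<close> is the sum of the images of the \<open>s\<^sub>i\<close> under \<open>F\<^sup>i \<otimes> F\<^sup>k\<^sup>-\<^sup>i \<rightarrow> F\<^sup>i/F\<^sup>i\<^sup>-\<^sup>1 \<otimes> F\<^sup>k\<^sup>-\<^sup>i/F\<^sup>k\<^sup>-\<^sup>i\<^sup>-\<^sup>1\<close>.\<close>

definition filtered_split :: "nat \<Rightarrow> (perm \<Rightarrow>\<^sub>0 'k::field) \<Rightarrow> (nat \<Rightarrow> (perm \<Rightarrow>\<^sub>0 'k, 'k) tensor) \<Rightarrow> bool" where
  "filtered_split k h s \<longleftrightarrow>
     (\<forall>i\<le>k. \<forall>l\<in>Poly_Mapping.keys (s i).
        \<exists>a b. l = [a, b] \<and> a \<in> coradical SSym i \<and> b \<in> coradical SSym (k - i)) \<and>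
     tensor_eq smul (hcomult SSym h) (\<Sum>i\<le>k. s i)"

definition gr_comult_hom :: "nat \<Rightarrow> (perm \<Rightarrow>\<^sub>0 'k::field) \<Rightarrow> ('k gr, 'k) tensor" where
  "gr_comult_hom k h =
     (let s = (SOME s. filtered_split k h s)
      in \<Sum>i\<le>k. lin_ext smul (\<lambda>l. bas [gr_class i (l ! 0), gr_class (k - i) (l ! 1)]) (s i))"

definition gr_comult :: "'k::field gr \<Rightarrow> ('k gr, 'k) tensor" where
  "gr_comult x = (\<Sum>k\<in>Poly_Mapping.keys (rep_gr x). gr_comult_hom k (Poly_Mapping.lookup (rep_gr x) k))"

definition M_gr :: "perm \<Rightarrow> 'k::field gr" where
  "M_gr w = gr_class (num_components w) (M_SSym w)"

definition gr_SSym :: "('k::field gr, 'k) hopf" where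
  "gr_SSym = \<lparr> hscale = gr_scale,
               hmult = gr_mult,
               hone = gr_class 0 (hone SSym),
               hcomult = gr_comult,
               hcounit = (\<lambda>x. hcounit SSym (Poly_Mapping.lookup (rep_gr x) 0)),
               hdeg = (\<lambda>n. module.span gr_scale {M_gr w | w. psize w = n}) \<rparr>"

section \<open>The graded dual\<close>

lemma vector_space_pair_gr: "vector_space_pair (gr_scale :: 'k::field \<Rightarrow> _) ((*) :: 'k \<Rightarrow> 'k \<Rightarrow> 'k)"
  by (intro vector_space_pair.intro vector_space_gr_scale)
    (unfold_locales, simp_all add: algebra_simps)

typedef (overloaded) 'k gr_dual =
  "{f :: 'k::field gr \<Rightarrow> 'k. Vector_Spaces.linear gr_scale (*) f \<and>
      finite {n. \<exists>x\<in>hdeg gr_SSym n. f x \<noteq> 0}}"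
  morphisms ev Abs_gr_dual
  by (rule exI[of _ "\<lambda>_. 0"]) (simp add: vector_space_pair.linear_zero[OF vector_space_pair_gr])

setup_lifting type_definition_gr_dual

instantiation gr_dual :: (field) ab_group_add
begin

lift_definition zero_gr_dual :: "'a gr_dual" is "\<lambda>_. 0"
  by (simp add: vector_space_pair.linear_zero[OF vector_space_pair_gr])

lift_definition plus_gr_dual :: "'a gr_dual \<Rightarrow> 'a gr_dual \<Rightarrow> 'a gr_dual" is "\<lambda>f g x. f x + g x"
proof (rule conjI)
  fix f g :: "'a gr \<Rightarrow> 'a"
  assume f: "Vector_Spaces.linear gr_scale (*) f \<and> finite {n. \<exists>x\<in>hdeg gr_SSym n. f x \<noteq> 0}"
    and g: "Vector_Spaces.linear gr_scale (*) g \<and> finite {n. \<exists>x\<in>hdeg gr_SSym n. g x \<noteq> 0}"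
  show "Vector_Spaces.linear gr_scale (*) (\<lambda>x. f x + g x)"
    using f g by (simp add: vector_space_pair.linear_compose_add[OF vector_space_pair_gr])
  have "{n. \<exists>x\<in>hdeg gr_SSym n. f x + g x \<noteq> 0} \<subseteq>
      {n. \<exists>x\<in>hdeg gr_SSym n. f x \<noteq> 0} \<union> {n. \<exists>x\<in>hdeg gr_SSym n. g x \<noteq> 0}"
    by force
  then show "finite {n. \<exists>x\<in>hdeg gr_SSym n. f x + g x \<noteq> 0}"
    using f g by (auto intro: finite_subset)
qed

lift_definition uminus_gr_dual :: "'a gr_dual \<Rightarrow> 'a gr_dual" is "\<lambda>f x. - f x"
  by (simp add: vector_space_pair.linear_compose_neg[OF vector_space_pair_gr])

definition minus_gr_dual :: "'a gr_dual \<Rightarrow> 'a gr_dual \<Rightarrow> 'a gr_dual" where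
  "minus_gr_dual f g = f + - g"

instance
  by standard (simp add: minus_gr_dual_def | transfer, simp add: fun_eq_iff algebra_simps)+

end

lift_definition dual_scale :: "'k::field \<Rightarrow> 'k gr_dual \<Rightarrow> 'k gr_dual" is "\<lambda>c f x. c * f x"
  apply (rule conjI)
   apply (simp add: vector_space_pair.linear_compose_scale_right[OF vector_space_pair_gr])
  apply (elim conjE)
  apply (erule finite_subset[rotated])
  apply force
  done

text \<open>Under \<open>A\<^sup>* \<otimes> A\<^sup>* \<subseteq> (A \<otimes> A)\<^sup>*\<close>, \<open>(f \<otimes> g)(x \<otimes> y) = f(x) g(y)\<close>, the product of the dual is
  \<open>f g = (f \<otimes> g) \<circ> \<Delta>\<close>, and the coproduct of \<open>f\<close> is \<open>(x, y) \<mapsto> f(x y)\<close>.\<close>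

definition dual_mult :: "'k::field gr_dual \<Rightarrow> 'k gr_dual \<Rightarrow> 'k gr_dual" where
  "dual_mult f g = Abs_gr_dual (\<lambda>x. lin_ext (*) (\<lambda>l. ev f (l ! 0) * ev g (l ! 1)) (hcomult gr_SSym x))"

definition dual_comult :: "'k::field gr_dual \<Rightarrow> ('k gr_dual, 'k) tensor" where
  "dual_comult f = (SOME t. (\<forall>l\<in>Poly_Mapping.keys t. length l = 2) \<and>
     (\<forall>x y. lin_ext (*) (\<lambda>l. ev (l ! 0) x * ev (l ! 1) y) t = ev f (hmult gr_SSym x y)))"

definition gr_SSym_dual :: "('k::field gr_dual, 'k) hopf" where
  "gr_SSym_dual = \<lparr> hscale = dual_scale,
                    hmult = dual_mult,
                    hone = Abs_gr_dual (hcounit gr_SSym),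
                    hcomult = dual_comult,
                    hcounit = (\<lambda>f. ev f (hone gr_SSym)),
                    hdeg = (\<lambda>n. {f. \<forall>m. m \<noteq> n \<longrightarrow> (\<forall>x\<in>hdeg gr_SSym m. ev f x = 0)}) \<rparr>"

definition M_dual :: "perm \<Rightarrow> 'k::field gr_dual" where
  "M_dual w = (THE f. \<forall>v. ev f (M_gr v) = (if v = w then 1 else 0))"

section \<open>Heap-ordered trees\<close>

datatype ltree = Node (root: nat) (subtrees: "ltree list")

fun labels :: "ltree \<Rightarrow> nat list" where
  "labels (Node a ts) = a # concat (map labels ts)"

fun heap :: "ltree \<Rightarrow> bool" where
  "heap (Node a ts) \<longleftrightarrow> (\<forall>t\<in>set ts. a < root t \<and> heap t) \<and> sorted_wrt (>) (map root ts)"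

typedef ho_tree = "{t. heap t \<and> root t = 0 \<and> distinct (labels t) \<and> set (labels t) = {0..<length (labels t)}}"
  morphisms tree_of Abs_ho_tree
  by (rule exI[of _ "Node 0 []"]) simp

abbreviation branches :: "ho_tree \<Rightarrow> ltree list" where
  "branches x \<equiv> subtrees (tree_of x)"

definition tree_degree :: "ho_tree \<Rightarrow> nat" where
  "tree_degree x = length (labels (tree_of x)) - 1"

fun relabel :: "(nat \<Rightarrow> nat) \<Rightarrow> ltree \<Rightarrow> ltree" where
  "relabel f (Node a ts) = Node (f a) (map (relabel f) ts)"

text \<open>Nodes are identified with their labels.  \<open>graft f cs t\<close> attaches, for each \<open>i\<close>, the tree
  \<open>cs ! i\<close> (a planted component with its root removed) as a child of the node \<open>f i\<close> of \<open>t\<close>, to the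
  left of the children already there.\<close>

fun graft :: "(nat \<Rightarrow> nat) \<Rightarrow> ltree list \<Rightarrow> ltree \<Rightarrow> ltree" where
  "graft f cs (Node a ts) = Node a ([cs ! i. i \<leftarrow> [0..<length cs], f i = a] @ map (graft f cs) ts)"

definition ho_graft :: "(nat \<Rightarrow> nat) \<Rightarrow> ho_tree \<Rightarrow> ho_tree \<Rightarrow> ho_tree" where
  "ho_graft f x y = Abs_ho_tree
     (graft f (map (relabel (\<lambda>a. a + Max (set (labels (tree_of y))))) (branches x)) (tree_of y))"

text \<open>Planted components are numbered from \<open>0\<close>.  Each remaining label is replaced by the number of
  smaller remaining labels, so the root keeps the label \<open>0\<close>.\<close>

definition ho_restrict :: "ho_tree \<Rightarrow> nat set \<Rightarrow> ho_tree" where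
  "ho_restrict x S =
     (let t = Node 0 (nths (branches x) S)
      in Abs_ho_tree (relabel (\<lambda>a. card {b \<in> set (labels t). b < a}) t))"

definition T_mult :: "ho_tree \<Rightarrow> ho_tree \<Rightarrow> (ho_tree \<Rightarrow>\<^sub>0 'k::field)" where
  "T_mult x y = (\<Sum>f \<in> {..<length (branches x)} \<rightarrow>\<^sub>E set (labels (tree_of y)). bas (ho_graft f x y))"

definition T_comult :: "ho_tree \<Rightarrow> (ho_tree \<Rightarrow>\<^sub>0 'k::field, 'k) tensor" where
  "T_comult x = (\<Sum>S \<in> Pow {..<length (branches x)}.
     bas [bas (ho_restrict x S), bas (ho_restrict x ({..<length (branches x)} - S))])"

definition H_HO :: "(ho_tree \<Rightarrow>\<^sub>0 'k::field, 'k) hopf" where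
  "H_HO = \<lparr> hscale = smul,
            hmult = (\<lambda>x y. lin_ext smul (\<lambda>u. lin_ext smul (\<lambda>v. T_mult u v) y) x),
            hone = bas (Abs_ho_tree (Node 0 [])),
            hcomult = lin_ext smul T_comult,
            hcounit = (\<lambda>x. Poly_Mapping.lookup x (Abs_ho_tree (Node 0 []))),
            hdeg = (\<lambda>n. module.span smul {bas t | t. tree_degree t = n}) \<rparr>"

section \<open>The bijection from permutations to heap-ordered trees\<close>

fun add_child :: "nat \<Rightarrow> nat \<Rightarrow> ltree \<Rightarrow> ltree" where
  "add_child p c (Node a ts) =
     Node a (map (add_child p c) ts @ (if a = p then [Node c []] else []))"

text \<open>\<open>u\<close> is the word of the permutation with \<open>u(0) = 0\<close> put in front.\<close>

definition phi_step :: "nat list \<Rightarrow> nat \<Rightarrow> ltree \<Rightarrow> ltree" where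
  "phi_step u i t = add_child (u ! Max {j. j < i \<and> u ! i > u ! j}) (u ! i) t"

definition phi :: "perm \<Rightarrow> ho_tree" where
  "phi w = (let u = 0 # word w
            in Abs_ho_tree (fold (phi_step u) [1..<length u] (Node 0 [])))"

end

theory Submission
  imports Defs "HOL-Computational_Algebra.Polynomial" "HOL-Combinatorics.Multiset_Permutations"
begin

text \<open>In the associated graded algebra the product of \<open>M\<^sub>u\<close> and \<open>M\<^sub>v\<close> is the sum of the \<open>M\<^sub>w\<close> over the
  shuffles of the irreducible components of \<open>u\<close> and \<open>v\<close>, and the coproduct is deconcatenation of
  components. Its graded dual is therefore the free algebra on the primitive elements \<open>M\<^sub>w\<^sup>*\<close>, \<open>w\<close>
  irreducible, where the dual basis multiplies by \<open>M\<^sub>u\<^sup>* M\<^sub>v\<^sup>* = M\<^bsub>u\<setminus>v\<^esub>\<^sup>*\<close>. Since the algebra of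
  heap-ordered trees is cocommutative, \<open>e(\<phi>(w))\<close> is primitive, so \<open>M\<^sub>w\<^sup>* \<mapsto> e(\<phi>(w))\<close> extends to a
  unique morphism \<open>\<Phi>\<close> of Hopf algebras. It is bijective by triangularity. The product of two trees is
  their join at the root plus trees with fewer branches at the root, and \<open>\<phi>(u\<setminus>v)\<close> is the join of
  \<open>\<phi>(u)\<close> and \<open>\<phi>(v)\<close>; moreover \<open>e(t)\<close> is \<open>t\<close> plus products of at least two nonempty trees whose
  numbers of root branches add up to that of \<open>t\<close>. So \<open>\<Phi>(M\<^sub>w\<^sup>*)\<close> is \<open>\<phi>(w)\<close> plus trees with fewer root
  branches, or with as many root branches but more irreducible components.\<close>

section \<open>Linear maps and tensors\<close>

text \<open>Representatives of classes in the associated graded algebra, splittings of coproducts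
  and dual coproducts are arbitrary choices, and tensors are formal sums modulo multilinearity.
  Hence statements about them are tested on coordinate functionals of the monomial basis. There the
  coproduct formula is just that \<open>M_coord u\<close> tensor \<open>M_coord v\<close> composed
  with the coproduct is \<open>M_coord (backslash u v)\<close>; it holds because every pair of
  positions across the cut of \<open>backslash u v\<close> is an inversion, so it constrains nothing
  in the weak order. The shuffle rule comes from a recursion: compatibility of product and coproduct
  expresses the coefficient at \<open>backslash u v\<close> through those at \<open>u\<close> and
  \<open>v\<close>, and in the extremal filtration degree an irreducible left factor can absorb only
  one component of one of the two arguments. Ordered trees with relabeling resist direct
  computation. The heap condition makes a tree recoverable from the parent of each label; on parent
  lists the product appends a word and the coproduct selects nodes by a coloring, so the Hopf axioms
  become identities of finite sums proved by adding one last node.\<close>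

definition lin :: "('k \<Rightarrow> 'v \<Rightarrow> 'v) \<Rightarrow> ('k \<Rightarrow> 'w \<Rightarrow> 'w) \<Rightarrow> ('v::ab_group_add \<Rightarrow> 'w::ab_group_add) \<Rightarrow> bool"
  where "lin s s' f \<longleftrightarrow> (\<forall>x y. f (x + y) = f x + f y) \<and> (\<forall>c x. f (s c x) = s' c (f x))"

lemma linI: "(\<And>x y. f (x + y) = f x + f y) \<Longrightarrow> (\<And>c x. f (s c x) = s' c (f x)) \<Longrightarrow> lin s s' f"
  by (simp add: lin_def)

lemma lin_add: "lin s s' f \<Longrightarrow> f (x + y) = f x + f y"
  and lin_scale: "lin s s' f \<Longrightarrow> f (s c x) = s' c (f x)"
  by (simp_all add: lin_def)

lemma lin_0: "lin s s' f \<Longrightarrow> f 0 = 0"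
  using lin_add[of s s' f 0 0] by simp

lemma lin_diff: "lin s s' f \<Longrightarrow> f (x - y) = f x - f y"
  using lin_add[of s s' f "x - y" y] by simp

lemma lin_sum: "lin s s' f \<Longrightarrow> f (sum g A) = (\<Sum>a\<in>A. f (g a))"
  by (induction A rule: infinite_finite_induct) (auto simp: lin_0 lin_add)

lemma lin_comp: "lin s s' f \<Longrightarrow> lin s' s'' g \<Longrightarrow> lin s s'' (\<lambda>x. g (f x))"
  by (simp add: lin_def)

lemma vector_space_times: "vector_space ((*) :: 'k::field \<Rightarrow> 'k \<Rightarrow> 'k)"
  by unfold_locales (auto simp: algebra_simps)

lemma lin_lin_ext: "vector_space s \<Longrightarrow> lin smul s (lin_ext s f)"
  by (intro linI lin_ext_add lin_ext_smul)

lemmas lin_lin_ext_smul = lin_lin_ext[OF vector_space_smul]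
lemmas lin_ext_smul_simps = lin_ext_add[OF vector_space_smul] lin_ext_smul[OF vector_space_smul]
  lin_ext_single[OF vector_space_smul] lin_ext_diff[OF vector_space_smul]
lemmas lin_ext_times_simps = lin_ext_add[OF vector_space_times] lin_ext_smul[OF vector_space_times]
  lin_ext_single[OF vector_space_times] lin_ext_diff[OF vector_space_times]

lemma lin_ext_bas: "vector_space s \<Longrightarrow> lin_ext s f (bas b) = f b"
  using lin_ext_single[of s f b 1] by (simp add: vector_space.vector_space_assms(4))

lemmas lin_ext_bas_smul [simp] = lin_ext_bas[OF vector_space_smul]
lemmas lin_ext_bas_times [simp] = lin_ext_bas[OF vector_space_times]

lemma lin_ext_0 [simp]: "lin_ext s f 0 = 0"
  by (simp add: lin_ext_def)

lemma bas_expand: "x = (\<Sum>b\<in>Poly_Mapping.keys x. smul (Poly_Mapping.lookup x b) (bas b))"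
  by (rule poly_mapping_eqI)
    (auto simp: lookup_sum lookup_single when_def in_keys_iff if_distrib sum.delta' cong: if_cong)

lemma lin_expand:
  assumes "lin smul s f"
  shows "f x = lin_ext s (\<lambda>b. f (bas b)) x"
proof -
  have "f x = f (\<Sum>b\<in>Poly_Mapping.keys x. smul (Poly_Mapping.lookup x b) (bas b))"
    using bas_expand[of x] by (rule arg_cong)
  also have "\<dots> = lin_ext s (\<lambda>b. f (bas b)) x"
    unfolding lin_sum[OF assms] lin_scale[OF assms] lin_ext_def ..
  finally show ?thesis .
qed

lemma lin_eqI:
  assumes "lin smul s f" "lin smul s g" "\<And>b. f (bas b) = g (bas b)"
  shows "f x = g x"
  by (subst lin_expand[OF assms(1)], subst lin_expand[OF assms(2)]) (simp only: assms(3))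

lemma lin_ext_sum_fun:
  assumes "vector_space s"
  shows "lin_ext s (\<lambda>b. \<Sum>i\<in>I. f i b) x = (\<Sum>i\<in>I. lin_ext s (f i) x)"
proof -
  interpret vector_space s by fact
  show ?thesis
    unfolding lin_ext_def by (simp add: scale_sum_right) (rule sum.swap)
qed

lemma lin_ext_lin: "lin s s' g \<Longrightarrow> g (lin_ext s f x) = lin_ext s' (\<lambda>b. g (f b)) x"
  by (simp add: lin_ext_def lin_sum[of s s' g] lin_scale[of s s' g])

lemma lin_ext_cong: "(\<And>b. b \<in> Poly_Mapping.keys x \<Longrightarrow> f b = g b) \<Longrightarrow> lin_ext s f x = lin_ext s g x"
  by (simp add: lin_ext_def)

text \<open>\<open>Vector_Spaces.linear\<close> has both vector space assumptions built in;
  \<open>lin\<close> keeps only the two equations, so the rules above need no such premises. This is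
  the bridge to the library notion used in the definitions.\<close>

lemma lin_iff_linear:
  "vector_space s \<Longrightarrow> vector_space s' \<Longrightarrow> lin s s' f \<longleftrightarrow> Vector_Spaces.linear s s' f"
  by (simp add: lin_def Vector_Spaces.linear_iff)

subsection \<open>Evaluation of tensors by functionals\<close>

text \<open>The pure tensor of the functionals in the first list. Words of the wrong length get the
  value 0, so an evaluation sees only one tensor degree; this is why length conditions accompany
  many of its uses.\<close>

fun word_eval :: "('v \<Rightarrow> 'k::field) list \<Rightarrow> 'v list \<Rightarrow> 'k" where
  "word_eval [] [] = 1"
| "word_eval (f # fs) (v # vs) = f v * word_eval fs vs"
| "word_eval _ _ = 0"

definition tensor_eval :: "('v \<Rightarrow> 'k::field) list \<Rightarrow> ('v, 'k) tensor \<Rightarrow> 'k" where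
  "tensor_eval fs = lin_ext (*) (word_eval fs)"

lemma lin_tensor_eval: "lin smul (*) (tensor_eval fs)"
  unfolding tensor_eval_def by (rule lin_lin_ext[OF vector_space_times])

lemma tensor_eval_bas [simp]: "tensor_eval fs (bas l) = word_eval fs l"
  by (simp add: tensor_eval_def)

lemma word_eval_append:
  "length fs = length xs \<Longrightarrow> word_eval (fs @ gs) (xs @ ys) = word_eval fs xs * word_eval gs ys"
  by (induction fs xs rule: list_induct2) auto

lemma word_eval_add:
  "\<forall>f\<in>set fs. lin s (*) f \<Longrightarrow>
     word_eval fs (xs @ (a + b) # ys) = word_eval fs (xs @ a # ys) + word_eval fs (xs @ b # ys)"
proof (induction xs arbitrary: fs)
  case Nil
  then show ?case by (cases fs) (auto simp: lin_add algebra_simps)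
next
  case (Cons x xs)
  then show ?case by (cases fs) (auto simp: algebra_simps)
qed

lemma word_eval_scale:
  "\<forall>f\<in>set fs. lin s (*) f \<Longrightarrow> word_eval fs (xs @ s c a # ys) = c * word_eval fs (xs @ a # ys)"
proof (induction xs arbitrary: fs)
  case Nil
  then show ?case by (cases fs) (auto simp: lin_scale algebra_simps)
next
  case (Cons x xs)
  then show ?case by (cases fs) (auto simp: algebra_simps)
qed

lemma subspace_tensor_rel: "smul.subspace (tensor_rel s)"
  unfolding tensor_rel_def by (rule smul.subspace_span)

lemma tensor_eval_rel:
  assumes "\<forall>f\<in>set fs. lin s (*) f" "t \<in> tensor_rel s"
  shows "tensor_eval fs t = 0"
proof -
  have "tensor_rel s \<subseteq> {t. tensor_eval fs t = 0}"
    unfolding tensor_rel_def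
  proof (rule smul.span_minimal)
    show "smul.subspace {t. tensor_eval fs t = 0}"
      by (rule smul.subspaceI)
        (simp_all add: lin_0[OF lin_tensor_eval] lin_add[OF lin_tensor_eval] lin_scale[OF lin_tensor_eval])
  qed (auto simp: lin_diff[OF lin_tensor_eval] lin_scale[OF lin_tensor_eval]
        word_eval_add[OF assms(1)] word_eval_scale[OF assms(1)])
  then show ?thesis using assms(2) by blast
qed

text \<open>Linear functionals kill the multilinearity relations, so evaluation descends to the
  tensor power. This is how information is extracted from \<open>tensor_eq\<close>.\<close>

lemma tensor_eval_cong:
  assumes "\<forall>f\<in>set fs. lin s (*) f" "tensor_eq s t u"
  shows "tensor_eval fs t = tensor_eval fs u"
  using tensor_eval_rel[OF assms(1), of "t - u"] assms(2)
  by (simp add: tensor_eq_def lin_diff[OF lin_tensor_eval])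

lemma tensor_eq_refl: "tensor_eq s t t"
  by (simp add: tensor_eq_def smul.subspace_0[OF subspace_tensor_rel])

lemma tensor_eq_sym: "tensor_eq s t u \<Longrightarrow> tensor_eq s u t"
  unfolding tensor_eq_def by (metis minus_diff_eq smul.subspace_neg subspace_tensor_rel)

lemma tensor_eq_trans [trans]: "tensor_eq s t u \<Longrightarrow> tensor_eq s u v \<Longrightarrow> tensor_eq s t v"
  unfolding tensor_eq_def
  by (drule (1) smul.subspace_add[OF subspace_tensor_rel]) simp

lemma tensor_eq_add: "tensor_eq s t u \<Longrightarrow> tensor_eq s t' u' \<Longrightarrow> tensor_eq s (t + t') (u + u')"
  unfolding tensor_eq_def
  by (drule (1) smul.subspace_add[OF subspace_tensor_rel]) (simp add: algebra_simps)

lemma tensor_eq_smul: "tensor_eq s t u \<Longrightarrow> tensor_eq s (smul c t) (smul c u)"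
  unfolding tensor_eq_def
  by (drule smul.subspace_scale[OF subspace_tensor_rel]) (simp add: smul.scale_right_diff_distrib)

lemma tensor_eq_sum: "(\<And>i. i \<in> I \<Longrightarrow> tensor_eq s (f i) (g i)) \<Longrightarrow> tensor_eq s (sum f I) (sum g I)"
  by (induction I rule: infinite_finite_induct) (auto intro: tensor_eq_refl tensor_eq_add)

lemma tensor_eq_slot_add: "tensor_eq s (bas (xs @ (a + b) # ys)) (bas (xs @ a # ys) + bas (xs @ b # ys))"
  unfolding tensor_eq_def tensor_rel_def
  by (rule smul.span_base) (auto simp flip: diff_diff_eq)

lemma tensor_eq_slot_scale: "tensor_eq s (bas (xs @ s c a # ys)) (smul c (bas (xs @ a # ys)))"
  unfolding tensor_eq_def tensor_rel_def by (rule smul.span_base) blast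

lemma tensor_eq_slot_sum:
  assumes "vector_space s" "finite A"
  shows "tensor_eq s (bas (xs @ (\<Sum>b\<in>A. s (c b) (e b)) # ys)) (\<Sum>b\<in>A. smul (c b) (bas (xs @ e b # ys)))"
  using assms(2)
proof (induction A)
  case empty
  interpret vector_space s by fact
  show ?case using tensor_eq_slot_scale[of s xs 0 0 ys] by simp
next
  case (insert a A)
  show ?case
    unfolding sum.insert[OF insert(1,2)]
    by (rule tensor_eq_trans[OF tensor_eq_slot_add tensor_eq_add[OF tensor_eq_slot_scale insert(3)]])
qed

lemma tensor_eqI:
  fixes t u :: "('v::ab_group_add, 'k::field) tensor"
  assumes vs: "vector_space s"
    and fin: "\<And>v. finite {b. \<gamma> b v \<noteq> 0}"
    and expand: "\<And>v. v = (\<Sum>b | \<gamma> b v \<noteq> 0. s (\<gamma> b v) (e b))"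
    and len: "\<And>l. l \<in> Poly_Mapping.keys t \<union> Poly_Mapping.keys u \<Longrightarrow> length l = 2"
    and eq: "\<And>b b'. tensor_eval [\<gamma> b, \<gamma> b'] t = tensor_eval [\<gamma> b, \<gamma> b'] u"
  shows "tensor_eq s t u"
proof -
  interpret V: vector_space s by fact
  \<comment> \<open>All basis indices occurring in a word of \<open>t\<close> or \<open>u\<close>; a
    common finite range lets every word be expanded over the same pairs.\<close>
  define A where "A = (\<Union>l\<in>Poly_Mapping.keys t \<union> Poly_Mapping.keys u. {b. \<gamma> b (l!0) \<noteq> 0} \<union> {b. \<gamma> b (l!1) \<noteq> 0})"
  have A: "finite A" unfolding A_def by (auto intro: fin)
  have exA: "v = (\<Sum>b\<in>A. s (\<gamma> b v) (e b))" if "{b. \<gamma> b v \<noteq> 0} \<subseteq> A" for v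
    by (subst expand) (rule sum.mono_neutral_left, use A that in auto)
  \<comment> \<open>A normal form that depends on its argument only through the evaluations, so it
    agrees on \<open>t\<close> and \<open>u\<close> by hypothesis.\<close>
  define N where "N = (\<lambda>w. \<Sum>b\<in>A. \<Sum>b'\<in>A. smul (tensor_eval [\<gamma> b, \<gamma> b'] w) (bas [e b, e b']))"
  have word: "tensor_eq s (bas l) (N (bas l))" if l: "l \<in> Poly_Mapping.keys t \<union> Poly_Mapping.keys u" for l
  proof -
    obtain v v' where lv: "l = [v, v']" using len[OF l] by (auto simp: numeral_2_eq_2 length_Suc_conv)
    have v: "v = (\<Sum>b\<in>A. s (\<gamma> b v) (e b))" and v': "v' = (\<Sum>b\<in>A. s (\<gamma> b v') (e b))"
      by (rule exA; use l lv in \<open>auto simp: A_def\<close>)+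
    have "tensor_eq s (bas [v, v']) (\<Sum>b\<in>A. smul (\<gamma> b v) (bas [e b, v']))"
      by (subst (1) v) (use tensor_eq_slot_sum[OF vs A, of "[]" _ _ "[v']"] in simp)
    also have "tensor_eq s \<dots>
        (\<Sum>b\<in>A. smul (\<gamma> b v) (\<Sum>b'\<in>A. smul (\<gamma> b' v') (bas [e b, e b'])))"
      by (subst (1) v') (intro tensor_eq_sum tensor_eq_smul,
        use tensor_eq_slot_sum[OF vs A, of "[x]" _ _ "[]" for x] in simp)
    finally show ?thesis
      by (simp add: lv N_def smul.scale_sum_right)
  qed
  have linN: "lin smul smul N"
    unfolding N_def
    by (rule linI) (simp_all add: lin_add[OF lin_tensor_eval] lin_scale[OF lin_tensor_eval]
        smul.scale_left_distrib sum.distrib smul.scale_sum_right)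
  have norm: "tensor_eq s w (N w)" if "w \<in> {t, u}" for w
  proof -
    have "tensor_eq s (\<Sum>l\<in>Poly_Mapping.keys w. smul (Poly_Mapping.lookup w l) (bas l))
        (\<Sum>l\<in>Poly_Mapping.keys w. smul (Poly_Mapping.lookup w l) (N (bas l)))"
      using that by (intro tensor_eq_sum tensor_eq_smul word) auto
    moreover have "(\<Sum>l\<in>Poly_Mapping.keys w. smul (Poly_Mapping.lookup w l) (N (bas l))) = N w"
      by (simp add: lin_expand[OF linN, of w] lin_ext_def)
    ultimately show ?thesis by (simp flip: bas_expand)
  qed
  have "N t = N u" unfolding N_def eq ..
  then show ?thesis using norm[of t] norm[of u] by (metis insertCI tensor_eq_sym tensor_eq_trans)
qed

section \<open>Permutations\<close>

lemma perm_eqI: "word u = word v \<Longrightarrow> u = v"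
  by (simp add: Rep_perm_inject)

lemma distinct_word [simp]: "distinct (word w)"
  and set_word: "set (word w) = {1..psize w}"
  and length_word [simp]: "length (word w) = psize w"
  using Rep_perm[of w] by (auto simp: psize_def)

lemma word_Abs_perm: "distinct xs \<Longrightarrow> set xs = {1..length xs} \<Longrightarrow> word (Abs_perm xs) = xs"
  by (simp add: Abs_perm_inverse)

lemma psize_Abs_perm: "distinct xs \<Longrightarrow> set xs = {1..length xs} \<Longrightarrow> psize (Abs_perm xs) = length xs"
  by (simp add: psize_def word_Abs_perm)

lemma word_perm_empty [simp]: "word perm_empty = []"
  unfolding perm_empty_def by (rule word_Abs_perm) auto

lemma psize_perm_empty [simp]: "psize perm_empty = 0"
  by (simp add: psize_def)

lemma psize_0_iff [simp]: "psize w = 0 \<longleftrightarrow> w = perm_empty"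
  using perm_eqI[of w perm_empty] by (auto simp flip: length_word)

lemma word_backslash [simp]: "word (backslash u v) = map (\<lambda>x. x + psize v) (word u) @ word v"
  unfolding backslash_def
proof (rule word_Abs_perm)
  have "set (map (\<lambda>x. x + psize v) (word u)) = {psize v + 1..psize v + psize u}"
    by (simp add: set_word image_add_atLeastAtMost add.commute[of _ "psize v"])
  then show "distinct (map (\<lambda>x. x + psize v) (word u) @ word v)"
    and "set (map (\<lambda>x. x + psize v) (word u) @ word v) = {1..length (map (\<lambda>x. x + psize v) (word u) @ word v)}"
    by (auto simp: distinct_map set_word)
qed

lemma psize_backslash [simp]: "psize (backslash u v) = psize u + psize v"
  by (simp flip: length_word)

lemma backslash_empty [simp]: "backslash perm_empty w = w" "backslash w perm_empty = w"
  by (auto intro!: perm_eqI)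

lemma backslash_assoc: "backslash (backslash u v) w = backslash u (backslash v w)"
  by (auto intro!: perm_eqI)

lemma backslash_eq_empty_iff [simp]: "backslash u v = perm_empty \<longleftrightarrow> u = perm_empty \<and> v = perm_empty"
  by (metis add_is_0 psize_0_iff psize_backslash)

lemma backslash_eq_split:
  assumes eq: "backslash u v = backslash u' v'" and le: "psize u \<le> psize u'"
  obtains z where "u' = backslash u z" "v = backslash z v'"
proof -
  have sz: "psize u + psize v = psize u' + psize v'" using eq by (metis psize_backslash)
  let ?q = "psize v" and ?q' = "psize v'"
  have w: "map (\<lambda>x. x + ?q) (word u) @ word v = map (\<lambda>x. x + ?q') (word u') @ word v'"
    using eq by (metis word_backslash)
  define zs where "zs = drop (psize u) (word u')"
  have len: "length zs = psize u' - psize u" by (simp add: zs_def)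
  have 1: "map (\<lambda>x. x + ?q) (word u) = map (\<lambda>x. x + ?q') (take (psize u) (word u'))"
    using arg_cong[OF w, of "take (psize u)"] le by (simp add: take_map)
  have 2: "word v = map (\<lambda>x. x + ?q') zs @ word v'"
    using arg_cong[OF w, of "drop (psize u)"] le by (simp add: drop_map zs_def)
  have dz: "distinct zs" by (simp add: zs_def)
  have "(\<lambda>x. x + ?q') ` set zs = {1..?q} - {1..?q'}"
  proof -
    have "set zs \<subseteq> {1..psize u'}"
      using set_drop_subset[of "psize u" "word u'"] by (simp add: zs_def set_word)
    moreover have "{1..?q} = (\<lambda>x. x + ?q') ` set zs \<union> {1..?q'}"
      using arg_cong[OF 2, of set] by (simp add: set_word)
    ultimately show ?thesis by auto
  qed
  also have "\<dots> = (\<lambda>x. x + ?q') ` {1..length zs}"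
  proof -
    have "{1..?q} - {1..?q'} = {?q' + 1..?q' + length zs}"
      using sz le by (auto simp: len)
    then show ?thesis by (simp add: image_add_atLeastAtMost add.commute[of _ ?q'])
  qed
  finally have sz': "set zs = {1..length zs}"
    by (subst (asm) inj_image_eq_iff) (auto simp: inj_def)
  define z where "z = Abs_perm zs"
  have wz: "word z = zs" unfolding z_def by (rule word_Abs_perm[OF dz sz'])
  have pz: "psize z = psize u' - psize u" by (simp add: wz len flip: length_word)
  show ?thesis
  proof
    show "v = backslash z v'" by (rule perm_eqI) (simp add: wz 2)
    have "?q = ?q' + psize z" using sz le pz by simp
    then have "map (\<lambda>x. x + psize z) (word u) = take (psize u) (word u')"
    proof -
      have "map (\<lambda>x. x + ?q') (map (\<lambda>x. x + psize z) (word u)) = map (\<lambda>x. x + ?q') (take (psize u) (word u'))"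
        using 1 \<open>?q = ?q' + psize z\<close> by (simp add: o_def ac_simps)
      then show ?thesis by (metis (no_types, lifting) add_right_cancel inj_onI inj_map_eq_map)
    qed
    then show "u' = backslash u z" by (intro perm_eqI) (simp add: wz zs_def)
  qed
qed

lemma backslash_cancel_same_size:
  "backslash u v = backslash u' v' \<Longrightarrow> psize u = psize u' \<Longrightarrow> u = u' \<and> v = v'"
  by (erule backslash_eq_split)
    (simp, metis add_cancel_left_right backslash_empty psize_0_iff psize_backslash)

lemma backslash_left_cancel [simp]: "backslash u v = backslash u v' \<longleftrightarrow> v = v'"
  using backslash_cancel_same_size by blast

section \<open>Unique factorization into irreducible permutations\<close>

definition backslash_list :: "perm list \<Rightarrow> perm" where
  "backslash_list ws = foldr backslash ws perm_empty"

lemma backslash_list_simps [simp]: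
  "backslash_list [] = perm_empty"
  "backslash_list (w # ws) = backslash w (backslash_list ws)"
  by (simp_all add: backslash_list_def)

lemma backslash_list_append: "backslash_list (us @ vs) = backslash (backslash_list us) (backslash_list vs)"
  by (induction us) (auto simp: backslash_assoc)

lemma perm_irreducible_nonempty: "perm_irreducible w \<Longrightarrow> w \<noteq> perm_empty"
  by (auto simp: perm_irreducible_def)

lemma perm_irreducible_split:
  "perm_irreducible (backslash u v) \<Longrightarrow> u = perm_empty \<or> v = perm_empty"
  by (auto simp: perm_irreducible_def)

lemma exists_irreducible_decomposition:
  "\<exists>ws. (\<forall>u\<in>set ws. perm_irreducible u) \<and> w = backslash_list ws"
proof (induction "psize w" arbitrary: w rule: less_induct)
  case less
  consider "w = perm_empty" | "perm_irreducible w"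
    | u v where "u \<noteq> perm_empty" "v \<noteq> perm_empty" "w = backslash u v"
    unfolding perm_irreducible_def by (metis less_one linorder_not_less psize_0_iff)
  then show ?case
  proof cases
    case 1
    then show ?thesis by (intro exI[of _ "[]"]) simp
  next
    case 2
    then show ?thesis by (intro exI[of _ "[w]"]) simp
  next
    case 3
    then have "psize u < psize w" "psize v < psize w" by (auto simp flip: psize_0_iff)
    then obtain us vs where "\<forall>x\<in>set us. perm_irreducible x" "u = backslash_list us"
      "\<forall>x\<in>set vs. perm_irreducible x" "v = backslash_list vs"
      using less by meson
    then show ?thesis using 3 by (intro exI[of _ "us @ vs"]) (auto simp: backslash_list_append)
  qed
qed

lemma irreducible_decomposition_unique:
  "\<forall>u\<in>set us. perm_irreducible u \<Longrightarrow> \<forall>v\<in>set vs. perm_irreducible v \<Longrightarrow>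
     backslash_list us = backslash_list vs \<Longrightarrow> us = vs"
proof (induction us arbitrary: vs)
  case Nil
  then show ?case by (cases vs) (auto dest: perm_irreducible_nonempty simp: eq_commute[of perm_empty])
next
  case (Cons u us)
  from Cons.prems(1,3) have "vs \<noteq> []" by (auto dest: perm_irreducible_nonempty)
  then obtain v vs' where vs: "vs = v # vs'" by (cases vs) auto
  have eq: "backslash u (backslash_list us) = backslash v (backslash_list vs')"
    using Cons.prems(3) vs by simp
  have irr: "perm_irreducible u" "perm_irreducible v" using Cons.prems vs by auto
  have "u = v"
  proof (cases "psize u \<le> psize v")
    case True
    then obtain z where "v = backslash u z" using eq backslash_eq_split by metis
    then show ?thesis using irr perm_irreducible_split perm_irreducible_nonempty by (metis backslash_empty(2))
  next
    case False
    then obtain z where "u = backslash v z" using eq backslash_eq_split by (metis nat_le_linear)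
    then show ?thesis using irr perm_irreducible_split perm_irreducible_nonempty by (metis backslash_empty(2))
  qed
  then show ?case using eq Cons.IH[of vs'] Cons.prems vs by simp
qed

definition components :: "perm \<Rightarrow> perm list" where
  "components w = (SOME ws. (\<forall>u\<in>set ws. perm_irreducible u) \<and> w = backslash_list ws)"

lemma components_spec:
  "(\<forall>u\<in>set (components w). perm_irreducible u) \<and> w = backslash_list (components w)"
  unfolding components_def by (rule someI_ex) (rule exists_irreducible_decomposition)

lemma components_irreducible: "u \<in> set (components w) \<Longrightarrow> perm_irreducible u"
  using components_spec by blast

lemma backslash_list_components [simp]: "backslash_list (components w) = w"
  using components_spec by simp

lemma components_backslash_list:
  "\<forall>u\<in>set ws. perm_irreducible u \<Longrightarrow> components (backslash_list ws) = ws"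
  by (rule irreducible_decomposition_unique) (auto dest: components_irreducible)

lemma components_backslash [simp]: "components (backslash u v) = components u @ components v"
  using components_backslash_list[of "components u @ components v"]
  by (auto simp: backslash_list_append dest: components_irreducible)

lemma components_empty [simp]: "components perm_empty = []"
  using components_backslash_list[of "[]"] by simp

lemma components_eq_Nil_iff [simp]: "components w = [] \<longleftrightarrow> w = perm_empty"
  by (metis backslash_list_components backslash_list_simps(1) components_empty)

lemma components_of_irreducible: "perm_irreducible w \<Longrightarrow> components w = [w]"
  using components_backslash_list[of "[w]"] by simp

lemma components_inject [simp]: "components u = components v \<longleftrightarrow> u = v"
  by (metis backslash_list_components)

lemma num_components_eq: "num_components w = length (components w)"
  unfolding num_components_def backslash_list_def[symmetric]
proof (rule the_equality)
  show "\<exists>ws. length ws = length (components w) \<and> (\<forall>u\<in>set ws. perm_irreducible u) \<and> w = backslash_list ws"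
    by (rule exI[of _ "components w"]) (auto dest: components_irreducible)
qed (auto simp: components_backslash_list)

lemma num_components_empty [simp]: "num_components perm_empty = 0"
  by (simp add: num_components_eq)

lemma num_components_backslash [simp]: "num_components (backslash u v) = num_components u + num_components v"
  by (simp add: num_components_eq)

lemma num_components_0_iff [simp]: "num_components w = 0 \<longleftrightarrow> w = perm_empty"
  by (simp add: num_components_eq)

lemma finite_psize [simp]: "finite {w. psize w = n}"
proof -
  have "finite (word ` {w. psize w = n})"
    by (rule finite_subset[OF _ finite_lists_length_eq[of "{1..n}" n]]) (auto simp: set_word)
  then show ?thesis by (rule finite_imageD) (simp add: inj_on_def Rep_perm_inject)
qed

lemma card_psize: "card {w. psize w = n} = fact n"
proof -
  have "word ` {w. psize w = n} = permutations_of_set {1..n}"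
  proof (intro equalityI subsetI)
    fix xs assume "xs \<in> permutations_of_set {1..n}"
    then have xs: "set xs = {1..n}" "distinct xs" by (auto simp: permutations_of_set_def)
    moreover from this have "length xs = n" by (metis card_atLeastAtMost diff_Suc_1 distinct_card)
    ultimately have "psize (Abs_perm xs) = n" "word (Abs_perm xs) = xs"
      by (auto simp: psize_Abs_perm word_Abs_perm)
    then show "xs \<in> word ` {w. psize w = n}" by (metis (mono_tags) image_eqI mem_Collect_eq)
  qed (auto simp: permutations_of_set_def set_word)
  moreover have "inj_on word {w. psize w = n}" by (simp add: inj_on_def Rep_perm_inject)
  ultimately show ?thesis by (metis card_atLeastAtMost card_image card_permutations_of_set diff_Suc_1 finite_atLeastAtMost)
qed

definition splits :: "perm \<Rightarrow> (perm \<times> perm) set" where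
  "splits w = {(u, v). backslash u v = w}"

text \<open>The components of \<open>backslash u v\<close> are those of \<open>u\<close> followed by
  those of \<open>v\<close>, so every factorization is a cut of the component list.\<close>

lemma splits_conv_components:
  "splits w = (\<lambda>i. (backslash_list (take i (components w)), backslash_list (drop i (components w)))) `
     {..num_components w}"
proof (intro equalityI subsetI)
  fix x assume "x \<in> splits w"
  then obtain u v where x: "x = (u, v)" and w: "w = backslash u v" by (auto simp: splits_def)
  show "x \<in> (\<lambda>i. (backslash_list (take i (components w)), backslash_list (drop i (components w)))) `
     {..num_components w}"
    by (rule image_eqI[of _ _ "num_components u"]) (simp_all add: x w num_components_eq)
qed (auto simp: splits_def simp flip: backslash_list_append)

lemma finite_splits [simp]: "finite (splits w)"
  by (simp add: splits_conv_components)

lemma sum_splits: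
  "(\<Sum>(u, v)\<in>splits w. f u v) =
     (\<Sum>i\<le>num_components w. f (backslash_list (take i (components w))) (backslash_list (drop i (components w))))"
proof -
  have "inj_on (\<lambda>i. (backslash_list (take i (components w)), backslash_list (drop i (components w))))
     {..num_components w}"
  proof (rule inj_onI)
    fix i j assume "i \<in> {..num_components w}" "j \<in> {..num_components w}"
      "(backslash_list (take i (components w)), backslash_list (drop i (components w))) =
       (backslash_list (take j (components w)), backslash_list (drop j (components w)))"
    then have "components (backslash_list (take i (components w))) = components (backslash_list (take j (components w)))"
      and le: "i \<le> length (components w)" "j \<le> length (components w)"
      by (simp_all add: num_components_eq)
    then have "take i (components w) = take j (components w)"
      by (subst (asm) (1 2) components_backslash_list) (auto dest: in_set_takeD components_irreducible)
    then show "i = j" using le by (metis length_take min.absorb2)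
  qed
  then show ?thesis
    by (simp add: splits_conv_components sum.reindex)
qed

subsection \<open>The weak order\<close>

text \<open>The weak order for arbitrary words, so that prefixes, suffixes and shuffles can be
  compared with a permutation before they are standardized.\<close>

definition le_word :: "nat list \<Rightarrow> nat list \<Rightarrow> bool" where
  "le_word xs ys \<longleftrightarrow> length xs = length ys \<and>
     (\<forall>i j. i < j \<longrightarrow> j < length xs \<longrightarrow> xs ! i > xs ! j \<longrightarrow> ys ! i > ys ! j)"

lemma weak_le_iff: "weak_le u v \<longleftrightarrow> le_word (word u) (word v)"
  by (auto simp: weak_le_def le_word_def inversions_def)

lemma weak_le_refl [simp]: "weak_le u u"
  and weak_le_trans: "weak_le u v \<Longrightarrow> weak_le v w \<Longrightarrow> weak_le u w"
  and weak_le_psize: "weak_le u v \<Longrightarrow> psize u = psize v"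
  by (auto simp: weak_le_def)

lemma finite_weak_le [simp]: "finite {v. weak_le u v}" "finite {v. weak_le v u}"
  by (rule finite_subset[OF _ finite_psize[of "psize u"]]; auto simp: weak_le_def)+

lemma nth_word_eq_card: "i < psize w \<Longrightarrow> word w ! i = card {j. j < psize w \<and> word w ! j \<le> word w ! i}"
proof -
  assume i: "i < psize w"
  have "word w ! i \<in> {1..psize w}" using i by (metis length_word nth_mem set_word)
  then have "{1..word w ! i} = (!) (word w) ` {j. j < psize w \<and> word w ! j \<le> word w ! i}"
  proof (intro equalityI subsetI)
    fix x assume "x \<in> {1..word w ! i}"
    then have "x \<in> set (word w)" using \<open>word w ! i \<in> {1..psize w}\<close> by (auto simp: set_word)
    then show "x \<in> (!) (word w) ` {j. j < psize w \<and> word w ! j \<le> word w ! i}"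
      using \<open>x \<in> {1..word w ! i}\<close> by (auto simp: in_set_conv_nth)
  next
    fix x assume "x \<in> (!) (word w) ` {j. j < psize w \<and> word w ! j \<le> word w ! i}"
    moreover have "word w ! j \<ge> 1" if "j < psize w" for j
      using that by (metis atLeastAtMost_iff length_word nth_mem set_word)
    ultimately show "x \<in> {1..word w ! i}" by auto
  qed
  moreover have "inj_on ((!) (word w)) {j. j < psize w \<and> word w ! j \<le> word w ! i}"
    by (auto simp: inj_on_def nth_eq_iff_index_eq)
  ultimately show ?thesis by (metis card_atLeastAtMost card_image diff_Suc_1)
qed

text \<open>Equal inversion sets give the same relative order of letters at all positions, and a
  letter of a permutation is the number of positions whose letter does not exceed it.\<close>

lemma weak_le_antisym:
  assumes "weak_le u v" "weak_le v u"
  shows "u = v"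
proof (rule perm_eqI)
  have n: "psize u = psize v" using assms(1) by (rule weak_le_psize)
  have inv: "word u ! i > word u ! j \<longleftrightarrow> word v ! i > word v ! j" if "i < j" "j < psize u" for i j
    using assms that by (auto simp: weak_le_iff le_word_def)
  have le: "word u ! i \<le> word u ! j \<longleftrightarrow> word v ! i \<le> word v ! j" if "i < psize u" "j < psize u" for i j
  proof -
    have "word u ! i = word u ! j \<longleftrightarrow> i = j" "word v ! i = word v ! j \<longleftrightarrow> i = j"
      using that n by (auto simp: nth_eq_iff_index_eq)
    then show ?thesis using inv[of i j] inv[of j i] that by (cases i j rule: linorder_cases) auto
  qed
  show "word u = word v"
  proof (rule nth_equalityI)
    fix i assume i: "i < length (word u)"
    have "word u ! i = card {j. j < psize u \<and> word u ! j \<le> word u ! i}"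
      using i by (intro nth_word_eq_card) simp
    also have "{j. j < psize u \<and> word u ! j \<le> word u ! i} = {j. j < psize v \<and> word v ! j \<le> word v ! i}"
      using le n i by auto
    also have "card \<dots> = word v ! i"
      using i n by (intro nth_word_eq_card[symmetric]) simp
    finally show "word u ! i = word v ! i" .
  qed (simp add: n)
qed

lemma weak_less_iff: "weak_less u v \<longleftrightarrow> weak_le u v \<and> u \<noteq> v"
  using weak_le_antisym by (auto simp: weak_less_def)

lemma le_word_map:
  "strict_mono_on (set xs) f \<Longrightarrow> le_word (map f xs) ys \<longleftrightarrow> le_word xs ys"
  unfolding le_word_def
  by (intro conj_cong all_cong imp_cong) (auto simp: strict_mono_on_less)

text \<open>In \<open>backslash u v\<close> every letter of the first block exceeds every letter of
  the second, so pairs of positions across the cut are inversions already and impose no condition on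
  \<open>xs\<close>.\<close>

lemma le_word_backslash:
  assumes "length xs = psize u + psize v"
  shows "le_word xs (word (backslash u v)) \<longleftrightarrow>
     le_word (take (psize u) xs) (word u) \<and> le_word (drop (psize u) xs) (word v)" (is "?L \<longleftrightarrow> ?A \<and> ?B")
proof (intro iffI conjI)
  assume L: ?L
  have inv: "word (backslash u v) ! i > word (backslash u v) ! j" if "i < j" "j < length xs" "xs ! i > xs ! j" for i j
    using L that by (auto simp: le_word_def)
  show ?A unfolding le_word_def
  proof (intro conjI allI impI)
    fix i j assume "i < j" "j < length (take (psize u) xs)" "take (psize u) xs ! j < take (psize u) xs ! i"
    then show "word u ! j < word u ! i" using inv[of i j] assms by (auto simp: nth_append)
  qed (use assms in simp)
  show ?B unfolding le_word_def
  proof (intro conjI allI impI)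
    fix i j assume "i < j" "j < length (drop (psize u) xs)" "drop (psize u) xs ! j < drop (psize u) xs ! i"
    then show "word v ! j < word v ! i" using inv[of "psize u + i" "psize u + j"] assms by (auto simp: nth_append)
  qed (use assms in simp)
next
  assume AB: "?A \<and> ?B"
  show ?L unfolding le_word_def
  proof (intro conjI allI impI)
    fix i j assume ij: "i < j" "j < length xs" "xs ! j < xs ! i"
    have A: "word u ! j < word u ! i" if "j < psize u"
      using AB ij that assms by (auto simp: le_word_def)
    have B: "word v ! (j - psize u) < word v ! (i - psize u)" if "psize u \<le> i"
    proof -
      have "drop (psize u) xs ! (j - psize u) < drop (psize u) xs ! (i - psize u)"
        using ij that assms by simp
      moreover have "i - psize u < j - psize u" "j - psize u < length (drop (psize u) xs)"
        using ij that by auto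
      ultimately show ?thesis using AB unfolding le_word_def by blast
    qed
    have C: "word v ! (j - psize u) < word u ! i + psize v" if "i < psize u" "psize u \<le> j"
    proof -
      have "word v ! (j - psize u) \<in> {1..psize v}"
        by (subst set_word[symmetric]) (use ij that assms in \<open>auto intro!: nth_mem\<close>)
      moreover have "word u ! i \<in> {1..psize u}"
        by (subst set_word[symmetric]) (use ij that assms in \<open>auto intro!: nth_mem\<close>)
      ultimately show ?thesis by auto
    qed
    show "word (backslash u v) ! j < word (backslash u v) ! i"
      using ij assms A B C by (auto simp: nth_append)
  qed (use assms in simp)
qed

text \<open>Standardization is strictly increasing on letters, so the weak order cannot see it.\<close>

definition rank_in :: "nat set \<Rightarrow> nat \<Rightarrow> nat" where
  "rank_in A x = card {y \<in> A. y \<le> x}"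

lemma rank_in_less: "finite A \<Longrightarrow> y \<in> A \<Longrightarrow> x < y \<Longrightarrow> rank_in A x < rank_in A y"
proof -
  assume *: "finite A" "y \<in> A" "x < y"
  then have "y \<in> {z \<in> A. z \<le> y}" "y \<notin> {z \<in> A. z \<le> x}" "{z \<in> A. z \<le> x} \<subseteq> {z \<in> A. z \<le> y}" by auto
  then show ?thesis unfolding rank_in_def using *(1) by (intro psubset_card_mono) auto
qed

lemma strict_mono_rank_in: "finite A \<Longrightarrow> strict_mono_on A (rank_in A)"
  by (intro strict_mono_onI rank_in_less)

lemma rank_in_image: "finite A \<Longrightarrow> rank_in A ` A = {1..card A}"
proof -
  assume A: "finite A"
  have "rank_in A ` A \<subseteq> {1..card A}"
    by (auto simp: rank_in_def card_gt_0_iff Suc_le_eq intro!: card_mono A)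
  moreover have "card (rank_in A ` A) = card {1..card A}"
    using strict_mono_on_imp_inj_on[OF strict_mono_rank_in[OF A]] by (simp add: card_image)
  ultimately show ?thesis by (intro card_subset_eq) auto
qed

lemma standardize_eq: "standardize xs = map (rank_in (set xs)) xs"
  by (simp add: standardize_def rank_in_def)

lemma word_standardize: "distinct xs \<Longrightarrow> word (Abs_perm (standardize xs)) = standardize xs"
  by (rule word_Abs_perm)
    (auto simp: standardize_eq distinct_map rank_in_image distinct_card
      intro!: strict_mono_on_imp_inj_on strict_mono_rank_in)

lemma le_word_standardize: "le_word (standardize xs) ys \<longleftrightarrow> le_word xs ys"
  by (simp add: standardize_eq le_word_map strict_mono_rank_in)

section \<open>The monomial basis\<close>

text \<open>The coordinate functionals of the monomial basis: \<open>F\<^sub>u\<close> is the sum of the \<open>M\<^sub>w\<close> with \<open>u \<le> w\<close>.\<close>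

definition M_coord :: "perm \<Rightarrow> (perm \<Rightarrow>\<^sub>0 'k::field) \<Rightarrow> 'k" where
  "M_coord w h = (\<Sum>u | weak_le u w. Poly_Mapping.lookup h u)"

lemma lin_M_coord: "lin smul (*) (M_coord w)"
  by (rule linI) (simp_all add: M_coord_def lookup_add sum.distrib sum_distrib_left)

lemma M_coord_bas: "M_coord w (bas u) = (if weak_le u w then 1 else 0)"
  by (simp add: M_coord_def lookup_single when_def)

lemma M_coord_bas_word: "M_coord w (bas u) = (if le_word (word u) (word w) then 1 else 0)"
  by (simp add: M_coord_bas weak_le_iff)

text \<open>Moebius inversion: the recursion defining \<open>mobius\<close> says that its sum over
  the interval from \<open>u\<close> to \<open>w\<close> vanishes unless
  \<open>u = w\<close>.\<close>

lemma M_coord_M: "M_coord w (M_SSym u) = (if u = w then 1 else 0 :: 'k::field)"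
proof -
  have "M_coord w (M_SSym u) = (\<Sum>v | weak_le u v. of_int (mobius u v) * (if weak_le v w then 1 else 0 :: 'k))"
    unfolding M_SSym_def lin_sum[OF lin_M_coord] lin_scale[OF lin_M_coord] M_coord_bas ..
  also have "\<dots> = (\<Sum>v | weak_le u v \<and> weak_le v w. of_int (mobius u v))"
    by (rule sum.mono_neutral_cong_right) auto
  also have "\<dots> = of_int (\<Sum>v | weak_le u v \<and> weak_le v w. mobius u v)" by simp
  also have "(\<Sum>v | weak_le u v \<and> weak_le v w. mobius u v) = (if u = w then 1 else 0)"
  proof -
    consider "u = w" | "u \<noteq> w" "weak_le u w" | "\<not> weak_le u w" by blast
    then show ?thesis
    proof cases
      case 1
      then have "{v. weak_le u v \<and> weak_le v w} = {u}" using weak_le_antisym weak_le_refl by blast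
      then show ?thesis using 1 by (simp add: mobius.simps)
    next
      case 2
      then have *: "{v. weak_le u v \<and> weak_le v w} = insert w {z. weak_le u z \<and> weak_less z w}"
        by (auto simp: weak_less_iff)
      have "finite {z. weak_le u z \<and> weak_less z w}"
        by (rule finite_subset[OF _ finite_weak_le(1)[of u]]) auto
      then have "(\<Sum>v | weak_le u v \<and> weak_le v w. mobius u v) =
          mobius u w + (\<Sum>z | weak_le u z \<and> weak_less z w. mobius u z)"
        unfolding * by (subst sum.insert) (auto simp: weak_less_iff)
      also have "\<dots> = 0" using 2 by (subst mobius.simps) (simp add: weak_less_iff)
      finally show ?thesis using 2 by simp
    next
      case 3
      then have *: "{v. weak_le u v \<and> weak_le v w} = {}" using weak_le_trans by blast
      have "u \<noteq> w" using 3 by auto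
      then show ?thesis unfolding * by simp
    qed
  qed
  finally show ?thesis by simp
qed

text \<open>At a key \<open>u\<close> of a nonzero difference with the fewest inversions, every
  other permutation below \<open>u\<close> has coefficient 0, so the coordinate at \<open>u\<close>
  is the single nonzero coefficient of \<open>u\<close>.\<close>

lemma M_coord_eqI:
  fixes h h' :: "perm \<Rightarrow>\<^sub>0 'k::field"
  assumes "\<And>w. M_coord w h = M_coord w h'"
  shows "h = h'"
proof (rule ccontr)
  assume "h \<noteq> h'"
  define d where "d = h - h'"
  have d0: "M_coord w d = 0" for w unfolding d_def by (simp add: lin_diff[OF lin_M_coord] assms)
  have "Poly_Mapping.keys d \<noteq> {}" using \<open>h \<noteq> h'\<close> by (simp add: d_def)
  then obtain u where u: "u \<in> Poly_Mapping.keys d"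
    and min: "\<And>v. v \<in> Poly_Mapping.keys d \<Longrightarrow> card (inversions u) \<le> card (inversions v)"
    using ex_min_if_finite[of "(\<lambda>v. card (inversions v)) ` Poly_Mapping.keys d"] by (force simp: not_less)
  have "Poly_Mapping.lookup d v = 0" if "weak_le v u" "v \<noteq> u" for v
  proof (rule ccontr)
    assume "Poly_Mapping.lookup d v \<noteq> 0"
    then have "card (inversions u) \<le> card (inversions v)" by (intro min) (simp add: in_keys_iff)
    moreover have sub: "inversions v \<subseteq> inversions u" using that by (simp add: weak_le_def)
    ultimately have "inversions u = inversions v" by (metis card_seteq finite_inversions)
    then have "weak_le u v" using weak_le_psize[OF that(1)] by (simp add: weak_le_def)
    then show False using that weak_le_antisym by blast
  qed
  then have "M_coord u d = (\<Sum>v\<in>{u}. Poly_Mapping.lookup d v)"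
    unfolding M_coord_def by (intro sum.mono_neutral_right) auto
  then show False using d0 u by (simp add: in_keys_iff)
qed

lemma finite_M_coord: "finite {w. M_coord w h \<noteq> 0}"
proof -
  have "{w. M_coord w h \<noteq> 0} \<subseteq> (\<Union>u\<in>Poly_Mapping.keys h. {w. weak_le u w})"
  proof
    fix w assume "w \<in> {w. M_coord w h \<noteq> 0}"
    then obtain u where "weak_le u w" "Poly_Mapping.lookup h u \<noteq> 0"
      unfolding M_coord_def by (auto elim: sum.not_neutral_contains_not_neutral)
    then show "w \<in> (\<Union>u\<in>Poly_Mapping.keys h. {w. weak_le u w})" by (auto simp: in_keys_iff)
  qed
  then show ?thesis by (rule finite_subset) auto
qed

lemma M_expand: "h = (\<Sum>w | M_coord w h \<noteq> 0. smul (M_coord w h) (M_SSym w))"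
  by (rule M_coord_eqI)
    (simp add: lin_sum[OF lin_M_coord] lin_scale[OF lin_M_coord] M_coord_M finite_M_coord
      if_distrib cong: if_cong)

lemma M_SSym_empty: "M_SSym perm_empty = bas perm_empty"
proof (rule M_coord_eqI)
  fix w :: perm
  have "weak_le perm_empty w \<longleftrightarrow> w = perm_empty"
    using weak_le_psize[of perm_empty w] by (metis psize_0_iff psize_perm_empty weak_le_refl)
  then show "M_coord w (M_SSym perm_empty) = M_coord w (bas perm_empty :: perm \<Rightarrow>\<^sub>0 'a)"
    by (auto simp: M_coord_M M_coord_bas)
qed

section \<open>The coproduct and the coradical filtration\<close>

lemma SSym_sel [simp]:
  "hscale SSym = smul" "hone SSym = bas perm_empty" "hcomult SSym = lin_ext smul F_comult"
  "hmult SSym x y = lin_ext smul (\<lambda>u. lin_ext smul (\<lambda>v. F_mult u v) y) x"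
  "hcounit SSym x = Poly_Mapping.lookup x perm_empty"
  "hdeg SSym n = module.span smul {bas w | w. psize w = n}"
  by (simp_all add: SSym_def)

lemma keys_lin_ext: "Poly_Mapping.keys (lin_ext smul f x) \<subseteq> (\<Union>b\<in>Poly_Mapping.keys x. Poly_Mapping.keys (f b))"
proof
  fix k assume "k \<in> Poly_Mapping.keys (lin_ext smul f x)"
  then have "(\<Sum>b\<in>Poly_Mapping.keys x. Poly_Mapping.lookup x b * Poly_Mapping.lookup (f b) k) \<noteq> 0"
    by (simp add: lin_ext_def in_keys_iff lookup_sum)
  then obtain b where "b \<in> Poly_Mapping.keys x" "Poly_Mapping.lookup (f b) k \<noteq> 0"
    by (auto elim: sum.not_neutral_contains_not_neutral)
  then show "k \<in> (\<Union>b\<in>Poly_Mapping.keys x. Poly_Mapping.keys (f b))" by (auto simp: in_keys_iff)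
qed

lemma keys_sum_bas: "Poly_Mapping.keys (\<Sum>i\<in>I. bas (f i)) \<subseteq> f ` I"
  using keys_sum[of "\<lambda>i. bas (f i)" I] by (auto split: if_splits)

lemma length_comult_SSym: "l \<in> Poly_Mapping.keys (hcomult SSym h) \<Longrightarrow> length l = 2"
  using keys_lin_ext[of F_comult h] keys_sum_bas by (fastforce simp: F_comult_def)

text \<open>The deconcatenation formula for the monomial basis in transposed form. Among the cuts of
  a basis permutation only the one at \<open>psize u\<close> can contribute, because
  \<open>le_word\<close> compares words of equal length; \<open>le_word_backslash\<close> then joins
  the two conditions.\<close>

lemma comult_M_coord:
  "tensor_eval [M_coord u, M_coord v] (hcomult SSym h) = M_coord (backslash u v) (h :: perm \<Rightarrow>\<^sub>0 'k::field)"
proof (rule lin_eqI[of "(*)" "\<lambda>h. tensor_eval [M_coord u, M_coord v] (hcomult SSym h)"])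
  show "lin smul (*) (\<lambda>h. tensor_eval [M_coord u, M_coord v] (hcomult SSym h))"
    by (simp add: lin_comp[OF lin_lin_ext_smul lin_tensor_eval])
  show "lin smul (*) (M_coord (backslash u v))" by (rule lin_M_coord)
  fix x
  let ?t = "\<lambda>p. le_word (take p (word x)) (word u)" and ?d = "\<lambda>p. le_word (drop p (word x)) (word v)"
  have "tensor_eval [M_coord u, M_coord v] (hcomult SSym (bas x)) =
      (\<Sum>p\<le>psize x. if ?t p \<and> ?d p then 1 else 0 :: 'k)"
    by (simp add: F_comult_def lin_sum[OF lin_tensor_eval] M_coord_bas_word word_standardize
        le_word_standardize cong: if_cong)
      (rule sum.cong, auto)
  also have "\<dots> = (if le_word (word x) (word (backslash u v)) then 1 else 0)"
  proof (cases "psize x = psize u + psize v")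
    case True
    have "(\<Sum>p\<le>psize x. if ?t p \<and> ?d p then 1 else 0 :: 'k) =
        (\<Sum>p\<in>{psize u}. if ?t p \<and> ?d p then 1 else 0 :: 'k)"
      by (rule sum.mono_neutral_right) (auto simp: True le_word_def)
    then show ?thesis using le_word_backslash[of "word x" u v] True by simp
  next
    case False
    then have "\<not> (?t p \<and> ?d p)" if "p \<le> psize x" for p using that by (auto simp: le_word_def)
    then have "(\<Sum>p\<le>psize x. if ?t p \<and> ?d p then 1 else 0 :: 'k) = 0" by (intro sum.neutral) auto
    then show ?thesis using False by (simp add: le_word_def del: word_backslash)
  qed
  finally show "tensor_eval [M_coord u, M_coord v] (hcomult SSym (bas x)) = M_coord (backslash u v) (bas x :: perm \<Rightarrow>\<^sub>0 'k)"
    by (simp only: M_coord_bas_word)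
qed

lemma tensor_eqI_SSym:
  fixes t u :: "(perm \<Rightarrow>\<^sub>0 'k::field, 'k) tensor"
  assumes "\<And>l. l \<in> Poly_Mapping.keys t \<union> Poly_Mapping.keys u \<Longrightarrow> length l = 2"
    and "\<And>a b. tensor_eval [M_coord a, M_coord b] t = tensor_eval [M_coord a, M_coord b] u"
  shows "tensor_eq smul t u"
  by (rule tensor_eqI[OF vector_space_smul finite_M_coord M_expand assms])

lemma comult_M:
  "tensor_eq smul (hcomult SSym (M_SSym a)) (\<Sum>(u, v)\<in>splits a. bas [M_SSym u, M_SSym v :: perm \<Rightarrow>\<^sub>0 'k::field])"
proof (rule tensor_eqI_SSym)
  fix l assume "l \<in> Poly_Mapping.keys (hcomult SSym (M_SSym a :: perm \<Rightarrow>\<^sub>0 'k)) \<union>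
      Poly_Mapping.keys (\<Sum>(u, v)\<in>splits a. bas [M_SSym u, M_SSym v :: perm \<Rightarrow>\<^sub>0 'k])"
  then show "length l = 2"
    using keys_sum_bas[of "\<lambda>(u, v). [M_SSym u, M_SSym v :: perm \<Rightarrow>\<^sub>0 'k]" "splits a"]
    by (auto dest: length_comult_SSym simp: case_prod_unfold simp del: SSym_sel)
next
  fix u v
  have "tensor_eval [M_coord u, M_coord v] (\<Sum>(u, v)\<in>splits a. bas [M_SSym u, M_SSym v :: perm \<Rightarrow>\<^sub>0 'k])
      = (\<Sum>x\<in>splits a. (if fst x = u then 1 else 0) * (if snd x = v then 1 else 0))"
    unfolding lin_sum[OF lin_tensor_eval] case_prod_unfold by (simp add: M_coord_M)
  also have "\<dots> = (\<Sum>x\<in>splits a. if x = (u, v) then 1 else 0)"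
    by (rule sum.cong) auto
  also have "\<dots> = M_coord (backslash u v) (M_SSym a)"
    by (simp add: M_coord_M) (auto simp: splits_def)
  finally show "tensor_eval [M_coord u, M_coord v] (hcomult SSym (M_SSym a)) =
      tensor_eval [M_coord u, M_coord v] (\<Sum>(u, v)\<in>splits a. bas [M_SSym u, M_SSym v :: perm \<Rightarrow>\<^sub>0 'k])"
    by (simp add: comult_M_coord del: SSym_sel)
qed

section \<open>Iterated coproducts and the coradical filtration\<close>

lemma length_iter_comult: "l \<in> Poly_Mapping.keys (iter_comult SSym k h) \<Longrightarrow> length l = Suc k"
proof (induction k arbitrary: l)
  case (Suc k)
  then obtain l' where l': "l' \<in> Poly_Mapping.keys (iter_comult SSym k h)"
    and "l \<in> Poly_Mapping.keys (lin_ext smul (\<lambda>p. bas (p @ tl l')) (hcomult SSym (hd l')))"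
    using keys_lin_ext by (fastforce simp del: SSym_sel)
  then obtain p where "p \<in> Poly_Mapping.keys (hcomult SSym (hd l'))" "l = p @ tl l'"
    using keys_lin_ext[of "\<lambda>p. bas (p @ tl l')" "hcomult SSym (hd l')"] by (fastforce simp del: SSym_sel split: if_splits)
  then show ?case using Suc.IH[OF l'] length_comult_SSym by fastforce
qed (simp split: if_splits)

lemma iter_comult_M_coord:
  "length ws = Suc k \<Longrightarrow> tensor_eval (map M_coord ws) (iter_comult SSym k h) = M_coord (backslash_list ws) h"
proof (induction k arbitrary: ws)
  case 0
  then show ?case by (auto simp: length_Suc_conv)
next
  case (Suc k)
  then obtain u v ws' where ws: "ws = u # v # ws'" and len: "length ws' = k"
    by (auto simp: length_Suc_conv)
  let ?D = "\<lambda>l. lin_ext smul (\<lambda>p. bas (p @ tl l)) (hcomult SSym (hd l))"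
  have "tensor_eval (map M_coord ws) (?D l) = word_eval (map M_coord (backslash u v # ws')) l"
    if l: "l \<in> Poly_Mapping.keys (iter_comult SSym k h)" for l
  proof -
    obtain x xs where lx: "l = x # xs" "length xs = k" using length_iter_comult[OF l] by (auto simp: length_Suc_conv)
    have "tensor_eval (map M_coord ws) (?D l) =
        lin_ext (*) (\<lambda>p. word_eval (map M_coord ws) (p @ xs)) (hcomult SSym x)"
      by (simp add: lin_ext_lin[OF lin_tensor_eval] lx del: SSym_sel)
    also have "\<dots> = lin_ext (*) (\<lambda>p. word_eval [M_coord u, M_coord v] p * word_eval (map M_coord ws') xs) (hcomult SSym x)"
    proof (rule lin_ext_cong)
      fix p assume "p \<in> Poly_Mapping.keys (hcomult SSym x)"
      then have "length [M_coord u, M_coord v] = length p" using length_comult_SSym by fastforce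
      from word_eval_append[OF this, of "map M_coord ws'" xs]
      show "word_eval (map M_coord ws) (p @ xs) = word_eval [M_coord u, M_coord v] p * word_eval (map M_coord ws') xs"
        by (simp add: ws)
    qed
    also have "\<dots> = tensor_eval [M_coord u, M_coord v] (hcomult SSym x) * word_eval (map M_coord ws') xs"
      by (simp add: tensor_eval_def lin_ext_def sum_distrib_right mult.assoc)
    finally show ?thesis by (simp add: comult_M_coord lx del: SSym_sel)
  qed
  then have "tensor_eval (map M_coord ws) (iter_comult SSym (Suc k) h) =
      tensor_eval (map M_coord (backslash u v # ws')) (iter_comult SSym k h)"
    unfolding iter_comult.simps lin_ext_lin[OF lin_tensor_eval]
    unfolding tensor_eval_def[of "map M_coord (backslash u v # ws')"] by (rule lin_ext_cong)
  also have "\<dots> = M_coord (backslash_list ws) h"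
    using Suc.IH[of "backslash u v # ws'"] by (simp add: len ws backslash_assoc)
  finally show ?case .
qed

lemma tensor_eq_append_right:
  fixes t u :: "('v::ab_group_add, 'k::field) tensor"
  assumes "tensor_eq s t u"
  shows "tensor_eq s (lin_ext smul (\<lambda>p. bas (p @ ys)) t) (lin_ext smul (\<lambda>p. bas (p @ ys)) u)"
proof -
  let ?A = "lin_ext smul (\<lambda>p. bas (p @ ys)) :: ('v, 'k) tensor \<Rightarrow> _"
  have "smul.span ({bas (xs @ (a + b) # ys) - bas (xs @ a # ys) - bas (xs @ b # ys) |xs a b ys. True} \<union>
        {bas (xs @ s c a # ys) - smul c (bas (xs @ a # ys)) |xs c a ys. True}) \<subseteq> {t. ?A t \<in> tensor_rel s}"
  proof (rule smul.span_minimal)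
    show "smul.subspace {t. ?A t \<in> tensor_rel s}"
      by (rule smul.subspaceI)
        (simp_all add: lin_ext_smul_simps smul.subspace_0 smul.subspace_add smul.subspace_scale subspace_tensor_rel)
    show "{bas (xs @ (a + b) # ys) - bas (xs @ a # ys) - bas (xs @ b # ys) |xs a b ys. True} \<union>
        {bas (xs @ s c a # ys) - smul c (bas (xs @ a # ys)) |xs c a ys. True} \<subseteq> {t. ?A t \<in> tensor_rel s}"
      using tensor_eq_slot_add[of s] tensor_eq_slot_scale[of s]
      by (auto simp: lin_ext_smul_simps tensor_eq_def diff_diff_eq)
  qed
  then have "tensor_rel s \<subseteq> {t. ?A t \<in> tensor_rel s}" by (subst tensor_rel_def)
  then show ?thesis using assms by (auto simp: tensor_eq_def simp flip: lin_ext_smul_simps(4))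
qed

text \<open>For membership in the filtration only the shape of the words matters, namely that their
  entries form a factorization of \<open>a\<close>; the coefficients are therefore left
  unspecified.\<close>

lemma iter_comult_M:
  "\<exists>t \<in> smul.span {bas (map M_SSym as) | as. length as = Suc k \<and> backslash_list as = a}.
     tensor_eq smul (iter_comult SSym k (M_SSym a :: perm \<Rightarrow>\<^sub>0 'k::field)) t"
proof (induction k)
  case 0
  show ?case
    by (rule bexI[of _ "bas (map M_SSym [a])"]) (auto intro!: tensor_eq_refl smul.span_base exI[of _ "[a]"])
next
  case (Suc k)
  let ?X = "\<lambda>k. {bas (map M_SSym as) | as. length as = Suc k \<and> backslash_list as = a} :: (perm \<Rightarrow>\<^sub>0 'k, 'k) tensor set"
  let ?D = "lin_ext smul (\<lambda>l. lin_ext smul (\<lambda>p. bas (p @ tl l)) (hcomult SSym (hd l)))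
     :: (perm \<Rightarrow>\<^sub>0 'k, 'k) tensor \<Rightarrow> _"
  obtain t where t: "t \<in> smul.span (?X k)" "tensor_eq smul (iter_comult SSym k (M_SSym a)) t"
    using Suc by blast
  have "?D (iter_comult SSym k (M_SSym a) - t) \<in> tensor_rel smul"
    using tensor_rel_step[of SSym "iter_comult SSym k (M_SSym a) - t"] t(2)
    by (simp add: lin_ext_smul_simps tensor_eq_def)
  then have D: "tensor_eq smul (iter_comult SSym (Suc k) (M_SSym a)) (?D t)"
    by (simp only: lin_ext_smul_simps tensor_eq_def iter_comult.simps)
  have "\<exists>t'\<in>smul.span (?X (Suc k)). tensor_eq smul (?D t) t'"
    using t(1)
  proof (induction rule: smul.span_induct)
    case base
    show ?case
    proof (rule smul.subspaceI)
      show "0 \<in> {x. \<exists>t'\<in>smul.span (?X (Suc k)). tensor_eq smul (?D x) t'}"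
        using tensor_eq_refl smul.span_zero by fastforce
      show "x + y \<in> {x. \<exists>t'\<in>smul.span (?X (Suc k)). tensor_eq smul (?D x) t'}"
        if "x \<in> {x. \<exists>t'\<in>smul.span (?X (Suc k)). tensor_eq smul (?D x) t'}"
          "y \<in> {x. \<exists>t'\<in>smul.span (?X (Suc k)). tensor_eq smul (?D x) t'}" for x y
        using that by (auto simp: lin_ext_smul_simps intro: tensor_eq_add smul.span_add)
      show "smul c x \<in> {x. \<exists>t'\<in>smul.span (?X (Suc k)). tensor_eq smul (?D x) t'}"
        if "x \<in> {x. \<exists>t'\<in>smul.span (?X (Suc k)). tensor_eq smul (?D x) t'}" for c x
        using that by (auto simp: lin_ext_smul_simps intro: tensor_eq_smul smul.span_scale)
    qed
  next
    case (step x)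
    then obtain as' where "x = bas (map M_SSym as')" "length as' = Suc k" "backslash_list as' = a" by auto
    then obtain b as where x: "x = bas (map M_SSym (b # as))" "length as = k" "backslash b (backslash_list as) = a"
      by (auto simp: length_Suc_conv)
    let ?t = "\<Sum>(u, v)\<in>splits b. bas (map M_SSym (u # v # as)) :: (perm \<Rightarrow>\<^sub>0 'k, 'k) tensor"
    have "?t \<in> smul.span (?X (Suc k))"
      by (rule smul.span_sum) (use x in \<open>auto simp: splits_def backslash_assoc
         intro!: smul.span_base exI[of _ "u # v # as" for u v]\<close>)
    moreover have "tensor_eq smul (?D x) ?t"
      using tensor_eq_append_right[OF comult_M[of b], of "map M_SSym as"]
      by (simp add: x lin_sum[OF lin_lin_ext_smul] case_prod_unfold)
    ultimately show ?case by blast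
  qed
  then show ?case using D tensor_eq_trans by blast
qed

lemma coradical0_SSym: "coradical0 SSym = {smul c (bas perm_empty) | c. True}"
  by (simp add: coradical0_def)

lemma M_coord_coradical0: "a \<in> coradical0 SSym \<Longrightarrow> w \<noteq> perm_empty \<Longrightarrow> M_coord w a = 0"
  using M_coord_M[of w perm_empty] by (auto simp: coradical0_SSym lin_scale[OF lin_M_coord] M_SSym_empty)

text \<open>The first \<open>k\<close> components are kept and the remaining ones merged; the merged
  factor is nonempty because there are more than \<open>k\<close> components.\<close>

lemma exists_long_factorization:
  "num_components w > k \<Longrightarrow> \<exists>ws. length ws = Suc k \<and> backslash_list ws = w \<and> perm_empty \<notin> set ws"
proof -
  assume "num_components w > k"
  then have k: "k < length (components w)" by (simp add: num_components_eq)
  let ?r = "backslash_list (drop k (components w))"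
  have "length (take k (components w) @ [?r]) = Suc k" using k by simp
  moreover have "backslash_list (take k (components w) @ [?r]) = w"
    by (simp add: backslash_list_append flip: backslash_list_append[of "take k _"])
  moreover have "?r \<noteq> perm_empty"
  proof
    assume "?r = perm_empty"
    then have "components ?r = []" by simp
    then have "drop k (components w) = []"
      by (subst (asm) components_backslash_list) (auto dest: in_set_dropD components_irreducible)
    then show False using k by simp
  qed
  moreover have "perm_empty \<notin> set (take k (components w))"
    by (metis in_set_takeD components_irreducible perm_irreducible_nonempty)
  moreover have "perm_empty \<notin> set (take k (components w) @ [?r])" using calculation(3,4) by simp
  ultimately show ?thesis by blast
qed

text \<open>Pigeonhole: a factorization of \<open>a\<close> into \<open>k + 1\<close> factors must
  contain an empty one, since each nonempty factor uses up at least one of at most \<open>k\<close>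
  components.\<close>

lemma M_in_coradical:
  assumes "num_components a \<le> k"
  shows "(M_SSym a :: perm \<Rightarrow>\<^sub>0 'k::field) \<in> coradical SSym k"
proof (cases "k = 0")
  case True
  then have "a = perm_empty" using assms by simp
  then show ?thesis using True
    by (auto simp: coradical_def coradical0_SSym M_SSym_empty intro!: exI[of _ 1])
next
  case False
  obtain t where t: "t \<in> smul.span {bas (map M_SSym as) | as. length as = Suc k \<and> backslash_list as = a}"
    "tensor_eq smul (iter_comult SSym k (M_SSym a :: perm \<Rightarrow>\<^sub>0 'k)) t"
    using iter_comult_M by blast
  have "{bas (map M_SSym as) | as. length as = Suc k \<and> backslash_list as = a} \<subseteq>
      ({bas l | l. length l = k + 1 \<and> (\<exists>i\<le>k. l ! i \<in> coradical0 (SSym :: (perm \<Rightarrow>\<^sub>0 'k, 'k) hopf))} :: (perm \<Rightarrow>\<^sub>0 'k, 'k) tensor set)"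
  proof
    fix x :: "(perm \<Rightarrow>\<^sub>0 'k, 'k) tensor"
    assume "x \<in> {bas (map M_SSym as) | as. length as = Suc k \<and> backslash_list as = a}"
    then obtain as where x: "x = bas (map M_SSym as)" and as: "length as = Suc k" "a = backslash_list as" by auto
    have "perm_empty \<in> set as"
    proof (rule ccontr)
      assume "perm_empty \<notin> set as"
      then have "length as \<le> num_components (backslash_list as)"
      proof (induction as)
        case (Cons a as)
        then have "num_components a \<noteq> 0" "length as \<le> num_components (backslash_list as)" by auto
        then show ?case unfolding list.size backslash_list_simps num_components_backslash by linarith
      qed simp
      then show False using as assms by simp
    qed
    then obtain i where i: "i \<le> k" "as ! i = perm_empty" using as(1) by (auto simp: in_set_conv_nth less_Suc_eq_le)
    then have "map M_SSym as ! i \<in> coradical0 (SSym :: (perm \<Rightarrow>\<^sub>0 'k, 'k) hopf)"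
      using as(1) by (auto simp: coradical0_SSym M_SSym_empty intro!: exI[of _ 1])
    then show "x \<in> {bas l | l. length l = k + 1 \<and> (\<exists>i\<le>k. l ! i \<in> coradical0 (SSym :: (perm \<Rightarrow>\<^sub>0 'k, 'k) hopf))}"
      using as(1) i(1) x by (auto intro!: exI[of _ "map M_SSym as"])
  qed
  from smul.span_mono[OF this] t False show ?thesis
    by (auto simp: coradical_def)
qed

text \<open>If \<open>w\<close> has more than \<open>k\<close> components, it factors into
  \<open>k + 1\<close> nonempty permutations. Their coordinate functionals kill every word with an
  entry in \<open>coradical0\<close>, while on the iterated coproduct of \<open>h\<close> they
  return \<open>M_coord w h\<close>. The converse expands \<open>h\<close> in the monomial
  basis.\<close>

lemma coradical_SSym_iff:
  "(h :: perm \<Rightarrow>\<^sub>0 'k::field) \<in> coradical SSym k \<longleftrightarrow> (\<forall>w. num_components w > k \<longrightarrow> M_coord w h = 0)"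
proof (intro iffI allI impI)
  fix w assume h: "h \<in> coradical SSym k" and w: "num_components w > k"
  show "M_coord w h = 0"
  proof (cases "k = 0")
    case True
    then show ?thesis using h w by (intro M_coord_coradical0) (auto simp: coradical_def)
  next
    case False
    obtain ws where ws: "length ws = Suc k" "backslash_list ws = w" "perm_empty \<notin> set ws"
      using exists_long_factorization[OF w] by blast
    let ?X = "{bas l | l. length l = k + 1 \<and> (\<exists>i\<le>k. l ! i \<in> coradical0 SSym)} :: (perm \<Rightarrow>\<^sub>0 'k, 'k) tensor set"
    obtain t where t: "t \<in> smul.span ?X" "tensor_eq smul (iter_comult SSym k h) t"
      using h False by (auto simp: coradical_def)
    have "smul.span ?X \<subseteq> {t. tensor_eval (map M_coord ws) t = 0}"
    proof (rule smul.span_minimal)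
      show "smul.subspace {t. tensor_eval (map M_coord ws) t = 0}"
        by (rule smul.subspaceI)
          (simp_all add: lin_0[OF lin_tensor_eval] lin_add[OF lin_tensor_eval] lin_scale[OF lin_tensor_eval])
      show "?X \<subseteq> {t. tensor_eval (map M_coord ws) t = 0}"
      proof clarify
        fix l :: "(perm \<Rightarrow>\<^sub>0 'k) list" and i
        assume l: "length l = k + 1" "i \<le> k" "l ! i \<in> coradical0 SSym"
        have l_eq: "l = take i l @ l ! i # drop (Suc i) l" using l by (simp add: id_take_nth_drop)
        have ws_eq: "ws = take i ws @ ws ! i # drop (Suc i) ws" using l ws by (simp add: id_take_nth_drop)
        have "M_coord (ws ! i) (l ! i) = 0"
          using l ws by (intro M_coord_coradical0) (auto, metis less_Suc_eq_le nth_mem)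
        then have "word_eval (map M_coord (take i ws) @ map M_coord (ws ! i # drop (Suc i) ws)) (take i l @ l ! i # drop (Suc i) l) = 0"
          by (subst word_eval_append) (use l ws in auto)
        then show "tensor_eval (map M_coord ws) (bas l) = 0"
          using l_eq ws_eq by (metis map_append tensor_eval_bas)
      qed
    qed
    then have "tensor_eval (map M_coord ws) t = 0" using t by blast
    moreover have "tensor_eval (map M_coord ws) (iter_comult SSym k h) = tensor_eval (map M_coord ws) t"
      by (rule tensor_eval_cong[OF _ t(2)]) (auto simp: lin_M_coord)
    ultimately show ?thesis using iter_comult_M_coord[OF ws(1), of h] ws(2) by simp
  qed
next
  assume h: "\<forall>w. num_components w > k \<longrightarrow> M_coord w h = 0"
  show "h \<in> coradical SSym k"
    by (subst M_expand, intro smul.subspace_sum smul.subspace_scale subspace_coradical_SSym M_in_coradical)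
      (use h in force)
qed

lemma coradical_pred_SSym_iff:
  "(h :: perm \<Rightarrow>\<^sub>0 'k::field) \<in> coradical_pred SSym k \<longleftrightarrow> (\<forall>w. num_components w \<ge> k \<longrightarrow> M_coord w h = 0)"
proof (cases k)
  case 0
  then show ?thesis using M_coord_eqI[of h 0] by (auto simp: coradical_pred_def lin_0[OF lin_M_coord])
qed (auto simp: coradical_pred_def coradical_SSym_iff Suc_le_eq)

section \<open>The product on the monomial basis\<close>

lemma append_in_shuffles_split:
  "s1 @ s2 \<in> shuffles xs ys \<Longrightarrow> \<exists>p q. p \<le> length xs \<and> q \<le> length ys \<and>
    s1 \<in> shuffles (take p xs) (take q ys) \<and> s2 \<in> shuffles (drop p xs) (drop q ys)"
proof (induction s1 arbitrary: xs ys)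
  case Nil
  then show ?case by (intro exI[of _ 0]) simp
next
  case (Cons z s1)
  from Cons.prems have "(xs \<noteq> [] \<and> hd xs = z \<and> s1 @ s2 \<in> shuffles (tl xs) ys) \<or>
      (ys \<noteq> [] \<and> hd ys = z \<and> s1 @ s2 \<in> shuffles xs (tl ys))"
    by (simp add: Cons_in_shuffles_iff)
  then show ?case
  proof
    assume *: "xs \<noteq> [] \<and> hd xs = z \<and> s1 @ s2 \<in> shuffles (tl xs) ys"
    then obtain xs' where xs: "xs = z # xs'" by (cases xs) auto
    obtain p q where "p \<le> length xs'" "q \<le> length ys" "s1 \<in> shuffles (take p xs') (take q ys)"
      "s2 \<in> shuffles (drop p xs') (drop q ys)"
      using Cons.IH[of xs' ys] * xs by auto
    then show ?thesis using xs by (intro exI[of _ "Suc p"] exI[of _ q]) (simp add: Cons_in_shuffles_iff)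
  next
    assume *: "ys \<noteq> [] \<and> hd ys = z \<and> s1 @ s2 \<in> shuffles xs (tl ys)"
    then obtain ys' where ys: "ys = z # ys'" by (cases ys) auto
    obtain p q where "p \<le> length xs" "q \<le> length ys'" "s1 \<in> shuffles (take p xs) (take q ys')"
      "s2 \<in> shuffles (drop p xs) (drop q ys')"
      using Cons.IH[of xs ys'] * ys by auto
    then show ?thesis using ys by (intro exI[of _ p] exI[of _ "Suc q"]) (simp add: Cons_in_shuffles_iff)
  qed
qed

lemma append_in_shuffles:
  "s1 \<in> shuffles xs ys \<Longrightarrow> s2 \<in> shuffles xs' ys' \<Longrightarrow> s1 @ s2 \<in> shuffles (xs @ xs') (ys @ ys')"
proof (induction s1 arbitrary: xs ys)
  case Nil
  then show ?case by simp
next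
  case (Cons z s1)
  from Cons.prems(1) have "(xs \<noteq> [] \<and> hd xs = z \<and> s1 \<in> shuffles (tl xs) ys) \<or>
      (ys \<noteq> [] \<and> hd ys = z \<and> s1 \<in> shuffles xs (tl ys))"
    by (simp add: Cons_in_shuffles_iff)
  then have "(xs \<noteq> [] \<and> hd xs = z \<and> s1 @ s2 \<in> shuffles (tl xs @ xs') (ys @ ys')) \<or>
      (ys \<noteq> [] \<and> hd ys = z \<and> s1 @ s2 \<in> shuffles (xs @ xs') (tl ys @ ys'))"
    using Cons.IH Cons.prems(2) by blast
  then show ?case by (auto simp: Cons_in_shuffles_iff)
qed

definition shuffles_below :: "nat list \<Rightarrow> nat list \<Rightarrow> perm \<Rightarrow> nat list set" where
  "shuffles_below xs ys w = {s \<in> shuffles xs ys. le_word s (word w)}"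

lemma finite_shuffles_below [simp]: "finite (shuffles_below xs ys w)"
  by (simp add: shuffles_below_def)

lemma length_shuffles_below: "s \<in> shuffles_below xs ys w \<Longrightarrow> length s = psize w"
  by (simp add: shuffles_below_def le_word_def)

text \<open>A shuffle is cut at position \<open>psize u\<close>: its two halves are shuffles of
  prefixes and of suffixes, and the order condition splits by \<open>le_word_backslash\<close>.
  Distinct letters make the cut points \<open>p\<close> and \<open>q\<close> recoverable from the
  first half, which gives a bijection.\<close>

lemma card_shuffles_below_backslash:
  assumes dist: "distinct (xs @ ys)"
  shows "card (shuffles_below xs ys (backslash u v)) =
    (\<Sum>p\<le>length xs. \<Sum>q\<le>length ys. card (shuffles_below (take p xs) (take q ys) u) *
       card (shuffles_below (drop p xs) (drop q ys) v))"
proof -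
  define T where "T = (SIGMA pq:{..length xs} \<times> {..length ys}.
     shuffles_below (take (fst pq) xs) (take (snd pq) ys) u \<times> shuffles_below (drop (fst pq) xs) (drop (snd pq) ys) v)"
  define h where "h = (\<lambda>(pq :: nat \<times> nat, s1, s2). s1 @ s2 :: nat list)"
  have recover: "p = card (set s1 \<inter> set xs) \<and> q = card (set s1 \<inter> set ys)"
    if "s1 \<in> shuffles (take p xs) (take q ys)" "p \<le> length xs" "q \<le> length ys" for s1 p q
  proof -
    have "set s1 = set (take p xs) \<union> set (take q ys)" using that(1) by (rule set_shuffles)
    moreover have "set (take p xs) \<subseteq> set xs" "set (take q ys) \<subseteq> set ys" by (rule set_take_subset)+
    ultimately have "set s1 \<inter> set xs = set (take p xs)" "set s1 \<inter> set ys = set (take q ys)"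
      using dist by auto
    then show ?thesis using dist that(2,3) by (simp add: distinct_card)
  qed
  have "bij_betw h T (shuffles_below xs ys (backslash u v))"
  proof (rule bij_betw_imageI)
    show "inj_on h T"
    proof (rule inj_onI)
      fix x y assume xy: "x \<in> T" "y \<in> T" "h x = h y"
      obtain p q s1 s2 where x: "x = ((p, q), s1, s2)" by (metis prod.exhaust)
      obtain p' q' s1' s2' where y: "y = ((p', q'), s1', s2')" by (metis prod.exhaust)
      have s: "s1 \<in> shuffles_below (take p xs) (take q ys) u" "s1' \<in> shuffles_below (take p' xs) (take q' ys) u"
        and le: "p \<le> length xs" "q \<le> length ys" "p' \<le> length xs" "q' \<le> length ys"
        using xy x y by (auto simp: T_def)
      have "length s1 = length s1'" using s[THEN length_shuffles_below] by simp
      then have eq: "s1 = s1'" "s2 = s2'" using xy(3) x y by (auto simp: h_def)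
      then show "x = y"
        using recover[of s1 p q] recover[of s1' p' q'] s le x y by (simp add: shuffles_below_def)
    qed
    show "h ` T = shuffles_below xs ys (backslash u v)"
    proof (intro equalityI subsetI)
      fix s assume "s \<in> h ` T"
      then obtain p q s1 s2 where s: "s = s1 @ s2" and s1: "s1 \<in> shuffles_below (take p xs) (take q ys) u"
        and s2: "s2 \<in> shuffles_below (drop p xs) (drop q ys) v"
        by (auto simp: T_def h_def)
      have "s \<in> shuffles xs ys"
        using append_in_shuffles[of s1 "take p xs" "take q ys" s2 "drop p xs" "drop q ys"] s1 s2
        by (simp add: s shuffles_below_def)
      moreover have "le_word s (word (backslash u v))"
        using s1 s2 length_shuffles_below[OF s1] length_shuffles_below[OF s2]
        by (subst le_word_backslash) (simp_all add: s shuffles_below_def)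
      ultimately show "s \<in> shuffles_below xs ys (backslash u v)" by (simp add: shuffles_below_def)
    next
      fix s assume s: "s \<in> shuffles_below xs ys (backslash u v)"
      then have len: "length s = psize u + psize v" using length_shuffles_below by fastforce
      let ?s1 = "take (psize u) s" and ?s2 = "drop (psize u) s"
      have "?s1 @ ?s2 \<in> shuffles xs ys" using s by (simp add: shuffles_below_def)
      then obtain p q where pq: "p \<le> length xs" "q \<le> length ys"
        "?s1 \<in> shuffles (take p xs) (take q ys)" "?s2 \<in> shuffles (drop p xs) (drop q ys)"
        using append_in_shuffles_split by blast
      have "le_word ?s1 (word u) \<and> le_word ?s2 (word v)"
        using s le_word_backslash[OF len] by (simp add: shuffles_below_def del: word_backslash)
      then have "((p, q), ?s1, ?s2) \<in> T" using pq by (simp add: T_def shuffles_below_def)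
      then show "s \<in> h ` T" by (rule image_eqI[rotated]) (simp add: h_def)
    qed
  qed
  then have "card (shuffles_below xs ys (backslash u v)) = card T" by (metis bij_betw_same_card)
  also have "\<dots> = (\<Sum>pq\<in>{..length xs} \<times> {..length ys}.
     card (shuffles_below (take (fst pq) xs) (take (snd pq) ys) u \<times> shuffles_below (drop (fst pq) xs) (drop (snd pq) ys) v))"
    unfolding T_def by (rule card_SigmaI) auto
  finally show ?thesis by (simp add: card_cartesian_product sum.cartesian_product case_prod_unfold)
qed

lemma word_in_shifted_shuffles:
  assumes "s \<in> shuffles (word u) (map (\<lambda>x. x + psize u) (word v))"
  shows "word (Abs_perm s) = s"
proof (rule word_Abs_perm)
  have ran: "set (map (\<lambda>x. x + psize u) (word v)) = {psize u + 1..psize u + psize v}"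
    by (simp add: set_word image_add_atLeastAtMost add.commute[of _ "psize u"])
  show "distinct s"
    by (rule distinct_disjoint_shuffles[OF _ _ _ assms]) (unfold ran, auto simp: distinct_map set_word)
  have "set s = {1..psize u} \<union> {psize u + 1..psize u + psize v}"
    unfolding set_shuffles[OF assms] ran set_word ..
  also have "\<dots> = {1..length s}" unfolding length_shuffles[OF assms] by auto
  finally show "set s = {1..length s}" .
qed

lemma M_coord_F_mult:
  "M_coord w (F_mult u v) = (of_nat (card (shuffles_below (word u) (map (\<lambda>x. x + psize u) (word v)) w)) :: 'k::field)"
proof -
  let ?S = "shuffles (word u) (map (\<lambda>x. x + psize u) (word v))"
  have "M_coord w (F_mult u v) = (\<Sum>s\<in>?S. if le_word s (word w) then 1 else 0 :: 'k)"
    unfolding F_mult_def lin_sum[OF lin_M_coord] M_coord_bas_word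
    by (rule sum.cong) (auto simp: word_in_shifted_shuffles)
  also have "\<dots> = of_nat (card {s \<in> ?S. le_word s (word w)})"
    by (simp add: Int_def flip: sum.inter_filter)
  finally show ?thesis by (simp add: shuffles_below_def)
qed

lemma shuffles_map: "shuffles (map f xs) (map f ys) = map f ` shuffles xs ys"
  by (induction xs ys rule: shuffles.induct) (simp_all add: image_Un image_image)

lemma card_shuffles_below_map:
  assumes "strict_mono_on (set xs \<union> set ys) f"
  shows "card (shuffles_below (map f xs) (map f ys) w) = card (shuffles_below xs ys w)"
proof -
  have sub: "set s \<subseteq> set xs \<union> set ys" if "s \<in> shuffles xs ys" for s
    using set_shuffles[OF that] by simp
  have "le_word (map f s) (word w) \<longleftrightarrow> le_word s (word w)" if "s \<in> shuffles xs ys" for s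
    by (rule le_word_map) (rule monotone_on_subset[OF assms sub[OF that]])
  then have "shuffles_below (map f xs) (map f ys) w = map f ` shuffles_below xs ys w"
    by (auto simp: shuffles_below_def shuffles_map)
  moreover have "inj_on (map f) (shuffles_below xs ys w)"
  proof (rule inj_on_subset)
    show "inj_on (map f) (lists (set xs \<union> set ys))"
      by (rule inj_on_map_lists) (rule strict_mono_on_imp_inj_on[OF assms])
    show "shuffles_below xs ys w \<subseteq> lists (set xs \<union> set ys)"
      using sub by (auto simp: shuffles_below_def lists_eq_set)
  qed
  ultimately show ?thesis by (simp add: card_image)
qed

text \<open>Because all letters of \<open>xs\<close> lie below those of \<open>ys\<close>,
  standardizing the two words separately and shifting the second agrees with ranking both in the
  union of their letters, which is increasing and hence invisible to \<open>le_word\<close>.\<close>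

lemma card_shuffles_below_standardize:
  assumes dist: "distinct xs" "distinct ys" and less: "\<And>x y. x \<in> set xs \<Longrightarrow> y \<in> set ys \<Longrightarrow> x < y"
  shows "card (shuffles_below (standardize xs) (map (\<lambda>x. x + length xs) (standardize ys)) w) =
     card (shuffles_below xs ys w)"
proof -
  let ?f = "rank_in (set xs \<union> set ys)"
  have "?f x = rank_in (set xs) x" if "x \<in> set xs" for x
    unfolding rank_in_def by (rule arg_cong[of _ _ card]) (use less that in fastforce)
  moreover have "?f y = rank_in (set ys) y + length xs" if "y \<in> set ys" for y
  proof -
    have "{z \<in> set xs \<union> set ys. z \<le> y} = {z \<in> set ys. z \<le> y} \<union> set xs"
      using less[OF _ that] by (auto intro: less_imp_le)
    moreover have "{z \<in> set ys. z \<le> y} \<inter> set xs = {}" using less by fastforce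
    ultimately show ?thesis unfolding rank_in_def using dist by (simp add: card_Un_disjoint distinct_card)
  qed
  ultimately have "standardize xs = map ?f xs" "map (\<lambda>x. x + length xs) (standardize ys) = map ?f ys"
    by (simp_all add: standardize_eq)
  then show ?thesis by (simp add: card_shuffles_below_map strict_mono_rank_in)
qed

lemma M_coord_F_mult_standardize:
  assumes "distinct xs" "distinct ys" "\<And>x y. x \<in> set xs \<Longrightarrow> y \<in> set ys \<Longrightarrow> x < y + n"
  shows "M_coord w (F_mult (Abs_perm (standardize xs)) (Abs_perm (standardize ys))) =
     (of_nat (card (shuffles_below xs (map (\<lambda>x. x + n) ys) w)) :: 'k::field)"
proof -
  have "strict_mono_on (set ys) (\<lambda>x. x + n)" by (auto simp: strict_mono_on_def)
  have "rank_in ((\<lambda>x. x + n) ` set ys) (y + n) = rank_in (set ys) y" for y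
  proof -
    have "{z \<in> (\<lambda>x. x + n) ` set ys. z \<le> y + n} = (\<lambda>x. x + n) ` {z \<in> set ys. z \<le> y}" by auto
    then show ?thesis by (simp add: rank_in_def card_image)
  qed
  then have std: "standardize (map (\<lambda>x. x + n) ys) = standardize ys" by (simp add: standardize_eq)
  have "psize (Abs_perm (standardize xs)) = length xs"
    using assms(1) by (simp add: word_standardize flip: length_word) (simp add: standardize_def)
  moreover have "card (shuffles_below (standardize xs) (map (\<lambda>x. x + length xs) (standardize ys)) w) =
      card (shuffles_below xs (map (\<lambda>x. x + n) ys) w)"
    by (subst std[symmetric], rule card_shuffles_below_standardize) (use assms in \<open>auto simp: distinct_map\<close>)
  ultimately show ?thesis
    using assms by (simp add: M_coord_F_mult word_standardize)
qed

text \<open>That the coproduct of a product is the product of the coproducts, read through a pair of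
  monomial coordinates.\<close>

lemma M_coord_F_mult_backslash:
  "M_coord (backslash u v) (F_mult x y) =
    (\<Sum>p\<le>psize x. \<Sum>q\<le>psize y.
       M_coord u (F_mult (Abs_perm (standardize (take p (word x)))) (Abs_perm (standardize (take q (word y))))) *
       (M_coord v (F_mult (Abs_perm (standardize (drop p (word x)))) (Abs_perm (standardize (drop q (word y))))) :: 'k::field))"
proof -
  let ?ys = "map (\<lambda>z. z + psize x) (word y)"
  have lt: "a < b + psize x" if "a \<in> set (word x)" "b \<in> set (word y)" for a b
    using that by (auto simp: set_word)
  have "set (word x) \<inter> set ?ys = {}" using lt by fastforce
  then have dist: "distinct (word x @ ?ys)" by (simp add: distinct_map)
  have "M_coord (backslash u v) (F_mult x y) = (of_nat (card (shuffles_below (word x) ?ys (backslash u v))) :: 'k)"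
    by (rule M_coord_F_mult)
  also have "\<dots> = (\<Sum>p\<le>psize x. \<Sum>q\<le>psize y.
       of_nat (card (shuffles_below (take p (word x)) (map (\<lambda>z. z + psize x) (take q (word y))) u)) *
       of_nat (card (shuffles_below (drop p (word x)) (map (\<lambda>z. z + psize x) (drop q (word y))) v)))"
    unfolding card_shuffles_below_backslash[OF dist] by (simp add: take_map drop_map)
  also have "\<dots> = (\<Sum>p\<le>psize x. \<Sum>q\<le>psize y.
       M_coord u (F_mult (Abs_perm (standardize (take p (word x)))) (Abs_perm (standardize (take q (word y))))) *
       M_coord v (F_mult (Abs_perm (standardize (drop p (word x)))) (Abs_perm (standardize (drop q (word y))))))"
    by (intro sum.cong refl arg_cong2[of _ _ _ _ "(*)"] M_coord_F_mult_standardize[symmetric])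
      (auto dest: in_set_takeD in_set_dropD intro!: lt)
  finally show ?thesis .
qed

lemma lin_mult_SSym_left: "lin smul smul (\<lambda>x. hmult SSym x y)"
  by (simp add: lin_lin_ext_smul)

lemma lin_mult_SSym_right: "lin smul smul (hmult SSym x)"
  by (rule linI) (simp_all add: lin_ext_smul_simps lin_ext_def[of _ _ x] smul.scale_right_distrib
      sum.distrib smul.scale_sum_right mult.commute)

lemma mult_SSym_one [simp]:
  shows "hmult SSym x (bas perm_empty) = x" "hmult SSym (bas perm_empty) x = (x :: perm \<Rightarrow>\<^sub>0 'k::field)"
proof -
  have "F_mult u perm_empty = (bas u :: perm \<Rightarrow>\<^sub>0 'k)" "F_mult perm_empty u = (bas u :: perm \<Rightarrow>\<^sub>0 'k)" for u
    by (simp_all add: F_mult_def Rep_perm_inverse)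
  then show "hmult SSym x (bas perm_empty) = x" "hmult SSym (bas perm_empty) x = x"
    by (simp_all add: lin_ext_def flip: bas_expand)
qed

lemma M_coord_mult:
  "M_coord (backslash u v) (hmult SSym x y) =
     lin_ext (*) (\<lambda>l. lin_ext (*) (\<lambda>l'. M_coord u (hmult SSym (l ! 0) (l' ! 0)) *
       M_coord v (hmult SSym (l ! 1) (l' ! 1))) (hcomult SSym y)) (hcomult SSym (x :: perm \<Rightarrow>\<^sub>0 'k::field))"
    (is "_ = ?R x y")
proof -
  have R1: "lin smul (*) (\<lambda>x. ?R x y)" for y
    by (rule lin_comp[of smul smul "hcomult SSym"]) (simp_all add: lin_lin_ext_smul lin_lin_ext vector_space_times)
  have R2: "lin smul (*) (?R x)" for x
  proof -
    have g: "lin smul (*) (\<lambda>y. lin_ext (*) G (hcomult SSym y :: (perm \<Rightarrow>\<^sub>0 'k, 'k) tensor))" for G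
      by (rule lin_comp[of smul smul "hcomult SSym"]) (simp_all add: lin_lin_ext_smul lin_lin_ext vector_space_times)
    show ?thesis
      unfolding lin_ext_def[of _ _ "hcomult SSym x"]
      by (rule linI) (simp_all only: lin_add[OF g] lin_scale[OF g] distrib_left sum.distrib
          sum_distrib_left mult.left_commute)
  qed
  have L1: "lin smul (*) (\<lambda>x. M_coord (backslash u v) (hmult SSym x y))" for y :: "perm \<Rightarrow>\<^sub>0 'k"
    by (rule lin_comp[OF lin_mult_SSym_left lin_M_coord])
  have L2: "lin smul (*) (\<lambda>y. M_coord (backslash u v) (hmult SSym x y))" for x :: "perm \<Rightarrow>\<^sub>0 'k"
    by (rule lin_comp[OF lin_mult_SSym_right lin_M_coord])
  have "M_coord (backslash u v) (hmult SSym (bas a) (bas b)) = ?R (bas a) (bas b)" for a b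
    by (simp add: M_coord_F_mult_backslash F_comult_def lin_sum[OF lin_lin_ext[OF vector_space_times]])
  then have "M_coord (backslash u v) (hmult SSym (bas a) y) = ?R (bas a) y" for a
    by - (rule lin_eqI[OF L2 R2])
  then show ?thesis by - (rule lin_eqI[OF L1 R1])
qed

lemma lin_ext_pair:
  "(\<And>l. l \<in> Poly_Mapping.keys t \<Longrightarrow> length l = 2) \<Longrightarrow>
     lin_ext (*) (\<lambda>l. f (l ! 0) * g (l ! 1)) t = tensor_eval [f, g] t"
  unfolding tensor_eval_def
proof (rule lin_ext_cong)
  fix l assume "\<And>l. l \<in> Poly_Mapping.keys t \<Longrightarrow> length l = 2" "l \<in> Poly_Mapping.keys t"
  then have "length l = 2" by blast
  then show "f (l ! 0) * g (l ! 1) = word_eval [f, g] l" by (auto simp: numeral_2_eq_2 length_Suc_conv)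
qed

section \<open>Structure constants of the monomial basis and their extremal part\<close>

definition M_mult_coeff :: "perm \<Rightarrow> perm \<Rightarrow> perm \<Rightarrow> 'k::field" where
  "M_mult_coeff w a b = M_coord w (hmult SSym (M_SSym a) (M_SSym b))"

lemma M_mult_coeff_empty:
  "M_mult_coeff w a perm_empty = (if a = w then 1 else 0)"
  "M_mult_coeff w perm_empty b = (if b = w then 1 else 0)"
  unfolding M_mult_coeff_def by (simp_all add: M_SSym_empty M_coord_M del: SSym_sel)

lemma tensor_eval_comult_M:
  fixes f g :: "(perm \<Rightarrow>\<^sub>0 'k::field) \<Rightarrow> 'k"
  assumes "lin smul (*) f" "lin smul (*) g"
  shows "lin_ext (*) (\<lambda>l. f (l ! 0) * g (l ! 1)) (hcomult SSym (M_SSym a)) =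
     (\<Sum>(u, v)\<in>splits a. f (M_SSym u) * g (M_SSym v))"
proof -
  have "lin_ext (*) (\<lambda>l. f (l ! 0) * g (l ! 1)) (hcomult SSym (M_SSym a)) =
      tensor_eval [f, g] (hcomult SSym (M_SSym a))"
    by (rule lin_ext_pair) (rule length_comult_SSym)
  also have "\<dots> = tensor_eval [f, g] (\<Sum>(u, v)\<in>splits a. bas [M_SSym u, M_SSym v])"
    by (rule tensor_eval_cong[OF _ comult_M]) (use assms in simp)
  also have "\<dots> = (\<Sum>(u, v)\<in>splits a. f (M_SSym u) * g (M_SSym v))"
    unfolding lin_sum[OF lin_tensor_eval] by (simp add: case_prod_unfold)
  finally show ?thesis .
qed

text \<open>The recursion behind the shuffle rule: compatibility of product and coproduct, combined
  with deconcatenation of both arguments.\<close>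

lemma M_mult_coeff_backslash:
  "M_mult_coeff (backslash u v) a b =
     (\<Sum>(a1, a2)\<in>splits a. \<Sum>(b1, b2)\<in>splits b. M_mult_coeff u a1 b1 * (M_mult_coeff v a2 b2 :: 'k::field))"
proof -
  have lr: "lin smul (*) (\<lambda>y. M_coord w (hmult SSym x y :: perm \<Rightarrow>\<^sub>0 'k))" for w x
    by (rule lin_comp[OF lin_mult_SSym_right lin_M_coord])
  have ll: "lin smul (*) (\<lambda>x. M_coord w (hmult SSym x y :: perm \<Rightarrow>\<^sub>0 'k))" for w y
    by (rule lin_comp[OF lin_mult_SSym_left lin_M_coord])
  have "M_mult_coeff (backslash u v) a b =
    lin_ext (*) (\<lambda>l. \<Sum>y\<in>splits b. M_coord u (hmult SSym (l ! 0) (M_SSym (fst y))) *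
       M_coord v (hmult SSym (l ! 1) (M_SSym (snd y)))) (hcomult SSym (M_SSym a :: perm \<Rightarrow>\<^sub>0 'k))"
    unfolding M_mult_coeff_def M_coord_mult tensor_eval_comult_M[OF lr lr] case_prod_unfold ..
  also have "\<dots> = (\<Sum>y\<in>splits b. \<Sum>x\<in>splits a. M_mult_coeff u (fst x) (fst y) * M_mult_coeff v (snd x) (snd y))"
    unfolding lin_ext_sum_fun[OF vector_space_times] tensor_eval_comult_M[OF ll ll] M_mult_coeff_def case_prod_unfold ..
  also have "\<dots> = (\<Sum>x\<in>splits a. \<Sum>y\<in>splits b. M_mult_coeff u (fst x) (fst y) * M_mult_coeff v (snd x) (snd y))"
    by (rule sum.swap)
  finally show ?thesis by (simp add: case_prod_unfold)
qed

text \<open>A list, not a set: equal entries of the word produce repeated pairs, and these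
  repetitions are the multiplicities in the shuffle product.\<close>

fun unshuffles :: "'a list \<Rightarrow> ('a list \<times> 'a list) list" where
  "unshuffles [] = [([], [])]"
| "unshuffles (x # xs) =
     map (\<lambda>(a, b). (x # a, b)) (unshuffles xs) @ map (\<lambda>(a, b). (a, x # b)) (unshuffles xs)"

lemma unshuffles_set: "(a, b) \<in> set (unshuffles xs) \<Longrightarrow> set a \<subseteq> set xs \<and> set b \<subseteq> set xs"
  by (induction xs arbitrary: a b) fastforce+

lemma unshuffles_length: "(a, b) \<in> set (unshuffles xs) \<Longrightarrow> length a + length b = length xs"
  by (induction xs arbitrary: a b) fastforce+

lemma sum_list_map_eq_0: "(\<And>x. x \<in> set xs \<Longrightarrow> f x = (0 :: 'a::monoid_add)) \<Longrightarrow> sum_list (map f xs) = 0"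
  by (induction xs) auto

lemma sum_01:
  fixes f :: "nat \<Rightarrow> nat \<Rightarrow> 'a::comm_monoid_add"
  assumes "\<And>i j. i \<le> m \<Longrightarrow> j \<le> n \<Longrightarrow> i + j \<noteq> 1 \<Longrightarrow> f i j = 0"
  shows "(\<Sum>i\<le>m. \<Sum>j\<le>n. f i j) = (if m = 0 then 0 else f 1 0) + (if n = 0 then 0 else f 0 1)"
proof -
  have 0: "(\<Sum>j\<le>n. f 0 j) = (if n = 0 then 0 else f 0 1)"
  proof -
    have "(\<Sum>j\<le>n. f 0 j) = (\<Sum>j\<in>(if n = 0 then {} else {1}). f 0 j)"
      by (rule sum.mono_neutral_right) (auto simp: assms split: if_splits)
    then show ?thesis by simp
  qed
  have i: "(\<Sum>j\<le>n. f i j) = (if i = 1 then f 1 0 else 0)" if "i \<le> m" "i \<noteq> 0" for i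
  proof -
    have "(\<Sum>j\<le>n. f i j) = (\<Sum>j\<in>{0}. f i j)"
      by (rule sum.mono_neutral_right) (use that in \<open>auto simp: assms\<close>)
    then show ?thesis using assms[of i 0] that by auto
  qed
  have "(\<Sum>i\<le>m. \<Sum>j\<le>n. f i j) = (\<Sum>j\<le>n. f 0 j) + (\<Sum>i\<in>{..m} - {0}. \<Sum>j\<le>n. f i j)"
    by (rule sum.remove) auto
  also have "(\<Sum>i\<in>{..m} - {0}. \<Sum>j\<le>n. f i j) = (\<Sum>i\<in>{..m} - {0}. if i = 1 then f 1 0 else 0)"
    by (rule sum.cong) (auto simp: i)
  finally show ?thesis by (simp add: 0 add.commute)
qed

text \<open>An irreducible component of \<open>w\<close> can only arise from a pair with at least one component, so
  the extremal part of the product is the shuffle product on components.\<close>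

lemma M_mult_coeff_top:
  "\<forall>w\<in>set ws. perm_irreducible w \<Longrightarrow> num_components a + num_components b \<le> length ws \<Longrightarrow>
    M_mult_coeff (backslash_list ws) a b =
      (\<Sum>(p, q)\<leftarrow>unshuffles ws. if backslash_list p = a \<and> backslash_list q = b then 1 else 0 :: 'k::field)"
proof (induction ws arbitrary: a b)
  case Nil
  then show ?case by (simp add: M_mult_coeff_empty)
next
  case (Cons w ws)
  have irr: "perm_irreducible w" "\<forall>w\<in>set ws. perm_irreducible w" using Cons.prems by auto
  let ?m = "num_components a" and ?n = "num_components b"
  define A where "A = (\<lambda>i. backslash_list (take i (components a)))"
  define A' where "A' = (\<lambda>i. backslash_list (drop i (components a)))"
  define B where "B = (\<lambda>i. backslash_list (take i (components b)))"
  define B' where "B' = (\<lambda>i. backslash_list (drop i (components b)))"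
  define f where "f = (\<lambda>i j. M_mult_coeff w (A i) (B j) * (M_mult_coeff (backslash_list ws) (A' i) (B' j) :: 'k))"
  let ?U = "\<lambda>a b. \<Sum>(p, q)\<leftarrow>unshuffles ws. if backslash_list p = a \<and> backslash_list q = b then 1 else 0 :: 'k"
  have nc: "num_components (A' i) = ?m - i" "num_components (B' i) = ?n - i" for i
    unfolding A'_def B'_def num_components_eq
    by (subst components_backslash_list; auto dest: in_set_dropD components_irreducible)+
  \<comment> \<open>By the induction hypothesis the coefficient counts unshuffles of
    \<open>ws\<close>, and the two halves of an unshuffle have lengths adding up to that of
    \<open>ws\<close>, which exceeds the available number of components.\<close>
  have zero: "M_mult_coeff (backslash_list ws) a' b' = (0 :: 'k)"
    if "num_components a' + num_components b' < length ws" for a' b'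
  proof -
    have "\<not> (backslash_list p = a' \<and> backslash_list q = b')" if pq: "(p, q) \<in> set (unshuffles ws)" for p q
    proof -
      have "num_components (backslash_list p) = length p" "num_components (backslash_list q) = length q"
        unfolding num_components_eq using unshuffles_set[OF pq] irr(2)
        by (subst components_backslash_list; auto)+
      then show ?thesis using unshuffles_length[OF pq] \<open>_ < length ws\<close> by auto
    qed
    then have "?U a' b' = 0"
      by (intro sum_list_map_eq_0) auto
    then show ?thesis using Cons.IH[of a' b'] irr that by simp
  qed
  \<comment> \<open>With nothing given to \<open>w\<close> the first factor is the coefficient of a
    nonempty permutation in the unit; with two or more components given to \<open>w\<close> the tail
    has too few left.\<close>
  have f0: "f i j = 0" if "i \<le> ?m" "j \<le> ?n" "i + j \<noteq> 1" for i j
  proof (cases "i + j = 0")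
    case True
    then show ?thesis using perm_irreducible_nonempty[OF irr(1)]
      by (auto simp: f_def A_def B_def M_mult_coeff_empty)
  next
    case False
    have "2 \<le> i + j" using False that(3) by linarith
    then have "num_components (A' i) + num_components (B' j) < length ws"
      using that Cons.prems(2) unfolding nc list.size by linarith
    then show ?thesis by (simp add: f_def zero)
  qed
  have "M_mult_coeff (backslash_list (w # ws)) a b = (\<Sum>i\<le>?m. \<Sum>j\<le>?n. f i j)"
    by (simp add: M_mult_coeff_backslash sum_splits f_def A_def A'_def B_def B'_def)
  also have "\<dots> = (if ?m = 0 then 0 else f 1 0) + (if ?n = 0 then 0 else f 0 1)"
    using f0 by (rule sum_01)
  also have "(if ?m = 0 then 0 else f 1 0) =
     (\<Sum>(p, q)\<leftarrow>unshuffles ws. if backslash w (backslash_list p) = a \<and> backslash_list q = b then 1 else 0 :: 'k)"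
  proof (cases "components a")
    case Nil
    then show ?thesis using perm_irreducible_nonempty[OF irr(1)] by (simp add: case_prod_unfold)
  next
    case (Cons x xs)
    have a: "a = backslash x (backslash_list xs)" by (metis Cons backslash_list_components backslash_list_simps(2))
    have "components x = [x]" using components_irreducible[of x a] Cons by (intro components_of_irreducible) simp
    then have eq: "backslash w r = a \<longleftrightarrow> w = x \<and> r = backslash_list xs" for r
      using components_of_irreducible[OF irr(1)] unfolding a by (subst components_inject[symmetric]) simp
    have "f 1 0 = (if x = w then M_mult_coeff (backslash_list ws) (backslash_list xs) b else 0)"
      by (simp add: f_def A_def A'_def B_def B'_def Cons M_mult_coeff_empty)
    moreover have "M_mult_coeff (backslash_list ws) (backslash_list xs) b = ?U (backslash_list xs) b"
      using Cons.prems Cons nc(1)[of 1] by (intro Cons.IH) (auto simp: A'_def num_components_eq)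
    ultimately show ?thesis using Cons by (simp add: eq num_components_eq case_prod_unfold)
  qed
  also have "(if ?n = 0 then 0 else f 0 1) =
     (\<Sum>(p, q)\<leftarrow>unshuffles ws. if backslash_list p = a \<and> backslash w (backslash_list q) = b then 1 else 0 :: 'k)"
  proof (cases "components b")
    case Nil
    then show ?thesis using perm_irreducible_nonempty[OF irr(1)] by (simp add: case_prod_unfold)
  next
    case (Cons x xs)
    have b: "b = backslash x (backslash_list xs)" by (metis Cons backslash_list_components backslash_list_simps(2))
    have "components x = [x]" using components_irreducible[of x b] Cons by (intro components_of_irreducible) simp
    then have eq: "backslash w r = b \<longleftrightarrow> w = x \<and> r = backslash_list xs" for r
      using components_of_irreducible[OF irr(1)] unfolding b by (subst components_inject[symmetric]) simp
    have "f 0 1 = (if x = w then M_mult_coeff (backslash_list ws) a (backslash_list xs) else 0)"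
      by (simp add: f_def A_def A'_def B_def B'_def Cons M_mult_coeff_empty)
    moreover have "M_mult_coeff (backslash_list ws) a (backslash_list xs) = ?U a (backslash_list xs)"
      using Cons.prems Cons nc(2)[of 1] by (intro Cons.IH) (auto simp: B'_def num_components_eq)
    ultimately show ?thesis using Cons by (simp add: eq num_components_eq case_prod_unfold)
  qed
  finally show ?case by (simp add: case_prod_unfold o_def)
qed

lemma M_coord_mult_top:
  fixes x y :: "perm \<Rightarrow>\<^sub>0 'k::field"
  assumes x: "x \<in> coradical SSym i" and y: "y \<in> coradical SSym j" and w: "i + j \<le> num_components w"
  shows "M_coord w (hmult SSym x y) =
    (\<Sum>(p, q)\<leftarrow>unshuffles (components w). M_coord (backslash_list p) x * M_coord (backslash_list q) y)"
proof -
  let ?A = "{a. M_coord a x \<noteq> 0}" and ?B = "{b. M_coord b y \<noteq> 0}"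
  let ?U = "unshuffles (components w)"
  have sl: "sum_list (map (\<lambda>z. \<Sum>a\<in>A. g z a) zs) = (\<Sum>a\<in>A. sum_list (map (\<lambda>z. g z a) zs))"
    for g :: "'b \<Rightarrow> 'c \<Rightarrow> 'k" and A zs
    by (induction zs) (auto simp: sum.distrib)
  have "M_coord w (hmult SSym x y) = M_coord w (hmult SSym (\<Sum>a\<in>?A. smul (M_coord a x) (M_SSym a)) (\<Sum>b\<in>?B. smul (M_coord b y) (M_SSym b)))"
    by (simp only: M_expand[symmetric])
  also have "\<dots> = (\<Sum>a\<in>?A. \<Sum>b\<in>?B. M_coord a x * (M_coord b y * M_mult_coeff w a b))"
    unfolding lin_sum[OF lin_mult_SSym_left] lin_sum[OF lin_mult_SSym_right] lin_scale[OF lin_mult_SSym_left]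
      lin_scale[OF lin_mult_SSym_right] lin_sum[OF lin_M_coord] lin_scale[OF lin_M_coord] M_mult_coeff_def
    by (simp add: lin_sum[OF lin_M_coord] lin_scale[OF lin_M_coord] sum_distrib_left del: SSym_sel)
      (subst sum.swap, simp add: mult.left_commute del: SSym_sel)
  also have "\<dots> = (\<Sum>a\<in>?A. \<Sum>b\<in>?B. M_coord a x * (M_coord b y *
      (\<Sum>(p, q)\<leftarrow>?U. if backslash_list p = a \<and> backslash_list q = b then 1 else 0)))"
  proof (intro sum.cong refl arg_cong2[of _ _ _ _ "(*)"])
    fix a b assume "a \<in> ?A" "b \<in> ?B"
    then have "num_components a \<le> i" "num_components b \<le> j"
      using x y by (auto simp: coradical_SSym_iff not_less[symmetric])
    then have "num_components a + num_components b \<le> length (components w)"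
      using w by (simp add: num_components_eq)
    then show "M_mult_coeff w a b = (\<Sum>(p, q)\<leftarrow>?U. if backslash_list p = a \<and> backslash_list q = b then 1 else 0 :: 'k)"
      using M_mult_coeff_top[of "components w" a b] by (simp add: components_irreducible)
  qed
  also have "\<dots> = (\<Sum>z\<leftarrow>?U. \<Sum>a\<in>?A. \<Sum>b\<in>?B. if backslash_list (fst z) = a \<and> backslash_list (snd z) = b
      then M_coord a x * M_coord b y else 0)"
    unfolding sl by (simp add: sum_list_const_mult[symmetric] case_prod_unfold if_distrib cong: if_cong)
  also have "\<dots> = (\<Sum>z\<leftarrow>?U. M_coord (backslash_list (fst z)) x * M_coord (backslash_list (snd z)) y)"
  proof (intro arg_cong[of _ _ sum_list] map_cong refl)
    fix z :: "perm list \<times> perm list"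
    have "(\<Sum>a\<in>?A. \<Sum>b\<in>?B. if backslash_list (fst z) = a \<and> backslash_list (snd z) = b then M_coord a x * M_coord b y else 0)
        = (\<Sum>a\<in>?A. if backslash_list (fst z) = a then M_coord a x * M_coord (backslash_list (snd z)) y else 0)"
      by (intro sum.cong) (auto simp: finite_M_coord)
    then show "(\<Sum>a\<in>?A. \<Sum>b\<in>?B. if backslash_list (fst z) = a \<and> backslash_list (snd z) = b then M_coord a x * M_coord b y else 0)
        = M_coord (backslash_list (fst z)) x * M_coord (backslash_list (snd z)) y"
      by (auto simp: finite_M_coord)
  qed
  finally show ?thesis by (simp add: case_prod_unfold)
qed

text \<open>If \<open>w\<close> has more than \<open>i + j\<close> components, one half of every
  unshuffle is too long for its argument, so each summand has a vanishing coordinate.\<close>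

lemma mult_coradical:
  fixes x y :: "perm \<Rightarrow>\<^sub>0 'k::field"
  assumes x: "x \<in> coradical SSym i" and y: "y \<in> coradical SSym j"
  shows "hmult SSym x y \<in> coradical SSym (i + j)"
  unfolding coradical_SSym_iff
proof (intro allI impI)
  fix w assume w: "i + j < num_components w"
  have "M_coord (backslash_list p) x * M_coord (backslash_list q) y = 0"
    if pq: "(p, q) \<in> set (unshuffles (components w))" for p q
  proof -
    have "num_components (backslash_list p) = length p" "num_components (backslash_list q) = length q"
      unfolding num_components_eq using unshuffles_set[OF pq]
      by (subst components_backslash_list; auto dest: components_irreducible)+
    then have "num_components (backslash_list p) > i \<or> num_components (backslash_list q) > j"
      using unshuffles_length[OF pq] w by (auto simp: num_components_eq)
    then show ?thesis using x y by (auto simp: coradical_SSym_iff)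
  qed
  then have "(\<Sum>(p, q)\<leftarrow>unshuffles (components w). M_coord (backslash_list p) x * M_coord (backslash_list q) y) = 0"
    by (intro sum_list_map_eq_0) auto
  then show "M_coord w (hmult SSym x y) = 0"
    by (subst M_coord_mult_top[OF x y]) (use w in simp_all)
qed

section \<open>The associated graded Hopf algebra\<close>

lemma gr_SSym_sel [simp]:
  "hscale gr_SSym = gr_scale" "hmult gr_SSym = gr_mult" "hone gr_SSym = gr_class 0 (bas perm_empty)"
  "hcomult gr_SSym = gr_comult"
  "hcounit gr_SSym x = Poly_Mapping.lookup (Poly_Mapping.lookup (rep_gr x) 0) perm_empty"
  "hdeg gr_SSym n = module.span gr_scale {M_gr w | w. psize w = n}"
  by (simp_all add: gr_SSym_def del: SSym_sel(3))

interpretation gr: vector_space gr_scale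
  by (rule vector_space_gr_scale)

definition gr_coord :: "perm \<Rightarrow> 'k::field gr \<Rightarrow> 'k" where
  "gr_coord w x = M_coord w (Poly_Mapping.lookup (rep_gr x) (num_components w))"

lemma abs_rep_gr [simp]: "abs_gr (rep_gr x) = x"
  by (rule Quotient3_abs_rep[OF Quotient3_gr])

lemma gr_rel_rep: "gr_rel (rep_gr x) (rep_gr x)"
  by (rule Quotient3_rep_reflp[OF Quotient3_gr])

lemma rep_gr_coradical: "Poly_Mapping.lookup (rep_gr x) k \<in> coradical SSym k"
  using gr_rel_rep[of x] by (simp add: gr_rel_def)

text \<open>Two representatives differ in position k by an element of filtration k - 1, on which
  every coordinate with k or more components vanishes. So \<open>gr_coord\<close> does not depend on
  the family chosen by \<open>rep_gr\<close>.\<close>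

lemma gr_coord_abs:
  assumes "gr_rel y y"
  shows "gr_coord w (abs_gr y) = M_coord w (Poly_Mapping.lookup y (num_components w))"
proof -
  have "gr_rel (rep_gr (abs_gr y)) y"
    using assms by (rule Quotient3_rep_abs[OF Quotient3_gr])
  then have "M_coord w (Poly_Mapping.lookup (rep_gr (abs_gr y)) (num_components w) - Poly_Mapping.lookup y (num_components w)) = 0"
    unfolding gr_rel_def coradical_pred_SSym_iff by blast
  then show ?thesis by (simp add: gr_coord_def lin_diff[OF lin_M_coord])
qed

lemma lin_gr_coord: "lin gr_scale (*) (gr_coord w)"
proof (rule linI)
  fix x y :: "'k::field gr" and c
  have "x + y = abs_gr (rep_gr x + rep_gr y)"
    using plus_gr.abs_eq[OF gr_rel_rep gr_rel_rep, of x y] by simp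
  then have "gr_coord w (x + y) = M_coord w (Poly_Mapping.lookup (rep_gr x + rep_gr y) (num_components w))"
    using gr_coord_abs[OF gr_rel_add[OF gr_rel_rep gr_rel_rep], of w x y] by simp
  then show "gr_coord w (x + y) = gr_coord w x + gr_coord w y"
    by (simp add: lookup_add lin_add[OF lin_M_coord] gr_coord_def)
  have "gr_scale c x = abs_gr (fam_scale c (rep_gr x))"
    using gr_scale.abs_eq[OF gr_rel_rep, of c x] by simp
  then have "gr_coord w (gr_scale c x) = M_coord w (Poly_Mapping.lookup (fam_scale c (rep_gr x)) (num_components w))"
    using gr_coord_abs[OF gr_rel_scale[OF gr_rel_rep], of w c x] by simp
  then show "gr_coord w (gr_scale c x) = c * gr_coord w x"
    by (simp add: lin_scale[OF lin_M_coord] gr_coord_def)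
qed

lemma gr_coord_eqI:
  assumes "\<And>w. gr_coord w x = gr_coord w y"
  shows "x = y"
proof -
  have "Poly_Mapping.lookup (rep_gr x) k - Poly_Mapping.lookup (rep_gr y) k \<in> coradical_pred SSym k" for k
    unfolding coradical_pred_SSym_iff
  proof (intro allI impI)
    fix w assume "k \<le> num_components w"
    then consider "num_components w = k" | "k < num_components w" by linarith
    then show "M_coord w (Poly_Mapping.lookup (rep_gr x) k - Poly_Mapping.lookup (rep_gr y) k) = 0"
    proof cases
      case 1
      then show ?thesis using assms[of w] by (simp add: lin_diff[OF lin_M_coord] gr_coord_def)
    next
      case 2
      then show ?thesis using rep_gr_coradical[of x k] rep_gr_coradical[of y k]
        by (simp add: lin_diff[OF lin_M_coord] coradical_SSym_iff)
    qed
  qed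
  then have "gr_rel (rep_gr x) (rep_gr y)" by (simp add: gr_rel_def rep_gr_coradical)
  then have "abs_gr (rep_gr x) = abs_gr (rep_gr y)" by (rule Quotient3_rel_abs[OF Quotient3_gr])
  then show ?thesis by simp
qed

lemma finite_gr_coord: "finite {w. gr_coord w x \<noteq> 0}"
proof (rule finite_subset)
  show "{w. gr_coord w x \<noteq> 0} \<subseteq> (\<Union>k\<in>Poly_Mapping.keys (rep_gr x). {w. M_coord w (Poly_Mapping.lookup (rep_gr x) k) \<noteq> 0})"
  proof
    fix w assume w: "w \<in> {w. gr_coord w x \<noteq> 0}"
    then have "Poly_Mapping.lookup (rep_gr x) (num_components w) \<noteq> 0"
      by (auto simp: gr_coord_def lin_0[OF lin_M_coord])
    then show "w \<in> (\<Union>k\<in>Poly_Mapping.keys (rep_gr x). {w. M_coord w (Poly_Mapping.lookup (rep_gr x) k) \<noteq> 0})"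
      using w by (auto simp: gr_coord_def in_keys_iff)
  qed
qed (auto simp: finite_M_coord)

lemma gr_coord_class:
  assumes "h \<in> coradical SSym k"
  shows "gr_coord w (gr_class k h) = (if num_components w = k then M_coord w h else 0)"
proof -
  have "gr_rel (Poly_Mapping.single k h) (Poly_Mapping.single k h)"
    using assms by (auto simp: gr_rel_def lookup_single when_def smul.subspace_0
        subspace_coradical_SSym subspace_coradical_pred_SSym)
  then show ?thesis
    by (auto simp: gr_class_def gr_coord_abs lookup_single when_def lin_0[OF lin_M_coord])
qed

lemma gr_coord_M: "gr_coord w (M_gr v) = (if v = w then 1 else 0)"
  by (simp add: M_gr_def gr_coord_class M_in_coradical M_coord_M)

lemma gr_expand: "x = (\<Sum>w | gr_coord w x \<noteq> 0. gr_scale (gr_coord w x) (M_gr w))"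
  by (rule gr_coord_eqI)
    (simp add: lin_sum[OF lin_gr_coord] lin_scale[OF lin_gr_coord] gr_coord_M finite_gr_coord
      if_distrib cong: if_cong)

lemma lin_sum_list: "lin s s' f \<Longrightarrow> f (sum_list xs) = (\<Sum>x\<leftarrow>xs. f x)"
  by (induction xs) (auto simp: lin_0 lin_add)

lemma sum_sum_list: "(\<Sum>a\<in>A. \<Sum>z\<leftarrow>zs. g z a) = (\<Sum>z\<leftarrow>zs. \<Sum>a\<in>A. g z a)"
  for g :: "'b \<Rightarrow> 'c \<Rightarrow> 'a::comm_monoid_add"
  by (induction zs) (auto simp: sum.distrib)

lemma num_components_unshuffles:
  "(p, q) \<in> set (unshuffles (components w)) \<Longrightarrow>
     num_components (backslash_list p) = length p \<and> num_components (backslash_list q) = length q"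
  unfolding num_components_eq using unshuffles_set[of p q "components w"]
  by (subst (1 2) components_backslash_list) (auto dest: components_irreducible)

text \<open>For an unshuffle into \<open>p\<close> and \<open>q\<close> only the homogeneous parts
  in positions \<open>length p\<close> and \<open>length q\<close> contribute: any other pair of
  positions with the same sum has one position too small for the coordinate to be nonzero.\<close>

lemma gr_coord_mult:
  "gr_coord w (gr_mult x y) =
     (\<Sum>(p, q)\<leftarrow>unshuffles (components w). gr_coord (backslash_list p) x * gr_coord (backslash_list q) y)"
proof -
  let ?x = "Poly_Mapping.lookup (rep_gr x)" and ?y = "Poly_Mapping.lookup (rep_gr y)"
  let ?X = "Poly_Mapping.keys (rep_gr x)" and ?Y = "Poly_Mapping.keys (rep_gr y)"
  let ?U = "unshuffles (components w)"
  have "gr_coord w (gr_mult x y) = (\<Sum>i\<in>?X. \<Sum>j\<in>?Y. if num_components w = i + j then M_coord w (hmult SSym (?x i) (?y j)) else 0)"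
    unfolding gr_mult_def lin_sum[OF lin_gr_coord]
    by (intro sum.cong refl gr_coord_class mult_coradical rep_gr_coradical)
  also have "\<dots> = (\<Sum>i\<in>?X. \<Sum>j\<in>?Y. \<Sum>z\<leftarrow>?U. if num_components w = i + j then
      M_coord (backslash_list (fst z)) (?x i) * M_coord (backslash_list (snd z)) (?y j) else 0)"
    by (intro sum.cong refl)
      (auto simp: M_coord_mult_top[OF rep_gr_coradical rep_gr_coradical] case_prod_unfold sum_list_map_eq_0
        simp del: SSym_sel)
  also have "\<dots> = (\<Sum>z\<leftarrow>?U. \<Sum>i\<in>?X. \<Sum>j\<in>?Y. if num_components w = i + j then
      M_coord (backslash_list (fst z)) (?x i) * M_coord (backslash_list (snd z)) (?y j) else 0)"
    unfolding sum_sum_list ..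
  also have "\<dots> = (\<Sum>z\<leftarrow>?U. gr_coord (backslash_list (fst z)) x * gr_coord (backslash_list (snd z)) y)"
  proof (intro arg_cong[of _ _ sum_list] map_cong refl)
    fix z assume zU: "z \<in> set ?U"
    obtain p q where z: "z = (p, q)" by (cases z)
    then have pq: "(p, q) \<in> set ?U" using zU by simp
    have nc: "num_components (backslash_list p) = length p" "num_components (backslash_list q) = length q"
      using num_components_unshuffles[OF pq] by auto
    have len: "num_components w = length p + length q"
      using unshuffles_length[OF pq] by (simp add: num_components_eq)
    have zero: "M_coord (backslash_list p) (?x i) * M_coord (backslash_list q) (?y j) = 0"
      if "num_components w = i + j" "\<not> (i = length p \<and> j = length q)" for i j
    proof -
      have "i < length p \<or> j < length q" using that len by linarith
      then show ?thesis using rep_gr_coradical[of x i] rep_gr_coradical[of y j] nc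
        by (auto simp: coradical_SSym_iff)
    qed
    have "(\<Sum>i\<in>?X. \<Sum>j\<in>?Y. if num_components w = i + j then M_coord (backslash_list p) (?x i) * M_coord (backslash_list q) (?y j) else 0)
       = (\<Sum>i\<in>?X. \<Sum>j\<in>?Y. if i = length p then if j = length q then M_coord (backslash_list p) (?x (length p)) * M_coord (backslash_list q) (?y (length q)) else 0 else 0)"
      by (intro sum.cong refl) (use zero len in auto)
    also have "\<dots> = (\<Sum>i\<in>?X. if i = length p then (if length q \<in> ?Y then M_coord (backslash_list p) (?x (length p)) * M_coord (backslash_list q) (?y (length q)) else 0) else 0)"
      by (intro sum.cong refl) auto
    also have "\<dots> = M_coord (backslash_list p) (?x (length p)) * M_coord (backslash_list q) (?y (length q))"
      by (auto simp: in_keys_iff lin_0[OF lin_M_coord])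
    finally show "(\<Sum>i\<in>?X. \<Sum>j\<in>?Y. if num_components w = i + j then
        M_coord (backslash_list (fst z)) (?x i) * M_coord (backslash_list (snd z)) (?y j) else 0) =
        gr_coord (backslash_list (fst z)) x * gr_coord (backslash_list (snd z)) y"
      unfolding z fst_conv snd_conv gr_coord_def nc .
  qed
  finally show ?thesis by (simp add: case_prod_unfold)
qed

lemma gr_one: "gr_class 0 (bas perm_empty) = M_gr perm_empty"
  by (simp add: M_gr_def M_SSym_empty)

lemma gr_counit: "hcounit gr_SSym = gr_coord perm_empty"
proof
  fix x :: "'k::field gr"
  have "{u. weak_le u perm_empty} = {perm_empty}"
    using weak_le_psize[of _ perm_empty] by auto
  then show "hcounit gr_SSym x = gr_coord perm_empty x" by (simp add: gr_coord_def M_coord_def)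
qed

text \<open>Justifies the choice made in \<open>gr_comult_hom\<close>: the terms of the
  deconcatenation of \<open>h\<close> are grouped by the number of components of their left
  factor.\<close>

lemma exists_filtered_split:
  assumes h: "(h :: perm \<Rightarrow>\<^sub>0 'k::field) \<in> coradical SSym k"
  shows "\<exists>s. filtered_split k h s"
proof -
  let ?A = "{a. M_coord a h \<noteq> 0}"
  let ?w = "\<lambda>x :: perm \<times> perm. bas [M_SSym (fst x), M_SSym (snd x)] :: (perm \<Rightarrow>\<^sub>0 'k, 'k) tensor"
  define s where "s = (\<lambda>i. \<Sum>a\<in>?A. smul (M_coord a h) (\<Sum>x | x \<in> splits a \<and> num_components (fst x) = i. ?w x))"
  have nk: "num_components a \<le> k" if "a \<in> ?A" for a
    using h that by (auto simp: coradical_SSym_iff not_less[symmetric])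
  have "\<exists>a b. l = [a, b] \<and> a \<in> coradical SSym i \<and> b \<in> coradical SSym (k - i)"
    if i: "i \<le> k" and l: "l \<in> Poly_Mapping.keys (s i)" for i l
  proof -
    obtain a where a: "a \<in> ?A"
      and "l \<in> Poly_Mapping.keys (smul (M_coord a h) (\<Sum>x | x \<in> splits a \<and> num_components (fst x) = i. ?w x))"
      using l keys_sum[of "\<lambda>a. smul (M_coord a h) (\<Sum>x | x \<in> splits a \<and> num_components (fst x) = i. ?w x)" ?A]
      unfolding s_def by blast
    then have "l \<in> Poly_Mapping.keys (\<Sum>x | x \<in> splits a \<and> num_components (fst x) = i. ?w x)"
      by (simp add: in_keys_iff)
    then obtain x where x: "x \<in> splits a" "num_components (fst x) = i" "l = [M_SSym (fst x), M_SSym (snd x)]"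
      using keys_sum_bas[of "\<lambda>x. [M_SSym (fst x), M_SSym (snd x)] :: (perm \<Rightarrow>\<^sub>0 'k) list"] by blast
    then have "num_components a = i + num_components (snd x)" by (auto simp: splits_def)
    then have "num_components (snd x) \<le> k - i" using nk[OF a] by linarith
    then show ?thesis using x by (auto intro!: M_in_coradical)
  qed
  moreover have "tensor_eq smul (hcomult SSym h) (\<Sum>i\<le>k. s i)"
  proof -
    have lc: "lin smul smul (hcomult (SSym :: (perm \<Rightarrow>\<^sub>0 'k, 'k) hopf))" by (simp add: lin_lin_ext_smul)
    have "hcomult SSym h = (\<Sum>a\<in>?A. smul (M_coord a h) (hcomult SSym (M_SSym a)))"
      by (subst (1) M_expand) (simp only: lin_sum[OF lc] lin_scale[OF lc])
    moreover have "tensor_eq smul (\<Sum>a\<in>?A. smul (M_coord a h) (hcomult SSym (M_SSym a)))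
        (\<Sum>a\<in>?A. smul (M_coord a h) (\<Sum>x\<in>splits a. ?w x))"
      using comult_M by (intro tensor_eq_sum tensor_eq_smul) (simp add: case_prod_unfold)
    moreover have "(\<Sum>a\<in>?A. smul (M_coord a h) (\<Sum>x\<in>splits a. ?w x)) = (\<Sum>i\<le>k. s i)"
    proof -
      have "(\<Sum>x\<in>splits a. ?w x) = (\<Sum>i\<le>k. \<Sum>x | x \<in> splits a \<and> num_components (fst x) = i. ?w x)"
        if "a \<in> ?A" for a
      proof (rule sum.group[symmetric])
        show "(\<lambda>x. num_components (fst x)) ` splits a \<subseteq> {..k}"
          using nk[OF that] by (auto simp: splits_def)
      qed auto
      then have "(\<Sum>a\<in>?A. smul (M_coord a h) (\<Sum>x\<in>splits a. ?w x)) =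
          (\<Sum>a\<in>?A. \<Sum>i\<le>k. smul (M_coord a h) (\<Sum>x | x \<in> splits a \<and> num_components (fst x) = i. ?w x))"
        by (intro sum.cong refl) (simp only: smul.scale_sum_right)
      then show ?thesis unfolding s_def by (subst (asm) sum.swap)
    qed
    ultimately show ?thesis by simp
  qed
  ultimately show ?thesis unfolding filtered_split_def by (intro exI[of _ s]) blast
qed

text \<open>Whatever split is chosen, the piece with index \<open>i\<close> different from the
  number of components of \<open>u\<close> is killed: then either \<open>i\<close> or
  \<open>k - i\<close> is below what the corresponding coordinate needs. The surviving piece alone
  therefore computes the coordinate of the full coproduct.\<close>

lemma gr_comult_hom_coord:
  fixes h :: "perm \<Rightarrow>\<^sub>0 'k::field"
  assumes h: "h \<in> coradical SSym k"
  shows "tensor_eval [gr_coord u, gr_coord v] (gr_comult_hom k h) =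
      (if num_components u + num_components v = k then M_coord (backslash u v) h else 0)"
proof -
  define s where "s = (SOME s. filtered_split k h s)"
  have fs: "filtered_split k h s" unfolding s_def using exists_filtered_split[OF h] by (rule someI_ex)
  let ?nu = "num_components u" and ?nv = "num_components v"
  let ?e = "\<lambda>i. lin_ext (*) (\<lambda>l. M_coord u (l ! 0) * M_coord v (l ! 1)) (s i)"
  have l: "\<exists>a b. l = [a, b] \<and> a \<in> coradical SSym i \<and> b \<in> coradical SSym (k - i)"
    if "i \<le> k" "l \<in> Poly_Mapping.keys (s i)" for i l
    using fs that unfolding filtered_split_def by blast
  have summand: "tensor_eval [gr_coord u, gr_coord v] (lin_ext smul (\<lambda>l. bas [gr_class i (l ! 0), gr_class (k - i) (l ! 1)]) (s i)) =
      (if ?nu = i \<and> ?nv = k - i then ?e i else 0)" if i: "i \<le> k" for i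
  proof -
    have "tensor_eval [gr_coord u, gr_coord v] (lin_ext smul (\<lambda>l. bas [gr_class i (l ! 0), gr_class (k - i) (l ! 1)]) (s i)) =
        lin_ext (*) (\<lambda>l. gr_coord u (gr_class i (l ! 0)) * gr_coord v (gr_class (k - i) (l ! 1))) (s i)"
      by (simp add: lin_ext_lin[OF lin_tensor_eval])
    also have "\<dots> = lin_ext (*) (\<lambda>l. if ?nu = i \<and> ?nv = k - i then M_coord u (l ! 0) * M_coord v (l ! 1) else 0) (s i)"
      by (rule lin_ext_cong) (use l[OF i] in \<open>force simp: gr_coord_class\<close>)
    also have "\<dots> = (if ?nu = i \<and> ?nv = k - i then ?e i else 0)" by (auto simp: lin_ext_def)
    finally show ?thesis .
  qed
  have L: "tensor_eval [gr_coord u, gr_coord v] (gr_comult_hom k h) = (\<Sum>i\<le>k. if ?nu = i \<and> ?nv = k - i then ?e i else 0)"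
    unfolding gr_comult_hom_def Let_def s_def[symmetric] lin_sum[OF lin_tensor_eval]
    by (rule sum.cong[OF refl], rule summand) simp
  show ?thesis
  proof (cases "?nu + ?nv = k")
    case False
    then show ?thesis unfolding L by (auto intro!: sum.neutral)
  next
    case True
    have "M_coord (backslash u v) h = tensor_eval [M_coord u, M_coord v] (\<Sum>i\<le>k. s i)"
      using tensor_eval_cong[of "[M_coord u, M_coord v]" smul "hcomult SSym h" "\<Sum>i\<le>k. s i"] fs
      by (simp add: lin_M_coord comult_M_coord filtered_split_def del: SSym_sel)
    also have "\<dots> = (\<Sum>i\<le>k. ?e i)"
      unfolding lin_sum[OF lin_tensor_eval]
      by (intro sum.cong refl lin_ext_pair[symmetric]) (use l in force)
    also have "\<dots> = (\<Sum>i\<le>k. if ?nu = i \<and> ?nv = k - i then ?e i else 0)"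
    proof (intro sum.cong refl)
      fix i assume "i \<in> {..k}"
      then have i: "i \<le> k" by simp
      show "?e i = (if ?nu = i \<and> ?nv = k - i then ?e i else 0)"
      proof (cases "?nu = i")
        case False
        then have "i < ?nu \<or> k - i < ?nv" using True i by linarith
        then have "?e i = lin_ext (*) (\<lambda>_. 0) (s i)"
          by (intro lin_ext_cong) (use l[OF i] in \<open>force simp: coradical_SSym_iff\<close>)
        then show ?thesis using False by (simp add: lin_ext_def)
      qed (use True in auto)
    qed
    finally show ?thesis using True L by simp
  qed
qed

lemma gr_comult_coord: "tensor_eval [gr_coord u, gr_coord v] (gr_comult x) = gr_coord (backslash u v) x"
proof -
  have "tensor_eval [gr_coord u, gr_coord v] (gr_comult x) =
    (\<Sum>k\<in>Poly_Mapping.keys (rep_gr x). if num_components u + num_components v = k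
       then M_coord (backslash u v) (Poly_Mapping.lookup (rep_gr x) k) else 0)"
    unfolding gr_comult_def lin_sum[OF lin_tensor_eval]
    by (intro sum.cong refl gr_comult_hom_coord rep_gr_coradical)
  also have "\<dots> = gr_coord (backslash u v) x"
    by (auto simp: gr_coord_def in_keys_iff lin_0[OF lin_M_coord])
  finally show ?thesis .
qed

lemma length_gr_comult: "l \<in> Poly_Mapping.keys (gr_comult x) \<Longrightarrow> length l = 2"
proof -
  assume "l \<in> Poly_Mapping.keys (gr_comult x)"
  then obtain k where "l \<in> Poly_Mapping.keys (gr_comult_hom k (Poly_Mapping.lookup (rep_gr x) k))"
    unfolding gr_comult_def using keys_sum by fastforce
  then obtain i and s where "l \<in> Poly_Mapping.keys (lin_ext smul (\<lambda>l. bas [gr_class i (l ! 0), gr_class (k - i) (l ! 1)]) s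
      :: ('a gr, 'a) tensor)"
    unfolding gr_comult_hom_def Let_def using keys_sum by fastforce
  then show ?thesis using keys_lin_ext by (fastforce split: if_splits)
qed

lemma gr_coord_hdeg: "x \<in> hdeg gr_SSym n \<Longrightarrow> psize w \<noteq> n \<Longrightarrow> gr_coord w x = 0"
proof -
  assume x: "x \<in> hdeg gr_SSym n" and w: "psize w \<noteq> n"
  have "gr.span {M_gr w | w. psize w = n} \<subseteq> {x. gr_coord w x = 0}"
  proof (rule gr.span_minimal)
    show "gr.subspace {x. gr_coord w x = 0}"
      by (rule gr.subspaceI) (simp_all add: lin_0[OF lin_gr_coord] lin_add[OF lin_gr_coord] lin_scale[OF lin_gr_coord])
  qed (use w in \<open>auto simp: gr_coord_M\<close>)
  then show ?thesis using x by auto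
qed

lemma M_gr_hdeg: "M_gr w \<in> hdeg gr_SSym (psize w)"
  by (auto intro: gr.span_base)

section \<open>The graded dual\<close>

lemma lin_ev: "lin gr_scale (*) (ev f)"
  using ev[of f] lin_iff_linear[OF vector_space_gr_scale vector_space_times, of "ev f"] by simp

text \<open>An element of the graded dual lives in finitely many degrees, and each degree contains
  finitely many permutations. This makes the dual basis span, with \<open>dual_coeff\<close> and
  \<open>dual_of\<close> as inverse coordinate maps.\<close>

lemma finite_ev_M: "finite {w. ev f (M_gr w) \<noteq> 0}"
proof (rule finite_subset)
  show "{w. ev f (M_gr w) \<noteq> 0} \<subseteq> (\<Union>n\<in>{n. \<exists>x\<in>hdeg gr_SSym n. ev f x \<noteq> 0}. {w. psize w = n})"
    using M_gr_hdeg by fastforce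
  show "finite (\<Union>n\<in>{n. \<exists>x\<in>hdeg gr_SSym n. ev f x \<noteq> 0}. {w. psize w = n})"
    using ev[of f] by auto
qed

definition dual_coeff :: "'k::field gr_dual \<Rightarrow> perm \<Rightarrow>\<^sub>0 'k" where
  "dual_coeff f = Abs_poly_mapping (\<lambda>w. ev f (M_gr w))"

lemma lookup_dual_coeff [simp]: "Poly_Mapping.lookup (dual_coeff f) w = ev f (M_gr w)"
  unfolding dual_coeff_def by (simp add: finite_ev_M)

lemma ev_eq: "ev f x = lin_ext (*) (\<lambda>w. gr_coord w x) (dual_coeff f)"
proof -
  let ?W = "{w. gr_coord w x \<noteq> 0}"
  have "ev f x = (\<Sum>w\<in>?W. gr_coord w x * ev f (M_gr w))"
    by (subst gr_expand) (simp only: lin_sum[OF lin_ev] lin_scale[OF lin_ev])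
  also have "\<dots> = (\<Sum>w\<in>?W \<union> Poly_Mapping.keys (dual_coeff f). gr_coord w x * ev f (M_gr w))"
    by (rule sum.mono_neutral_left) (auto simp: finite_gr_coord)
  also have "\<dots> = (\<Sum>w\<in>Poly_Mapping.keys (dual_coeff f). ev f (M_gr w) * gr_coord w x)"
    by (rule sum.mono_neutral_cong_right) (auto simp: finite_gr_coord in_keys_iff mult.commute)
  finally show ?thesis by (simp add: lin_ext_def)
qed

definition dual_of :: "(perm \<Rightarrow>\<^sub>0 'k::field) \<Rightarrow> 'k gr_dual" where
  "dual_of p = Abs_gr_dual (\<lambda>x. lin_ext (*) (\<lambda>w. gr_coord w x) p)"

lemma ev_dual_of [simp]: "ev (dual_of p) x = lin_ext (*) (\<lambda>w. gr_coord w x) p"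
proof -
  let ?f = "\<lambda>x. lin_ext (*) (\<lambda>w. gr_coord w x) p"
  have "lin gr_scale (*) ?f"
    unfolding lin_ext_def
    by (rule linI) (simp_all only: lin_add[OF lin_gr_coord] lin_scale[OF lin_gr_coord] distrib_left
        sum.distrib sum_distrib_left mult.left_commute)
  moreover have "finite {n. \<exists>x\<in>hdeg gr_SSym n. ?f x \<noteq> 0}"
  proof (rule finite_subset)
    show "{n. \<exists>x\<in>hdeg gr_SSym n. ?f x \<noteq> 0} \<subseteq> psize ` Poly_Mapping.keys p"
    proof
      fix n assume "n \<in> {n. \<exists>x\<in>hdeg gr_SSym n. ?f x \<noteq> 0}"
      then obtain x where x: "x \<in> hdeg gr_SSym n" "?f x \<noteq> 0" by blast
      then obtain w where "w \<in> Poly_Mapping.keys p" "gr_coord w x \<noteq> 0"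
        unfolding lin_ext_def by (auto elim!: sum.not_neutral_contains_not_neutral)
      moreover from this have "psize w = n" using gr_coord_hdeg[OF x(1), of w] by blast
      ultimately show "n \<in> psize ` Poly_Mapping.keys p" by blast
    qed
  qed simp
  ultimately show ?thesis
    unfolding dual_of_def
    by (subst Abs_gr_dual_inverse) (auto simp: lin_iff_linear[OF vector_space_gr_scale vector_space_times])
qed

lemma dual_coeff_dual_of [simp]: "dual_coeff (dual_of p) = p"
  by (rule poly_mapping_eqI) (auto simp: lin_ext_def gr_coord_M if_distrib in_keys_iff cong: if_cong)

lemma dual_of_dual_coeff [simp]: "dual_of (dual_coeff f) = f"
  by (simp add: ev_inject[symmetric] fun_eq_iff ev_eq)

lemma dual_coeff_eqI: "(\<And>w. ev f (M_gr w) = ev g (M_gr w)) \<Longrightarrow> f = g"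
  by (metis dual_of_dual_coeff lookup_dual_coeff poly_mapping_eqI)

lemma lin_dual_coeff: "lin dual_scale smul dual_coeff"
  by (rule linI; rule poly_mapping_eqI) (simp_all add: lookup_add plus_gr_dual.rep_eq dual_scale.rep_eq)

lemma vector_space_dual_scale: "vector_space (dual_scale :: 'k::field \<Rightarrow> _)"
  by unfold_locales
    (auto intro!: dual_coeff_eqI simp: plus_gr_dual.rep_eq dual_scale.rep_eq algebra_simps)

lemma lin_dual_of: "lin smul dual_scale dual_of"
  by (rule linI; rule dual_coeff_eqI)
    (simp_all add: plus_gr_dual.rep_eq dual_scale.rep_eq lin_ext_times_simps)

lemma bij_dual_coeff: "bij dual_coeff"
  by (rule o_bij[of dual_of]) (auto simp: fun_eq_iff)

lemma M_dual_eq: "M_dual w = dual_of (bas w)"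
  unfolding M_dual_def
proof (rule the_equality)
  show "\<forall>v. ev (dual_of (bas w)) (M_gr v) = (if v = w then 1 else 0)" by (simp add: gr_coord_M)
qed (auto intro!: dual_coeff_eqI simp: gr_coord_M)

lemma dual_coeff_M_dual [simp]: "dual_coeff (M_dual w) = bas w"
  by (simp add: M_dual_eq)

lemma gr_SSym_dual_sel [simp]:
  "hscale gr_SSym_dual = dual_scale" "hmult gr_SSym_dual = dual_mult"
  "hcomult gr_SSym_dual = dual_comult"
  "hcounit gr_SSym_dual f = ev f (M_gr perm_empty)"
  "hdeg gr_SSym_dual n = {f. \<forall>m. m \<noteq> n \<longrightarrow> (\<forall>x\<in>hdeg gr_SSym m. ev f x = 0)}"
  by (simp_all add: gr_SSym_dual_def gr_one)

lemma dual_one: "hone gr_SSym_dual = M_dual perm_empty"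
  unfolding gr_SSym_dual_def M_dual_eq dual_of_def by (simp add: gr_counit)

lemma word_eval_sum_left:
  "word_eval [\<lambda>v. \<Sum>i\<in>I. c i * f i v, g] l = (\<Sum>i\<in>I. c i * word_eval [f i, g] l)"
  by (cases l; cases "tl l"; cases "tl (tl l)") (auto simp: sum_distrib_right sum_distrib_left mult_ac)

lemma word_eval_sum_right:
  "word_eval [g, \<lambda>v. \<Sum>i\<in>I. c i * f i v] l = (\<Sum>i\<in>I. c i * word_eval [g, f i] l)"
  by (cases l; cases "tl l"; cases "tl (tl l)") (auto simp: sum_distrib_right sum_distrib_left mult_ac)

lemma tensor_eval_lin_ext_left:
  "tensor_eval [\<lambda>v. lin_ext (*) (\<lambda>i. f i v) p, g] t = lin_ext (*) (\<lambda>i. tensor_eval [f i, g] t) p"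
  unfolding tensor_eval_def lin_ext_def word_eval_sum_left sum_distrib_left
  by (subst sum.swap) (simp add: mult.left_commute)

lemma tensor_eval_lin_ext_right:
  "tensor_eval [g, \<lambda>v. lin_ext (*) (\<lambda>i. f i v) p] t = lin_ext (*) (\<lambda>i. tensor_eval [g, f i] t) p"
  unfolding tensor_eval_def lin_ext_def word_eval_sum_right sum_distrib_left
  by (subst sum.swap) (simp add: mult.left_commute)

text \<open>The transpose of \<open>gr_comult_coord\<close>: deconcatenation of components turns
  into \<open>backslash\<close> on dual basis elements.\<close>

lemma dual_mult_eq:
  "dual_mult f g = dual_of (lin_ext smul (\<lambda>u. lin_ext smul (\<lambda>v. bas (backslash u v)) (dual_coeff g)) (dual_coeff f))"
proof -
  have "lin_ext (*) (\<lambda>l. ev f (l ! 0) * ev g (l ! 1)) (hcomult gr_SSym x) =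
      lin_ext (*) (\<lambda>w. gr_coord w x) (lin_ext smul (\<lambda>u. lin_ext smul (\<lambda>v. bas (backslash u v)) (dual_coeff g)) (dual_coeff f))"
    for x
  proof -
    have "lin_ext (*) (\<lambda>l. ev f (l ! 0) * ev g (l ! 1)) (hcomult gr_SSym x) = tensor_eval [ev f, ev g] (gr_comult x)"
      unfolding gr_SSym_sel by (rule lin_ext_pair) (rule length_gr_comult)
    also have "\<dots> = lin_ext (*) (\<lambda>u. lin_ext (*) (\<lambda>v. gr_coord (backslash u v) x) (dual_coeff g)) (dual_coeff f)"
      by (subst (1 2) ev_eq[abs_def]) (simp add: tensor_eval_lin_ext_left tensor_eval_lin_ext_right gr_comult_coord)
    finally show ?thesis
      by (simp add: lin_ext_lin[OF lin_lin_ext[OF vector_space_times]])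
  qed
  then show ?thesis unfolding dual_mult_def dual_of_def by simp
qed

lemma keys_sum_list_bas: "Poly_Mapping.keys (\<Sum>x\<leftarrow>xs. bas (f x)) \<subseteq> f ` set xs"
proof (induction xs)
  case (Cons x xs)
  then show ?case using keys_add[of "bas (f x)" "\<Sum>x\<leftarrow>xs. bas (f x)"] by (fastforce split: if_splits)
qed simp

text \<open>\<open>dual_comult\<close> is an arbitrary tensor representing the form that sends
  \<open>x\<close> and \<open>y\<close> to the value of \<open>f\<close> on their product. The
  transpose of \<open>gr_coord_mult\<close> supplies an explicit tensor \<open>t\<close> with this
  property, and two such tensors have equal coordinates because both represent the same
  form.\<close>

lemma dual_comult_eq:
  fixes f :: "'k::field gr_dual"
  shows "tensor_eq dual_scale (dual_comult f)
    (lin_ext smul (\<lambda>w. \<Sum>(p, q)\<leftarrow>unshuffles (components w). bas [M_dual (backslash_list p), M_dual (backslash_list q)])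
       (dual_coeff f))"
proof -
  define t :: "('k gr_dual, 'k) tensor" where
    "t = lin_ext smul (\<lambda>w. \<Sum>z\<leftarrow>unshuffles (components w). bas [M_dual (backslash_list (fst z)), M_dual (backslash_list (snd z))])
       (dual_coeff f)"
  have len: "length l = 2" if l: "l \<in> Poly_Mapping.keys t" for l
  proof -
    obtain w where "l \<in> Poly_Mapping.keys (\<Sum>z\<leftarrow>unshuffles (components w).
        bas [M_dual (backslash_list (fst z)), M_dual (backslash_list (snd z))] :: ('k gr_dual, 'k) tensor)"
      using l keys_lin_ext[of "\<lambda>w. \<Sum>z\<leftarrow>unshuffles (components w).
        bas [M_dual (backslash_list (fst z)), M_dual (backslash_list (snd z))] :: ('k gr_dual, 'k) tensor" "dual_coeff f"]
      unfolding t_def by blast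
    then show ?thesis using keys_sum_list_bas[of "\<lambda>z. [M_dual (backslash_list (fst z)), M_dual (backslash_list (snd z)) :: 'k gr_dual]"]
      by fastforce
  qed
  have eval: "lin_ext (*) (\<lambda>l. ev (l ! 0) x * ev (l ! 1) y) t = ev f (hmult gr_SSym x y)" for x y
  proof -
    have "lin_ext (*) (\<lambda>l. ev (l ! 0) x * ev (l ! 1) y) t = lin_ext (*) (\<lambda>w. gr_coord w (gr_mult x y)) (dual_coeff f)"
      unfolding t_def lin_ext_lin[OF lin_lin_ext[OF vector_space_times]]
      by (rule lin_ext_cong)
        (simp add: lin_sum_list[OF lin_lin_ext[OF vector_space_times]] gr_coord_mult M_dual_eq case_prod_unfold o_def)
    then show ?thesis by (simp add: ev_eq)
  qed
  have lt: "\<forall>l\<in>Poly_Mapping.keys t. length l = 2" using len by blast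
  let ?P = "\<lambda>t. (\<forall>l\<in>Poly_Mapping.keys t. length l = 2) \<and>
     (\<forall>x y. lin_ext (*) (\<lambda>l. ev (l ! 0) x * ev (l ! 1) y) t = ev f (hmult gr_SSym x y))"
  \<comment> \<open>The tensor \<open>t\<close> witnesses that the choice in
    \<open>dual_comult\<close> is not vacuous.\<close>
  have P: "?P (dual_comult f)"
    unfolding dual_comult_def by (rule someI[of ?P t]) (use len eval in blast)
  have te: "tensor_eval [\<lambda>f. Poly_Mapping.lookup (dual_coeff f) w, \<lambda>f. Poly_Mapping.lookup (dual_coeff f) w'] t'
      = lin_ext (*) (\<lambda>l. ev (l ! 0) (M_gr w) * ev (l ! 1) (M_gr w')) t'"
    if "\<forall>l\<in>Poly_Mapping.keys t'. length l = 2" for t' :: "('k gr_dual, 'k) tensor" and w w'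
    using that by (subst lin_ext_pair[symmetric]) auto
  have "tensor_eq dual_scale (dual_comult f) t"
  proof (rule tensor_eqI[where \<gamma> = "\<lambda>w f. Poly_Mapping.lookup (dual_coeff f) w" and e = M_dual, OF vector_space_dual_scale])
    fix v :: "'k gr_dual"
    show "finite {w. Poly_Mapping.lookup (dual_coeff v) w \<noteq> 0}" by (simp add: finite_ev_M)
    show "v = (\<Sum>w | Poly_Mapping.lookup (dual_coeff v) w \<noteq> 0. dual_scale (Poly_Mapping.lookup (dual_coeff v) w) (M_dual w))"
    proof -
      have "dual_of (dual_coeff v) = (\<Sum>w\<in>Poly_Mapping.keys (dual_coeff v). dual_scale (Poly_Mapping.lookup (dual_coeff v) w) (M_dual w))"
        using lin_expand[OF lin_dual_of, of "dual_coeff v"] by (simp add: lin_ext_def M_dual_eq)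
      then show ?thesis by (simp add: keys.rep_eq)
    qed
  next
    fix l assume "l \<in> Poly_Mapping.keys (dual_comult f) \<union> Poly_Mapping.keys t"
    then show "length l = 2" using P len by blast
  next
    fix w w'
    show "tensor_eval [\<lambda>f. Poly_Mapping.lookup (dual_coeff f) w, \<lambda>f. Poly_Mapping.lookup (dual_coeff f) w'] (dual_comult f)
      = tensor_eval [\<lambda>f. Poly_Mapping.lookup (dual_coeff f) w, \<lambda>f. Poly_Mapping.lookup (dual_coeff f) w'] t"
      unfolding te[OF conjunct1[OF P]] te[OF lt] eval using P by blast
  qed
  then show ?thesis by (simp add: t_def case_prod_unfold)
qed

lemma dual_hdeg_iff: "f \<in> hdeg gr_SSym_dual n \<longleftrightarrow> (\<forall>w\<in>Poly_Mapping.keys (dual_coeff f). psize w = n)"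
proof
  assume f: "f \<in> hdeg gr_SSym_dual n"
  show "\<forall>w\<in>Poly_Mapping.keys (dual_coeff f). psize w = n"
  proof (intro ballI, rule ccontr)
    fix w assume "w \<in> Poly_Mapping.keys (dual_coeff f)" "psize w \<noteq> n"
    then show False using f M_gr_hdeg[of w] by (auto simp: in_keys_iff simp del: gr_SSym_sel(6))
  qed
next
  assume *: "\<forall>w\<in>Poly_Mapping.keys (dual_coeff f). psize w = n"
  have "ev f x = 0" if "m \<noteq> n" "x \<in> hdeg gr_SSym m" for m x
    unfolding ev_eq lin_ext_def by (intro sum.neutral) (use * that gr_coord_hdeg[OF that(2)] in auto)
  then show "f \<in> hdeg gr_SSym_dual n" by (simp del: gr_SSym_sel(6))
qed

section \<open>Parent lists\<close>

text \<open>A heap-ordered tree with nodes \<open>0, \<dots>, n\<close> is encoded by the list whose \<open>i\<close>-th entry is the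
  parent of the node \<open>i + 1\<close>.\<close>

definition parent_list :: "nat list \<Rightarrow> bool" where
  "parent_list x \<longleftrightarrow> (\<forall>i<length x. x ! i \<le> i)"

lemma parent_list_Nil [simp]: "parent_list []"
  by (simp add: parent_list_def)

lemma parent_list_snoc: "parent_list (x @ [p]) \<longleftrightarrow> parent_list x \<and> p \<le> length x"
  by (auto simp: parent_list_def nth_append less_Suc_eq)

lemma parent_list_induct [consumes 1, case_names Nil snoc]:
  assumes "parent_list x" "P []" "\<And>x p. parent_list x \<Longrightarrow> p \<le> length x \<Longrightarrow> P x \<Longrightarrow> P (x @ [p])"
  shows "P x"
  using assms(1) by (induction x rule: rev_induct) (auto simp: parent_list_snoc intro: assms(2,3))

lemma parent_list_le: "parent_list x \<Longrightarrow> p \<in> set x \<Longrightarrow> p \<le> length x"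
  by (force simp: parent_list_def in_set_conv_nth)

text \<open>An entry 0 marks the top node of a root component, which may be attached to any of the
  nodes from 0 to \<open>q\<close>; a nonzero parent is only relabeled, since the labels of the
  grafted tree are raised by \<open>q\<close>.\<close>

definition graft_choices :: "nat \<Rightarrow> nat \<Rightarrow> nat set" where
  "graft_choices q p = (if p = 0 then {..q} else {p + q})"

text \<open>The parent lists of \<open>x\<close> after its root components have been attached, in all possible ways, to
  the nodes \<open>0, \<dots>, q\<close> of another tree.\<close>

definition grafts :: "nat \<Rightarrow> nat list \<Rightarrow> nat list set" where
  "grafts q x = {z. list_all2 (\<lambda>p m. m \<in> graft_choices q p) x z}"

lemma finite_graft_choices [simp]: "finite (graft_choices q p)"
  by (simp add: graft_choices_def)

lemma grafts_Nil [simp]: "grafts q [] = {[]}"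
  by (simp add: grafts_def)

lemma length_grafts: "z \<in> grafts q x \<Longrightarrow> length z = length x"
  by (auto simp: grafts_def dest: list_all2_lengthD)

lemma grafts_append: "grafts q (x @ y) = (\<lambda>(z, z'). z @ z') ` (grafts q x \<times> grafts q y)"
  by (auto simp: grafts_def list_all2_append1 image_iff) (metis list_all2_lengthD)

lemma grafts_single: "grafts q [p] = (\<lambda>m. [m]) ` graft_choices q p"
  by (auto simp: grafts_def list_all2_Cons1)

lemma finite_grafts [simp]: "finite (grafts q x)"
  by (induction x rule: rev_induct) (simp_all add: grafts_append grafts_single)

lemma sum_grafts_append:
  "(\<Sum>z\<in>grafts q (x @ y). f z) = (\<Sum>z\<in>grafts q x. \<Sum>z'\<in>grafts q y. f (z @ z'))"
proof -
  have "inj_on (\<lambda>(z, z'). z @ z') (grafts q x \<times> grafts q y)"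
    by (auto simp: inj_on_def dest!: length_grafts)
  then show ?thesis by (simp add: grafts_append sum.reindex sum.cartesian_product case_prod_unfold)
qed

lemma sum_grafts_single: "(\<Sum>z\<in>grafts q [p]. f z) = (\<Sum>m\<in>graft_choices q p. f [m])"
  by (simp add: grafts_single sum.reindex inj_on_def)

lemma sum_grafts_snoc:
  "(\<Sum>z\<in>grafts q (x @ [p]). f z) = (\<Sum>z\<in>grafts q x. \<Sum>m\<in>graft_choices q p. f (z @ [m]))"
  by (simp add: sum_grafts_append sum_grafts_single)

lemma parent_list_append_grafts:
  assumes "parent_list y" "parent_list x" "z \<in> grafts (length y) x"
  shows "parent_list (y @ z)"
  using assms(2,3)
proof (induction x arbitrary: z rule: parent_list_induct)
  case (snoc x p)
  then obtain z' m where z: "z = z' @ [m]" "z' \<in> grafts (length y) x" "m \<in> graft_choices (length y) p"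
    by (auto simp: grafts_append grafts_single)
  then have "parent_list (y @ z')" "m \<le> length (y @ z')"
    using snoc length_grafts[OF z(2)] by (auto simp: graft_choices_def split: if_splits)
  then show ?case unfolding z append_assoc[symmetric] parent_list_snoc by simp
qed (simp add: assms(1))

text \<open>Associativity of the product. A component first sent to a non-root node of the middle
  tree stays there, one sent to its root is redistributed over 0 to \<open>r\<close>; together these
  are exactly the nodes from 0 to \<open>r + q\<close>.\<close>

lemma sum_grafts_grafts:
  fixes f :: "nat list \<Rightarrow> 'a::comm_monoid_add"
  shows "(\<Sum>s\<in>grafts q x. \<Sum>t\<in>grafts r s. f t) = (\<Sum>t\<in>grafts (r + q) x. f t)"
proof (induction x arbitrary: f rule: rev_induct)
  case (snoc p x)
  have 1: "(\<Sum>m\<in>graft_choices q p. \<Sum>m'\<in>graft_choices r m. g m') = (\<Sum>m\<in>graft_choices (r + q) p. g m)"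
    for g :: "nat \<Rightarrow> 'a"
  proof (cases "p = 0")
    case True
    have "(\<Sum>m\<le>q. \<Sum>m'\<in>graft_choices r m. g m') = (\<Sum>m\<le>r + q. g m)"
      by (induction q) (auto simp: graft_choices_def add.commute add.left_commute)
    then show ?thesis using True by (simp add: graft_choices_def)
  qed (simp add: graft_choices_def ac_simps)
  have "(\<Sum>s\<in>grafts q (x @ [p]). \<Sum>t\<in>grafts r s. f t) =
      (\<Sum>s\<in>grafts q x. \<Sum>t\<in>grafts r s. \<Sum>m\<in>graft_choices q p. \<Sum>m'\<in>graft_choices r m. f (t @ [m']))"
    unfolding sum_grafts_snoc by (intro sum.cong refl, subst sum.swap) simp
  also have "\<dots> = (\<Sum>t\<in>grafts (r + q) (x @ [p]). f t)"
    unfolding 1 snoc sum_grafts_snoc ..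
  finally show ?case .
qed simp

subsection \<open>Colorings\<close>

text \<open>A set of components at the root is encoded by the coloring of the non-root nodes that is
  constant on each component.\<close>

definition colorings :: "nat list \<Rightarrow> 'c list set" where
  "colorings x = {\<kappa>. length \<kappa> = length x \<and> (\<forall>i<length x. x ! i > 0 \<longrightarrow> \<kappa> ! i = \<kappa> ! (x ! i - 1))}"

definition count_true :: "bool list \<Rightarrow> nat \<Rightarrow> nat" where
  "count_true \<chi> m = length (filter id (take m \<chi>))"

text \<open>The color at index \<open>i\<close> belongs to the node \<open>i + 1\<close>. Hence
  \<open>count_true \<chi> p\<close> is the new label of a kept node \<open>p\<close>, and it is 0
  for the root.\<close>

definition restrict_list :: "nat list \<Rightarrow> bool list \<Rightarrow> nat list" where
  "restrict_list x \<chi> = map (\<lambda>(p, b). count_true \<chi> p) (filter snd (zip x \<chi>))"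

abbreviation compl_list :: "bool list \<Rightarrow> bool list" where
  "compl_list \<equiv> map Not"

lemma length_colorings: "\<kappa> \<in> colorings x \<Longrightarrow> length \<kappa> = length x"
  by (simp add: colorings_def)

lemma colorings_Nil [simp]: "colorings [] = {[]}"
  by (auto simp: colorings_def)

lemma finite_colorings [simp]: "finite (colorings x :: 'c::finite list set)"
  by (rule finite_subset[OF _ finite_lists_length_eq[of UNIV "length x"]]) (auto simp: colorings_def)

lemma colorings_map: "\<kappa> \<in> colorings x \<Longrightarrow> parent_list x \<Longrightarrow> map f \<kappa> \<in> colorings x"
  by (force simp: colorings_def parent_list_def)

lemma snoc_in_colorings_iff:
  assumes "parent_list x" "p \<le> length x" "length \<kappa> = length x"
  shows "\<kappa> @ [k] \<in> colorings (x @ [p]) \<longleftrightarrow> \<kappa> \<in> colorings x \<and> (p > 0 \<longrightarrow> k = \<kappa> ! (p - 1))"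
proof -
  have A: "((x @ [p]) ! i > 0 \<longrightarrow> (\<kappa> @ [k]) ! i = (\<kappa> @ [k]) ! ((x @ [p]) ! i - 1)) \<longleftrightarrow>
      (x ! i > 0 \<longrightarrow> \<kappa> ! i = \<kappa> ! (x ! i - 1))" if i: "i < length x" for i
  proof -
    have "x ! i \<le> i" using assms(1) i by (simp add: parent_list_def)
    then have "x ! i - 1 < length \<kappa>" using i assms(3) by linarith
    then show ?thesis using i assms(3) by (simp add: nth_append)
  qed
  have B: "((x @ [p]) ! length x > 0 \<longrightarrow> (\<kappa> @ [k]) ! length x = (\<kappa> @ [k]) ! ((x @ [p]) ! length x - 1)) \<longleftrightarrow>
      (p > 0 \<longrightarrow> k = \<kappa> ! (p - 1))"
    using assms(2,3) by (cases p) (simp_all add: nth_append)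
  show ?thesis
    unfolding colorings_def mem_Collect_eq length_append list.size add_0_left add_Suc_right add_0_right
      All_less_Suc B
    using A assms(3) by auto
qed

lemma count_true_0 [simp]: "count_true \<chi> 0 = 0"
  by (simp add: count_true_def)

lemma count_true_append: "m \<le> length \<chi> \<Longrightarrow> count_true (\<chi> @ \<chi>') m = count_true \<chi> m"
  by (simp add: count_true_def)

lemma count_true_append_ge:
  "count_true (\<chi> @ \<chi>') (length \<chi> + m) = count_true \<chi> (length \<chi>) + count_true \<chi>' m"
  by (simp add: count_true_def)

lemma count_true_Suc_length:
  "count_true (\<chi> @ [b]) (Suc (length \<chi>)) = count_true \<chi> (length \<chi>) + (if b then 1 else 0)"
  by (simp add: count_true_def)

lemma count_true_mono: "m \<le> n \<Longrightarrow> count_true \<chi> m \<le> count_true \<chi> n"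
  unfolding count_true_def
  by (metis filter_append le_add1 length_append nat_le_iff_add take_add)

lemma count_true_pos: "0 < p \<Longrightarrow> p \<le> length \<chi> \<Longrightarrow> \<chi> ! (p - 1) \<Longrightarrow> 0 < count_true \<chi> p"
  by (cases p) (auto simp: count_true_def take_Suc_conv_app_nth)

lemma restrict_list_Nil [simp]: "restrict_list [] \<chi> = []" "restrict_list x [] = []"
  by (simp_all add: restrict_list_def)

lemma restrict_list_append:
  assumes "length \<chi> = length x" "\<And>p. p \<in> set x \<Longrightarrow> p \<le> length x"
  shows "restrict_list (x @ y) (\<chi> @ \<chi>') =
    restrict_list x \<chi> @ map (\<lambda>(p, b). count_true (\<chi> @ \<chi>') p) (filter snd (zip y \<chi>'))"
  using assms by (auto simp: restrict_list_def count_true_append dest!: set_zip_leftD)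

lemma restrict_list_snoc:
  assumes "parent_list x" "length \<chi> = length x" "p \<le> length x"
  shows "restrict_list (x @ [p]) (\<chi> @ [b]) = restrict_list x \<chi> @ (if b then [count_true \<chi> p] else [])"
  using assms parent_list_le[OF assms(1)] by (simp add: restrict_list_append count_true_append)

lemma length_restrict_list: "length \<chi> = length x \<Longrightarrow> length (restrict_list x \<chi>) = count_true \<chi> (length \<chi>)"
proof -
  have "length \<chi> = length x \<Longrightarrow> length (filter snd (zip x \<chi>)) = length (filter id \<chi>)"
    by (induction rule: list_induct2) auto
  then show "length \<chi> = length x \<Longrightarrow> ?thesis" by (simp add: restrict_list_def count_true_def)
qed

lemma parent_list_restrict_list:
  "parent_list x \<Longrightarrow> length \<chi> = length x \<Longrightarrow> parent_list (restrict_list x \<chi>)"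
proof (induction x arbitrary: \<chi> rule: parent_list_induct)
  case (snoc x p)
  then obtain \<chi>' b where \<chi>: "\<chi> = \<chi>' @ [b]" "length \<chi>' = length x" by (cases \<chi> rule: rev_cases) auto
  have "count_true \<chi>' p \<le> count_true \<chi>' (length \<chi>')" using snoc \<chi> by (simp add: count_true_mono)
  then show ?case using snoc \<chi> by (simp add: restrict_list_snoc parent_list_snoc length_restrict_list)
qed simp

text \<open>The root together with the nodes colored \<open>True\<close> is renumbered bijectively
  by 0 up to the number of such nodes.\<close>

lemma sum_count_true:
  fixes g :: "nat \<Rightarrow> 'a::comm_monoid_add"
  shows "(\<Sum>m | m \<le> length \<chi> \<and> (m > 0 \<longrightarrow> \<chi> ! (m - 1)). g (count_true \<chi> m)) = (\<Sum>m\<le>count_true \<chi> (length \<chi>). g m)"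
proof (induction \<chi> rule: rev_induct)
  case Nil
  have "{m :: nat. m \<le> 0 \<and> (m > 0 \<longrightarrow> [] ! (m - 1))} = {0}" by auto
  then show ?case by simp
next
  case (snoc b \<chi>)
  let ?n = "length \<chi>"
  let ?A = "{m. m \<le> ?n \<and> (m > 0 \<longrightarrow> \<chi> ! (m - 1))}"
  have eq: "{m. m \<le> length (\<chi> @ [b]) \<and> (m > 0 \<longrightarrow> (\<chi> @ [b]) ! (m - 1))} = ?A \<union> (if b then {Suc ?n} else {})"
    by (auto simp: nth_append le_Suc_eq)
  have "(\<Sum>m\<in>?A \<union> (if b then {Suc ?n} else {}). g (count_true (\<chi> @ [b]) m)) =
      (\<Sum>m\<in>?A. g (count_true (\<chi> @ [b]) m)) + (\<Sum>m\<in>(if b then {Suc ?n} else {}). g (count_true (\<chi> @ [b]) m))"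
    by (rule sum.union_disjoint) auto
  also have "(\<Sum>m\<in>?A. g (count_true (\<chi> @ [b]) m)) = (\<Sum>m\<in>?A. g (count_true \<chi> m))"
    by (intro sum.cong) (auto simp: count_true_append)
  also have "\<dots> = (\<Sum>m\<le>count_true \<chi> ?n. g m)" by (rule snoc)
  finally show ?case unfolding eq using count_true_Suc_length[of \<chi> b] by (cases b) simp_all
qed

subsection \<open>Compatibility of product and coproduct\<close>

lemma Collect_bool: "{b. b} = {True}" "{b. \<not> b} = {False}" "Collect Not = {False}"
  by auto

definition extensions :: "nat list \<Rightarrow> bool list \<Rightarrow> nat list \<Rightarrow> bool list set" where
  "extensions y \<chi> z = {\<chi>'. length \<chi>' = length z \<and> \<chi> @ \<chi>' \<in> colorings (y @ z)}"

lemma finite_extensions [simp]: "finite (extensions y \<chi> z)"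
  by (rule finite_subset[OF _ finite_lists_length_eq[of UNIV "length z"]]) (auto simp: extensions_def)

text \<open>Parents of nodes of \<open>y\<close> lie in \<open>y\<close> again or are the root, so a
  coloring of the larger tree restricts to \<open>y\<close>; the inner sum runs over its
  continuations.\<close>

lemma sum_colorings_append:
  assumes "parent_list y"
  shows "(\<Sum>\<chi>\<in>colorings (y @ z). f \<chi>) = (\<Sum>\<chi>\<in>colorings y. \<Sum>\<chi>'\<in>extensions y \<chi> z. f (\<chi> @ \<chi>'))"
proof -
  have inj: "inj_on (\<lambda>(\<chi>, \<chi>'). \<chi> @ \<chi>') (Sigma (colorings y) (\<lambda>\<chi>. extensions y \<chi> z))"
    by (auto simp: inj_on_def dest!: length_colorings)
  have take: "take (length y) \<chi> \<in> colorings y" if \<chi>: "\<chi> \<in> colorings (y @ z)" for \<chi> :: "bool list"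
    unfolding colorings_def
  proof (intro CollectI conjI allI impI)
    show "length (take (length y) \<chi>) = length y" using length_colorings[OF \<chi>] by simp
    fix i assume i: "i < length y" "0 < y ! i"
    then have "y ! i \<le> i" using assms by (simp add: parent_list_def)
    then show "take (length y) \<chi> ! i = take (length y) \<chi> ! (y ! i - 1)"
      using \<chi> i by (auto simp: colorings_def nth_append)
  qed
  have eq: "colorings (y @ z) = (\<lambda>(\<chi>, \<chi>'). \<chi> @ \<chi>') ` Sigma (colorings y) (\<lambda>\<chi>. extensions y \<chi> z)"
  proof (intro equalityI subsetI)
    fix \<chi> :: "bool list" assume \<chi>: "\<chi> \<in> colorings (y @ z)"
    then show "\<chi> \<in> (\<lambda>(\<chi>, \<chi>'). \<chi> @ \<chi>') ` Sigma (colorings y) (\<lambda>\<chi>. extensions y \<chi> z)"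
      using take[OF \<chi>] length_colorings[OF \<chi>]
      by (intro image_eqI[of _ _ "(take (length y) \<chi>, drop (length y) \<chi>)"]) (auto simp: extensions_def)
  qed (auto simp: extensions_def)
  have "(\<Sum>\<chi>\<in>colorings (y @ z). f \<chi>) =
      (\<Sum>(\<chi>, \<chi>')\<in>Sigma (colorings y) (\<lambda>\<chi>. extensions y \<chi> z). f (\<chi> @ \<chi>'))"
    unfolding eq sum.reindex[OF inj] by (simp add: o_def case_prod_unfold)
  also have "\<dots> = (\<Sum>\<chi>\<in>colorings y. \<Sum>\<chi>'\<in>extensions y \<chi> z. f (\<chi> @ \<chi>'))"
    by (rule sum.Sigma[symmetric]) auto
  finally show ?thesis .
qed

lemma sum_colorings_snoc:
  fixes f :: "bool list \<Rightarrow> 'a::comm_monoid_add"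
  assumes "parent_list x" "p \<le> length x"
  shows "(\<Sum>\<chi>\<in>colorings (x @ [p]). f \<chi>) =
    (\<Sum>\<chi>\<in>colorings x. \<Sum>b | p > 0 \<longrightarrow> b = \<chi> ! (p - 1). f (\<chi> @ [b]))"
  unfolding sum_colorings_append[OF assms(1)]
proof (intro sum.cong refl)
  fix \<chi> :: "bool list" assume \<chi>: "\<chi> \<in> colorings x"
  have iff: "[b] \<in> extensions x \<chi> [p] \<longleftrightarrow> (p > 0 \<longrightarrow> b = \<chi> ! (p - 1))" for b
    using snoc_in_colorings_iff[OF assms length_colorings[OF \<chi>], of b] \<chi> unfolding extensions_def by simp
  have ext: "\<exists>b. \<chi>' = [b]" if "\<chi>' \<in> extensions x \<chi> [p]" for \<chi>'
    using that by (simp add: extensions_def length_Suc_conv)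
  have "extensions x \<chi> [p] = (\<lambda>b. [b]) ` {b. p > 0 \<longrightarrow> b = \<chi> ! (p - 1)}"
  proof (intro equalityI subsetI)
    fix \<chi>' assume *: "\<chi>' \<in> extensions x \<chi> [p]"
    then obtain b where b: "\<chi>' = [b]" using ext by blast
    then have "b \<in> {b. p > 0 \<longrightarrow> b = \<chi> ! (p - 1)}" using * iff by blast
    then show "\<chi>' \<in> (\<lambda>b. [b]) ` {b. p > 0 \<longrightarrow> b = \<chi> ! (p - 1)}" unfolding b by (rule imageI)
  next
    fix \<chi>' assume "\<chi>' \<in> (\<lambda>b. [b]) ` {b. p > 0 \<longrightarrow> b = \<chi> ! (p - 1)}"
    then show "\<chi>' \<in> extensions x \<chi> [p]" using iff by blast
  qed
  then show "(\<Sum>\<chi>'\<in>extensions x \<chi> [p]. f (\<chi> @ \<chi>')) = (\<Sum>b | p > 0 \<longrightarrow> b = \<chi> ! (p - 1). f (\<chi> @ [b]))"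
    by (simp add: sum.reindex inj_on_def)
qed

lemma sum_extensions_snoc:
  fixes f :: "bool list \<Rightarrow> 'a::comm_monoid_add"
  assumes "parent_list (y @ z)" "m \<le> length (y @ z)" "length \<chi> = length y"
  shows "(\<Sum>\<chi>'\<in>extensions y \<chi> (z @ [m]). f \<chi>') =
    (\<Sum>\<chi>'\<in>extensions y \<chi> z. \<Sum>b | m > 0 \<longrightarrow> b = (\<chi> @ \<chi>') ! (m - 1). f (\<chi>' @ [b]))"
proof -
  let ?S = "Sigma (extensions y \<chi> z) (\<lambda>\<chi>'. {b. m > 0 \<longrightarrow> b = (\<chi> @ \<chi>') ! (m - 1)})"
  have len: "length (\<chi> @ \<chi>') = length (y @ z)" if "length \<chi>' = length z" for \<chi>'
    using that assms(3) by simp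
  have iff: "\<chi>' @ [b] \<in> extensions y \<chi> (z @ [m]) \<longleftrightarrow> \<chi>' \<in> extensions y \<chi> z \<and> (m > 0 \<longrightarrow> b = (\<chi> @ \<chi>') ! (m - 1))"
    if "length \<chi>' = length z" for \<chi>' b
    using snoc_in_colorings_iff[OF assms(1,2) len[OF that], of b] that by (auto simp: extensions_def)
  have "extensions y \<chi> (z @ [m]) = (\<lambda>(\<chi>', b). \<chi>' @ [b]) ` ?S"
  proof (intro equalityI subsetI)
    fix \<chi>' assume *: "\<chi>' \<in> extensions y \<chi> (z @ [m])"
    then obtain \<chi>'' b where \<chi>': "\<chi>' = \<chi>'' @ [b]" "length \<chi>'' = length z"
      by (cases \<chi>' rule: rev_cases) (auto simp: extensions_def)
    then have "(\<chi>'', b) \<in> ?S" using * iff by auto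
    then show "\<chi>' \<in> (\<lambda>(\<chi>', b). \<chi>' @ [b]) ` ?S" by (rule image_eqI[rotated]) (simp add: \<chi>')
  qed (use iff in \<open>auto simp: extensions_def\<close>)
  moreover have "inj_on (\<lambda>(\<chi>', b). \<chi>' @ [b]) ?S" by (auto simp: inj_on_def)
  ultimately show ?thesis by (simp add: sum.reindex sum.Sigma case_prod_unfold)
qed

text \<open>Coloring a grafted tree amounts to coloring \<open>x\<close> and grafting each color
  class onto the matching part of \<open>y\<close>. The induction adds the last node of
  \<open>x\<close>. \<open>G\<close> also receives the coloring of \<open>x\<close>, so that the
  hypothesis can be applied to a modified \<open>G'\<close> which reads the color of the last node's
  parent.\<close>

lemma sum_grafts_extensions:
  fixes G :: "bool list \<Rightarrow> nat list \<Rightarrow> nat list \<Rightarrow> 'a::comm_monoid_add"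
  assumes y: "parent_list y" and \<chi>: "\<chi> \<in> colorings y" and x: "parent_list x"
  shows "(\<Sum>z\<in>grafts (length y) x. \<Sum>\<chi>'\<in>extensions y \<chi> z.
       G \<chi>' (restrict_list (y @ z) (\<chi> @ \<chi>')) (restrict_list (y @ z) (compl_list (\<chi> @ \<chi>')))) =
    (\<Sum>\<chi>'\<in>colorings x. \<Sum>z1\<in>grafts (length (restrict_list y \<chi>)) (restrict_list x \<chi>').
       \<Sum>z2\<in>grafts (length (restrict_list y (compl_list \<chi>))) (restrict_list x (compl_list \<chi>')).
       G \<chi>' (restrict_list y \<chi> @ z1) (restrict_list y (compl_list \<chi>) @ z2))"
  using x
proof (induction x arbitrary: G rule: parent_list_induct)
  case Nil
  have "extensions y \<chi> [] = {[]}" using \<chi> by (auto simp: extensions_def)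
  then show ?case by simp
next
  case (snoc x p)
  let ?q = "length y" and ?q1 = "length (restrict_list y \<chi>)" and ?q2 = "length (restrict_list y (compl_list \<chi>))"
  let ?n = "compl_list"
  have len: "length \<chi> = ?q" using \<chi> by (rule length_colorings)
  have q1: "?q1 = count_true \<chi> (length \<chi>)" and q2: "?q2 = count_true (?n \<chi>) (length (?n \<chi>))"
    using len by (simp_all add: length_restrict_list)
  define ap where "ap = (\<lambda>b c a. if b then a @ [c] else a :: nat list)"
  have pl: "parent_list (y @ z)" if "z \<in> grafts ?q x" for z
    by (rule parent_list_append_grafts[OF y snoc(1) that])
  have rs: "restrict_list (y @ z @ [m]) (\<chi> @ \<chi>' @ [b]) = ap b (count_true (\<chi> @ \<chi>') m) (restrict_list (y @ z) (\<chi> @ \<chi>'))"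
    "restrict_list (y @ z @ [m]) (?n \<chi> @ ?n \<chi>' @ [\<not> b]) = ap (\<not> b) (count_true (?n (\<chi> @ \<chi>')) m) (restrict_list (y @ z) (?n (\<chi> @ \<chi>')))"
    if "z \<in> grafts ?q x" "m \<le> length (y @ z)" "\<chi>' \<in> extensions y \<chi> z" for z m \<chi>' b
  proof -
    have l: "length (\<chi> @ \<chi>') = length (y @ z)" using that len by (simp add: extensions_def)
    show "restrict_list (y @ z @ [m]) (\<chi> @ \<chi>' @ [b]) = ap b (count_true (\<chi> @ \<chi>') m) (restrict_list (y @ z) (\<chi> @ \<chi>'))"
      using restrict_list_snoc[OF pl[OF that(1)] l that(2), of b] by (simp add: ap_def)
    show "restrict_list (y @ z @ [m]) (?n \<chi> @ ?n \<chi>' @ [\<not> b]) = ap (\<not> b) (count_true (?n (\<chi> @ \<chi>')) m) (restrict_list (y @ z) (?n (\<chi> @ \<chi>')))"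
      using restrict_list_snoc[OF pl[OF that(1)] _ that(2), of "?n (\<chi> @ \<chi>')" "\<not> b"] l by (simp add: ap_def)
  qed
  have rx: "restrict_list (x @ [p]) (\<chi>' @ [b]) = restrict_list x \<chi>' @ (if b then [count_true \<chi>' p] else [])"
    "restrict_list (x @ [p]) (?n \<chi>' @ [\<not> b]) = restrict_list x (?n \<chi>') @ (if b then [] else [count_true (?n \<chi>') p])"
    if "\<chi>' \<in> colorings x" for \<chi>' b
    using length_colorings[OF that] snoc(1,2) by (simp_all add: restrict_list_snoc)
  have mle: "m \<le> length (y @ z)" if "z \<in> grafts ?q x" "m \<in> graft_choices ?q p" for z m
    using that snoc(2) length_grafts[OF that(1)] by (auto simp: graft_choices_def split: if_splits)
  have L: "(\<Sum>z\<in>grafts ?q (x @ [p]). \<Sum>\<chi>'\<in>extensions y \<chi> z.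
       G \<chi>' (restrict_list (y @ z) (\<chi> @ \<chi>')) (restrict_list (y @ z) (?n (\<chi> @ \<chi>')))) =
     (\<Sum>z\<in>grafts ?q x. \<Sum>\<chi>'\<in>extensions y \<chi> z. \<Sum>m\<in>graft_choices ?q p. \<Sum>b | m > 0 \<longrightarrow> b = (\<chi> @ \<chi>') ! (m - 1).
       G (\<chi>' @ [b]) (ap b (count_true (\<chi> @ \<chi>') m) (restrict_list (y @ z) (\<chi> @ \<chi>')))
         (ap (\<not> b) (count_true (?n (\<chi> @ \<chi>')) m) (restrict_list (y @ z) (?n (\<chi> @ \<chi>')))))"
    unfolding sum_grafts_snoc
  proof (intro sum.cong refl)
    fix z assume z: "z \<in> grafts ?q x"
    have "(\<Sum>m\<in>graft_choices ?q p. \<Sum>\<chi>'\<in>extensions y \<chi> (z @ [m]).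
       G \<chi>' (restrict_list (y @ z @ [m]) (\<chi> @ \<chi>')) (restrict_list (y @ z @ [m]) (?n (\<chi> @ \<chi>')))) =
      (\<Sum>m\<in>graft_choices ?q p. \<Sum>\<chi>'\<in>extensions y \<chi> z. \<Sum>b | m > 0 \<longrightarrow> b = (\<chi> @ \<chi>') ! (m - 1).
       G (\<chi>' @ [b]) (ap b (count_true (\<chi> @ \<chi>') m) (restrict_list (y @ z) (\<chi> @ \<chi>')))
         (ap (\<not> b) (count_true (?n (\<chi> @ \<chi>')) m) (restrict_list (y @ z) (?n (\<chi> @ \<chi>')))))"
    proof (rule sum.cong[OF refl])
      fix m assume m: "m \<in> graft_choices ?q p"
      show "(\<Sum>\<chi>'\<in>extensions y \<chi> (z @ [m]).
         G \<chi>' (restrict_list (y @ z @ [m]) (\<chi> @ \<chi>')) (restrict_list (y @ z @ [m]) (?n (\<chi> @ \<chi>')))) =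
        (\<Sum>\<chi>'\<in>extensions y \<chi> z. \<Sum>b | m > 0 \<longrightarrow> b = (\<chi> @ \<chi>') ! (m - 1).
         G (\<chi>' @ [b]) (ap b (count_true (\<chi> @ \<chi>') m) (restrict_list (y @ z) (\<chi> @ \<chi>')))
           (ap (\<not> b) (count_true (?n (\<chi> @ \<chi>')) m) (restrict_list (y @ z) (?n (\<chi> @ \<chi>')))))"
        unfolding sum_extensions_snoc[OF pl[OF z] mle[OF z m] len]
        by (intro sum.cong refl) (simp add: rs[OF z mle[OF z m]])
    qed
    then show "(\<Sum>m\<in>graft_choices ?q p. \<Sum>\<chi>'\<in>extensions y \<chi> (z @ [m]).
       G \<chi>' (restrict_list (y @ z @ [m]) (\<chi> @ \<chi>')) (restrict_list (y @ z @ [m]) (?n (\<chi> @ \<chi>')))) =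
      (\<Sum>\<chi>'\<in>extensions y \<chi> z. \<Sum>m\<in>graft_choices ?q p. \<Sum>b | m > 0 \<longrightarrow> b = (\<chi> @ \<chi>') ! (m - 1).
       G (\<chi>' @ [b]) (ap b (count_true (\<chi> @ \<chi>') m) (restrict_list (y @ z) (\<chi> @ \<chi>')))
         (ap (\<not> b) (count_true (?n (\<chi> @ \<chi>')) m) (restrict_list (y @ z) (?n (\<chi> @ \<chi>')))))"
      by (rule trans[OF _ sum.swap])
  qed
  have R: "(\<Sum>\<chi>'\<in>colorings (x @ [p]). \<Sum>z1\<in>grafts ?q1 (restrict_list (x @ [p]) \<chi>').
       \<Sum>z2\<in>grafts ?q2 (restrict_list (x @ [p]) (?n \<chi>')).
       G \<chi>' (restrict_list y \<chi> @ z1) (restrict_list y (?n \<chi>) @ z2)) =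
     (\<Sum>\<chi>'\<in>colorings x. \<Sum>b | p > 0 \<longrightarrow> b = \<chi>' ! (p - 1).
       \<Sum>z1\<in>grafts ?q1 (restrict_list x \<chi>' @ (if b then [count_true \<chi>' p] else [])).
       \<Sum>z2\<in>grafts ?q2 (restrict_list x (?n \<chi>') @ (if b then [] else [count_true (?n \<chi>') p])).
       G (\<chi>' @ [b]) (restrict_list y \<chi> @ z1) (restrict_list y (?n \<chi>) @ z2))"
    unfolding sum_colorings_snoc[OF snoc(1,2)] by (intro sum.cong refl) (simp_all add: rx)
  show ?case
  proof (cases "p = 0")
    case True
    \<comment> \<open>The last node starts a new component. It hangs from the root with either color
      or from a node of \<open>y\<close> whose color it takes; sorting by color and renumbering
      leaves the targets 0 to \<open>?q1\<close> for \<open>True\<close> and 0 to \<open>?q2\<close>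
      for \<open>False\<close>.\<close>
    define G' where "G' = (\<lambda>\<chi>' a c. (\<Sum>m\<le>?q1. G (\<chi>' @ [True]) (a @ [m]) c) + (\<Sum>m\<le>?q2. G (\<chi>' @ [False]) a (c @ [m])))"
    have *: "(\<Sum>m\<le>?q. \<Sum>b | m > 0 \<longrightarrow> b = (\<chi> @ \<chi>') ! (m - 1).
       G (\<chi>' @ [b]) (ap b (count_true (\<chi> @ \<chi>') m) a) (ap (\<not> b) (count_true (?n (\<chi> @ \<chi>')) m) c)) = G' \<chi>' a c" for \<chi>' a c
    proof -
      let ?H = "\<lambda>m b. G (\<chi>' @ [b]) (ap b (count_true \<chi> m) a) (ap (\<not> b) (count_true (?n \<chi>) m) c)"
      have "(\<Sum>m\<le>?q. \<Sum>b | m > 0 \<longrightarrow> b = (\<chi> @ \<chi>') ! (m - 1).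
        G (\<chi>' @ [b]) (ap b (count_true (\<chi> @ \<chi>') m) a) (ap (\<not> b) (count_true (?n (\<chi> @ \<chi>')) m) c)) =
        (\<Sum>m\<le>?q. (if m > 0 \<longrightarrow> \<chi> ! (m - 1) then ?H m True else 0) + (if m > 0 \<longrightarrow> ?n \<chi> ! (m - 1) then ?H m False else 0))"
      proof (intro sum.cong refl)
        fix m assume "m \<in> {..?q}"
        then have m: "m \<le> length \<chi>" using len by simp
        then have c: "count_true (\<chi> @ \<chi>') m = count_true \<chi> m" "count_true (?n (\<chi> @ \<chi>')) m = count_true (?n \<chi>) m"
          by (simp_all add: count_true_append)
        have nth: "(\<chi> @ \<chi>') ! (m - 1) = \<chi> ! (m - 1) \<and> ?n \<chi> ! (m - 1) = (\<not> \<chi> ! (m - 1))" if "m > 0"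
          using m that by (auto simp: nth_append)
        consider "m = 0" | "m > 0" "\<chi> ! (m - 1)" | "m > 0" "\<not> \<chi> ! (m - 1)" by blast
        then show "(\<Sum>b | m > 0 \<longrightarrow> b = (\<chi> @ \<chi>') ! (m - 1).
           G (\<chi>' @ [b]) (ap b (count_true (\<chi> @ \<chi>') m) a) (ap (\<not> b) (count_true (?n (\<chi> @ \<chi>')) m) c)) =
           (if m > 0 \<longrightarrow> \<chi> ! (m - 1) then ?H m True else 0) + (if m > 0 \<longrightarrow> ?n \<chi> ! (m - 1) then ?H m False else 0)"
          unfolding c using nth by cases (simp_all add: UNIV_bool add.commute Collect_bool)
      qed
      also have "\<dots> = (\<Sum>m | m \<le> length \<chi> \<and> (m > 0 \<longrightarrow> \<chi> ! (m - 1)). ?H m True) +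
          (\<Sum>m | m \<le> length (?n \<chi>) \<and> (m > 0 \<longrightarrow> ?n \<chi> ! (m - 1)). ?H m False)"
        by (simp only: sum.distrib len length_map flip: sum.inter_filter[OF finite_atMost] atMost_iff)
      also have "\<dots> = G' \<chi>' a c"
        using sum_count_true[of "\<lambda>m. G (\<chi>' @ [True]) (a @ [m]) c" \<chi>]
          sum_count_true[of "\<lambda>m. G (\<chi>' @ [False]) a (c @ [m])" "?n \<chi>"]
        by (simp only: ap_def G'_def q1 q2 if_True if_False not_True_eq_False not_False_eq_True)
      finally show ?thesis .
    qed
    have ch: "graft_choices ?q p = {..?q}" "graft_choices ?q1 0 = {..?q1}" "graft_choices ?q2 0 = {..?q2}"
      using True by (simp_all add: graft_choices_def)
    show ?thesis
      unfolding L R ch * snoc.IH[of G']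
    proof (rule sum.cong[OF refl])
      fix \<chi>' :: "bool list"
      have "(\<Sum>b\<in>UNIV.
       \<Sum>z1\<in>grafts ?q1 (restrict_list x \<chi>' @ (if b then [0] else [])).
       \<Sum>z2\<in>grafts ?q2 (restrict_list x (?n \<chi>') @ (if b then [] else [0])).
       G (\<chi>' @ [b]) (restrict_list y \<chi> @ z1) (restrict_list y (?n \<chi>) @ z2)) =
       (\<Sum>z1\<in>grafts ?q1 (restrict_list x \<chi>'). \<Sum>z2\<in>grafts ?q2 (restrict_list x (?n \<chi>')).
          \<Sum>m\<le>?q1. G (\<chi>' @ [True]) ((restrict_list y \<chi> @ z1) @ [m]) (restrict_list y (?n \<chi>) @ z2)) +
       (\<Sum>z1\<in>grafts ?q1 (restrict_list x \<chi>'). \<Sum>z2\<in>grafts ?q2 (restrict_list x (?n \<chi>')).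
          \<Sum>m\<le>?q2. G (\<chi>' @ [False]) (restrict_list y \<chi> @ z1) ((restrict_list y (?n \<chi>) @ z2) @ [m]))"
        by (simp add: UNIV_bool sum_grafts_snoc ch(2,3) add.commute sum.swap[of _ "{..?q1}"])
      then show "(\<Sum>z1\<in>grafts ?q1 (restrict_list x \<chi>'). \<Sum>z2\<in>grafts ?q2 (restrict_list x (?n \<chi>')).
          G' \<chi>' (restrict_list y \<chi> @ z1) (restrict_list y (?n \<chi>) @ z2)) =
       (\<Sum>b | p > 0 \<longrightarrow> b = \<chi>' ! (p - 1).
       \<Sum>z1\<in>grafts ?q1 (restrict_list x \<chi>' @ (if b then [count_true \<chi>' p] else [])).
       \<Sum>z2\<in>grafts ?q2 (restrict_list x (?n \<chi>') @ (if b then [] else [count_true (?n \<chi>') p])).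
       G (\<chi>' @ [b]) (restrict_list y \<chi> @ z1) (restrict_list y (?n \<chi>) @ z2))"
        using True by (simp add: G'_def sum.distrib cong: if_cong)
    qed
  next
    case False
    \<comment> \<open>The last node has a non-root parent, so its place and its color are forced;
      only the two ways of computing its new parent label have to agree.\<close>
    define G' where "G' = (\<lambda>\<chi>' a c. let b = \<chi>' ! (p - 1) in
       G (\<chi>' @ [b]) (ap b (count_true \<chi>' p + ?q1) a) (ap (\<not> b) (count_true (?n \<chi>') p + ?q2) c))"
    have ch: "graft_choices ?q p = {?q + p}" using False by (simp add: graft_choices_def)
    have *: "(\<Sum>b | ?q + p > 0 \<longrightarrow> b = (\<chi> @ \<chi>') ! (?q + p - 1).
       G (\<chi>' @ [b]) (ap b (count_true (\<chi> @ \<chi>') (?q + p)) a) (ap (\<not> b) (count_true (?n (\<chi> @ \<chi>')) (?q + p)) c)) = G' \<chi>' a c"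
      for \<chi>' a c
    proof -
      have "(\<chi> @ \<chi>') ! (?q + p - 1) = \<chi>' ! (p - 1)" using False len by (cases p) (simp_all add: nth_append)
      moreover have "count_true (\<chi> @ \<chi>') (?q + p) = count_true \<chi>' p + ?q1"
        using count_true_append_ge[of \<chi> \<chi>' p] len q1 by simp
      moreover have "count_true (?n (\<chi> @ \<chi>')) (?q + p) = count_true (?n \<chi>') p + ?q2"
        using count_true_append_ge[of "?n \<chi>" "?n \<chi>'" p] len q2 by simp
      ultimately show ?thesis using False by (simp add: G'_def Let_def)
    qed
    have L': "(\<Sum>z\<in>grafts ?q x. \<Sum>\<chi>'\<in>extensions y \<chi> z. \<Sum>m\<in>graft_choices ?q p. \<Sum>b | m > 0 \<longrightarrow> b = (\<chi> @ \<chi>') ! (m - 1).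
       G (\<chi>' @ [b]) (ap b (count_true (\<chi> @ \<chi>') m) (restrict_list (y @ z) (\<chi> @ \<chi>')))
         (ap (\<not> b) (count_true (?n (\<chi> @ \<chi>')) m) (restrict_list (y @ z) (?n (\<chi> @ \<chi>'))))) =
      (\<Sum>z\<in>grafts ?q x. \<Sum>\<chi>'\<in>extensions y \<chi> z. G' \<chi>' (restrict_list (y @ z) (\<chi> @ \<chi>')) (restrict_list (y @ z) (?n (\<chi> @ \<chi>'))))"
      unfolding ch by (simp only: * sum.insert finite.emptyI empty_iff not_False_eq_True sum.empty add_0_right)
    show ?thesis
      unfolding L R L' snoc.IH[of G']
    proof (rule sum.cong[OF refl])
      fix \<chi>' :: "bool list" assume "\<chi>' \<in> colorings x"
      then have l: "p \<le> length \<chi>'" using snoc(2) length_colorings by metis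
      have c: "graft_choices ?q1 (count_true \<chi>' p) = {count_true \<chi>' p + ?q1}" if "\<chi>' ! (p - 1)"
        using count_true_pos[of p \<chi>'] False l that by (simp add: graft_choices_def)
      have c': "graft_choices ?q2 (count_true (?n \<chi>') p) = {count_true (?n \<chi>') p + ?q2}" if "\<not> \<chi>' ! (p - 1)"
        using count_true_pos[of p "?n \<chi>'"] False l that by (simp add: graft_choices_def)
      show "(\<Sum>z1\<in>grafts ?q1 (restrict_list x \<chi>'). \<Sum>z2\<in>grafts ?q2 (restrict_list x (?n \<chi>')).
          G' \<chi>' (restrict_list y \<chi> @ z1) (restrict_list y (?n \<chi>) @ z2)) =
       (\<Sum>b | p > 0 \<longrightarrow> b = \<chi>' ! (p - 1).
       \<Sum>z1\<in>grafts ?q1 (restrict_list x \<chi>' @ (if b then [count_true \<chi>' p] else [])).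
       \<Sum>z2\<in>grafts ?q2 (restrict_list x (?n \<chi>') @ (if b then [] else [count_true (?n \<chi>') p])).
       G (\<chi>' @ [b]) (restrict_list y \<chi> @ z1) (restrict_list y (?n \<chi>) @ z2))"
        using False c c' by (cases "\<chi>' ! (p - 1)") (simp_all add: G'_def ap_def sum_grafts_snoc Collect_bool)
    qed
  qed
qed

theorem sum_grafts_colorings:
  fixes F :: "nat list \<Rightarrow> nat list \<Rightarrow> 'a::comm_monoid_add"
  assumes y: "parent_list y" and x: "parent_list x"
  shows "(\<Sum>z\<in>grafts (length y) x. \<Sum>\<chi>\<in>colorings (y @ z). F (restrict_list (y @ z) \<chi>) (restrict_list (y @ z) (compl_list \<chi>))) =
    (\<Sum>\<chi>'\<in>colorings x. \<Sum>\<chi>\<in>colorings y.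
       \<Sum>z1\<in>grafts (length (restrict_list y \<chi>)) (restrict_list x \<chi>').
       \<Sum>z2\<in>grafts (length (restrict_list y (compl_list \<chi>))) (restrict_list x (compl_list \<chi>')).
       F (restrict_list y \<chi> @ z1) (restrict_list y (compl_list \<chi>) @ z2))"
proof -
  have "(\<Sum>z\<in>grafts (length y) x. \<Sum>\<chi>\<in>colorings (y @ z). F (restrict_list (y @ z) \<chi>) (restrict_list (y @ z) (compl_list \<chi>))) =
    (\<Sum>\<chi>\<in>colorings y. \<Sum>z\<in>grafts (length y) x. \<Sum>\<chi>'\<in>extensions y \<chi> z.
       F (restrict_list (y @ z) (\<chi> @ \<chi>')) (restrict_list (y @ z) (compl_list (\<chi> @ \<chi>'))))"
    unfolding sum_colorings_append[OF y] by (rule sum.swap)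
  also have "\<dots> = (\<Sum>\<chi>\<in>colorings y. \<Sum>\<chi>'\<in>colorings x.
       \<Sum>z1\<in>grafts (length (restrict_list y \<chi>)) (restrict_list x \<chi>').
       \<Sum>z2\<in>grafts (length (restrict_list y (compl_list \<chi>))) (restrict_list x (compl_list \<chi>')).
       F (restrict_list y \<chi> @ z1) (restrict_list y (compl_list \<chi>) @ z2))"
    by (rule sum.cong[OF refl]) (rule sum_grafts_extensions[OF y _ x])
  also have "\<dots> = (\<Sum>\<chi>'\<in>colorings x. \<Sum>\<chi>\<in>colorings y.
       \<Sum>z1\<in>grafts (length (restrict_list y \<chi>)) (restrict_list x \<chi>').
       \<Sum>z2\<in>grafts (length (restrict_list y (compl_list \<chi>))) (restrict_list x (compl_list \<chi>')).
       F (restrict_list y \<chi> @ z1) (restrict_list y (compl_list \<chi>) @ z2))"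
    by (rule sum.swap)
  finally show ?thesis .
qed

subsection \<open>Iterated coproducts\<close>

text \<open>Coloring the nodes, then recoloring those of color \<open>True\<close>, amounts to a coloring by
  \<open>bool option\<close>, where \<open>None\<close> stands for the first color \<open>False\<close>.\<close>

fun recolor :: "bool list \<Rightarrow> 'c list \<Rightarrow> 'c option list" where
  "recolor [] \<psi> = []"
| "recolor (False # \<chi>) \<psi> = None # recolor \<chi> \<psi>"
| "recolor (True # \<chi>) \<psi> = Some (hd \<psi>) # recolor \<chi> (tl \<psi>)"

fun is_some :: "'c option \<Rightarrow> bool" where
  "is_some None = False"
| "is_some (Some c) = True"

lemma not_is_some_iff [simp]: "\<not> is_some c \<longleftrightarrow> c = None"
  by (cases c) auto

lemma map_is_some_recolor [simp]: "map is_some (recolor \<chi> \<psi>) = \<chi>"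
  by (induction \<chi> \<psi> rule: recolor.induct) auto

lemma somes_recolor: "length \<psi> = length (filter id \<chi>) \<Longrightarrow> map the (filter is_some (recolor \<chi> \<psi>)) = \<psi>"
proof (induction \<chi> \<psi> rule: recolor.induct)
  case (3 \<chi> \<psi>)
  then show ?case by (cases \<psi>) auto
qed auto

lemma recolor_is_some: "recolor (map is_some \<kappa>) (map the (filter is_some \<kappa>)) = \<kappa>"
proof (induction \<kappa>)
  case (Cons c \<kappa>)
  then show ?case by (cases c) auto
qed simp

lemma count_true_map: "count_true (map P \<kappa>) p = length (filter P (take p \<kappa>))"
  by (simp add: count_true_def take_map filter_map o_def)

lemma take_filter_length: "take (length (filter P (take p \<kappa>))) (filter P \<kappa>) = filter P (take p \<kappa>)"
  by (metis append_eq_conv_conj append_take_drop_id filter_append)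

lemma nth_filter_count:
  assumes "0 < p" "p \<le> length \<kappa>" "P (\<kappa> ! (p - 1))"
  shows "filter P \<kappa> ! (length (filter P (take p \<kappa>)) - 1) = \<kappa> ! (p - 1)"
proof -
  obtain m where p: "p = Suc m" using assms(1) by (cases p) auto
  have "filter P (take p \<kappa>) = filter P (take m \<kappa>) @ [\<kappa> ! m]"
    using assms p by (simp add: take_Suc_conv_app_nth)
  moreover have "filter P \<kappa> = filter P (take p \<kappa>) @ filter P (drop p \<kappa>)"
    by (metis append_take_drop_id filter_append)
  ultimately show ?thesis using p by (simp add: nth_append)
qed

text \<open>Restricting twice relabels twice, and the resulting label of a node counts the nodes of
  its final color up to it. That is the label given by one restriction to this final color.\<close>

lemma colorings_recolor:
  fixes \<kappa> :: "bool option list"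
  assumes "parent_list x" "length \<kappa> = length x"
  shows "(\<kappa> \<in> colorings x \<longleftrightarrow> map is_some \<kappa> \<in> colorings x \<and>
      map the (filter is_some \<kappa>) \<in> colorings (restrict_list x (map is_some \<kappa>))) \<and>
    restrict_list (restrict_list x (map is_some \<kappa>)) (map the (filter is_some \<kappa>)) =
      restrict_list x (map (\<lambda>c. c = Some True) \<kappa>) \<and>
    restrict_list (restrict_list x (map is_some \<kappa>)) (compl_list (map the (filter is_some \<kappa>))) =
      restrict_list x (map (\<lambda>c. c = Some False) \<kappa>)"
  using assms
proof (induction x arbitrary: \<kappa> rule: parent_list_induct)
  case (snoc x p)
  then obtain \<kappa>' k where \<kappa>: "\<kappa> = \<kappa>' @ [k]" "length \<kappa>' = length x" by (cases \<kappa> rule: rev_cases) auto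
  let ?s = "map is_some \<kappa>'" and ?t = "map the (filter is_some \<kappa>')"
  have rp: "parent_list (restrict_list x ?s)" using \<kappa> snoc(1) by (simp add: parent_list_restrict_list)
  have len: "length ?t = length (restrict_list x ?s)"
    using \<kappa>(2) by (simp add: length_restrict_list count_true_map)
  have cle: "count_true ?s p \<le> length (restrict_list x ?s)"
    using \<kappa>(2) snoc(2) by (simp add: length_restrict_list count_true_mono)
  have A: "\<kappa> \<in> colorings (x @ [p]) \<longleftrightarrow> map is_some \<kappa> \<in> colorings (x @ [p]) \<and>
      map the (filter is_some \<kappa>) \<in> colorings (restrict_list (x @ [p]) (map is_some \<kappa>))"
  proof (cases k)
    case None
    then have "\<kappa> \<in> colorings (x @ [p]) \<longleftrightarrow> \<kappa>' \<in> colorings x \<and> (p > 0 \<longrightarrow> \<not> is_some (\<kappa>' ! (p - 1)))"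
      using snoc_in_colorings_iff[OF snoc(1,2) \<kappa>(2), of k] by (auto simp: \<kappa>(1))
    moreover have "map is_some \<kappa> \<in> colorings (x @ [p]) \<longleftrightarrow> ?s \<in> colorings x \<and> (p > 0 \<longrightarrow> \<not> is_some (\<kappa>' ! (p - 1)))"
      using snoc_in_colorings_iff[OF snoc(1,2), of ?s "is_some k"] \<kappa>(2) snoc(2) None by (auto simp: \<kappa>(1))
    moreover have "restrict_list (x @ [p]) (map is_some \<kappa>) = restrict_list x ?s"
      using restrict_list_snoc[OF snoc(1), of ?s p "is_some k"] \<kappa> snoc(2) None by simp
    ultimately show ?thesis using snoc.IH[OF \<kappa>(2)] None by (auto simp: \<kappa>(1))
  next
    case (Some b)
    have 1: "\<kappa> \<in> colorings (x @ [p]) \<longleftrightarrow> \<kappa>' \<in> colorings x \<and> (p > 0 \<longrightarrow> \<kappa>' ! (p - 1) = Some b)"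
      using snoc_in_colorings_iff[OF snoc(1,2) \<kappa>(2), of k] by (auto simp: \<kappa>(1) Some)
    have 2: "map is_some \<kappa> \<in> colorings (x @ [p]) \<longleftrightarrow> ?s \<in> colorings x \<and> (p > 0 \<longrightarrow> is_some (\<kappa>' ! (p - 1)))"
      using snoc_in_colorings_iff[OF snoc(1,2), of ?s "is_some k"] \<kappa>(2) snoc(2) Some by (auto simp: \<kappa>(1))
    have r: "restrict_list (x @ [p]) (map is_some \<kappa>) = restrict_list x ?s @ [count_true ?s p]"
      using restrict_list_snoc[OF snoc(1), of ?s p "is_some k"] \<kappa> snoc(2) Some by simp
    have 3: "map the (filter is_some \<kappa>) \<in> colorings (restrict_list (x @ [p]) (map is_some \<kappa>)) \<longleftrightarrow>
        ?t \<in> colorings (restrict_list x ?s) \<and> (count_true ?s p > 0 \<longrightarrow> b = ?t ! (count_true ?s p - 1))"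
      unfolding r using snoc_in_colorings_iff[OF rp cle len, of b] by (simp add: \<kappa>(1) Some)
    \<comment> \<open>The parent \<open>p\<close> is itself kept, and its second color stands in the
      filtered list at its new label minus one.\<close>
    have 4: "(count_true ?s p > 0 \<longrightarrow> b = ?t ! (count_true ?s p - 1)) \<longleftrightarrow> (p > 0 \<longrightarrow> \<kappa>' ! (p - 1) = Some b)"
      if "p > 0 \<longrightarrow> is_some (\<kappa>' ! (p - 1))"
    proof (cases "p = 0")
      case False
      then have isk: "is_some (\<kappa>' ! (p - 1))" using that by simp
      have pos: "count_true ?s p > 0"
        using count_true_pos[of p ?s] False isk \<kappa>(2) snoc(2) by simp
      have "?t ! (count_true ?s p - 1) = the (filter is_some \<kappa>' ! (count_true ?s p - 1))"
        by (rule nth_map) (use pos cle len in auto)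
      also have "\<dots> = the (\<kappa>' ! (p - 1))"
        using nth_filter_count[of p \<kappa>' is_some] False isk \<kappa>(2) snoc(2) by (simp add: count_true_map)
      finally show ?thesis using pos isk False by (cases "\<kappa>' ! (p - 1)") auto
    qed simp
    show ?thesis using 1 2 3 4 snoc.IH[OF \<kappa>(2)] by auto
  qed
  have rr: "restrict_list (restrict_list (x @ [p]) (map is_some \<kappa>)) (map f (map the (filter is_some \<kappa>))) =
      restrict_list (restrict_list x ?s) (map f ?t) @ (if is_some k \<and> f (the k) then [count_true (map (\<lambda>c. is_some c \<and> f (the c)) \<kappa>') p] else [])" for f
  proof (cases k)
    case None
    then show ?thesis
      using restrict_list_snoc[OF snoc(1), of ?s p "is_some k"] \<kappa> snoc(2) by simp
  next
    case (Some b)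
    have r: "restrict_list (x @ [p]) (map is_some \<kappa>) = restrict_list x ?s @ [count_true ?s p]"
      using restrict_list_snoc[OF snoc(1), of ?s p "is_some k"] \<kappa> snoc(2) Some by simp
    have t: "take (count_true ?s p) (map f ?t) = map f (map the (filter is_some (take p \<kappa>')))"
      by (simp add: take_map count_true_map take_filter_length)
    have "count_true (map f ?t) (count_true ?s p) = length (filter id (map f (map the (filter is_some (take p \<kappa>')))))"
      unfolding count_true_def[of "map f ?t"] t ..
    also have "\<dots> = count_true (map (\<lambda>c. is_some c \<and> f (the c)) \<kappa>') p"
      by (simp add: count_true_map filter_map o_def conj_commute)
    finally have c: "count_true (map f ?t) (count_true ?s p) = count_true (map (\<lambda>c. is_some c \<and> f (the c)) \<kappa>') p" .
    show ?thesis unfolding r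
      using restrict_list_snoc[OF rp, of "map f ?t" "count_true ?s p" "f b"] len cle Some
      by (simp add: \<kappa>(1) c[unfolded map_map])
  qed
  have m: "map (\<lambda>c. is_some c \<and> the c) \<kappa>' = map (\<lambda>c. c = Some True) \<kappa>'"
    "map (\<lambda>c. is_some c \<and> \<not> the c) \<kappa>' = map (\<lambda>c. c = Some False) \<kappa>'"
    by (simp_all, metis is_some.simps option.sel option.exhaust, metis is_some.simps option.sel option.exhaust)
  have k: "(is_some k \<and> the k) = (k = Some True)" "(is_some k \<and> \<not> the k) = (k = Some False)"
    by (cases k; simp)+
  have B: "restrict_list (restrict_list (x @ [p]) (map is_some \<kappa>)) (map the (filter is_some \<kappa>)) =
      restrict_list (x @ [p]) (map (\<lambda>c. c = Some True) \<kappa>)"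
    using rr[of "\<lambda>b. b"] snoc.IH[OF \<kappa>(2)] \<kappa> snoc(2)
      restrict_list_snoc[OF snoc(1), of "map (\<lambda>c. c = Some True) \<kappa>'" p "k = Some True"]
    by (simp only: m k list.map_ident length_map map_append list.map)
  have C: "restrict_list (restrict_list (x @ [p]) (map is_some \<kappa>)) (compl_list (map the (filter is_some \<kappa>))) =
      restrict_list (x @ [p]) (map (\<lambda>c. c = Some False) \<kappa>)"
    using rr[of Not] snoc.IH[OF \<kappa>(2)] \<kappa> snoc(2)
      restrict_list_snoc[OF snoc(1), of "map (\<lambda>c. c = Some False) \<kappa>'" p "k = Some False"]
    by (simp only: m k length_map map_append list.map)
  show ?case using A B C by blast
qed auto

lemmas colorings_iff_recolor = colorings_recolor[THEN conjunct1]
  colorings_recolor[THEN conjunct2, THEN conjunct1] colorings_recolor[THEN conjunct2, THEN conjunct2]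

lemma sum_colorings_colorings:
  fixes F :: "nat list \<Rightarrow> nat list \<Rightarrow> nat list \<Rightarrow> 'a::comm_monoid_add"
  assumes x: "parent_list x"
  shows "(\<Sum>\<chi>\<in>colorings x. \<Sum>\<psi>\<in>colorings (restrict_list x \<chi>).
      F (restrict_list (restrict_list x \<chi>) \<psi>) (restrict_list (restrict_list x \<chi>) (compl_list \<psi>)) (restrict_list x (compl_list \<chi>))) =
    (\<Sum>\<kappa>\<in>colorings x. F (restrict_list x (map (\<lambda>c. c = Some True) \<kappa>)) (restrict_list x (map (\<lambda>c. c = Some False) \<kappa>))
      (restrict_list x (map (\<lambda>c. c = None) \<kappa>)))"
proof -
  let ?S = "Sigma (colorings x) (\<lambda>\<chi>. colorings (restrict_list x \<chi>)) :: (bool list \<times> bool list) set"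
  let ?G = "\<lambda>(\<chi>, \<psi>). F (restrict_list (restrict_list x \<chi>) \<psi>) (restrict_list (restrict_list x \<chi>) (compl_list \<psi>)) (restrict_list x (compl_list \<chi>))"
  have "(\<Sum>y\<in>?S. ?G y) = (\<Sum>\<kappa>\<in>colorings x. F (restrict_list x (map (\<lambda>c. c = Some True) \<kappa>)) (restrict_list x (map (\<lambda>c. c = Some False) \<kappa>))
      (restrict_list x (map (\<lambda>c. c = None) \<kappa>)))"
  proof (rule sum.reindex_bij_witness[where j = "\<lambda>(\<chi>, \<psi>). recolor \<chi> \<psi>" and i = "\<lambda>\<kappa>. (map is_some \<kappa>, map the (filter is_some \<kappa>))"])
    fix a assume a: "a \<in> ?S"
    obtain \<chi> \<psi> where a': "a = (\<chi>, \<psi>)" by (cases a)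
    then have \<chi>: "\<chi> \<in> colorings x" and \<psi>: "\<psi> \<in> colorings (restrict_list x \<chi>)" using a by auto
    have l\<chi>: "length \<chi> = length x" using \<chi> by (rule length_colorings)
    have l\<psi>: "length \<psi> = length (filter id \<chi>)"
      using length_colorings[OF \<psi>] by (simp add: length_restrict_list l\<chi> count_true_def)
    have l: "length (recolor \<chi> \<psi>) = length x" using l\<chi> map_is_some_recolor[of \<chi> \<psi>] by (metis length_map)
    show *: "(map is_some (case a of (\<chi>, \<psi>) \<Rightarrow> recolor \<chi> \<psi>), map the (filter is_some (case a of (\<chi>, \<psi>) \<Rightarrow> recolor \<chi> \<psi>))) = a"
      using somes_recolor[OF l\<psi>] by (simp add: a')
    show "(case a of (\<chi>, \<psi>) \<Rightarrow> recolor \<chi> \<psi>) \<in> colorings x"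
      using colorings_iff_recolor(1)[OF x l] somes_recolor[OF l\<psi>] \<chi> \<psi> by (simp add: a')
    have nn: "map (\<lambda>c. c = None) (recolor \<chi> \<psi>) = compl_list \<chi>"
    proof -
      have "compl_list \<chi> = compl_list (map is_some (recolor \<chi> \<psi>))" by simp
      then show ?thesis by (simp only: map_map o_def not_is_some_iff)
    qed
    show "F (restrict_list x (map (\<lambda>c. c = Some True) (case a of (\<chi>, \<psi>) \<Rightarrow> recolor \<chi> \<psi>)))
        (restrict_list x (map (\<lambda>c. c = Some False) (case a of (\<chi>, \<psi>) \<Rightarrow> recolor \<chi> \<psi>)))
        (restrict_list x (map (\<lambda>c. c = None) (case a of (\<chi>, \<psi>) \<Rightarrow> recolor \<chi> \<psi>))) = ?G a"
      using colorings_iff_recolor(2,3)[OF x l] somes_recolor[OF l\<psi>] by (simp add: a' nn)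
  next
    fix \<kappa> :: "bool option list" assume \<kappa>: "\<kappa> \<in> colorings x"
    show "(case (map is_some \<kappa>, map the (filter is_some \<kappa>)) of (\<chi>, \<psi>) \<Rightarrow> recolor \<chi> \<psi>) = \<kappa>"
      by (simp add: recolor_is_some)
    show "(map is_some \<kappa>, map the (filter is_some \<kappa>)) \<in> ?S"
      using colorings_iff_recolor(1)[OF x length_colorings[OF \<kappa>]] \<kappa> by simp
  qed
  moreover have "(\<Sum>y\<in>?S. ?G y) = (\<Sum>\<chi>\<in>colorings x. \<Sum>\<psi>\<in>colorings (restrict_list x \<chi>). ?G (\<chi>, \<psi>))"
    by (subst sum.Sigma) auto
  ultimately show ?thesis by simp
qed

lemma sum_colorings_compl:
  assumes "parent_list x"
  shows "(\<Sum>\<chi>\<in>colorings x. f (compl_list \<chi>)) = (\<Sum>\<chi>\<in>colorings x. f \<chi>)"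
  by (rule sum.reindex_bij_witness[where i = compl_list and j = compl_list])
    (auto simp: o_def intro: colorings_map assms)

text \<open>Both sides are sums over three-colorings of the components; they differ only in which
  color class is split off first.\<close>

lemma sum_colorings_coassoc:
  fixes F :: "nat list \<Rightarrow> nat list \<Rightarrow> nat list \<Rightarrow> 'a::comm_monoid_add"
  assumes x: "parent_list x"
  shows "(\<Sum>\<chi>\<in>colorings x. \<Sum>\<psi>\<in>colorings (restrict_list x \<chi>).
      F (restrict_list (restrict_list x \<chi>) \<psi>) (restrict_list (restrict_list x \<chi>) (compl_list \<psi>)) (restrict_list x (compl_list \<chi>))) =
    (\<Sum>\<chi>\<in>colorings x. \<Sum>\<psi>\<in>colorings (restrict_list x (compl_list \<chi>)).
      F (restrict_list x \<chi>) (restrict_list (restrict_list x (compl_list \<chi>)) \<psi>)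
        (restrict_list (restrict_list x (compl_list \<chi>)) (compl_list \<psi>)))"
proof -
  let ?r = "\<lambda>c \<kappa>. restrict_list x (map (\<lambda>c'. c' = c) \<kappa>)"
  \<comment> \<open>A cyclic permutation of the three colors, with inverse \<tau>; it matches the
    order in which the two iterated splittings produce the classes.\<close>
  define \<sigma> :: "bool option \<Rightarrow> bool option" where
    "\<sigma> = (\<lambda>c. case c of None \<Rightarrow> Some True | Some b \<Rightarrow> if b then Some False else None)"
  define \<tau> :: "bool option \<Rightarrow> bool option" where
    "\<tau> = (\<lambda>c. case c of None \<Rightarrow> Some False | Some b \<Rightarrow> if b then None else Some True)"
  have st: "\<sigma> (\<tau> c) = c" "\<tau> (\<sigma> c) = c" for c by (auto simp: \<sigma>_def \<tau>_def split: option.splits)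
  have se: "(\<sigma> c = Some True) = (c = None)" "(\<sigma> c = Some False) = (c = Some True)" "(\<sigma> c = None) = (c = Some False)" for c
    by (auto simp: \<sigma>_def split: option.splits)
  have "(\<Sum>\<chi>\<in>colorings x. \<Sum>\<psi>\<in>colorings (restrict_list x (compl_list \<chi>)).
      F (restrict_list x \<chi>) (restrict_list (restrict_list x (compl_list \<chi>)) \<psi>)
        (restrict_list (restrict_list x (compl_list \<chi>)) (compl_list \<psi>))) =
    (\<Sum>\<chi>\<in>colorings x. \<Sum>\<psi>\<in>colorings (restrict_list x \<chi>).
      F (restrict_list x (compl_list \<chi>)) (restrict_list (restrict_list x \<chi>) \<psi>) (restrict_list (restrict_list x \<chi>) (compl_list \<psi>)))"
    by (subst sum_colorings_compl[OF x, symmetric]) (simp add: o_def)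
  also have "\<dots> = (\<Sum>\<kappa>\<in>colorings x. F (?r None \<kappa>) (?r (Some True) \<kappa>) (?r (Some False) \<kappa>))"
    by (rule sum_colorings_colorings[OF x, of "\<lambda>a b c. F c a b"])
  also have "\<dots> = (\<Sum>\<kappa>\<in>colorings x. F (?r (Some True) \<kappa>) (?r (Some False) \<kappa>) (?r None \<kappa>))"
    by (rule sum.reindex_bij_witness[where i = "map \<tau>" and j = "map \<sigma>"])
      (auto simp: o_def st se intro: colorings_map x)
  also have "\<dots> = (\<Sum>\<chi>\<in>colorings x. \<Sum>\<psi>\<in>colorings (restrict_list x \<chi>).
      F (restrict_list (restrict_list x \<chi>) \<psi>) (restrict_list (restrict_list x \<chi>) (compl_list \<psi>)) (restrict_list x (compl_list \<chi>)))"
    by (rule sum_colorings_colorings[OF x, symmetric])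
  finally show ?thesis by (rule sym)
qed

section \<open>Trees as sets of edges\<close>

fun edge_list :: "ltree \<Rightarrow> (nat \<times> nat) list" where
  "edge_list (Node a ts) = concat (map (\<lambda>t. (a, root t) # edge_list t) ts)"

definition edges :: "ltree \<Rightarrow> (nat \<times> nat) set" where
  "edges t = set (edge_list t)"

lemma edges_Node [simp]: "edges (Node a ts) = (\<Union>t\<in>set ts. insert (a, root t) (edges t))"
  by (auto simp: edges_def)

lemma set_labels_Node [simp]: "set (labels (Node a ts)) = insert a (\<Union>t\<in>set ts. set (labels t))"
  by simp

lemma root_in_labels [simp]: "root t \<in> set (labels t)"
  by (cases t) simp

lemma set_labels: "set (labels t) = insert (root t) (snd ` edges t)"
  by (induction t) (simp add: image_UN del: labels.simps)

lemma edges_labels: "(p, c) \<in> edges t \<Longrightarrow> p \<in> set (labels t) \<and> c \<in> set (labels t)"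
  by (induction t) (simp del: labels.simps, use root_in_labels in blast)

lemma heap_root_le: "heap t \<Longrightarrow> b \<in> set (labels t) \<Longrightarrow> root t \<le> b"
  by (induction t arbitrary: b) (fastforce simp del: labels.simps)

lemma heap_edges_less: "heap t \<Longrightarrow> (p, c) \<in> edges t \<Longrightarrow> p < c"
  by (induction t) auto

lemma distinct_labels_children:
  "distinct (concat (map labels ts)) \<Longrightarrow> t \<in> set ts \<Longrightarrow> t' \<in> set ts \<Longrightarrow>
     c \<in> set (labels t) \<Longrightarrow> c \<in> set (labels t') \<Longrightarrow> t = t'"
  by (induction ts) auto

lemma distinct_labels_child: "distinct (concat (map labels ts)) \<Longrightarrow> t \<in> set ts \<Longrightarrow> distinct (labels t)"
  by (induction ts) auto

lemma root_no_parent: "distinct (labels t) \<Longrightarrow> (p, root t) \<notin> edges t"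
  by (cases t) (use edges_labels root_in_labels in fastforce)

lemma edges_parent_unique: "distinct (labels t) \<Longrightarrow> (p, c) \<in> edges t \<Longrightarrow> (p', c) \<in> edges t \<Longrightarrow> p = p'"
proof (induction t)
  case (Node a ts)
  then obtain t t' where t: "t \<in> set ts" "(p, c) \<in> insert (a, root t) (edges t)"
    and t': "t' \<in> set ts" "(p', c) \<in> insert (a, root t') (edges t')" by auto
  have d: "distinct (concat (map labels ts))" using Node.prems by simp
  have "c \<in> set (labels t)" "c \<in> set (labels t')"
    using t(2) t'(2) by (metis insertE prod.inject edges_labels root_in_labels)+
  then have eq: "t' = t" using distinct_labels_children[OF d] t t' by blast
  have dt: "distinct (labels t)" using distinct_labels_child[OF d] t by blast
  show ?case using t t' Node.IH[OF t(1) dt] root_no_parent[OF dt] unfolding eq by blast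
qed

lemma labels_reachable: "b \<in> set (labels t) \<Longrightarrow> (root t, b) \<in> (edges t)\<^sup>*"
proof (induction t)
  case (Node a ts)
  show ?case
  proof (cases "b = a")
    case False
    then obtain t where t: "t \<in> set ts" "b \<in> set (labels t)" using Node.prems by auto
    have "edges t \<subseteq> edges (Node a ts)" "(a, root t) \<in> edges (Node a ts)" using t(1) by auto
    then show ?thesis using Node.IH[OF t] rtrancl_mono by (metis converse_rtrancl_into_rtrancl ltree.sel(1) subsetD)
  qed simp
qed

text \<open>Distinct labels make a subtree recoverable from the edges of the whole tree: its labels
  are the nodes reachable from its root.\<close>

lemma child_edges:
  assumes "distinct (labels (Node a ts))" "t \<in> set ts"
  shows "edges t = {(p, c) \<in> edges (Node a ts). p \<in> set (labels t)}"
    and "set (labels t) = {b. (root t, b) \<in> (edges (Node a ts))\<^sup>*}"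
proof -
  have d: "distinct (concat (map labels ts))" and a: "\<And>s. s \<in> set ts \<Longrightarrow> a \<notin> set (labels s)"
    using assms(1) by auto
  show e: "edges t = {(p, c) \<in> edges (Node a ts). p \<in> set (labels t)}"
  proof (intro equalityI subsetI; clarify)
    fix p c assume "(p, c) \<in> edges t"
    then show "(p, c) \<in> edges (Node a ts) \<and> p \<in> set (labels t)" using assms(2) edges_labels by auto
  next
    fix p c assume pc: "(p, c) \<in> edges (Node a ts)" "p \<in> set (labels t)"
    then obtain s where s: "s \<in> set ts" "(p, c) = (a, root s) \<or> (p, c) \<in> edges s" by auto
    then have "(p, c) \<in> edges s" using a[OF assms(2)] pc(2) by auto
    moreover from this have "s = t"
      using distinct_labels_children[OF d s(1) assms(2)] edges_labels pc(2) by blast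
    ultimately show "(p, c) \<in> edges t" by simp
  qed
  show "set (labels t) = {b. (root t, b) \<in> (edges (Node a ts))\<^sup>*}"
  proof (intro equalityI subsetI)
    fix b assume "b \<in> set (labels t)"
    then have "(root t, b) \<in> (edges t)\<^sup>*" by (rule labels_reachable)
    moreover have "edges t \<subseteq> edges (Node a ts)" using assms(2) by auto
    ultimately show "b \<in> {b. (root t, b) \<in> (edges (Node a ts))\<^sup>*}" using rtrancl_mono by blast
  next
    fix b assume "b \<in> {b. (root t, b) \<in> (edges (Node a ts))\<^sup>*}"
    then have "(root t, b) \<in> (edges (Node a ts))\<^sup>*" by simp
    then show "b \<in> set (labels t)"
    proof (induction rule: rtrancl_induct)
      case (step y z)
      then have "(y, z) \<in> edges t" using e by blast
      then show ?case using edges_labels by blast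
    qed simp
  qed
qed

text \<open>Siblings are listed by decreasing label, so the planar order carries no further
  information and the edge set determines the tree.\<close>

lemma tree_eqI:
  "heap t \<Longrightarrow> heap t' \<Longrightarrow> distinct (labels t) \<Longrightarrow> distinct (labels t') \<Longrightarrow> root t = root t' \<Longrightarrow>
     edges t = edges t' \<Longrightarrow> t = t'"
proof (induction t arbitrary: t')
  case (Node a ts)
  obtain us where t': "t' = Node a us" using Node.prems(5) by (cases t') simp
  let ?E = "edges (Node a ts)"
  have E: "edges (Node a us) = ?E" using Node.prems t' by simp
  have du: "distinct (labels (Node a us))" using Node.prems t' by simp
  have roots: "root ` set vs = {c. (a, c) \<in> edges (Node a vs)}" if "distinct (labels (Node a vs))" for vs
    using that edges_labels by fastforce
  have "set (map root ts) = set (map root us)"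
    using roots[OF Node.prems(3)] roots[OF du] E by (simp only: set_map)
  moreover have "sorted_wrt (<) (rev (map root ts))" "sorted_wrt (<) (rev (map root us))"
    using Node.prems(1,2) by (simp_all add: t' sorted_wrt_rev)
  ultimately have "rev (map root ts) = rev (map root us)"
    by (intro strict_sorted_equal) auto
  then have r: "map root ts = map root us" by simp
  have "ts = us"
  proof (rule nth_equalityI)
    show l: "length ts = length us" using r map_eq_imp_length_eq by blast
    fix i assume i: "i < length ts"
    let ?s = "ts ! i" and ?s' = "us ! i"
    have mem: "?s \<in> set ts" "?s' \<in> set us" using i l by auto
    have rr: "root ?s = root ?s'" using r i l by (metis nth_map)
    have "set (labels ?s) = set (labels ?s')"
      using child_edges(2)[OF Node.prems(3) mem(1)] child_edges(2)[OF du mem(2)] E rr by simp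
    then have "edges ?s = edges ?s'"
      using child_edges(1)[OF Node.prems(3) mem(1)] child_edges(1)[OF du mem(2)] unfolding E by simp
    moreover have "heap ?s" "heap ?s'" using Node.prems(1,2) mem t' by auto
    moreover have "distinct (labels ?s)" "distinct (labels ?s')"
      using Node.prems(3) du mem distinct_labels_child by auto
    ultimately show "?s = ?s'" using Node.IH[OF mem(1)] rr by blast
  qed
  then show ?case by (simp add: t')
qed

section \<open>Parent lists of heap-ordered trees\<close>

lemma tree_of_props:
  "heap (tree_of x)" "root (tree_of x) = 0" "distinct (labels (tree_of x))"
  "set (labels (tree_of x)) = {..tree_degree x}" "length (labels (tree_of x)) = Suc (tree_degree x)"
proof -
  show "heap (tree_of x)" "root (tree_of x) = 0" "distinct (labels (tree_of x))"
    using tree_of[of x] by auto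
  have s: "set (labels (tree_of x)) = {0..<length (labels (tree_of x))}" using tree_of[of x] by simp
  have "length (labels (tree_of x)) \<noteq> 0" by (cases "tree_of x") simp
  then show l: "length (labels (tree_of x)) = Suc (tree_degree x)" by (simp add: tree_degree_def)
  show "set (labels (tree_of x)) = {..tree_degree x}" using s unfolding l by (simp only: atLeast0LessThan lessThan_Suc_atMost)
qed

lemma tree_of_eq: "tree_of x = Node 0 (branches x)"
  using tree_of_props(2)[of x] by (cases "tree_of x") simp

lemma tree_of_Abs:
  assumes "heap t" "root t = 0" "distinct (labels t)" "set (labels t) = {..n}"
  shows "tree_of (Abs_ho_tree t) = t" "tree_degree (Abs_ho_tree t) = n"
proof -
  have l: "length (labels t) = Suc n" using assms(3,4) by (metis card_atMost distinct_card)
  have "set (labels t) = {0..<length (labels t)}"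
    unfolding l assms(4) by (simp only: atLeast0LessThan lessThan_Suc_atMost)
  then show "tree_of (Abs_ho_tree t) = t"
    by (intro Abs_ho_tree_inverse CollectI conjI assms)
  then show "tree_degree (Abs_ho_tree t) = n" by (simp add: tree_degree_def l)
qed

definition list_edges :: "nat list \<Rightarrow> (nat \<times> nat) set" where
  "list_edges l = (\<lambda>i. (l ! i, Suc i)) ` {..<length l}"

definition code :: "ho_tree \<Rightarrow> nat list" where
  "code x = map (\<lambda>i. THE p. (p, Suc i) \<in> edges (tree_of x)) [0..<tree_degree x]"

lemma length_code [simp]: "length (code x) = tree_degree x"
  by (simp add: code_def)

lemma code_edge: "i < tree_degree x \<Longrightarrow> (code x ! i, Suc i) \<in> edges (tree_of x)"
proof -
  assume i: "i < tree_degree x"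
  then have "Suc i \<in> set (labels (tree_of x))" by (simp add: tree_of_props)
  then obtain p where "(p, Suc i) \<in> edges (tree_of x)" using set_labels[of "tree_of x"] tree_of_props(2) by auto
  then have "(THE p. (p, Suc i) \<in> edges (tree_of x)) = p"
    using edges_parent_unique[OF tree_of_props(3)] by blast
  then show ?thesis using \<open>(p, Suc i) \<in> _\<close> i by (simp add: code_def)
qed

lemma edges_code: "edges (tree_of x) = list_edges (code x)"
proof (intro equalityI subsetI)
  fix e assume e: "e \<in> edges (tree_of x)"
  obtain p c where pc: "e = (p, c)" by (cases e)
  have "c \<in> set (labels (tree_of x))" using e pc edges_labels by blast
  then have c: "c \<le> tree_degree x" by (simp add: tree_of_props)
  have "p < c" using e pc heap_edges_less[OF tree_of_props(1)[of x], of p c] by simp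
  then have "c \<noteq> 0" by simp
  then obtain i where i: "c = Suc i" "i < tree_degree x" using c by (cases c) auto
  then have "p = code x ! i" using edges_parent_unique[OF tree_of_props(3)] code_edge e pc by blast
  then show "e \<in> list_edges (code x)" using i by (auto simp: list_edges_def pc)
qed (auto simp: list_edges_def code_edge)

lemma parent_list_code: "parent_list (code x)"
  unfolding parent_list_def using code_edge heap_edges_less[OF tree_of_props(1)] by fastforce

lemma list_edges_inject: "list_edges l = list_edges l' \<Longrightarrow> length l = length l' \<Longrightarrow> l = l'"
proof (rule nth_equalityI)
  fix i assume "list_edges l = list_edges l'" "length l = length l'" "i < length l"
  then have "(l ! i, Suc i) \<in> list_edges l'" unfolding list_edges_def by blast
  then show "l ! i = l' ! i" by (auto simp: list_edges_def)
qed auto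

lemma code_eqI: "edges (tree_of x) = list_edges l \<Longrightarrow> tree_degree x = length l \<Longrightarrow> code x = l"
  by (rule list_edges_inject) (simp_all add: edges_code)

lemma code_inject: "code x = code y \<Longrightarrow> x = y"
proof -
  assume "code x = code y"
  then have "edges (tree_of x) = edges (tree_of y)" by (simp add: edges_code)
  then have "tree_of x = tree_of y" using tree_of_props by (intro tree_eqI) auto
  then show ?thesis by (simp add: tree_of_inject)
qed

lemma list_edges_append:
  "list_edges (a @ b) = list_edges a \<union> (\<lambda>i. (b ! i, Suc (length a + i))) ` {..<length b}"
proof -
  have "{..<length a + length b} = {..<length a} \<union> (+) (length a) ` {..<length b}"
  proof (intro equalityI subsetI)
    fix i assume "i \<in> {..<length a + length b}"
    then show "i \<in> {..<length a} \<union> (+) (length a) ` {..<length b}"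
      by (cases "i < length a") (auto intro!: image_eqI[of _ _ "i - length a"])
  qed auto
  then show ?thesis unfolding list_edges_def length_append
    by (simp add: image_Un image_image nth_append)
qed

subsection \<open>Relabelling and grafting\<close>

lemma root_relabel [simp]: "root (relabel f t) = f (root t)"
  by (cases t) simp

lemma labels_relabel: "labels (relabel f t) = map f (labels t)"
  by (induction t) (auto simp: map_concat o_def intro!: arg_cong[of _ _ concat])

lemma edges_relabel: "edges (relabel f t) = map_prod f f ` edges t"
  by (induction t) (auto simp: image_UN)

lemma heap_relabel: "heap t \<Longrightarrow> strict_mono_on (set (labels t)) f \<Longrightarrow> heap (relabel f t)"
proof (induction t)
  case (Node a ts)
  have mono: "strict_mono_on (set (labels t)) f" if "t \<in> set ts" for t
    using Node.prems(2) that by (auto simp: strict_mono_on_def)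
  have less: "f x < f y" if "x < y" "x \<in> set (labels (Node a ts))" "y \<in> set (labels (Node a ts))" for x y
    using Node.prems(2) that by (simp add: strict_mono_on_def)
  have "root t \<in> set (labels (Node a ts))" if "t \<in> set ts" for t
    using that root_in_labels[of t] by (simp del: root_in_labels) blast
  then have r: "f (root t) < f (root t')" if "root t < root t'" "t \<in> set ts" "t' \<in> set ts" for t t'
    using that less by blast
  have "sorted_wrt (>) (map (\<lambda>t. f (root t)) ts)"
    using Node.prems(1) r by (auto simp: sorted_wrt_map intro: sorted_wrt_mono_rel[rotated])
  moreover have "f a < f (root t)" if "t \<in> set ts" for t
    using Node.prems(1) that less \<open>\<And>t. t \<in> set ts \<Longrightarrow> root t \<in> _\<close> by auto
  ultimately show ?case using Node.IH Node.prems(1) mono by (auto simp: o_def)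
qed

abbreviation attached :: "(nat \<Rightarrow> nat) \<Rightarrow> ltree list \<Rightarrow> nat \<Rightarrow> ltree list" where
  "attached f cs a \<equiv> map ((!) cs) (filter (\<lambda>i. f i = a) [0..<length cs])"

lemma graft_Node: "graft f cs (Node a ts) = Node a (attached f cs a @ map (graft f cs) ts)"
proof -
  have "concat (map (\<lambda>i. if f i = a then [cs ! i] else []) is) = map ((!) cs) (filter (\<lambda>i. f i = a) is)" for "is"
    by (induction "is") auto
  then show ?thesis by simp
qed

declare graft.simps [simp del] graft_Node [simp]

lemma root_graft [simp]: "root (graft f cs t) = root t"
  by (cases t) simp

lemma edges_graft:
  "edges (graft f cs t) = edges t \<union>
     (\<Union>i\<in>{i. i < length cs \<and> f i \<in> set (labels t)}. insert (f i, root (cs ! i)) (edges (cs ! i)))"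
  by (induction t) (auto simp del: labels.simps)

text \<open>Multisets record repetitions, so that distinctness of the labels after grafting can be
  read off.\<close>

lemma mset_labels_graft:
  "mset (labels (graft f cs t)) = mset (labels t) +
     (\<Sum>a\<in>#mset (labels t). mset (concat (map labels (attached f cs a))))"
proof (induction t)
  case (Node a ts)
  let ?g = "\<lambda>a. mset (concat (map labels (attached f cs a)))"
  have "mset (concat (map (labels \<circ> graft f cs) us)) = mset (concat (map labels us)) +
      (\<Sum>a\<in>#mset (concat (map labels us)). ?g a)" if "set us \<subseteq> set ts" for us
    using that
  proof (induction us)
    case (Cons u us)
    then have u: "u \<in> set ts" "set us \<subseteq> set ts" by auto
    show ?case using Cons.IH[OF u(2)] Node.IH[OF u(1)] by simp
  qed simp
  from this[of ts] show ?case by (simp add: ac_simps)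
qed

lemma labels_graft:
  assumes d: "distinct (labels t @ concat (map labels cs))" and f: "\<And>i. i < length cs \<Longrightarrow> f i \<in> set (labels t)"
  shows "distinct (labels (graft f cs t))"
    and "set (labels (graft f cs t)) = set (labels t) \<union> (\<Union>s\<in>set cs. set (labels s))"
proof -
  let ?A = "set (labels t)" and ?n = "length cs"
  have cs: "mset (concat (map labels ts)) = (\<Sum>t\<leftarrow>ts. mset (labels t))" for ts
    by (induction ts) auto
  have att: "mset (concat (map labels (attached f cs a))) = (\<Sum>i<?n. if f i = a then mset (labels (cs ! i)) else {#})" for a
  proof -
    have "mset (concat (map labels (attached f cs a))) = (\<Sum>i\<leftarrow>filter (\<lambda>i. f i = a) [0..<?n]. mset (labels (cs ! i)))"
      using cs[of "attached f cs a"] by (simp add: o_def del: mset_concat)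
    also have "\<dots> = (\<Sum>i\<leftarrow>[0..<?n]. if f i = a then mset (labels (cs ! i)) else {#})"
      by (rule sum_list_map_filter')
    finally show ?thesis by (simp add: interv_sum_list_conv_sum_set_nat atLeast0LessThan)
  qed
  have "mset (labels t) = mset_set ?A" using d by (simp add: mset_set_set)
  then have "(\<Sum>a\<in>#mset (labels t). mset (concat (map labels (attached f cs a)))) =
      (\<Sum>a\<in>?A. \<Sum>i<?n. if f i = a then mset (labels (cs ! i)) else {#})"
    unfolding att by (simp only: sum_unfold_sum_mset)
  also have "\<dots> = (\<Sum>i<?n. \<Sum>a\<in>?A. if f i = a then mset (labels (cs ! i)) else {#})"
    by (rule sum.swap)
  also have "\<dots> = (\<Sum>i<?n. mset (labels (cs ! i)))" using f by (intro sum.cong) auto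
  also have "\<dots> = mset (concat (map labels cs))"
    unfolding cs by (simp add: sum_list_sum_nth atLeast0LessThan)
  finally have m: "mset (labels (graft f cs t)) = mset (labels t @ concat (map labels cs))"
    unfolding mset_labels_graft by simp
  show "distinct (labels (graft f cs t))" using mset_eq_imp_distinct_iff[OF m] d by simp
  show "set (labels (graft f cs t)) = ?A \<union> (\<Union>s\<in>set cs. set (labels s))"
    using mset_eq_setD[OF m] by auto
qed

text \<open>Grafted trees have root labels above all labels of \<open>t\<close> and are placed to
  the left of the old children, so the labels of siblings still decrease.\<close>

lemma heap_graft:
  assumes "\<And>s. s \<in> set cs \<Longrightarrow> heap s" "sorted_wrt (>) (map root cs)"
  shows "heap t \<Longrightarrow> (\<And>s b. s \<in> set cs \<Longrightarrow> b \<in> set (labels t) \<Longrightarrow> b < root s) \<Longrightarrow> heap (graft f cs t)"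
proof (induction t)
  case (Node a ts)
  define A where "A = attached f cs a"
  define B where "B = map (graft f cs) ts"
  have att: "set A \<subseteq> set cs" by (auto simp: A_def)
  have "sorted_wrt (\<lambda>i j. root (cs ! i) > root (cs ! j)) [0..<length cs]"
    using assms(2) by (simp add: sorted_wrt_iff_nth_less)
  then have sA: "sorted_wrt (>) (map root A)"
    by (simp add: A_def sorted_wrt_map sorted_wrt_filter)
  have sB: "sorted_wrt (>) (map root B)"
    using Node.prems(1) by (simp add: B_def o_def)
  have hA: "a < root s \<and> heap s" if "s \<in> set A" for s
    using Node.prems(2)[of s a] att that assms(1) by auto
  have hB: "a < root t \<and> heap t" if "t \<in> set B" for t
  proof -
    obtain t' where t': "t' \<in> set ts" "t = graft f cs t'" using \<open>t \<in> set B\<close> by (auto simp: B_def)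
    have "heap (graft f cs t')"
    proof (rule Node.IH[OF t'(1)])
      show "heap t'" using Node.prems(1) t'(1) by simp
      show "b < root s" if "s \<in> set cs" "b \<in> set (labels t')" for s b
        using Node.prems(2)[OF that(1), of b] that(2) t'(1) unfolding set_labels_Node by blast
    qed
    then show ?thesis using Node.prems(1) t' by simp
  qed
  have AB: "root t < root s" if "s \<in> set A" "t \<in> set B" for s t
  proof -
    obtain t' where t': "t' \<in> set ts" "t = graft f cs t'" using \<open>t \<in> set B\<close> by (auto simp: B_def)
    have "root t' \<in> set (labels (Node a ts))" using t'(1) root_in_labels[of t'] unfolding set_labels_Node by blast
    then show ?thesis using Node.prems(2) att that(1) t'(2) by auto
  qed
  show ?case
    unfolding graft_Node A_def[symmetric] B_def[symmetric] heap.simps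
    using sA sB hA hB AB by (auto simp: sorted_wrt_append)
qed

text \<open>The last node has the largest label, so it is a leaf and the leftmost child of its
  parent; attaching it is a graft of a one-node tree.\<close>

lemma exists_code: "parent_list l \<Longrightarrow> \<exists>x. code x = l"
proof (induction l rule: parent_list_induct)
  case Nil
  have "tree_degree (Abs_ho_tree (Node 0 [])) = 0" by (rule tree_of_Abs) auto
  then show ?case by (intro exI[of _ "Abs_ho_tree (Node 0 [])"]) (simp add: code_def)
next
  case (snoc l p)
  then obtain x where x: "code x = l" by blast
  then have n: "tree_degree x = length l" by (metis length_code)
  let ?c = "[Node (Suc (length l)) []]"
  let ?t = "graft (\<lambda>_. p) ?c (tree_of x)"
  have d: "distinct (labels (tree_of x) @ concat (map labels ?c))"
    using tree_of_props[of x] n by simp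
  have p: "p \<in> set (labels (tree_of x))" using snoc(2) n tree_of_props[of x] by simp
  have "heap ?t" by (rule heap_graft) (use tree_of_props[of x] n in auto)
  moreover have "distinct (labels ?t)" by (rule labels_graft[OF d]) (rule p)
  moreover have "set (labels ?t) = {..Suc (length l)}"
    using labels_graft(2)[OF d, of "\<lambda>_. p"] p tree_of_props[of x] n by auto
  ultimately have "tree_of (Abs_ho_tree ?t) = ?t" "tree_degree (Abs_ho_tree ?t) = Suc (length l)"
    using tree_of_Abs[of ?t] tree_of_props[of x] by auto
  moreover have "edges ?t = list_edges (l @ [p])"
    using p by (simp add: edges_graft edges_code x list_edges_append lessThan_Suc)
  ultimately have "code (Abs_ho_tree ?t) = l @ [p]" by (intro code_eqI) auto
  then show ?case by blast
qed

definition decode :: "nat list \<Rightarrow> ho_tree" where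
  "decode = inv code"

lemma decode_code [simp]: "decode (code x) = x"
  unfolding decode_def by (rule inv_f_f) (auto simp: inj_def code_inject)

lemma code_decode: "parent_list l \<Longrightarrow> code (decode l) = l"
  using exists_code[of l] by auto

lemma decode_eqI: "edges (tree_of x) = list_edges l \<Longrightarrow> tree_degree x = length l \<Longrightarrow> decode l = x"
  using code_eqI by fastforce

subsection \<open>The branches at the root\<close>

lemma edges_branches:
  "edges (tree_of x) = (\<Union>i\<in>{..<length (branches x)}. insert (0, root (branches x ! i)) (edges (branches x ! i)))"
  by (subst tree_of_eq) (auto simp: set_conv_nth)

lemma branches_distinct: "distinct (concat (map labels (branches x)))" "0 \<notin> set (concat (map labels (branches x)))"
  using tree_of_props(3)[of x] by (subst (asm) tree_of_eq, simp)+

lemma branches_heap: "t \<in> set (branches x) \<Longrightarrow> heap t" "sorted_wrt (>) (map root (branches x))"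
proof -
  have "heap (Node 0 (branches x))" using tree_of_props(1)[of x] by (subst (asm) tree_of_eq)
  then show "t \<in> set (branches x) \<Longrightarrow> heap t" "sorted_wrt (>) (map root (branches x))"
    unfolding heap.simps by blast+
qed

lemma labels_branches: "(\<Union>t\<in>set (branches x). set (labels t)) = {1..tree_degree x}"
proof -
  have "insert 0 (\<Union>t\<in>set (branches x). set (labels t)) = {..tree_degree x}"
    using tree_of_props(4)[of x] by (subst (asm) tree_of_eq) (simp del: labels.simps)
  moreover have "0 \<notin> (\<Union>t\<in>set (branches x). set (labels t))" using branches_distinct(2)[of x] by simp
  ultimately have "(\<Union>t\<in>set (branches x). set (labels t)) = {..tree_degree x} - {0}" by blast
  also have "\<dots> = {1..tree_degree x}" by auto
  finally show ?thesis .
qed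

lemma labels_branch_bounds: "t \<in> set (branches x) \<Longrightarrow> c \<in> set (labels t) \<Longrightarrow> 0 < c \<and> c \<le> tree_degree x"
  using labels_branches[of x] by fastforce

lemma nth_code:
  assumes "(p, c) \<in> edges (tree_of x)"
  shows "code x ! (c - 1) = p" "0 < c" "c \<le> tree_degree x"
  using assms by (auto simp: edges_code list_edges_def)

lemma code_root_branch:
  "i < length (branches x) \<Longrightarrow> code x ! (root (branches x ! i) - 1) = 0"
  by (rule nth_code) (auto simp: edges_branches)

lemma branch_of_root_child:
  assumes "j < tree_degree x" "code x ! j = 0"
  shows "\<exists>i<length (branches x). root (branches x ! i) = Suc j"
proof -
  have "(0, Suc j) \<in> edges (tree_of x)" using code_edge[OF assms(1)] assms(2) by simp
  then obtain i where i: "i < length (branches x)"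
    and "(0, Suc j) = (0, root (branches x ! i)) \<or> (0, Suc j) \<in> edges (branches x ! i)"
    by (auto simp: edges_branches)
  then show ?thesis using edges_labels[of 0 "Suc j" "branches x ! i"] labels_branch_bounds[of "branches x ! i" x 0] nth_mem[OF i]
    by (intro exI[of _ i]) auto
qed

lemma branch_of_inner_child:
  assumes "j < tree_degree x" "code x ! j > 0"
  shows "\<exists>i<length (branches x). (code x ! j, Suc j) \<in> edges (branches x ! i)"
  using code_edge[OF assms(1)] assms(2) by (auto simp: edges_branches)

lemma branch_index_unique:
  assumes "i < length (branches x)" "j < length (branches x)"
    "c \<in> set (labels (branches x ! i))" "c \<in> set (labels (branches x ! j))"
  shows "i = j"
proof -
  have "branches x ! i = branches x ! j"
    using distinct_labels_children[OF branches_distinct(1)[of x]] assms by (meson nth_mem)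
  then have "map root (branches x) ! i = map root (branches x) ! j" using assms by simp
  moreover have "distinct (map root (branches x))"
  proof -
    have "sorted_wrt (>) ns \<Longrightarrow> distinct ns" for ns :: "nat list" by (induction ns) auto
    then show ?thesis using branches_heap(2) by blast
  qed
  ultimately show ?thesis using assms(1,2) by (metis length_map nth_eq_iff_index_eq)
qed

subsection \<open>Product and coproduct in terms of parent lists\<close>

lemma in_grafts_iff:
  "z \<in> grafts q l \<longleftrightarrow> length z = length l \<and> (\<forall>j<length l. if l ! j = 0 then z ! j \<le> q else z ! j = l ! j + q)"
  by (auto simp: grafts_def list_all2_conv_all_nth graft_choices_def split: if_splits)

text \<open>A branch is represented in \<open>z\<close> by the entry of its top node, at index root
  label minus one; all other entries of \<open>z\<close> are forced.\<close>

lemma ho_graft_eq: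
  assumes z: "z \<in> grafts (tree_degree y) (code x)"
    and f: "\<And>i. i < length (branches x) \<Longrightarrow> f i = z ! (root (branches x ! i) - 1)"
  shows "ho_graft f x y = decode (code y @ z)"
proof -
  let ?N = "tree_degree y" and ?p = "tree_degree x" and ?b = "branches x"
  let ?s = "\<lambda>a. a + ?N"
  let ?cs = "map (relabel ?s) ?b"
  let ?t = "graft f ?cs (tree_of y)"
  have N: "Max (set (labels (tree_of y))) = ?N"
    unfolding tree_of_props by (rule Max_eqI) auto
  have zl: "length z = ?p" and z0: "\<And>j. j < ?p \<Longrightarrow> code x ! j = 0 \<Longrightarrow> z ! j \<le> ?N"
    and z1: "\<And>j. j < ?p \<Longrightarrow> code x ! j > 0 \<Longrightarrow> z ! j = code x ! j + ?N"
    using z by (auto simp: in_grafts_iff)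
  have rb: "0 < root (?b ! i)" "root (?b ! i) \<le> ?p" if "i < length ?b" for i
    using labels_branch_bounds[OF nth_mem[OF that] root_in_labels] by auto
  have fN: "f i \<le> ?N" if "i < length ?b" for i
  proof -
    have "root (?b ! i) - 1 < ?p" using rb[OF that] by linarith
    then show ?thesis using f[OF that] z0 code_root_branch[OF that] by simp
  qed
  have lcs: "(\<Union>s\<in>set ?cs. set (labels s)) = {?N + 1..?N + ?p}"
  proof -
    have "(\<Union>s\<in>set ?cs. set (labels s)) = ?s ` (\<Union>t\<in>set ?b. set (labels t))"
      by (auto simp: labels_relabel)
    also have "\<dots> = {?N + 1..?N + ?p}" unfolding labels_branches by (simp add: image_add_atLeastAtMost add.commute[of _ ?N])
    finally show ?thesis .
  qed
  have ccs: "concat (map labels ?cs) = map ?s (concat (map labels ?b))"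
    by (simp add: map_concat o_def labels_relabel)
  have "distinct (concat (map labels ?cs))" unfolding ccs using branches_distinct(1)[of x] by (simp add: distinct_map)
  moreover have sc: "set (concat (map labels ?cs)) = {?N + 1..?N + ?p}" using lcs by simp
  have "set (labels (tree_of y)) \<inter> set (concat (map labels ?cs)) = {}"
    unfolding sc tree_of_props by auto
  ultimately have d: "distinct (labels (tree_of y) @ concat (map labels ?cs))"
    unfolding distinct_append using tree_of_props(3) by blast
  have fl: "f i \<in> set (labels (tree_of y))" if "i < length ?cs" for i
    using fN that by (simp add: tree_of_props)
  have "heap ?t"
  proof (rule heap_graft)
    show "heap s" if s: "s \<in> set ?cs" for s
    proof -
      obtain t where t: "t \<in> set ?b" "s = relabel ?s t" using s by auto
      show ?thesis unfolding t(2)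
        by (rule heap_relabel[OF branches_heap(1)[OF t(1)]]) (simp add: strict_mono_on_def)
    qed
    show "sorted_wrt (>) (map root ?cs)" using branches_heap(2)[of x] by (simp add: o_def sorted_wrt_map)
    show "heap (tree_of y)" by (rule tree_of_props)
    show "b < root s" if "s \<in> set ?cs" "b \<in> set (labels (tree_of y))" for s b
    proof -
      have "root s \<in> {?N + 1..?N + ?p}" using that(1) lcs root_in_labels by blast
      then show ?thesis using that(2) by (simp add: tree_of_props)
    qed
  qed
  moreover have "distinct (labels ?t)" by (rule labels_graft[OF d fl])
  moreover have "set (labels ?t) = {..?N + ?p}"
    using labels_graft(2)[OF d fl] unfolding lcs tree_of_props by auto
  ultimately have t: "tree_of (Abs_ho_tree ?t) = ?t" "tree_degree (Abs_ho_tree ?t) = ?N + ?p"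
    using tree_of_Abs[of ?t] tree_of_props(2)[of y] by auto
  have et: "edges ?t = edges (tree_of y) \<union>
      (\<Union>i\<in>{..<length ?b}. insert (f i, ?s (root (?b ! i))) (map_prod ?s ?s ` edges (?b ! i)))"
  proof -
    have S: "{i. i < length ?cs \<and> f i \<in> set (labels (tree_of y))} = {..<length ?b}" using fl by auto
    have "(\<Union>i\<in>{..<length ?b}. insert (f i, root (?cs ! i)) (edges (?cs ! i))) =
        (\<Union>i\<in>{..<length ?b}. insert (f i, ?s (root (?b ! i))) (map_prod ?s ?s ` edges (?b ! i)))"
      by (rule SUP_cong[OF refl]) (simp add: edges_relabel)
    then show ?thesis unfolding edges_graft S by (rule arg_cong)
  qed
  have U: "(\<Union>i\<in>{..<length ?b}. insert (f i, ?s (root (?b ! i))) (map_prod ?s ?s ` edges (?b ! i))) =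
      (\<lambda>j. (z ! j, Suc (?N + j))) ` {..<?p}"
  proof (intro equalityI subsetI)
    fix e assume "e \<in> (\<Union>i\<in>{..<length ?b}. insert (f i, ?s (root (?b ! i))) (map_prod ?s ?s ` edges (?b ! i)))"
    then obtain i where "i \<in> {..<length ?b}" and ie: "e \<in> insert (f i, ?s (root (?b ! i))) (map_prod ?s ?s ` edges (?b ! i))"
      by (rule UN_E)
    then have i: "i < length ?b" by simp
    from ie consider "e = (f i, ?s (root (?b ! i)))" | ac where "ac \<in> edges (?b ! i)" "e = map_prod ?s ?s ac"
      by (elim insertE imageE)
    then show "e \<in> (\<lambda>j. (z ! j, Suc (?N + j))) ` {..<?p}"
    proof cases
      case 1
      then show ?thesis using f[OF i] rb[OF i] by (intro image_eqI[of _ _ "root (?b ! i) - 1"]) auto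
    next
      case (2 ac)
      obtain a c where ac: "ac = (a, c)" by (cases ac)
      note 2 = 2[unfolded ac]
      have "(a, c) \<in> edges (tree_of x)" unfolding edges_branches using i 2(1) by blast
      note nc = nth_code[OF this]
      have "a > 0" using edges_labels[OF 2(1)] labels_branch_bounds[OF nth_mem[OF i]] by blast
      moreover have "c - 1 < ?p" using nc by linarith
      ultimately have "z ! (c - 1) = a + ?N" using z1[of "c - 1"] nc by simp
      then show ?thesis using 2(2) nc by (intro image_eqI[of _ _ "c - 1"]) auto
    qed
  next
    fix e assume "e \<in> (\<lambda>j. (z ! j, Suc (?N + j))) ` {..<?p}"
    then obtain j where j: "j < ?p" "e = (z ! j, Suc (?N + j))" by auto
    show "e \<in> (\<Union>i\<in>{..<length ?b}. insert (f i, ?s (root (?b ! i))) (map_prod ?s ?s ` edges (?b ! i)))"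
    proof (cases "code x ! j = 0")
      case True
      then obtain i where i: "i < length ?b" "root (?b ! i) = Suc j" using branch_of_root_child[OF j(1)] by blast
      then have "e = (f i, ?s (root (?b ! i)))" using f[OF i(1)] j by simp
      then show ?thesis using i by blast
    next
      case False
      then obtain i where i: "i < length ?b" "(code x ! j, Suc j) \<in> edges (?b ! i)"
        using branch_of_inner_child[OF j(1)] by auto
      have "e = map_prod ?s ?s (code x ! j, Suc j)" using z1[OF j(1)] False j by simp
      then show ?thesis using i by blast
    qed
  qed
  have "edges ?t = list_edges (code y @ z)"
    unfolding et U list_edges_append edges_code[symmetric] by (simp add: zl)
  then have "decode (code y @ z) = Abs_ho_tree ?t" by (intro decode_eqI) (simp_all add: t zl)
  then show ?thesis by (simp add: ho_graft_def N)
qed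

text \<open>The free entries of a graft word are those of the top nodes of the branches, so graft
  words correspond to functions from branches to nodes.\<close>

lemma T_mult_eq: "T_mult x y = (\<Sum>z\<in>grafts (tree_degree y) (code x). bas (decode (code y @ z)))"
proof -
  let ?N = "tree_degree y" and ?b = "branches x"
  let ?P = "{..<length ?b} \<rightarrow>\<^sub>E set (labels (tree_of y))"
  define g where "g = (\<lambda>z. restrict (\<lambda>i. z ! (root (?b ! i) - 1) :: nat) {..<length ?b})"
  have rb: "0 < root (?b ! i)" "root (?b ! i) - 1 < tree_degree x" if "i < length ?b" for i
    using labels_branch_bounds[OF nth_mem[OF that] root_in_labels] by auto
  have "bij_betw g (grafts ?N (code x)) ?P"
  proof (rule bij_betw_imageI)
    show "inj_on g (grafts ?N (code x))"
    proof (rule inj_onI)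
      fix z z' assume z: "z \<in> grafts ?N (code x)" "z' \<in> grafts ?N (code x)" "g z = g z'"
      show "z = z'"
      proof (rule nth_equalityI)
        show "length z = length z'" using z by (simp add: in_grafts_iff)
        fix j assume "j < length z"
        then have j: "j < tree_degree x" using z by (simp add: in_grafts_iff)
        show "z ! j = z' ! j"
        proof (cases "code x ! j = 0")
          case True
          then obtain i where i: "i < length ?b" "root (?b ! i) = Suc j" using branch_of_root_child[OF j] by blast
          then show ?thesis using fun_cong[OF z(3), of i] by (simp add: g_def)
        next
          case False
          then show ?thesis using z j by (simp add: in_grafts_iff)
        qed
      qed
    qed
    show "g ` grafts ?N (code x) = ?P"
    proof (intro equalityI subsetI)
      fix f assume "f \<in> g ` grafts ?N (code x)"
      then obtain z where z: "z \<in> grafts ?N (code x)" "f = g z" by blast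
      have "z ! (root (?b ! i) - 1) \<le> ?N" if "i < length ?b" for i
        using z(1) rb[OF that] code_root_branch[OF that] by (simp add: in_grafts_iff)
      then show "f \<in> ?P" by (auto simp: z(2) g_def tree_of_props)
    next
      fix f assume f: "f \<in> ?P"
      \<comment> \<open>The inverse of \<open>g\<close>: an entry with parent 0 belongs to the
        unique branch whose root has label \<open>Suc j\<close>, and takes the target of that
        branch.\<close>
      define z where "z = map (\<lambda>j. if code x ! j = 0 then f (THE i. i < length ?b \<and> root (?b ! i) = Suc j)
          else code x ! j + ?N) [0..<tree_degree x]"
      have the: "(THE i. i < length ?b \<and> root (?b ! i) = Suc j) = i" if "i < length ?b" "root (?b ! i) = Suc j" for i j
        using that branch_index_unique by (intro the_equality) (auto, metis root_in_labels)
      have fN: "f i \<le> ?N" if "i < length ?b" for i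
        using PiE_mem[OF f, of i] that by (simp add: tree_of_props)
      have "z \<in> grafts ?N (code x)"
        unfolding in_grafts_iff
      proof (intro conjI allI impI)
        fix j assume "j < length (code x)"
        then have j: "j < tree_degree x" by simp
        show "if code x ! j = 0 then z ! j \<le> ?N else z ! j = code x ! j + ?N"
        proof (cases "code x ! j = 0")
          case True
          then obtain i where i: "i < length ?b" "root (?b ! i) = Suc j" using branch_of_root_child[OF j] by blast
          then show ?thesis using True j fN the[OF i] by (simp add: z_def)
        qed (simp add: z_def j)
      qed (simp add: z_def)
      moreover have "f = g z"
      proof
        fix i
        show "f i = g z i"
        proof (cases "i < length ?b")
          case True
          have "Suc (root (?b ! i) - 1) = root (?b ! i)" using rb[OF True] by simp
          then show ?thesis
            using True rb[OF True] code_root_branch[OF True] the[of i "root (?b ! i) - 1"]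
            by (simp add: g_def z_def)
        next
          case False
          then show ?thesis using PiE_arb[OF f, of i] by (simp add: g_def)
        qed
      qed
      ultimately show "f \<in> g ` grafts ?N (code x)" by blast
    qed
  qed
  then have "T_mult x y = (\<Sum>z\<in>grafts ?N (code x). bas (ho_graft (g z) x y))"
    unfolding T_mult_def by (rule sum.reindex_bij_betw[symmetric])
  also have "\<dots> = (\<Sum>z\<in>grafts ?N (code x). bas (decode (code y @ z)))"
    by (intro sum.cong refl) (simp add: ho_graft_eq g_def)
  finally show ?thesis .
qed

lemma list_edges_restrict_list:
  "parent_list x \<Longrightarrow> length \<chi> = length x \<Longrightarrow>
    list_edges (restrict_list x \<chi>) = (\<lambda>i. (count_true \<chi> (x ! i), Suc (count_true \<chi> i))) ` {i. i < length x \<and> \<chi> ! i}"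
proof (induction x arbitrary: \<chi> rule: parent_list_induct)
  case (snoc x p)
  then obtain \<chi>' b where \<chi>: "\<chi> = \<chi>' @ [b]" "length \<chi>' = length x" by (cases \<chi> rule: rev_cases) auto
  have le: "x ! i \<le> length \<chi>'" if "i < length x" for i
    using snoc(1) that \<chi>(2) by (fastforce simp: parent_list_def)
  have set: "{i. i < length (x @ [p]) \<and> \<chi> ! i} = {i. i < length x \<and> \<chi>' ! i} \<union> (if b then {length x} else {})"
    using \<chi> by (auto simp: nth_append less_Suc_eq)
  have "(\<lambda>i. (count_true \<chi> ((x @ [p]) ! i), Suc (count_true \<chi> i))) ` {i. i < length x \<and> \<chi>' ! i} =
      (\<lambda>i. (count_true \<chi>' (x ! i), Suc (count_true \<chi>' i))) ` {i. i < length x \<and> \<chi>' ! i}"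
    using le \<chi> by (intro image_cong) (auto simp: nth_append count_true_append)
  then have "(\<lambda>i. (count_true \<chi> ((x @ [p]) ! i), Suc (count_true \<chi> i))) ` {i. i < length (x @ [p]) \<and> \<chi> ! i} =
      list_edges (restrict_list x \<chi>') \<union> (if b then {(count_true \<chi>' p, Suc (count_true \<chi>' (length x)))} else {})"
    unfolding set image_Un using snoc.IH[OF \<chi>(2)] \<chi> snoc(2) by (auto simp: count_true_append)
  moreover have "list_edges (restrict_list (x @ [p]) \<chi>) =
      list_edges (restrict_list x \<chi>') \<union> (if b then {(count_true \<chi>' p, Suc (count_true \<chi>' (length x)))} else {})"
    using restrict_list_snoc[OF snoc(1) \<chi>(2) snoc(2), of b] length_restrict_list[OF \<chi>(2)] \<chi>
    by (simp add: list_edges_append lessThan_Suc)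
  ultimately show ?case by simp
qed (simp add: list_edges_def)

lemma distinct_concat_nths: "distinct (concat xss) \<Longrightarrow> distinct (concat (nths xss S))"
proof (induction xss arbitrary: S)
  case (Cons xs xss)
  have "set (concat (nths xss S)) \<subseteq> set (concat xss)" for S using set_nths_subset[of xss S] by auto
  then show ?case using Cons by (fastforce simp: nths_Cons)
qed simp

lemma sorted_wrt_nths: "sorted_wrt P xs \<Longrightarrow> sorted_wrt P (nths xs S)"
proof (induction xs arbitrary: S)
  case (Cons x xs)
  then show ?case using set_nths_subset[of xs] by (auto simp: nths_Cons)
qed simp

definition branch_labels :: "ho_tree \<Rightarrow> nat set \<Rightarrow> nat set" where
  "branch_labels x S = (\<Union>i\<in>{i. i < length (branches x) \<and> i \<in> S}. set (labels (branches x ! i)))"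

definition branch_coloring :: "ho_tree \<Rightarrow> nat set \<Rightarrow> bool list" where
  "branch_coloring x S = map (\<lambda>i. Suc i \<in> branch_labels x S) [0..<tree_degree x]"

lemma branch_labels_bounds: "b \<in> branch_labels x S \<Longrightarrow> 0 < b \<and> b \<le> tree_degree x"
  unfolding branch_labels_def using labels_branch_bounds nth_mem by blast

lemma finite_branch_labels [simp]: "finite (branch_labels x S)"
  by (simp add: branch_labels_def)

lemma length_branch_coloring [simp]: "length (branch_coloring x S) = tree_degree x"
  by (simp add: branch_coloring_def)

lemma nth_branch_coloring: "i < tree_degree x \<Longrightarrow> branch_coloring x S ! i \<longleftrightarrow> Suc i \<in> branch_labels x S"
  by (simp add: branch_coloring_def)

lemma in_branch_labels_iff:
  "l < length (branches x) \<Longrightarrow> c \<in> set (labels (branches x ! l)) \<Longrightarrow> c \<in> branch_labels x S \<longleftrightarrow> l \<in> S"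
  unfolding branch_labels_def using branch_index_unique by blast

lemma label_in_branch: "0 < c \<Longrightarrow> c \<le> tree_degree x \<Longrightarrow> \<exists>l<length (branches x). c \<in> set (labels (branches x ! l))"
proof -
  assume "0 < c" "c \<le> tree_degree x"
  then have "c \<in> (\<Union>t\<in>set (branches x). set (labels t))" unfolding labels_branches by simp
  then obtain t where "t \<in> set (branches x)" "c \<in> set (labels t)" by blast
  then show ?thesis by (metis in_set_conv_nth)
qed

lemma count_true_branch_coloring:
  "m \<le> tree_degree x \<Longrightarrow> count_true (branch_coloring x S) m = card {b \<in> branch_labels x S. b \<le> m}"
proof -
  assume m: "m \<le> tree_degree x"
  have "count_true (branch_coloring x S) m = length (filter (\<lambda>i. Suc i \<in> branch_labels x S) [0..<m])"
    using m by (simp add: count_true_def branch_coloring_def take_map filter_map o_def)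
  also have "\<dots> = card {i. i < m \<and> Suc i \<in> branch_labels x S}"
    by (simp add: distinct_length_filter Int_def conj_commute)
  also have "\<dots> = card (Suc ` {i. i < m \<and> Suc i \<in> branch_labels x S})" by (simp add: card_image)
  also have "Suc ` {i. i < m \<and> Suc i \<in> branch_labels x S} = {b \<in> branch_labels x S. b \<le> m}"
  proof (intro equalityI subsetI)
    fix b assume b: "b \<in> {b \<in> branch_labels x S. b \<le> m}"
    then obtain i where "b = Suc i" using branch_labels_bounds[of b x S] by (cases b) auto
    then show "b \<in> Suc ` {i. i < m \<and> Suc i \<in> branch_labels x S}" using b by auto
  qed auto
  finally show ?thesis .
qed

text \<open>The new label of a kept node \<open>a\<close> counts the root and the smaller kept
  labels, which is the number of kept non-root labels up to and including \<open>a\<close>, hence a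
  value of \<open>count_true\<close>.\<close>

lemma ho_restrict_eq: "ho_restrict x S = decode (restrict_list (code x) (branch_coloring x S))"
proof -
  let ?b = "branches x" and ?L = "branch_labels x S" and ?\<chi> = "branch_coloring x S"
  define t where "t = Node 0 (nths ?b S)"
  define g where "g = (\<lambda>a. card {b \<in> set (labels t). b < a})"
  have setn: "set (nths ?b S) = {?b ! i | i. i < length ?b \<and> i \<in> S}" by (rule set_nths)
  then have L: "(\<Union>t\<in>set (nths ?b S). set (labels t)) = ?L" by (auto simp: branch_labels_def)
  have lt: "set (labels t) = insert 0 ?L" unfolding t_def set_labels_Node L ..
  have L0: "0 \<notin> ?L" using branch_labels_bounds by blast
  have "map labels (nths ?b S) = nths (map labels ?b) S" by (simp add: nths_map)
  then have "distinct (concat (map labels (nths ?b S)))"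
    using distinct_concat_nths[OF branches_distinct(1)[of x], of S] by simp
  moreover have "0 \<notin> set (concat (map labels (nths ?b S)))" using L L0 by simp
  ultimately have dt: "distinct (labels t)" by (simp add: t_def)
  have "heap u \<and> 0 < root u" if "u \<in> set (nths ?b S)" for u
    using that set_nths_subset[of ?b S] branches_heap(1)[of u x] labels_branch_bounds[of u x "root u"] by auto
  moreover have "sorted_wrt (>) (map root (nths ?b S))"
    using sorted_wrt_nths[OF branches_heap(2)[of x], of S] by (simp add: nths_map)
  ultimately have ht: "heap t" by (simp add: t_def)
  have fin: "finite (set (labels t))" by simp
  have mono: "strict_mono_on (set (labels t)) g"
  proof (rule strict_mono_onI)
    fix a a' assume a: "a \<in> set (labels t)" "a' \<in> set (labels t)" "a < a'"
    have "{b \<in> set (labels t). b < a} \<subseteq> {b \<in> set (labels t). b < a'}" using a(3) by auto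
    moreover have "a \<in> {b \<in> set (labels t). b < a'}" "a \<notin> {b \<in> set (labels t). b < a}" using a by auto
    ultimately have "{b \<in> set (labels t). b < a} \<subset> {b \<in> set (labels t). b < a'}" by blast
    then show "g a < g a'" unfolding g_def by (intro psubset_card_mono) auto
  qed
  have g: "g a = card {b \<in> ?L. b \<le> a}" if "a \<in> insert 0 ?L" for a
  proof (cases "a = 0")
    case True
    then have "{b \<in> ?L. b \<le> a} = {}" using L0 by auto
    then show ?thesis using True by (simp only: g_def) simp
  next
    case False
    then have "{b \<in> ?L. b \<le> a} = insert a {b \<in> ?L. b < a}" using that by auto
    moreover have "{b \<in> set (labels t). b < a} = insert 0 {b \<in> ?L. b < a}" unfolding lt using False by auto
    ultimately show ?thesis using L0 by (simp add: g_def)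
  qed
  have gc: "g a = count_true ?\<chi> a" if "a \<in> insert 0 ?L" for a
    using g[OF that] that branch_labels_bounds[of a x S] by (subst count_true_branch_coloring) auto
  have gS: "g (Suc i) = Suc (count_true ?\<chi> i)" if "Suc i \<in> ?L" for i
  proof -
    have i: "i < tree_degree x" using branch_labels_bounds[OF that] by simp
    have "{b \<in> ?L. b \<le> Suc i} = insert (Suc i) {b \<in> ?L. b \<le> i}" using that by (auto simp: le_Suc_eq)
    then have "g (Suc i) = Suc (card {b \<in> ?L. b \<le> i})" using g that by simp
    then show ?thesis using i by (simp add: count_true_branch_coloring)
  qed
  let ?t = "relabel g t"
  have g0: "g 0 = 0" using gc[of 0] by simp
  have card_lt: "card (set (labels t)) = Suc (card ?L)" unfolding lt using L0 by simp
  have "g ` set (labels t) = {..card ?L}"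
  proof (rule card_subset_eq)
    show "g ` set (labels t) \<subseteq> {..card ?L}"
      unfolding lt using g by (auto intro!: card_mono)
    show "card (g ` set (labels t)) = card {..card ?L}"
      using strict_mono_on_imp_inj_on[OF mono] card_lt by (simp add: card_image)
  qed simp
  then have "set (labels ?t) = {..card ?L}" by (simp add: labels_relabel)
  moreover have "distinct (labels ?t)"
    using dt strict_mono_on_imp_inj_on[OF mono] by (simp add: labels_relabel distinct_map)
  moreover have "heap ?t" by (rule heap_relabel[OF ht mono])
  moreover have "root ?t = 0" by (simp add: t_def g0)
  ultimately have T: "tree_of (Abs_ho_tree ?t) = ?t" "tree_degree (Abs_ho_tree ?t) = card ?L"
    using tree_of_Abs[of ?t "card ?L"] by auto
  have et: "edges t = {(a, b) \<in> edges (tree_of x). b \<in> ?L}"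
  proof (intro equalityI subsetI; clarify)
    fix a b assume "(a, b) \<in> edges t"
    then obtain i where i: "i < length ?b" "i \<in> S" "(a, b) \<in> insert (0, root (?b ! i)) (edges (?b ! i))"
      by (auto simp: t_def setn)
    then have "b \<in> set (labels (?b ! i))" by (metis insertE prod.inject edges_labels root_in_labels)
    then have "b \<in> ?L" using i in_branch_labels_iff by blast
    then show "(a, b) \<in> edges (tree_of x) \<and> b \<in> ?L" using i by (auto simp: edges_branches)
  next
    fix a b assume ab: "(a, b) \<in> edges (tree_of x)" "b \<in> ?L"
    then obtain i where i: "i < length ?b" "(a, b) \<in> insert (0, root (?b ! i)) (edges (?b ! i))"
      by (auto simp: edges_branches)
    then have "b \<in> set (labels (?b ! i))" by (metis insertE prod.inject edges_labels root_in_labels)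
    then have "i \<in> S" using ab(2) i in_branch_labels_iff by blast
    then show "(a, b) \<in> edges t" using i unfolding t_def edges_Node setn by blast
  qed
  have et': "edges t = (\<lambda>i. (code x ! i, Suc i)) ` {i. i < tree_degree x \<and> ?\<chi> ! i}"
    unfolding et edges_code list_edges_def by (auto simp: nth_branch_coloring)
  have "edges ?t = (\<lambda>i. (count_true ?\<chi> (code x ! i), Suc (count_true ?\<chi> i))) ` {i. i < tree_degree x \<and> ?\<chi> ! i}"
    unfolding edges_relabel et' image_image
  proof (rule image_cong[OF refl])
    fix i assume i: "i \<in> {i. i < tree_degree x \<and> ?\<chi> ! i}"
    then have "(code x ! i, Suc i) \<in> edges t" unfolding et' by blast
    then have "code x ! i \<in> insert 0 ?L" "Suc i \<in> ?L" using edges_labels[of "code x ! i" "Suc i" t] lt by auto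
    then show "map_prod g g (code x ! i, Suc i) = (count_true ?\<chi> (code x ! i), Suc (count_true ?\<chi> i))"
      using gc gS by simp
  qed
  also have "\<dots> = list_edges (restrict_list (code x) ?\<chi>)"
    using list_edges_restrict_list[OF parent_list_code, of ?\<chi> x] by simp
  finally have "edges ?t = list_edges (restrict_list (code x) ?\<chi>)" .
  moreover have "card ?L = length (restrict_list (code x) ?\<chi>)"
  proof -
    have "{b \<in> ?L. b \<le> tree_degree x} = ?L" using branch_labels_bounds by blast
    then show ?thesis by (simp add: length_restrict_list count_true_branch_coloring)
  qed
  ultimately have "decode (restrict_list (code x) ?\<chi>) = Abs_ho_tree ?t"
    by (intro decode_eqI) (simp_all add: T)
  then show ?thesis by (simp add: ho_restrict_def t_def g_def Let_def)
qed

text \<open>Sets of branches correspond to colorings, and complementary sets to complementary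
  colorings.\<close>

lemma T_comult_eq:
  "T_comult x = (\<Sum>\<chi>\<in>colorings (code x).
     bas [bas (decode (restrict_list (code x) \<chi>)), bas (decode (restrict_list (code x) (compl_list \<chi>)))])"
proof -
  let ?b = "branches x" and ?n = "tree_degree x"
  let ?\<chi> = "branch_coloring x"
  have bl: "?\<chi> S ! (c - 1) \<longleftrightarrow> l \<in> S" if "l < length ?b" "c \<in> set (labels (?b ! l))" for l c S
  proof -
    have c: "0 < c" "c \<le> ?n" using labels_branch_bounds[OF nth_mem[OF that(1)] that(2)] by auto
    then have "c - 1 < ?n" by linarith
    then show ?thesis using nth_branch_coloring[of "c - 1" x S] in_branch_labels_iff[OF that, of S] c by simp
  qed
  have compl: "?\<chi> ({..<length ?b} - S) = compl_list (?\<chi> S)" for S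
  proof (rule nth_equalityI)
    fix i assume "i < length (?\<chi> ({..<length ?b} - S))"
    then have i: "i < ?n" by simp
    obtain l where l: "l < length ?b" "Suc i \<in> set (labels (?b ! l))" using label_in_branch[of "Suc i" x] i by auto
    show "?\<chi> ({..<length ?b} - S) ! i = compl_list (?\<chi> S) ! i"
      using bl[OF l] i l by simp
  qed simp
  have "bij_betw ?\<chi> (Pow {..<length ?b}) (colorings (code x))"
  proof (rule bij_betw_imageI)
    show "inj_on ?\<chi> (Pow {..<length ?b})"
    proof (rule inj_onI)
      fix S S' assume S: "S \<in> Pow {..<length ?b}" "S' \<in> Pow {..<length ?b}" "?\<chi> S = ?\<chi> S'"
      have "l \<in> S \<longleftrightarrow> l \<in> S'" if "l < length ?b" for l
        using bl[OF that root_in_labels, of S] bl[OF that root_in_labels, of S'] S(3) by simp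
      then show "S = S'" using S by blast
    qed
    show "?\<chi> ` Pow {..<length ?b} = colorings (code x)"
    proof (intro equalityI subsetI)
      fix \<chi> assume "\<chi> \<in> ?\<chi> ` Pow {..<length ?b}"
      then obtain S where \<chi>: "\<chi> = ?\<chi> S" by blast
      show "\<chi> \<in> colorings (code x)"
        unfolding colorings_def
      proof (intro CollectI conjI allI impI)
        show "length \<chi> = length (code x)" by (simp add: \<chi>)
        fix i assume "i < length (code x)" "0 < code x ! i"
        then obtain l where l: "l < length ?b" "(code x ! i, Suc i) \<in> edges (?b ! l)"
          using branch_of_inner_child[of i x] by auto
        then show "\<chi> ! i = \<chi> ! (code x ! i - 1)"
          using bl[of l "Suc i" S] bl[of l "code x ! i" S] edges_labels[OF l(2)] by (simp add: \<chi>)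
      qed
    next
      fix \<chi> :: "bool list" assume \<chi>: "\<chi> \<in> colorings (code x)"
      define S where "S = {l. l < length ?b \<and> \<chi> ! (root (?b ! l) - 1)}"
      \<comment> \<open>A coloring agrees on a node and its non-root parent, so following parents
        upwards carries the color of any node to the top of its branch.\<close>
      have const: "\<chi> ! (c - 1) = \<chi> ! (root (?b ! l) - 1)" if l: "l < length ?b" and c: "c \<in> set (labels (?b ! l))" for l c
        using c
      proof (induction c rule: less_induct)
        case (less c)
        show ?case
        proof (cases "c = root (?b ! l)")
          case False
          then obtain a where a: "(a, c) \<in> edges (?b ! l)" using set_labels[of "?b ! l"] less.prems by auto
          then have "(a, c) \<in> edges (tree_of x)" using l by (auto simp: edges_branches)
          note nc = nth_code[OF this]
          have al: "a \<in> set (labels (?b ! l))" using edges_labels[OF a] by blast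
          then have a0: "0 < a" using labels_branch_bounds[OF nth_mem[OF l]] by blast
          have "a < c" by (rule heap_edges_less[OF branches_heap(1)[OF nth_mem[OF l]] a])
          then have "\<chi> ! (a - 1) = \<chi> ! (root (?b ! l) - 1)" using less.IH al by blast
          moreover have "\<chi> ! (c - 1) = \<chi> ! (a - 1)"
          proof -
            have "c - 1 < length (code x)" using nc by simp
            then show ?thesis using \<chi> nc(1) a0 unfolding colorings_def by blast
          qed
          ultimately show ?thesis by simp
        qed simp
      qed
      have "\<chi> = ?\<chi> S"
      proof (rule nth_equalityI)
        show "length \<chi> = length (?\<chi> S)" using length_colorings[OF \<chi>] by simp
        fix i assume "i < length \<chi>"
        then have i: "i < ?n" using length_colorings[OF \<chi>] by simp
        obtain l where l: "l < length ?b" "Suc i \<in> set (labels (?b ! l))" using label_in_branch[of "Suc i" x] i by auto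
        show "\<chi> ! i = ?\<chi> S ! i" using bl[OF l, of S] const[OF l] l by (simp add: S_def)
      qed
      moreover have "S \<in> Pow {..<length ?b}" by (auto simp: S_def)
      ultimately show "\<chi> \<in> ?\<chi> ` Pow {..<length ?b}" by blast
    qed
  qed
  then have "(\<Sum>\<chi>\<in>colorings (code x).
     bas [bas (decode (restrict_list (code x) \<chi>)), bas (decode (restrict_list (code x) (compl_list \<chi>)))]) =
    (\<Sum>S\<in>Pow {..<length ?b}. bas [bas (decode (restrict_list (code x) (?\<chi> S))),
        bas (decode (restrict_list (code x) (compl_list (?\<chi> S))))])"
    by (rule sum.reindex_bij_betw[symmetric])
  then show ?thesis unfolding T_comult_def ho_restrict_eq compl by (rule sym)
qed

section \<open>The bijection from permutations to trees\<close>

text \<open>In the preorder reading of a heap-ordered tree the parent of a node is the last smaller label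
  before it.\<close>

definition preorder_edges :: "nat list \<Rightarrow> (nat \<times> nat) set" where
  "preorder_edges L = {(p, c). \<exists>xs zs. L = xs @ c # zs \<and> filter (\<lambda>y. y < c) xs \<noteq> [] \<and> p = last (filter (\<lambda>y. y < c) xs)}"

lemma preorder_edges_Nil [simp]: "preorder_edges [] = {}"
  by (simp add: preorder_edges_def)

lemma preorder_edges_snoc:
  "preorder_edges (L @ [c]) = preorder_edges L \<union>
     (if filter (\<lambda>y. y < c) L = [] then {} else {(last (filter (\<lambda>y. y < c) L), c)})"
proof (intro equalityI subsetI)
  fix e assume "e \<in> preorder_edges (L @ [c])"
  then obtain p d xs zs where e: "e = (p, d)" "L @ [c] = xs @ d # zs" "filter (\<lambda>y. y < d) xs \<noteq> []"
    "p = last (filter (\<lambda>y. y < d) xs)" by (auto simp: preorder_edges_def)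
  then show "e \<in> preorder_edges L \<union> (if filter (\<lambda>y. y < c) L = [] then {} else {(last (filter (\<lambda>y. y < c) L), c)})"
  proof (cases zs rule: rev_cases)
    case Nil
    then show ?thesis using e by simp
  next
    case (snoc zs' z)
    then have "L = xs @ d # zs'" using e(2) by (metis append.assoc append_Cons butlast_snoc)
    then show ?thesis using e unfolding preorder_edges_def by blast
  qed
next
  fix e assume "e \<in> preorder_edges L \<union> (if filter (\<lambda>y. y < c) L = [] then {} else {(last (filter (\<lambda>y. y < c) L), c)})"
  then consider "e \<in> preorder_edges L" | "filter (\<lambda>y. y < c) L \<noteq> []" "e = (last (filter (\<lambda>y. y < c) L), c)"
    by (auto split: if_splits)
  then show "e \<in> preorder_edges (L @ [c])"
  proof cases
    case 1
    then obtain p d xs zs where "e = (p, d)" "L = xs @ d # zs" "filter (\<lambda>y. y < d) xs \<noteq> []"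
      "p = last (filter (\<lambda>y. y < d) xs)" by (auto simp: preorder_edges_def)
    then show ?thesis unfolding preorder_edges_def by (intro CollectI case_prodI2 exI[of _ xs] exI[of _ "zs @ [c]"]) auto
  next
    case 2
    then show ?thesis unfolding preorder_edges_def by (intro CollectI case_prodI2 exI[of _ L] exI[of _ "[]"]) auto
  qed
qed

lemma preorder_edges_map:
  "strict_mono_on (set L) f \<Longrightarrow> preorder_edges (map f L) = map_prod f f ` preorder_edges L"
proof (induction L rule: rev_induct)
  case (snoc c L)
  have mono: "strict_mono_on (set L) f" using snoc.prems by (auto simp: strict_mono_on_def)
  have "filter (\<lambda>y. y < f c) (map f L) = map f (filter (\<lambda>y. y < c) L)"
  proof -
    have "filter (\<lambda>y. f y < f c) L = filter (\<lambda>y. y < c) L"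
      by (rule filter_cong) (use strict_mono_on_less[OF snoc.prems] in auto)
    then show ?thesis by (simp add: filter_map o_def)
  qed
  then show ?case using snoc.IH[OF mono] by (auto simp: preorder_edges_snoc last_map)
qed simp

text \<open>Every letter of \<open>ys\<close> is smaller than all letters of \<open>xs\<close>, so
  the last smaller letter before it is never found in \<open>xs\<close>.\<close>

lemma preorder_edges_Cons_append:
  assumes "\<And>x y. x \<in> set xs \<Longrightarrow> y \<in> set ys \<Longrightarrow> y < x"
  shows "preorder_edges (a # xs @ ys) = preorder_edges (a # xs) \<union> preorder_edges (a # ys)"
  using assms
proof (induction ys rule: rev_induct)
  case (snoc c ys)
  have "filter (\<lambda>y. y < c) xs = []" using snoc.prems by (auto simp: filter_empty_conv dest: less_asym)
  then have f: "filter (\<lambda>y. y < c) (a # xs @ ys) = filter (\<lambda>y. y < c) (a # ys)" by simp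
  have "preorder_edges ((a # xs @ ys) @ [c]) = preorder_edges (a # xs) \<union> preorder_edges ((a # ys) @ [c])"
    unfolding preorder_edges_snoc f using snoc by auto
  then show ?case by simp
qed (simp add: preorder_edges_snoc[of "[]" a, simplified])

text \<open>Between a node and its child the preorder reading lists only the subtrees of left
  siblings, whose labels exceed that of the child; so the parent is the last smaller label.\<close>

lemma edges_preorder: "heap t \<Longrightarrow> edges t \<subseteq> preorder_edges (labels t)"
proof (induction t)
  case (Node a ts)
  show ?case
  proof
    fix e assume "e \<in> edges (Node a ts)"
    then obtain t where t: "t \<in> set ts" "e = (a, root t) \<or> e \<in> edges t" by auto
    obtain as bs where ts: "ts = as @ t # bs" using split_list[OF t(1)] by blast
    let ?A = "a # concat (map labels as)" and ?B = "concat (map labels bs)"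
    have L: "labels (Node a ts) = ?A @ labels t @ ?B" by (simp add: ts)
    from t(2) show "e \<in> preorder_edges (labels (Node a ts))"
    proof
      assume e: "e = (a, root t)"
      have "root t < root u" if "u \<in> set as" for u
        using Node.prems that by (auto simp: ts sorted_wrt_append)
      then have "root t \<le> b" if "b \<in> set (concat (map labels as))" for b
        using Node.prems that heap_root_le by (fastforce simp: ts)
      then have "filter (\<lambda>y. y < root t) (concat (map labels as)) = []"
        by (auto simp: filter_empty_conv not_less simp del: set_concat)
      then have f: "filter (\<lambda>y. y < root t) ?A = [a]" using Node.prems t(1) by simp
      obtain us where "labels t = root t # us" by (cases t) auto
      then have "labels (Node a ts) = ?A @ root t # us @ ?B" using L by simp
      then show ?thesis unfolding e preorder_edges_def using f
        by (intro CollectI case_prodI exI[of _ ?A] exI[of _ "us @ ?B"]) simp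
    next
      assume e: "e \<in> edges t"
      have "heap t" using Node.prems t(1) by simp
      then have "e \<in> preorder_edges (labels t)" using Node.IH[OF t(1)] e by blast
      then obtain p c xs zs where x: "e = (p, c)" "labels t = xs @ c # zs" "filter (\<lambda>y. y < c) xs \<noteq> []"
        "p = last (filter (\<lambda>y. y < c) xs)" by (auto simp: preorder_edges_def)
      then have "labels (Node a ts) = (?A @ xs) @ c # zs @ ?B" using L by simp
      then show ?thesis unfolding x(1) preorder_edges_def using x(3,4)
        by (intro CollectI case_prodI exI[of _ "?A @ xs"] exI[of _ "zs @ ?B"]) simp
    qed
  qed
qed

lemma root_add_child [simp]: "root (add_child p c t) = root t"
  by (cases t) simp

lemma edges_add_child:
  "edges (add_child p c t) = edges t \<union> (if p \<in> set (labels t) then {(p, c)} else {})"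
  by (induction t) (auto split: if_splits)

lemma replicate_mset_add: "replicate_mset (m + n) x = replicate_mset m x + replicate_mset n x"
  by (induction m) auto

lemma mset_labels_add_child:
  "mset (labels (add_child p c t)) = mset (labels t) + replicate_mset (count (mset (labels t)) p) c"
proof (induction t)
  case (Node a ts)
  have "mset (concat (map (labels \<circ> add_child p c) us)) =
      mset (concat (map labels us)) + replicate_mset (count (mset (concat (map labels us))) p) c"
    if "set us \<subseteq> set ts" for us
    using that by (induction us) (auto simp: Node.IH replicate_mset_add)
  from this[of ts] show ?case by auto
qed

lemma heap_add_child:
  "heap t \<Longrightarrow> p < c \<Longrightarrow> (\<And>b. (p, b) \<in> edges t \<Longrightarrow> c < b) \<Longrightarrow> heap (add_child p c t)"
proof (induction t)
  case (Node a ts)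
  have "heap (add_child p c t)" if "t \<in> set ts" for t
    using Node.prems that by (intro Node.IH) auto
  then show ?case using Node.prems by (auto simp: o_def sorted_wrt_append)
qed

lemma nth_Max_eq_last_filter:
  "filter P L \<noteq> [] \<Longrightarrow> L ! Max {j. j < length L \<and> P (L ! j)} = last (filter P L)"
proof (induction L rule: rev_induct)
  case (snoc c L)
  show ?case
  proof (cases "P c")
    case True
    then have "Max {j. j < length (L @ [c]) \<and> P ((L @ [c]) ! j)} = length L"
      by (intro Max_eqI) (auto simp: less_Suc_eq)
    then show ?thesis using True by simp
  next
    case False
    then have ne: "filter P L \<noteq> []" using snoc.prems by simp
    have eq: "{j. j < length (L @ [c]) \<and> P ((L @ [c]) ! j)} = {j. j < length L \<and> P (L ! j)}" (is "_ = ?S")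
      using False by (auto simp: nth_append less_Suc_eq)
    obtain y where "y \<in> set L" "P y" using ne by (auto simp: filter_empty_conv)
    then have "?S \<noteq> {}" by (auto simp: in_set_conv_nth)
    then have "Max ?S \<in> ?S" by (intro Max_in) auto
    then show ?thesis unfolding eq using snoc.IH[OF ne] False by (simp add: nth_append)
  qed
qed simp

text \<open>The invariant identifies the tree after each step by its edges, since the index chosen
  by \<open>phi_step\<close> is the position of the last smaller letter.\<close>

lemma fold_phi_step:
  assumes u: "distinct u" "u \<noteq> []" "hd u = 0" and k: "1 \<le> k" "k \<le> length u"
  defines "t \<equiv> fold (phi_step u) [1..<k] (Node 0 [])"
  shows "heap t \<and> root t = 0 \<and> mset (labels t) = mset (take k u) \<and> edges t = preorder_edges (take k u)"
  using k unfolding t_def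
proof (induction k rule: dec_induct)
  case base
  have "take 1 u = [0]" using u by (cases u) auto
  then show ?case using preorder_edges_snoc[of "[]" 0] by simp
next
  case (step k)
  let ?t = "fold (phi_step u) [1..<k] (Node 0 [])" and ?c = "u ! k"
  have IH: "heap ?t" "root ?t = 0" "mset (labels ?t) = mset (take k u)" "edges ?t = preorder_edges (take k u)"
    using step by auto
  have k: "k < length u" "0 < k" using step by auto
  have tk: "take (Suc k) u = take k u @ [?c]" using k by (simp add: take_Suc_conv_app_nth)
  let ?F = "filter (\<lambda>y. y < ?c) (take k u)"
  let ?p = "last ?F"
  have u0: "u ! 0 = 0" using u by (simp add: hd_conv_nth)
  have "?c \<noteq> u ! 0" using k u by (simp add: nth_eq_iff_index_eq)
  then have c0: "0 < ?c" using u0 by simp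
  have "0 \<in> set (take k u)" using k u0 by (auto simp: in_set_conv_nth intro!: exI[of _ 0])
  then have ne: "?F \<noteq> []" using c0 by (auto simp: filter_empty_conv)
  have "{j. j < length (take k u) \<and> take k u ! j < ?c} = {j. j < k \<and> ?c > u ! j}" using k by auto
  then have par: "take k u ! Max {j. j < k \<and> ?c > u ! j} = ?p"
    using nth_Max_eq_last_filter[OF ne] by simp
  have "u ! 0 < ?c" using u0 c0 by simp
  then have "Max {j. j < k \<and> ?c > u ! j} \<in> {j. j < k \<and> ?c > u ! j}" using k by (intro Max_in) auto
  then have p: "u ! Max {j. j < k \<and> ?c > u ! j} = ?p" using par by simp
  have "[1..<Suc k] = [1..<k] @ [k]" using k by simp
  then have T: "fold (phi_step u) [1..<Suc k] (Node 0 []) = add_child ?p ?c ?t"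
    by (simp add: phi_step_def p)
  have pF: "?p \<in> set ?F" using ne by (rule last_in_set)
  then have pc: "?p < ?c" "?p \<in> set (take k u)" by auto
  then have pl: "?p \<in> set (labels ?t)" using mset_eq_setD[OF IH(3)] by simp
  have "distinct (labels ?t)" using mset_eq_imp_distinct_iff[OF IH(3)] u by simp
  then have "count (mset (labels ?t)) ?p = 1" using pl by (simp add: distinct_count_atmost_1)
  then have ml: "mset (labels (add_child ?p ?c ?t)) = mset (take (Suc k) u)"
    unfolding mset_labels_add_child tk IH(3) by simp
  have ed: "edges (add_child ?p ?c ?t) = preorder_edges (take (Suc k) u)"
    unfolding edges_add_child tk preorder_edges_snoc IH(4) using pl ne by simp
  have "heap (add_child ?p ?c ?t)"
  \<comment> \<open>A child \<open>b\<close> of \<open>?p\<close> with \<open>b\<close> smaller than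
    the new label would be a later letter below it, contradicting that \<open>?p\<close> is the last
    one. So the new node may stand rightmost.\<close>
  proof (rule heap_add_child[OF IH(1) pc(1)])
    fix b assume "(?p, b) \<in> edges ?t"
    then obtain xs zs where x: "take k u = xs @ b # zs" "filter (\<lambda>y. y < b) xs \<noteq> []" "?p = last (filter (\<lambda>y. y < b) xs)"
      unfolding IH(4) by (auto simp: preorder_edges_def)
    show "?c < b"
    proof (rule ccontr)
      assume "\<not> ?c < b"
      moreover have "b \<noteq> ?c"
      proof -
        have "distinct (take (Suc k) u)" using u by simp
        then show ?thesis unfolding tk x(1) by auto
      qed
      ultimately have "b < ?c" by simp
      then have "?p \<in> set (b # zs)"
        using last_in_set[of "filter (\<lambda>y. y < ?c) (b # zs)"] unfolding x(1) by (auto split: if_splits)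
      moreover have "?p \<in> set xs" using last_in_set[OF x(2)] x(3) by simp
      moreover have "distinct (xs @ b # zs)" using u x(1) by (metis distinct_take)
      ultimately show False by auto
    qed
  qed
  then show ?case unfolding T using IH(2) ml ed by simp
qed

lemma phi_props:
  "edges (tree_of (phi w)) = preorder_edges (0 # word w)" "tree_degree (phi w) = psize w"
proof -
  let ?u = "0 # word w"
  define t where "t = fold (phi_step ?u) [1..<length ?u] (Node 0 [])"
  have d: "distinct ?u" by (simp add: set_word)
  have t: "heap t" "root t = 0" "mset (labels t) = mset ?u" "edges t = preorder_edges ?u"
    using fold_phi_step[OF d, of "length ?u"] unfolding t_def[symmetric] by auto
  have "set (labels t) = set ?u" using t(3) by (rule mset_eq_setD)
  also have "\<dots> = {..psize w}" by (auto simp: set_word)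
  finally have s: "set (labels t) = {..psize w}" .
  have "distinct (labels t)" using mset_eq_imp_distinct_iff[OF t(3)] d by blast
  note T = tree_of_Abs[OF t(1,2) this s]
  have "phi w = Abs_ho_tree t" unfolding phi_def Let_def t_def ..
  then show "edges (tree_of (phi w)) = preorder_edges ?u" "tree_degree (phi w) = psize w"
    using t(4) T by simp_all
qed

text \<open>The preimage is the preorder reading of \<open>x\<close> without its root. The edges of
  \<open>x\<close> are among those of its image, both trees have the same nodes, and parents are
  unique, so the codes agree.\<close>

lemma phi_surj: "\<exists>w. phi w = x"
proof -
  let ?L = "labels (tree_of x)"
  have L: "?L = 0 # tl ?L" using tree_of_eq[of x] by (metis labels.simps list.sel(3))
  have L': "distinct (0 # tl ?L)" "set (0 # tl ?L) = {..tree_degree x}" "length (0 # tl ?L) = Suc (tree_degree x)"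
    using tree_of_props[of x] unfolding L[symmetric] by blast+
  have "set (tl ?L) = set (0 # tl ?L) - {0}" using L'(1) by auto
  also have "\<dots> = {1..tree_degree x}" unfolding L'(2) by auto
  finally have "set (tl ?L) = {1..tree_degree x}" .
  moreover have len: "length (tl ?L) = tree_degree x" using L'(3) by simp
  ultimately have tl: "distinct (tl ?L)" "set (tl ?L) = {1..length (tl ?L)}" "length (tl ?L) = tree_degree x"
    using L'(1) by simp_all
  define w where "w = Abs_perm (tl ?L)"
  have w: "word w = tl ?L" "psize w = tree_degree x"
    unfolding w_def using tl by (simp_all add: word_Abs_perm psize_Abs_perm)
  have deg: "tree_degree (phi w) = tree_degree x" by (simp add: phi_props w)
  have sub: "edges (tree_of x) \<subseteq> edges (tree_of (phi w))"
    using edges_preorder[OF tree_of_props(1)[of x]] L by (simp add: phi_props w)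
  have "code (phi w) = code x"
  proof (rule nth_equalityI)
    fix i assume "i < length (code (phi w))"
    then have i: "i < tree_degree x" "i < tree_degree (phi w)" using deg by auto
    show "code (phi w) ! i = code x ! i"
      using edges_parent_unique[OF tree_of_props(3)] code_edge[OF i(1)] code_edge[OF i(2)] sub by blast
  qed (simp add: deg)
  then show ?thesis using code_inject by blast
qed

lemma card_parent_lists: "card {l. parent_list l \<and> length l = n} = fact n"
proof (induction n)
  case 0
  have "{l. parent_list l \<and> length l = 0} = {[]}" by auto
  then show ?case by simp
next
  case (Suc n)
  let ?P = "\<lambda>n. {l. parent_list l \<and> length l = n}"
  have eq: "?P (Suc n) = (\<lambda>(l, p). l @ [p]) ` (?P n \<times> {..n})"
  proof (intro equalityI subsetI)
    fix l assume l: "l \<in> ?P (Suc n)"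
    then obtain l' p where "l = l' @ [p]" by (cases l rule: rev_cases) auto
    then show "l \<in> (\<lambda>(l, p). l @ [p]) ` (?P n \<times> {..n})" using l by (auto simp: parent_list_snoc)
  qed (auto simp: parent_list_snoc)
  have "inj_on (\<lambda>(l, p). l @ [p]) (?P n \<times> {..n})" by (auto simp: inj_on_def)
  then have "card (?P (Suc n)) = card (?P n \<times> {..n})" unfolding eq by (rule card_image)
  then show ?case by (simp add: card_cartesian_product Suc)
qed

lemma card_tree_degree: "card {x. tree_degree x = n} = fact n"
proof -
  have eq: "code ` {x. tree_degree x = n} = {l. parent_list l \<and> length l = n}"
  proof (intro equalityI subsetI)
    fix l assume "l \<in> {l. parent_list l \<and> length l = n}"
    then have "code (decode l) = l" "length (code (decode l)) = n" by (simp_all add: code_decode)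
    then show "l \<in> code ` {x. tree_degree x = n}" by (metis (mono_tags) image_eqI length_code mem_Collect_eq)
  qed (auto simp: parent_list_code)
  have "inj_on code {x. tree_degree x = n}" by (auto simp: inj_on_def code_inject)
  from card_image[OF this] show ?thesis unfolding eq card_parent_lists by simp
qed

text \<open>By counting: in each degree \<open>phi\<close> maps onto a set of the same finite size n
  factorial.\<close>

lemma phi_inject: "phi w = phi w' \<longleftrightarrow> w = w'"
proof
  assume eq: "phi w = phi w'"
  let ?n = "psize w"
  have "phi ` {w. psize w = ?n} = {x. tree_degree x = ?n}"
  proof (intro equalityI subsetI)
    fix x assume "x \<in> {x. tree_degree x = ?n}"
    moreover obtain v where "phi v = x" using phi_surj by blast
    ultimately show "x \<in> phi ` {w. psize w = ?n}" using phi_props(2)[of v] by auto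
  qed (auto simp: phi_props)
  then have "inj_on phi {w. psize w = ?n}"
    by (intro eq_card_imp_inj_on) (simp_all add: card_psize card_tree_degree)
  moreover have "psize w' = ?n" using eq phi_props(2)[of w] phi_props(2)[of w'] by simp
  ultimately show "w = w'" using eq by (auto dest: inj_onD)
qed simp

lemma bij_phi: "bij phi"
  unfolding bij_def inj_def surj_def using phi_inject phi_surj by metis

text \<open>The graft word that attaches every component to the root.\<close>

definition shift_parents :: "nat \<Rightarrow> nat list \<Rightarrow> nat list" where
  "shift_parents q = map (\<lambda>a. if a = 0 then 0 else a + q)"

text \<open>The letters from \<open>v\<close> are below all shifted letters from \<open>u\<close>,
  so the preorder edges of the word split into those of the two parts, joined only at the
  root.\<close>

lemma code_phi_backslash: "code (phi (backslash u v)) = code (phi v) @ shift_parents (psize v) (code (phi u))"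
proof (rule code_eqI)
  let ?q = "psize v"
  let ?s = "\<lambda>a. if a = 0 then 0 else a + ?q"
  have pos: "0 < a" if "a \<in> set (word u)" for a using that by (auto simp: set_word)
  have m: "map (\<lambda>x. x + ?q) (word u) = map ?s (word u)" using pos by (auto intro!: map_cong)
  have "edges (tree_of (phi (backslash u v))) = preorder_edges (0 # map (\<lambda>x. x + ?q) (word u) @ word v)"
    by (simp add: phi_props)
  also have "\<dots> = preorder_edges (0 # map (\<lambda>x. x + ?q) (word u)) \<union> preorder_edges (0 # word v)"
    by (rule preorder_edges_Cons_append) (auto simp: set_word)
  also have "0 # map (\<lambda>x. x + ?q) (word u) = map ?s (0 # word u)" using m by simp
  also have "preorder_edges (map ?s (0 # word u)) = map_prod ?s ?s ` edges (tree_of (phi u))"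
    unfolding phi_props by (rule preorder_edges_map) (auto simp: strict_mono_on_def)
  also have "\<dots> \<union> preorder_edges (0 # word v) = list_edges (code (phi v) @ shift_parents ?q (code (phi u)))"
    unfolding edges_code phi_props(1)[symmetric] list_edges_append
    by (auto simp: list_edges_def shift_parents_def phi_props(2) image_iff add.commute)
  finally show "edges (tree_of (phi (backslash u v))) = list_edges (code (phi v) @ shift_parents ?q (code (phi u)))" .
  show "tree_degree (phi (backslash u v)) = length (code (phi v) @ shift_parents ?q (code (phi u)))"
    by (simp add: phi_props shift_parents_def)
qed

section \<open>Bilinear extension\<close>

definition bilin_ext :: "('a \<Rightarrow> 'b \<Rightarrow> ('c \<Rightarrow>\<^sub>0 'k::field)) \<Rightarrow> ('a \<Rightarrow>\<^sub>0 'k) \<Rightarrow> ('b \<Rightarrow>\<^sub>0 'k) \<Rightarrow> ('c \<Rightarrow>\<^sub>0 'k)" where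
  "bilin_ext F x y = lin_ext smul (\<lambda>u. lin_ext smul (\<lambda>v. F u v) y) x"

lemma lin_bilin_ext_left: "lin smul smul (\<lambda>x. bilin_ext F x y)"
  unfolding bilin_ext_def by (rule lin_lin_ext_smul)

lemma lin_bilin_ext_right: "lin smul smul (bilin_ext F x)"
  unfolding bilin_ext_def
  by (rule linI) (simp_all add: lin_ext_smul_simps lin_ext_def[of _ _ x] smul.scale_right_distrib
      sum.distrib smul.scale_sum_right mult.commute)

lemma bilin_ext_bas [simp]: "bilin_ext F (bas a) (bas b) = F a b"
  by (simp add: bilin_ext_def)

lemmas bilin_ext_simps =
  lin_0[OF lin_bilin_ext_left] lin_0[OF lin_bilin_ext_right]
  lin_add[OF lin_bilin_ext_left] lin_add[OF lin_bilin_ext_right]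
  lin_diff[OF lin_bilin_ext_left] lin_diff[OF lin_bilin_ext_right]
  lin_scale[OF lin_bilin_ext_left] lin_scale[OF lin_bilin_ext_right]

lemma free_induct [case_names bas add scale]:
  assumes "\<And>b. P (bas b)" "\<And>x y. P x \<Longrightarrow> P y \<Longrightarrow> P (x + y)" "\<And>c x. P x \<Longrightarrow> P (smul c x)"
  shows "P (x :: 'b \<Rightarrow>\<^sub>0 'k::field)"
proof -
  have "smul 0 (bas undefined) = (0 :: 'b \<Rightarrow>\<^sub>0 'k)" by simp
  then have 0: "P 0" using assms(3)[OF assms(1), of 0 undefined] by simp
  have "P (\<Sum>b\<in>A. smul (Poly_Mapping.lookup x b) (bas b))" if "finite A" for A
    using that by (induction A) (auto intro: 0 assms)
  then show ?thesis by (subst bas_expand) simp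
qed

section \<open>The algebra of heap-ordered trees\<close>

definition empty_tree :: ho_tree where
  "empty_tree = Abs_ho_tree (Node 0 [])"

lemma H_HO_sel [simp]:
  "hscale H_HO = smul" "hmult H_HO = bilin_ext T_mult" "hone H_HO = bas empty_tree"
  "hcomult H_HO = lin_ext smul T_comult" "hcounit H_HO x = Poly_Mapping.lookup x empty_tree"
  "hdeg H_HO n = module.span smul {bas t | t. tree_degree t = n}"
  by (simp_all add: H_HO_def empty_tree_def bilin_ext_def fun_eq_iff)

lemma tree_degree_empty [simp]: "tree_degree empty_tree = 0"
  unfolding empty_tree_def by (rule tree_of_Abs) auto

lemma code_empty [simp]: "code empty_tree = []"
  by (simp add: code_def)

lemma tree_degree_0_iff [simp]: "tree_degree t = 0 \<longleftrightarrow> t = empty_tree"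
  using code_inject[of t empty_tree] by (auto simp flip: length_code)

lemma phi_empty: "phi perm_empty = empty_tree"
  by (simp add: phi_props flip: tree_degree_0_iff)

lemma T_mult_empty [simp]: "T_mult empty_tree t = bas t" "T_mult t empty_tree = bas t"
proof -
  have "(if a = 0 then b \<le> 0 else b = a + 0) \<longleftrightarrow> b = a" for a b :: nat by auto
  then have "grafts 0 x = {x}" for x
    unfolding set_eq_iff in_grafts_iff by (auto simp: list_eq_iff_nth_eq)
  then show "T_mult empty_tree t = bas t" "T_mult t empty_tree = bas t" by (simp_all add: T_mult_eq)
qed

abbreviation tmul (infixl "\<odot>" 70) where
  "x \<odot> y \<equiv> bilin_ext T_mult x y"

lemma tmul_one [simp]: "bas empty_tree \<odot> x = x" "x \<odot> bas empty_tree = x"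
  by (induction x rule: free_induct) (simp_all add: bilin_ext_simps)

lemma code_decode_grafts: "z \<in> grafts (tree_degree b) (code a) \<Longrightarrow> code (decode (code b @ z)) = code b @ z"
  using parent_list_append_grafts[OF parent_list_code parent_list_code, of z b a] by (simp add: code_decode)

lemma tmul_assoc: "(x \<odot> y) \<odot> z = x \<odot> (y \<odot> z)"
proof -
  have basis: "(bas a \<odot> bas b) \<odot> bas c = (bas a \<odot> (bas b \<odot> bas c) :: ho_tree \<Rightarrow>\<^sub>0 'a)" for a b c
  proof -
    let ?r = "tree_degree c" and ?q = "tree_degree b"
    let ?B = "\<lambda>l. bas (decode (code c @ l)) :: ho_tree \<Rightarrow>\<^sub>0 'a"
    have "(bas a \<odot> bas b) \<odot> bas c = (\<Sum>s\<in>grafts ?q (code a). \<Sum>t\<in>grafts ?r (code b @ s). ?B t)"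
      by (simp add: T_mult_eq[of a b] lin_sum[OF lin_bilin_ext_left])
        (intro sum.cong refl, simp add: T_mult_eq code_decode_grafts)
    also have "\<dots> = (\<Sum>t1\<in>grafts ?r (code b). \<Sum>s\<in>grafts ?q (code a). \<Sum>t\<in>grafts ?r s. ?B (t1 @ t))"
      unfolding sum_grafts_append by (rule sum.swap)
    also have "\<dots> = (\<Sum>t1\<in>grafts ?r (code b). \<Sum>t\<in>grafts (?r + ?q) (code a). ?B (t1 @ t))"
      unfolding sum_grafts_grafts ..
    also have "\<dots> = bas a \<odot> (bas b \<odot> bas c)"
    proof -
      have "T_mult a (decode (code c @ t1)) = (\<Sum>t\<in>grafts (?r + ?q) (code a). ?B (t1 @ t))"
        if t1: "t1 \<in> grafts ?r (code b)" for t1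
        using length_grafts[OF t1] code_decode_grafts[OF t1] length_code[of "decode (code c @ t1)"]
        by (simp add: T_mult_eq[of a])
      then show ?thesis by (simp add: T_mult_eq[of b c] lin_sum[OF lin_bilin_ext_right])
    qed
    finally show ?thesis .
  qed
  show ?thesis
  proof (induction x rule: free_induct)
    case (bas a)
    show ?case
    proof (induction y rule: free_induct)
      case (bas b)
      show ?case by (induction z rule: free_induct) (simp_all only: basis bilin_ext_simps)
    qed (simp_all only: bilin_ext_simps)
  qed (simp_all only: bilin_ext_simps)
qed

subsection \<open>The tensor square\<close>

text \<open>A model of the tensor product with the pairs as basis, where equality is equality.
  Computations with the tree coproduct take place here and are carried back to formal tensors by
  \<open>pair_tensor\<close>.\<close>

definition ten :: "('a \<Rightarrow>\<^sub>0 'k::field) \<Rightarrow> ('b \<Rightarrow>\<^sub>0 'k) \<Rightarrow> ('a \<times> 'b \<Rightarrow>\<^sub>0 'k)" where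
  "ten = bilin_ext (\<lambda>a b. bas (a, b))"

lemma ten_bas [simp]: "ten (bas a) (bas b) = bas (a, b)"
  by (simp add: ten_def)

lemma lin_ten_left: "lin smul smul (\<lambda>x. ten x y)" and lin_ten_right: "lin smul smul (ten x)"
  unfolding ten_def by (rule lin_bilin_ext_left lin_bilin_ext_right)+

lemmas ten_simps = bilin_ext_simps[of "\<lambda>a b. bas (a, b)", folded ten_def]

abbreviation tmul2 (infixl "\<odot>\<odot>" 70) where
  "x \<odot>\<odot> y \<equiv> bilin_ext (\<lambda>a b. ten (T_mult (fst a) (fst b)) (T_mult (snd a) (snd b))) x y"

lemma tmul2_ten: "ten x y \<odot>\<odot> ten x' y' = ten (x \<odot> x') (y \<odot> y')"
proof (induction x rule: free_induct)
  case (bas a)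
  show ?case
  proof (induction y rule: free_induct)
    case (bas b)
    show ?case
    proof (induction x' rule: free_induct)
      case (bas a')
      show ?case by (induction y' rule: free_induct) (simp_all add: bilin_ext_simps ten_simps)
    qed (simp_all add: bilin_ext_simps ten_simps)
  qed (simp_all add: bilin_ext_simps ten_simps)
qed (simp_all add: bilin_ext_simps ten_simps)

lemma bas_ten: "bas p = ten (bas (fst p)) (bas (snd p))"
  by simp

lemma tmul2_one [simp]: "bas (empty_tree, empty_tree) \<odot>\<odot> x = x" "x \<odot>\<odot> bas (empty_tree, empty_tree) = x"
  by (induction x rule: free_induct) (simp_all add: bilin_ext_simps)

lemma tmul2_assoc: "(x \<odot>\<odot> y) \<odot>\<odot> z = x \<odot>\<odot> (y \<odot>\<odot> z)"
proof (induction x rule: free_induct)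
  case (bas a)
  show ?case
  proof (induction y rule: free_induct)
    case (bas b)
    show ?case
    proof (induction z rule: free_induct)
      case (bas c)
      show ?case
        by (simp only: bas_ten[of a] bas_ten[of b] bas_ten[of c] tmul2_ten tmul_assoc)
    qed (simp_all only: bilin_ext_simps)
  qed (simp_all only: bilin_ext_simps)
qed (simp_all only: bilin_ext_simps)

subsection \<open>Convolution\<close>

definition restrict_tree :: "ho_tree \<Rightarrow> bool list \<Rightarrow> ho_tree" where
  "restrict_tree t \<chi> = decode (restrict_list (code t) \<chi>)"

abbreviation tree_colorings :: "ho_tree \<Rightarrow> bool list set" where
  "tree_colorings t \<equiv> colorings (code t)"

lemma code_restrict_tree: "\<chi> \<in> tree_colorings t \<Longrightarrow> code (restrict_tree t \<chi>) = restrict_list (code t) \<chi>"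
  unfolding restrict_tree_def
  by (intro code_decode parent_list_restrict_list parent_list_code length_colorings)

lemma compl_in_colorings: "\<chi> \<in> tree_colorings t \<Longrightarrow> compl_list \<chi> \<in> tree_colorings t"
  by (rule colorings_map[OF _ parent_list_code])

lemma count_true_compl: "m \<le> length \<chi> \<Longrightarrow> count_true \<chi> m + count_true (compl_list \<chi>) m = m"
proof -
  have "length (filter id xs) + length (filter id (compl_list xs)) = length xs" for xs
    by (induction xs) auto
  then show "m \<le> length \<chi> \<Longrightarrow> ?thesis" by (simp add: count_true_def take_map)
qed

lemma tree_degree_restrict_tree:
  "\<chi> \<in> tree_colorings t \<Longrightarrow> tree_degree (restrict_tree t \<chi>) = count_true \<chi> (length \<chi>)"
  using code_restrict_tree[of \<chi> t] length_restrict_list[of \<chi> "code t"] length_colorings[of \<chi> "code t"]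
  by (metis length_code)

lemma tree_degree_restrict_compl:
  "\<chi> \<in> tree_colorings t \<Longrightarrow>
    tree_degree (restrict_tree t \<chi>) + tree_degree (restrict_tree t (compl_list \<chi>)) = tree_degree t"
  using tree_degree_restrict_tree[of \<chi> t] tree_degree_restrict_tree[OF compl_in_colorings, of \<chi> t]
    count_true_compl[of "length \<chi>" \<chi>] length_colorings[of \<chi> "code t"] by simp

lemma T_comult_restrict_tree:
  "T_comult t = (\<Sum>\<chi>\<in>tree_colorings t. bas [bas (restrict_tree t \<chi>), bas (restrict_tree t (compl_list \<chi>))])"
  unfolding T_comult_eq restrict_tree_def ..

lemma count_true_replicate: "m \<le> n \<Longrightarrow> count_true (replicate n b) m = (if b then m else 0)"
  by (simp add: count_true_def)

lemma restrict_all: "restrict_tree t (replicate (tree_degree t) True) = t"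
proof -
  have "restrict_list x (replicate (length x) True) = x" if "parent_list x" for x
    using that
  proof (induction x rule: parent_list_induct)
    case (snoc x p)
    have r: "replicate (length (x @ [p])) True = replicate (length x) True @ [True]"
      by (simp add: replicate_append_same)
    show ?case unfolding r by (subst restrict_list_snoc) (use snoc in \<open>simp_all add: count_true_replicate\<close>)
  qed simp
  from this[OF parent_list_code, of t] show ?thesis by (simp add: restrict_tree_def)
qed

lemma replicate_in_colorings: "replicate (tree_degree t) b \<in> tree_colorings t"
proof -
  have "code t ! i - 1 < tree_degree t" if "i < tree_degree t" for i
    using parent_list_code[of t] that by (fastforce simp: parent_list_def)
  then show ?thesis by (simp add: colorings_def)
qed

lemma restrict_tree_eq_empty:
  "\<chi> \<in> tree_colorings t \<Longrightarrow> restrict_tree t \<chi> = empty_tree \<longleftrightarrow> \<chi> = replicate (tree_degree t) False"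
proof -
  assume \<chi>: "\<chi> \<in> tree_colorings t"
  have "restrict_tree t \<chi> = empty_tree \<longleftrightarrow> length (filter id \<chi>) = 0"
    unfolding tree_degree_0_iff[symmetric] tree_degree_restrict_tree[OF \<chi>] by (simp add: count_true_def)
  also have "\<dots> \<longleftrightarrow> \<chi> = replicate (length \<chi>) False"
    by (induction \<chi>) auto
  finally show ?thesis using length_colorings[OF \<chi>] by simp
qed

text \<open>Convolution of maps from the coalgebra of trees to an arbitrary algebra. The algebra of
  trees itself and its tensor square are both used as targets.\<close>

locale tree_convolution =
  fixes mul :: "('b \<Rightarrow>\<^sub>0 'k::field) \<Rightarrow> ('b \<Rightarrow>\<^sub>0 'k) \<Rightarrow> ('b \<Rightarrow>\<^sub>0 'k)" and one :: "'b \<Rightarrow>\<^sub>0 'k"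
  assumes lin_left: "lin smul smul (\<lambda>x. mul x y)" and lin_right: "lin smul smul (mul x)"
    and assoc: "mul (mul x y) z = mul x (mul y z)"
    and one_left: "mul one x = x" and one_right: "mul x one = x"
begin

definition conv :: "(ho_tree \<Rightarrow> 'b \<Rightarrow>\<^sub>0 'k) \<Rightarrow> (ho_tree \<Rightarrow> 'b \<Rightarrow>\<^sub>0 'k) \<Rightarrow> ho_tree \<Rightarrow> 'b \<Rightarrow>\<^sub>0 'k" where
  "conv f g t = (\<Sum>\<chi>\<in>tree_colorings t. mul (f (restrict_tree t \<chi>)) (g (restrict_tree t (compl_list \<chi>))))"

definition eps :: "ho_tree \<Rightarrow> 'b \<Rightarrow>\<^sub>0 'k" where
  "eps t = (if t = empty_tree then one else 0)"

primrec cpow :: "(ho_tree \<Rightarrow> 'b \<Rightarrow>\<^sub>0 'k) \<Rightarrow> nat \<Rightarrow> ho_tree \<Rightarrow> 'b \<Rightarrow>\<^sub>0 'k" where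
  "cpow f 0 = eps"
| "cpow f (Suc n) = conv f (cpow f n)"

lemma conv_restrict_tree:
  assumes "\<chi> \<in> tree_colorings t"
  shows "conv f g (restrict_tree t \<chi>) = (\<Sum>\<psi>\<in>colorings (restrict_list (code t) \<chi>).
    mul (f (decode (restrict_list (restrict_list (code t) \<chi>) \<psi>)))
      (g (decode (restrict_list (restrict_list (code t) \<chi>) (compl_list \<psi>)))))"
  unfolding conv_def restrict_tree_def[of "restrict_tree t \<chi>"] code_restrict_tree[OF assms] ..

lemma conv_assoc: "conv (conv f g) h = conv f (conv g h)"
proof
  fix t
  let ?x = "code t"
  let ?F = "\<lambda>a b c. mul (f (decode a)) (mul (g (decode b)) (h (decode c)))"
  have "conv (conv f g) h t = (\<Sum>\<chi>\<in>colorings ?x. \<Sum>\<psi>\<in>colorings (restrict_list ?x \<chi>).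
      ?F (restrict_list (restrict_list ?x \<chi>) \<psi>) (restrict_list (restrict_list ?x \<chi>) (compl_list \<psi>)) (restrict_list ?x (compl_list \<chi>)))"
    unfolding conv_def[of "conv f g"]
  proof (rule sum.cong[OF refl])
    fix \<chi> :: "bool list" assume \<chi>: "\<chi> \<in> colorings ?x"
    show "mul (conv f g (restrict_tree t \<chi>)) (h (restrict_tree t (compl_list \<chi>))) = (\<Sum>\<psi>\<in>colorings (restrict_list ?x \<chi>).
      ?F (restrict_list (restrict_list ?x \<chi>) \<psi>) (restrict_list (restrict_list ?x \<chi>) (compl_list \<psi>)) (restrict_list ?x (compl_list \<chi>)))"
      unfolding conv_restrict_tree[OF \<chi>] lin_sum[OF lin_left] assoc unfolding restrict_tree_def ..
  qed
  also have "\<dots> = (\<Sum>\<chi>\<in>colorings ?x. \<Sum>\<psi>\<in>colorings (restrict_list ?x (compl_list \<chi>)).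
      ?F (restrict_list ?x \<chi>) (restrict_list (restrict_list ?x (compl_list \<chi>)) \<psi>)
        (restrict_list (restrict_list ?x (compl_list \<chi>)) (compl_list \<psi>)))"
    by (rule sum_colorings_coassoc[OF parent_list_code])
  also have "\<dots> = conv f (conv g h) t"
    unfolding conv_def[of f "conv g h"]
  proof (rule sum.cong[OF refl])
    fix \<chi> :: "bool list" assume \<chi>: "\<chi> \<in> colorings ?x"
    show "(\<Sum>\<psi>\<in>colorings (restrict_list ?x (compl_list \<chi>)).
      ?F (restrict_list ?x \<chi>) (restrict_list (restrict_list ?x (compl_list \<chi>)) \<psi>)
        (restrict_list (restrict_list ?x (compl_list \<chi>)) (compl_list \<psi>))) =
      mul (f (restrict_tree t \<chi>)) (conv g h (restrict_tree t (compl_list \<chi>)))"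
      unfolding conv_restrict_tree[OF compl_in_colorings[OF \<chi>]] lin_sum[OF lin_right] unfolding restrict_tree_def ..
  qed
  finally show "conv (conv f g) h t = conv f (conv g h) t" .
qed

text \<open>This is where cocommutativity enters: passing to complementary colorings permutes the
  summands, so commuting values suffice.\<close>

lemma conv_commute:
  assumes "\<And>a b. mul (f a) (g b) = mul (g b) (f a)"
  shows "conv f g = conv g f"
proof
  fix t
  have "conv f g t = (\<Sum>\<chi>\<in>tree_colorings t. mul (g (restrict_tree t (compl_list \<chi>))) (f (restrict_tree t (compl_list (compl_list \<chi>)))))"
    by (simp add: conv_def assms o_def)
  also have "\<dots> = conv g f t"
    unfolding conv_def by (rule sum_colorings_compl[OF parent_list_code])
  finally show "conv f g t = conv g f t" .
qed

lemma conv_eps_right: "conv f eps = f"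
proof
  fix t
  let ?T = "replicate (tree_degree t) True"
  have "mul (f (restrict_tree t \<chi>)) (eps (restrict_tree t (compl_list \<chi>))) =
      (if \<chi> = ?T then f t else 0)" if \<chi>: "\<chi> \<in> tree_colorings t" for \<chi>
  proof -
    have "compl_list \<chi> = replicate (tree_degree t) False \<longleftrightarrow> \<chi> = ?T"
    proof
      assume "compl_list \<chi> = replicate (tree_degree t) False"
      then have "compl_list (compl_list \<chi>) = compl_list (replicate (tree_degree t) False)" by simp
      then show "\<chi> = ?T" by (simp add: o_def)
    qed simp
    then show ?thesis
      using restrict_tree_eq_empty[OF compl_in_colorings[OF \<chi>]] restrict_all[of t]
      by (simp add: eps_def one_right lin_0[OF lin_right])
  qed
  then have "conv f eps t = (\<Sum>\<chi>\<in>tree_colorings t. if \<chi> = ?T then f t else 0)"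
    unfolding conv_def by (intro sum.cong refl)
  then show "conv f eps t = f t" using replicate_in_colorings[of t True] by simp
qed

lemma conv_eps_left: "conv eps f = f"
proof -
  have "conv eps f = conv f eps"
    by (rule conv_commute) (simp add: eps_def one_left one_right lin_0[OF lin_left] lin_0[OF lin_right])
  then show ?thesis by (simp add: conv_eps_right)
qed

lemma cpow_conv_commute:
  assumes "conv f g = conv g f"
  shows "conv g (cpow f m) = conv (cpow f m) g"
proof (induction m)
  case (Suc m)
  have "conv g (cpow f (Suc m)) = conv (conv f g) (cpow f m)" by (simp add: conv_assoc[symmetric] assms)
  also have "\<dots> = conv (cpow f (Suc m)) g" by (simp add: conv_assoc Suc)
  finally show ?case .
qed (simp add: conv_eps_left conv_eps_right)

lemma cpow_conv:
  assumes "conv f g = conv g f"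
  shows "cpow (conv f g) m = conv (cpow f m) (cpow g m)"
proof (induction m)
  case (Suc m)
  have "cpow (conv f g) (Suc m) = conv f (conv (conv g (cpow f m)) (cpow g m))"
    by (simp add: Suc conv_assoc)
  also have "\<dots> = conv (cpow f (Suc m)) (cpow g (Suc m))"
    unfolding cpow_conv_commute[OF assms] by (simp add: conv_assoc)
  finally show ?case .
qed (simp add: conv_eps_left)

lemma conv_add_left: "conv (\<lambda>t. f t + f' t) g t = conv f g t + conv f' g t"
  by (simp add: conv_def lin_add[OF lin_left] sum.distrib)

lemma conv_sum_right: "conv f (\<lambda>t. \<Sum>j\<in>A. smul (c j) (g j t)) t = (\<Sum>j\<in>A. smul (c j) (conv f (g j) t))"
  by (simp add: conv_def lin_sum[OF lin_right] lin_scale[OF lin_right] smul.scale_sum_right) (rule sum.swap)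

text \<open>The binomial theorem for \<open>f\<close> written as \<open>f - eps\<close> plus the
  convolution unit.\<close>

lemma cpow_binomial:
  "cpow f m t = (\<Sum>j\<le>m. smul (of_nat (m choose j)) (cpow (\<lambda>t. f t - eps t) j t))"
proof (induction m arbitrary: t)
  case (Suc m)
  let ?a = "\<lambda>j. cpow (\<lambda>t. f t - eps t) j"
  have IH: "cpow f m = (\<lambda>t. \<Sum>j\<le>m. smul (of_nat (m choose j)) (?a j t))" using Suc by blast
  have "cpow f (Suc m) t = conv (\<lambda>t. (f t - eps t) + eps t) (cpow f m) t" by simp
  also have "\<dots> = conv (\<lambda>t. f t - eps t) (cpow f m) t + cpow f m t"
    unfolding conv_add_left by (simp add: conv_eps_left)
  also have "\<dots> = (\<Sum>j\<le>m. smul (of_nat (m choose j)) (?a (Suc j) t)) + (\<Sum>j\<le>m. smul (of_nat (m choose j)) (?a j t))"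
    unfolding IH conv_sum_right by simp
  also have "(\<Sum>j\<le>m. smul (of_nat (m choose j)) (?a j t)) = ?a 0 t + (\<Sum>j\<le>m. smul (of_nat (m choose Suc j)) (?a (Suc j) t))"
  proof -
    have "(\<Sum>j\<le>m. smul (of_nat (m choose j)) (?a j t)) = (\<Sum>j\<le>Suc m. smul (of_nat (m choose j)) (?a j t))"
      by (simp add: binomial_eq_0)
    then show ?thesis unfolding sum.atMost_Suc_shift by simp
  qed
  also have "(\<Sum>j\<le>m. smul (of_nat (m choose j)) (?a (Suc j) t)) + (?a 0 t + (\<Sum>j\<le>m. smul (of_nat (m choose Suc j)) (?a (Suc j) t)))
      = ?a 0 t + (\<Sum>j\<le>m. smul (of_nat (Suc m choose Suc j)) (?a (Suc j) t))"
    by (simp add: smul.scale_left_distrib sum.distrib add.commute add.left_commute del: cpow.simps)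
  also have "\<dots> = (\<Sum>j\<le>Suc m. smul (of_nat (Suc m choose j)) (?a j t))"
    unfolding sum.atMost_Suc_shift by simp
  finally show ?case .
qed simp

text \<open>Each of the \<open>j\<close> factors must receive a nonempty part of \<open>t\<close>,
  and their degrees add up to that of \<open>t\<close>.\<close>

lemma cpow_vanish:
  assumes "f empty_tree = 0" "tree_degree t < j"
  shows "cpow f j t = 0"
  using assms(2)
proof (induction j arbitrary: t)
  case (Suc j)
  have "mul (f (restrict_tree t \<chi>)) (cpow f j (restrict_tree t (compl_list \<chi>))) = 0"
    if \<chi>: "\<chi> \<in> tree_colorings t" for \<chi>
  proof (cases "restrict_tree t \<chi> = empty_tree")
    case False
    then have "0 < tree_degree (restrict_tree t \<chi>)" by (metis neq0_conv tree_degree_0_iff)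
    then have "tree_degree (restrict_tree t (compl_list \<chi>)) < j"
      using tree_degree_restrict_compl[OF \<chi>] Suc.prems by linarith
    then show ?thesis using Suc.IH by (simp add: lin_0[OF lin_right])
  qed (simp add: assms(1) lin_0[OF lin_left])
  then show ?case by (simp add: conv_def)
qed simp

text \<open>The range of summation is now independent of \<open>m\<close>. Thus the convolution
  powers are polynomial in \<open>m\<close>, and their linear coefficient is the logarithm.\<close>

lemma cpow_binomial_bound:
  assumes f: "f empty_tree = one" and N: "tree_degree t \<le> N"
  shows "cpow f m t = (\<Sum>j\<le>N. smul (of_nat (m choose j)) (cpow (\<lambda>t. f t - eps t) j t))"
proof -
  let ?s = "\<lambda>j. smul (of_nat (m choose j)) (cpow (\<lambda>t. f t - eps t) j t)"
  have "f empty_tree - eps empty_tree = 0" using f by (simp add: eps_def)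
  then have z: "?s j = 0" if "N < j" for j
    using cpow_vanish[of "\<lambda>t. f t - eps t" t j] N that by simp
  have "cpow f m t = (\<Sum>j\<le>m. ?s j)" by (rule cpow_binomial)
  also have "\<dots> = (\<Sum>j\<in>{..m} \<union> {..N}. ?s j)"
    by (rule sum.mono_neutral_left) (auto simp: binomial_eq_0)
  also have "\<dots> = (\<Sum>j\<le>N. ?s j)"
    by (rule sum.mono_neutral_right) (use z in \<open>auto simp: not_le\<close>)
  finally show ?thesis .
qed

end

lemma cpow_hom:
  assumes A: "tree_convolution mul one" and B: "tree_convolution mul' one'"
    and h: "lin smul smul h" "\<And>x y. h (mul x y) = mul' (h x) (h y)" "h one = one'"
  shows "h (tree_convolution.cpow mul one f m t) = tree_convolution.cpow mul' one' (\<lambda>t. h (f t)) m t"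
proof -
  interpret A: tree_convolution mul one by (rule A)
  interpret B: tree_convolution mul' one' by (rule B)
  show ?thesis
  proof (induction m arbitrary: t)
    case 0
    then show ?case by (simp add: A.eps_def B.eps_def h(3) lin_0[OF h(1)])
  next
    case (Suc m)
    then show ?case by (simp add: A.conv_def B.conv_def lin_sum[OF h(1)] h(2))
  qed
qed

interpretation T: tree_convolution "bilin_ext T_mult" "bas empty_tree"
  by unfold_locales (rule lin_bilin_ext_left lin_bilin_ext_right tmul_assoc tmul_one)+

interpretation T2: tree_convolution "\<lambda>x y. x \<odot>\<odot> y" "bas (empty_tree, empty_tree)"
  by unfold_locales (rule lin_bilin_ext_left lin_bilin_ext_right tmul2_assoc tmul2_one)+

subsection \<open>The coproduct is multiplicative\<close>

definition tree_pairs :: "ho_tree \<Rightarrow> (ho_tree \<times> ho_tree \<Rightarrow>\<^sub>0 'k::field)" where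
  "tree_pairs t = (\<Sum>\<chi>\<in>tree_colorings t. bas (restrict_tree t \<chi>, restrict_tree t (compl_list \<chi>)))"

abbreviation Delta :: "(ho_tree \<Rightarrow>\<^sub>0 'k::field) \<Rightarrow> (ho_tree \<times> ho_tree \<Rightarrow>\<^sub>0 'k)" where
  "Delta \<equiv> lin_ext smul tree_pairs"

lemma lin_ten_sum: "ten (\<Sum>i\<in>A. f i) (\<Sum>j\<in>B. g j) = (\<Sum>i\<in>A. \<Sum>j\<in>B. ten (f i) (g j))"
  by (simp add: lin_sum[OF lin_ten_left] lin_sum[OF lin_ten_right]) (rule sum.swap)

text \<open>On basis trees this is \<open>sum_grafts_colorings\<close>, once the inner sums over
  graft words are recognized as products of the restricted trees.\<close>

lemma Delta_mult: "Delta (x \<odot> y) = Delta x \<odot>\<odot> (Delta y :: _ \<Rightarrow>\<^sub>0 'k::field)"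
proof -
  have basis: "Delta (T_mult t u) = tree_pairs t \<odot>\<odot> (tree_pairs u :: _ \<Rightarrow>\<^sub>0 'k)" for t u
  proof -
    let ?y = "code u" and ?x = "code t"
    let ?F = "\<lambda>a b. bas (decode a, decode b) :: _ \<Rightarrow>\<^sub>0 'k"
    have "Delta (T_mult t u) = (\<Sum>z\<in>grafts (length ?y) ?x. \<Sum>\<chi>\<in>colorings (?y @ z).
        ?F (restrict_list (?y @ z) \<chi>) (restrict_list (?y @ z) (compl_list \<chi>)))"
      by (simp add: T_mult_eq lin_sum[OF lin_lin_ext_smul] tree_pairs_def restrict_tree_def code_decode_grafts)
    also have "\<dots> = (\<Sum>\<chi>'\<in>colorings ?x. \<Sum>\<chi>\<in>colorings ?y.
       \<Sum>z1\<in>grafts (length (restrict_list ?y \<chi>)) (restrict_list ?x \<chi>').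
       \<Sum>z2\<in>grafts (length (restrict_list ?y (compl_list \<chi>))) (restrict_list ?x (compl_list \<chi>')).
       ?F (restrict_list ?y \<chi> @ z1) (restrict_list ?y (compl_list \<chi>) @ z2))"
      by (rule sum_grafts_colorings) (rule parent_list_code)+
    also have "\<dots> = (\<Sum>\<chi>'\<in>colorings ?x. \<Sum>\<chi>\<in>colorings ?y.
        ten (T_mult (restrict_tree t \<chi>') (restrict_tree u \<chi>))
          (T_mult (restrict_tree t (compl_list \<chi>')) (restrict_tree u (compl_list \<chi>))))"
    proof (intro sum.cong refl)
      fix \<chi>' \<chi> :: "bool list" assume \<chi>: "\<chi>' \<in> colorings ?x" "\<chi> \<in> colorings ?y"
      note c = code_restrict_tree[OF \<chi>(1)] code_restrict_tree[OF \<chi>(2)]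
        code_restrict_tree[OF compl_in_colorings[OF \<chi>(1)]] code_restrict_tree[OF compl_in_colorings[OF \<chi>(2)]]
      show "(\<Sum>z1\<in>grafts (length (restrict_list ?y \<chi>)) (restrict_list ?x \<chi>').
       \<Sum>z2\<in>grafts (length (restrict_list ?y (compl_list \<chi>))) (restrict_list ?x (compl_list \<chi>')).
       ?F (restrict_list ?y \<chi> @ z1) (restrict_list ?y (compl_list \<chi>) @ z2)) =
        ten (T_mult (restrict_tree t \<chi>') (restrict_tree u \<chi>))
          (T_mult (restrict_tree t (compl_list \<chi>')) (restrict_tree u (compl_list \<chi>)))"
        unfolding T_mult_eq length_code[symmetric] c lin_ten_sum ten_bas ..
    qed
    also have "\<dots> = tree_pairs t \<odot>\<odot> tree_pairs u"
      unfolding tree_pairs_def lin_sum[OF lin_bilin_ext_left] lin_sum[OF lin_bilin_ext_right]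
      by simp (rule sum.swap)
    finally show ?thesis .
  qed
  show ?thesis
  proof (induction x rule: free_induct)
    case (bas a)
    show ?case
      by (induction y rule: free_induct) (simp_all add: bilin_ext_simps lin_ext_smul_simps basis)
  qed (simp_all add: bilin_ext_simps lin_ext_smul_simps)
qed

lemma Delta_one: "Delta (bas empty_tree) = bas (empty_tree, empty_tree)"
  by (simp add: tree_pairs_def restrict_tree_def) (metis code_empty decode_code)

subsection \<open>The first Eulerian idempotent\<close>

abbreviation J :: "ho_tree \<Rightarrow> (ho_tree \<Rightarrow>\<^sub>0 'k::field)" where
  "J t \<equiv> bas t - T.eps t"

section \<open>Binomial coefficients as polynomials\<close>

definition binomial_poly :: "nat \<Rightarrow> 'k::field_char_0 poly" where
  "binomial_poly j = smult (1 / fact j) (\<Prod>i<j. [:- of_nat i, 1:])"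

lemma poly_binomial_poly: "poly (binomial_poly j) (of_nat m) = (of_nat (m choose j) :: 'k::field_char_0)"
proof -
  have "(of_nat (m choose j) :: 'k) = of_nat m gchoose j" by (rule binomial_gbinomial)
  also have "\<dots> = (\<Prod>i = 0..<j. of_nat m - of_nat i) / fact j" by (rule gbinomial_prod_rev)
  finally show ?thesis by (simp add: binomial_poly_def poly_prod atLeast0LessThan)
qed

text \<open>The coefficient of the j-th power of x in log(1 + x), which is also the linear
  coefficient in m of the binomial coefficient m over j.\<close>

definition log_coeff :: "nat \<Rightarrow> 'k::field_char_0" where
  "log_coeff j = (if j = 0 then 0 else (- 1) ^ (j - 1) / of_nat j)"

lemma coeff_binomial_poly:
  "coeff (binomial_poly j) 0 = (if j = 0 then 1 else 0 :: 'k::field_char_0)"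
  "coeff (binomial_poly j) (Suc 0) = (log_coeff j :: 'k)"
proof -
  show "coeff (binomial_poly j) 0 = (if j = 0 then 1 else 0 :: 'k)"
    unfolding poly_0_coeff_0[symmetric] using poly_binomial_poly[of j 0] by (cases j) auto
  show "coeff (binomial_poly j) (Suc 0) = (log_coeff j :: 'k)"
  proof (cases j)
    case (Suc n)
    let ?p = "\<Prod>i<n. [:- of_nat (Suc i), 1:] :: 'k poly"
    have "coeff ?p 0 = (\<Prod>i<n. - of_nat (Suc i))"
      unfolding poly_0_coeff_0[symmetric] poly_prod by simp
    also have "\<dots> = (- 1) ^ n * fact n"
      by (induction n) (simp_all add: algebra_simps)
    finally have p: "coeff ?p 0 = (- 1) ^ n * fact n" .
    have "(\<Prod>i<j. [:- of_nat i, 1:]) = pCons 0 ?p" unfolding Suc prod.lessThan_Suc_shift by simp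
    then have "coeff (binomial_poly j) (Suc 0) = (1 / fact j) * ((- 1) ^ n * fact n :: 'k)"
      using p by (simp add: binomial_poly_def)
    then show ?thesis by (simp add: log_coeff_def Suc field_simps del: of_nat_Suc)
  qed (simp add: binomial_poly_def log_coeff_def)
qed

text \<open>In characteristic 0 the natural numbers are infinitely many points, so the hypothesis is
  an identity of polynomials in \<open>m\<close>. A binomial polynomial of positive index has no
  constant term, so a product of two contributes to the linear coefficient only if one of the
  indices is 0.\<close>

lemma linear_coeff_eq:
  fixes a :: "nat \<Rightarrow> 'k::field_char_0"
  assumes "\<And>m. (\<Sum>j\<le>N. of_nat (m choose j) * a j) = (\<Sum>i\<le>N. \<Sum>j\<le>N. of_nat (m choose i) * of_nat (m choose j) * b i j)"
  shows "(\<Sum>j\<le>N. log_coeff j * a j) = (\<Sum>i\<le>N. log_coeff i * b i 0) + (\<Sum>j\<le>N. log_coeff j * b 0 j)"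
proof -
  let ?P = "\<Sum>j\<le>N. smult (a j) (binomial_poly j)"
  let ?Q = "\<Sum>i\<le>N. \<Sum>j\<le>N. smult (b i j) (binomial_poly i * binomial_poly j)"
  have "poly (?P - ?Q) (of_nat m) = 0" for m
    using assms[of m] by (simp add: poly_sum poly_binomial_poly mult.commute)
  then have "range (of_nat :: nat \<Rightarrow> 'k) \<subseteq> {x. poly (?P - ?Q) x = 0}" by auto
  moreover have "infinite (range (of_nat :: nat \<Rightarrow> 'k))" by (simp add: finite_image_iff inj_of_nat)
  ultimately have "?P - ?Q = 0" using poly_roots_finite finite_subset by blast
  then have "coeff ?P (Suc 0) = coeff ?Q (Suc 0)" by simp
  moreover have "coeff ?P (Suc 0) = (\<Sum>j\<le>N. log_coeff j * a j)"
    by (simp add: coeff_sum coeff_binomial_poly mult.commute)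
  moreover have "coeff ?Q (Suc 0) = (\<Sum>i\<le>N. log_coeff i * b i 0) + (\<Sum>j\<le>N. log_coeff j * b 0 j)"
  proof -
    have "coeff (binomial_poly i * binomial_poly j) (Suc 0) =
       (if i = 0 then log_coeff j else 0) + (if j = 0 then log_coeff i else 0 :: 'k)" for i j
      by (simp add: coeff_mult coeff_binomial_poly)
    then have "coeff ?Q (Suc 0) = (\<Sum>i\<le>N. \<Sum>j\<le>N. (if i = 0 then log_coeff j * b 0 j else 0) + (if j = 0 then log_coeff i * b i 0 else 0))"
      by (auto simp: coeff_sum distrib_left mult.commute intro!: sum.cong)
    also have "\<dots> = (\<Sum>i\<le>N. if i = 0 then (\<Sum>j\<le>N. log_coeff j * b 0 j) else 0) + (\<Sum>i\<le>N. log_coeff i * b i 0)"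
      unfolding sum.distrib by (intro arg_cong2[of _ _ _ _ "(+)"] sum.cong) auto
    finally show ?thesis by (simp add: add.commute)
  qed
  ultimately show ?thesis by simp
qed

definition euler :: "ho_tree \<Rightarrow> (ho_tree \<Rightarrow>\<^sub>0 'k::field_char_0)" where
  "euler t = (\<Sum>j\<le>tree_degree t. smul (log_coeff j) (T.cpow J j t))"

lemma J_empty: "J empty_tree = 0"
  by (simp add: T.eps_def)

lemma cpow_J_vanish: "tree_degree t < j \<Longrightarrow> T.cpow J j t = 0"
  by (rule T.cpow_vanish) (rule J_empty)

lemma conv_power_bas: "conv_power H_HO (\<lambda>y. y - conv_unit H_HO y) n (bas t) = T.cpow J n t"
proof (induction n arbitrary: t)
  case 0
  show ?case by (simp add: conv_unit_def T.eps_def lookup_single when_def)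
next
  case (Suc n)
  have J: "bas t - conv_unit H_HO (bas t) = J t" for t
    by (simp add: conv_unit_def T.eps_def lookup_single when_def)
  show ?case
    by (simp add: convolution_def T_comult_restrict_tree lin_sum[OF lin_lin_ext_smul] J Suc T.conv_def)
qed

lemma eulerian_idem_bas: "eulerian_idem H_HO (bas t) = euler t"
proof -
  let ?g = "\<lambda>n. smul ((- 1) ^ n / of_nat (Suc n)) (T.cpow J (Suc n) t)"
  have "eulerian_idem H_HO (bas t) = Sum_any ?g"
    unfolding eulerian_idem_def conv_power_bas by simp
  also have "\<dots> = (\<Sum>n<tree_degree t. ?g n)"
    by (rule Sum_any.expand_superset) (auto simp: cpow_J_vanish not_less simp del: T.cpow.simps intro: ccontr)
  also have "\<dots> = (\<Sum>n<tree_degree t. smul (log_coeff (Suc n)) (T.cpow J (Suc n) t))"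
    by (simp add: log_coeff_def)
  also have "\<dots> = euler t"
    unfolding euler_def lessThan_Suc_atMost[symmetric] sum.lessThan_Suc_shift by (simp add: log_coeff_def)
  finally show ?thesis .
qed

text \<open>The coproduct is the convolution product of the two commuting inclusions \<open>t \<mapsto> t \<otimes> 1\<close> and
  \<open>t \<mapsto> 1 \<otimes> t\<close>; hence it maps the \<open>m\<close>-th convolution power of the identity to the product of
  the \<open>m\<close>-th powers of the inclusions, and logarithms are compared as linear coefficients in \<open>m\<close>.\<close>

theorem Delta_euler:
  "Delta (euler t) = ten (euler t) (bas empty_tree) + ten (bas empty_tree) (euler t :: _ \<Rightarrow>\<^sub>0 'k::field_char_0)"
proof -
  let ?e = "bas empty_tree :: ho_tree \<Rightarrow>\<^sub>0 'k"
  define i1 :: "ho_tree \<Rightarrow> _ \<Rightarrow>\<^sub>0 'k" where "i1 = (\<lambda>t. ten (bas t) ?e)"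
  define i2 :: "ho_tree \<Rightarrow> _ \<Rightarrow>\<^sub>0 'k" where "i2 = (\<lambda>t. ten ?e (bas t))"
  note ax = T.tree_convolution_axioms T2.tree_convolution_axioms
  have h1: "ten (T.cpow f m u) ?e = T2.cpow (\<lambda>t. ten (f t) ?e) m u" for f m u
    by (rule cpow_hom[OF ax, of "\<lambda>x. ten x ?e"]) (simp_all add: lin_ten_left tmul2_ten)
  have h2: "ten ?e (T.cpow f m u) = T2.cpow (\<lambda>t. ten ?e (f t)) m u" for f m u
    by (rule cpow_hom[OF ax, of "ten ?e"]) (simp_all add: lin_ten_right tmul2_ten)
  have hD: "Delta (T.cpow f m u :: _ \<Rightarrow>\<^sub>0 'k) = T2.cpow (\<lambda>t. Delta (f t)) m u" for f m u
    by (rule cpow_hom[OF ax, of Delta]) (rule lin_lin_ext_smul Delta_mult Delta_one)+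
  have comm: "T2.conv i1 i2 = T2.conv i2 i1"
    by (rule T2.conv_commute) (simp add: i1_def i2_def tmul2_ten del: ten_bas)
  have D: "(\<lambda>t. Delta (bas t)) = T2.conv i1 i2"
    by (rule ext) (simp add: T2.conv_def tree_pairs_def i1_def i2_def)
  have pow: "Delta (T.cpow bas m t :: _ \<Rightarrow>\<^sub>0 'k) = T2.conv (T2.cpow i1 m) (T2.cpow i2 m) t" for m
    unfolding hD D by (rule fun_cong[OF T2.cpow_conv[OF comm]])
  let ?N = "tree_degree t"
  have expand: "(T.cpow bas m u :: _ \<Rightarrow>\<^sub>0 'k) = (\<Sum>j\<le>?N. smul (of_nat (m choose j)) (T.cpow J j u))"
    if "tree_degree u \<le> ?N" for m u
    using that by (intro T.cpow_binomial_bound) auto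
  \<comment> \<open>The coefficient of the product of the i-th and j-th binomials in the expansion
    of the product of the two inclusion powers.\<close>
  define b where "b = (\<lambda>i j. \<Sum>\<chi>\<in>tree_colorings t. ten (T.cpow J i (restrict_tree t \<chi>)) ?e \<odot>\<odot>
      ten ?e (T.cpow J j (restrict_tree t (compl_list \<chi>))))"
  have sub: "tree_degree (restrict_tree t \<chi>) \<le> ?N" "tree_degree (restrict_tree t (compl_list \<chi>)) \<le> ?N"
    if "\<chi> \<in> tree_colorings t" for \<chi>
    using tree_degree_restrict_compl[OF that] by auto
  have i1: "T2.cpow i1 m u = (\<Sum>j\<le>?N. smul (of_nat (m choose j)) (ten (T.cpow J j u) ?e))"
    and i2: "T2.cpow i2 m u = (\<Sum>j\<le>?N. smul (of_nat (m choose j)) (ten ?e (T.cpow J j u)))"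
    if "tree_degree u \<le> ?N" for m u
    unfolding i1_def i2_def h1[symmetric] h2[symmetric] expand[OF that]
    by (simp_all only: lin_sum[OF lin_ten_left] lin_scale[OF lin_ten_left] lin_sum[OF lin_ten_right] lin_scale[OF lin_ten_right])
  \<comment> \<open>The image under \<open>Delta\<close> of the m-th convolution power of the
    identity, expanded on the left through powers of \<open>J\<close> and on the right through both
    inclusions.\<close>
  have key: "(\<Sum>j\<le>?N. smul (of_nat (m choose j)) (Delta (T.cpow J j t))) =
      (\<Sum>i\<le>?N. \<Sum>j\<le>?N. smul (of_nat (m choose i) * of_nat (m choose j)) (b i j))" for m
  proof -
    have "(\<Sum>j\<le>?N. smul (of_nat (m choose j)) (Delta (T.cpow J j t))) = Delta (T.cpow bas m t :: _ \<Rightarrow>\<^sub>0 'k)"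
      unfolding expand[OF order_refl] lin_sum[OF lin_lin_ext_smul] lin_scale[OF lin_lin_ext_smul] ..
    also have "\<dots> = (\<Sum>\<chi>\<in>tree_colorings t. \<Sum>i\<le>?N. \<Sum>j\<le>?N. smul (of_nat (m choose i) * of_nat (m choose j))
        (ten (T.cpow J i (restrict_tree t \<chi>)) ?e \<odot>\<odot> ten ?e (T.cpow J j (restrict_tree t (compl_list \<chi>)))))"
      unfolding pow T2.conv_def
    proof (rule sum.cong[OF refl])
      fix \<chi> assume \<chi>: "\<chi> \<in> tree_colorings t"
      show "T2.cpow i1 m (restrict_tree t \<chi>) \<odot>\<odot> T2.cpow i2 m (restrict_tree t (compl_list \<chi>)) =
        (\<Sum>i\<le>?N. \<Sum>j\<le>?N. smul (of_nat (m choose i) * of_nat (m choose j))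
        (ten (T.cpow J i (restrict_tree t \<chi>)) ?e \<odot>\<odot> ten ?e (T.cpow J j (restrict_tree t (compl_list \<chi>)))))"
        unfolding i1[OF sub(1)[OF \<chi>]] i2[OF sub(2)[OF \<chi>]] lin_sum[OF lin_bilin_ext_left] lin_sum[OF lin_bilin_ext_right]
          lin_scale[OF lin_bilin_ext_left] lin_scale[OF lin_bilin_ext_right] smul.scale_sum_right smul.scale_scale
        by (subst sum.swap) (simp add: mult.commute)
    qed
    also have "\<dots> = (\<Sum>i\<le>?N. \<Sum>j\<le>?N. smul (of_nat (m choose i) * of_nat (m choose j)) (b i j))"
      unfolding b_def smul.scale_sum_right
      by (subst sum.swap) (intro sum.cong refl sum.swap)
    finally show ?thesis .
  qed
  have "(\<Sum>j\<le>?N. smul (log_coeff j) (Delta (T.cpow J j t))) =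
      (\<Sum>i\<le>?N. smul (log_coeff i) (b i 0)) + (\<Sum>j\<le>?N. smul (log_coeff j) (b 0 j))"
  proof (rule poly_mapping_eqI)
    fix uv
    have "(\<Sum>j\<le>?N. of_nat (m choose j) * Poly_Mapping.lookup (Delta (T.cpow J j t)) uv) =
      (\<Sum>i\<le>?N. \<Sum>j\<le>?N. of_nat (m choose i) * of_nat (m choose j) * Poly_Mapping.lookup (b i j) uv)" for m
      using arg_cong[OF key[of m], of "\<lambda>x. Poly_Mapping.lookup x uv"] by (simp add: lookup_sum)
    from linear_coeff_eq[OF this]
    show "Poly_Mapping.lookup (\<Sum>j\<le>?N. smul (log_coeff j) (Delta (T.cpow J j t))) uv =
      Poly_Mapping.lookup ((\<Sum>i\<le>?N. smul (log_coeff i) (b i 0)) + (\<Sum>j\<le>?N. smul (log_coeff j) (b 0 j))) uv"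
      by (simp add: lookup_sum lookup_add)
  qed
  \<comment> \<open>The zeroth power of \<open>J\<close> is the convolution unit, so this sum is a
    convolution with the unit.\<close>
  moreover have "b i 0 = ten (T.cpow J i t) ?e" for i
  proof -
    have "(\<lambda>t. ten ?e (T.eps t)) = T2.eps" by (rule ext) (simp add: T.eps_def T2.eps_def lin_0[OF lin_ten_right])
    then have "b i 0 = T2.conv (\<lambda>t. ten (T.cpow J i t) ?e) T2.eps t"
      unfolding b_def T2.conv_def by (simp add: fun_eq_iff)
    then show ?thesis by (simp add: T2.conv_eps_right)
  qed
  moreover have "b 0 j = ten ?e (T.cpow J j t)" for j
  proof -
    have "(\<lambda>t. ten (T.eps t) ?e) = T2.eps" by (rule ext) (simp add: T.eps_def T2.eps_def lin_0[OF lin_ten_left])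
    then have "b 0 j = T2.conv T2.eps (\<lambda>t. ten ?e (T.cpow J j t)) t"
      unfolding b_def T2.conv_def by (simp add: fun_eq_iff)
    then show ?thesis by (simp add: T2.conv_eps_left)
  qed
  ultimately show ?thesis
    unfolding euler_def lin_sum[OF lin_lin_ext_smul] lin_scale[OF lin_lin_ext_smul]
      lin_sum[OF lin_ten_left] lin_scale[OF lin_ten_left] lin_sum[OF lin_ten_right] lin_scale[OF lin_ten_right]
    by simp
qed

section \<open>Products of the primitive elements\<close>

definition euler_prod :: "perm list \<Rightarrow> (ho_tree \<Rightarrow>\<^sub>0 'k::field_char_0)" where
  "euler_prod ws = foldr (\<lambda>w x. euler (phi w) \<odot> x) ws (bas empty_tree)"

lemma euler_prod_simps [simp]:
  "euler_prod [] = bas empty_tree" "euler_prod (w # ws) = euler (phi w) \<odot> euler_prod ws"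
  by (simp_all add: euler_prod_def)

lemma euler_prod_append: "euler_prod (us @ vs) = euler_prod us \<odot> euler_prod vs"
  by (induction us) (simp_all add: tmul_assoc)

text \<open>Each primitive factor goes to the left or to the right tensor slot, which is the rule
  generating \<open>unshuffles\<close>; the same rule describes the dual coproduct.\<close>

lemma Delta_euler_prod:
  "Delta (euler_prod ws) = (\<Sum>(p, q)\<leftarrow>unshuffles ws. ten (euler_prod p) (euler_prod q :: _ \<Rightarrow>\<^sub>0 'k::field_char_0))"
proof (induction ws)
  case (Cons w ws)
  let ?e = "euler (phi w) :: _ \<Rightarrow>\<^sub>0 'k" and ?u = "bas empty_tree :: _ \<Rightarrow>\<^sub>0 'k"
  let ?S = "\<Sum>z\<leftarrow>unshuffles ws. ten (euler_prod (fst z)) (euler_prod (snd z)) :: _ \<Rightarrow>\<^sub>0 'k"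
  have "Delta (euler_prod (w # ws)) = (ten ?e ?u + ten ?u ?e) \<odot>\<odot> ?S"
    using Cons by (simp add: Delta_mult Delta_euler case_prod_unfold)
  also have "\<dots> = (\<Sum>z\<leftarrow>unshuffles ws. ten ?e ?u \<odot>\<odot> ten (euler_prod (fst z)) (euler_prod (snd z))) +
      (\<Sum>z\<leftarrow>unshuffles ws. ten ?u ?e \<odot>\<odot> ten (euler_prod (fst z)) (euler_prod (snd z)))"
    unfolding lin_add[OF lin_bilin_ext_left] by (simp add: lin_sum_list[OF lin_bilin_ext_right] o_def)
  finally show ?case by (simp add: tmul2_ten case_prod_unfold o_def)
qed (use Delta_one in simp)

subsection \<open>Triangularity\<close>

text \<open>Trees are compared by the number of root components first, and then by the number of
  irreducible components of the corresponding permutation.\<close>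

definition root_degree :: "ho_tree \<Rightarrow> nat" where
  "root_degree t = length (filter (\<lambda>p. p = 0) (code t))"

definition tree_components :: "ho_tree \<Rightarrow> nat" where
  "tree_components t = num_components (inv phi t)"

definition below :: "nat \<Rightarrow> nat \<Rightarrow> nat \<Rightarrow> (ho_tree \<Rightarrow>\<^sub>0 'k::field) set" where
  "below n r k = {x. \<forall>t\<in>Poly_Mapping.keys x. tree_degree t = n \<and>
     (root_degree t < r \<or> root_degree t = r \<and> k \<le> tree_components t)}"

lemma tree_components_phi [simp]: "tree_components (phi w) = num_components w"
  by (simp add: tree_components_def inv_f_f bij_is_inj bij_phi)

lemma root_degree_empty [simp]: "root_degree empty_tree = 0"
  by (simp add: root_degree_def)

lemma tree_components_eq_0_iff: "tree_components t = 0 \<longleftrightarrow> t = empty_tree"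
proof -
  obtain w where "t = phi w" using phi_surj by metis
  then show ?thesis using phi_inject[of w perm_empty] by (simp add: phi_empty)
qed

lemma num_components_le_psize: "num_components w \<le> psize w"
proof -
  have "length ws \<le> psize (backslash_list ws)" if "perm_empty \<notin> set ws" for ws
    using that
  proof (induction ws)
    case (Cons w ws)
    then have "psize w \<noteq> 0" "length ws \<le> psize (backslash_list ws)" by auto
    then show ?case unfolding list.size backslash_list_simps psize_backslash by linarith
  qed simp
  from this[of "components w"] show ?thesis
    using components_irreducible perm_irreducible_nonempty by (fastforce simp: num_components_eq)
qed

lemma tree_components_le: "tree_components t \<le> tree_degree t"
proof -
  obtain w where "t = phi w" using phi_surj by metis
  then show ?thesis using num_components_le_psize[of w] by (simp add: phi_props)
qed

lemma below_0: "0 \<in> below n r k"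
  by (simp add: below_def)

lemma below_add: "x \<in> below n r k \<Longrightarrow> y \<in> below n r k \<Longrightarrow> x + y \<in> below n r k"
  using keys_add[of x y] by (auto simp: below_def)

lemma below_smul: "x \<in> below n r k \<Longrightarrow> smul c x \<in> below n r k"
  by (auto simp: below_def in_keys_iff)

lemma below_sum: "(\<And>i. i \<in> I \<Longrightarrow> f i \<in> below n r k) \<Longrightarrow> sum f I \<in> below n r k"
  by (induction I rule: infinite_finite_induct) (auto intro: below_0 below_add)

lemma below_mono: "x \<in> below n r k \<Longrightarrow> k' \<le> k \<Longrightarrow> x \<in> below n r k'"
  by (auto simp: below_def)

lemma bas_below: "bas t \<in> below (tree_degree t) (root_degree t) (tree_components t)"
  by (simp add: below_def)

text \<open>The summand of the product in which all components of \<open>a\<close> are attached to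
  the root of \<open>b\<close>.\<close>

definition tree_join :: "ho_tree \<Rightarrow> ho_tree \<Rightarrow> ho_tree" where
  "tree_join a b = decode (code b @ shift_parents (tree_degree b) (code a))"

lemma tree_join_phi: "tree_join (phi u) (phi v) = phi (backslash u v)"
  using decode_code[of "phi (backslash u v)"] by (simp add: tree_join_def code_phi_backslash phi_props)

lemma shift_parents_in_grafts: "shift_parents q x \<in> grafts q x"
  by (simp add: in_grafts_iff shift_parents_def)

lemma code_tree_join: "code (tree_join a b) = code b @ shift_parents (tree_degree b) (code a)"
  unfolding tree_join_def by (rule code_decode_grafts) (rule shift_parents_in_grafts)

lemma tree_join_props:
  "tree_degree (tree_join a b) = tree_degree a + tree_degree b"
  "root_degree (tree_join a b) = root_degree a + root_degree b"
  "tree_components (tree_join a b) = tree_components a + tree_components b"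
proof -
  show "tree_degree (tree_join a b) = tree_degree a + tree_degree b"
    using arg_cong[OF code_tree_join[of a b], of length] by (simp add: shift_parents_def)
  have "filter (\<lambda>p. p = 0) (shift_parents q x) = shift_parents q (filter (\<lambda>p. p = 0) x)" for q x
    by (induction x) (auto simp: shift_parents_def)
  then show "root_degree (tree_join a b) = root_degree a + root_degree b"
    by (simp add: root_degree_def code_tree_join) (simp add: shift_parents_def)
  obtain u v where "a = phi u" "b = phi v" using phi_surj by metis
  then show "tree_components (tree_join a b) = tree_components a + tree_components b"
    by (simp add: tree_join_phi)
qed

text \<open>Any other graft word sends some root component of \<open>a\<close> to a non-root node,
  so the root loses a branch. The strict drop in root degree allows an arbitrary
  \<open>k\<close>.\<close>

lemma T_mult_leading:
  "T_mult a b - (bas (tree_join a b) :: _ \<Rightarrow>\<^sub>0 'k::field) \<in> below (tree_degree a + tree_degree b) (root_degree a + root_degree b) k"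
proof -
  let ?x = "code a" and ?q = "tree_degree b"
  let ?G = "grafts ?q ?x" and ?s = "shift_parents ?q ?x"
  have "T_mult a b - (bas (tree_join a b) :: _ \<Rightarrow>\<^sub>0 'k) = (\<Sum>z\<in>?G - {?s}. bas (decode (code b @ z)))"
    using sum.remove[OF finite_grafts shift_parents_in_grafts, of "\<lambda>z. bas (decode (code b @ z)) :: _ \<Rightarrow>\<^sub>0 'k" ?q ?x]
    by (simp add: T_mult_eq tree_join_def)
  also have "\<dots> \<in> below (tree_degree a + tree_degree b) (root_degree a + root_degree b) k"
  proof (rule below_sum)
    fix z assume "z \<in> ?G - {?s}"
    then have z: "z \<in> ?G" "z \<noteq> ?s" by auto
    have c: "code (decode (code b @ z)) = code b @ z" by (rule code_decode_grafts[OF z(1)])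
    have len: "length z = length ?x" using length_grafts[OF z(1)] .
    have deg: "tree_degree (decode (code b @ z)) = tree_degree a + tree_degree b"
      using arg_cong[OF c, of length] len by simp
    have "\<exists>j<length z. z ! j \<noteq> ?s ! j"
      using z(2) len by (auto simp: list_eq_iff_nth_eq shift_parents_def)
    then obtain j where j: "j < length ?x" "z ! j \<noteq> ?s ! j" using len by auto
    then have j0: "?x ! j = 0" "z ! j \<noteq> 0" using z(1) by (auto simp: in_grafts_iff shift_parents_def split: if_splits)
    have "{i. i < length z \<and> z ! i = 0} \<subseteq> {i. i < length ?x \<and> ?x ! i = 0}"
      using z(1) by (auto simp: in_grafts_iff split: if_splits)
    moreover have "j \<in> {i. i < length ?x \<and> ?x ! i = 0}" "j \<notin> {i. i < length z \<and> z ! i = 0}"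
      using j j0 by auto
    ultimately have "{i. i < length z \<and> z ! i = 0} \<subset> {i. i < length ?x \<and> ?x ! i = 0}" by blast
    then have "card {i. i < length z \<and> z ! i = 0} < card {i. i < length ?x \<and> ?x ! i = 0}"
      by (intro psubset_card_mono) auto
    then have "root_degree (decode (code b @ z)) < root_degree a + root_degree b"
      by (simp add: root_degree_def c length_filter_conv_card)
    then show "(bas (decode (code b @ z)) :: _ \<Rightarrow>\<^sub>0 'k) \<in> below (tree_degree a + tree_degree b) (root_degree a + root_degree b) k"
      by (simp add: below_def deg)
  qed
  finally show ?thesis .
qed

text \<open>Root degree and number of components are additive on the join of two trees, and the
  remaining terms of the product have smaller root degree.\<close>

lemma below_mult:
  assumes x: "x \<in> below n r k" and y: "y \<in> below n' r' k'"
  shows "x \<odot> y \<in> below (n + n') (r + r') (k + k')"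
proof -
  have "T_mult a b \<in> below (n + n') (r + r') (k + k')"
    if a: "a \<in> Poly_Mapping.keys x" and b: "b \<in> Poly_Mapping.keys y" for a b
  proof -
    have a': "tree_degree a = n" "root_degree a < r \<or> root_degree a = r \<and> k \<le> tree_components a"
      and b': "tree_degree b = n'" "root_degree b < r' \<or> root_degree b = r' \<and> k' \<le> tree_components b"
      using a b x y by (auto simp: below_def)
    have "bas (tree_join a b) \<in> below (n + n') (r + r') (k + k')"
      using a' b' by (auto simp: below_def tree_join_props)
    moreover have "T_mult a b - bas (tree_join a b) \<in> below (n + n') (r + r') (k + k')"
      using T_mult_leading[of a b "k + k'"] a' b' by (auto simp: below_def)
    ultimately have "(T_mult a b - bas (tree_join a b)) + bas (tree_join a b) \<in> below (n + n') (r + r') (k + k')"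
      by (intro below_add)
    then show ?thesis by simp
  qed
  then show ?thesis
    unfolding bilin_ext_def lin_ext_def by (intro below_sum below_smul)
qed

text \<open>Every root component goes to exactly one side, and a kept node with a non-root parent
  keeps a non-root parent, as that parent has the same color.\<close>

lemma root_degree_restrict:
  assumes "\<chi> \<in> tree_colorings t"
  shows "root_degree (restrict_tree t \<chi>) + root_degree (restrict_tree t (compl_list \<chi>)) = root_degree t"
proof -
  let ?z = "\<lambda>l :: nat list. length (filter (\<lambda>p. p = 0) l)"
  have "?z (restrict_list x \<chi>) + ?z (restrict_list x (compl_list \<chi>)) = ?z x"
    if "parent_list x" "\<chi> \<in> colorings x" for x \<chi>
    using that
  proof (induction x arbitrary: \<chi> rule: parent_list_induct)
    case (snoc x p)
    then obtain \<chi>' b where \<chi>: "\<chi> = \<chi>' @ [b]" and l: "length \<chi>' = length x"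
      using length_colorings[OF snoc.prems] by (cases \<chi> rule: rev_cases) auto
    have c: "\<chi>' \<in> colorings x" "0 < p \<Longrightarrow> b = \<chi>' ! (p - 1)"
      using snoc.prems snoc_in_colorings_iff[OF snoc(1,2) l, of b] \<chi> by auto
    have z: "count_true \<chi>' p = 0 \<longleftrightarrow> p = 0" if b
      using count_true_pos[of p \<chi>'] c(2) that l snoc(2) by (cases "p = 0") auto
    have z': "count_true (compl_list \<chi>') p = 0 \<longleftrightarrow> p = 0" if "\<not> b"
      using count_true_pos[of p "compl_list \<chi>'"] c(2) that l snoc(2) by (cases "p = 0") auto
    show ?case
      using snoc.IH[OF c(1)] restrict_list_snoc[OF snoc(1) l snoc(2), of b]
        restrict_list_snoc[OF snoc(1) _ snoc(2), of "compl_list \<chi>'" "\<not> b"] l z z'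
      by (cases b) (simp_all add: \<chi>)
  qed simp
  from this[OF parent_list_code assms] show ?thesis
    using code_restrict_tree[OF assms] code_restrict_tree[OF compl_in_colorings[OF assms]]
    by (simp add: root_degree_def)
qed

lemma J_below: "J t \<in> below (tree_degree t) (root_degree t) 1"
proof (cases "t = empty_tree")
  case False
  then have "1 \<le> tree_components t" using tree_components_eq_0_iff[of t] by (cases "tree_components t") auto
  then show ?thesis using below_mono[OF bas_below] False by (simp add: T.eps_def)
qed (simp add: T.eps_def below_0)

text \<open>\<open>J\<close> vanishes on the empty tree, so each of the \<open>j\<close> convolution
  factors contributes at least one irreducible component.\<close>

lemma cpow_J_below: "(T.cpow J j t :: _ \<Rightarrow>\<^sub>0 'k::field) \<in> below (tree_degree t) (root_degree t) j"
proof (induction j arbitrary: t)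
  case 0
  show ?case using bas_below[of t, where 'a = 'k] by (auto simp: T.eps_def below_0 below_def)
next
  case (Suc j)
  have "(J (restrict_tree t \<chi>) :: _ \<Rightarrow>\<^sub>0 'k) \<odot> T.cpow J j (restrict_tree t (compl_list \<chi>)) \<in>
      below (tree_degree t) (root_degree t) (Suc j)" if "\<chi> \<in> tree_colorings t" for \<chi>
    using below_mult[OF J_below Suc.IH, of "restrict_tree t \<chi>" "restrict_tree t (compl_list \<chi>)"]
    by (simp add: tree_degree_restrict_compl[OF that] root_degree_restrict[OF that])
  then show ?case unfolding T.cpow.simps T.conv_def by (intro below_sum)
qed

text \<open>The first convolution power gives \<open>t\<close> itself with coefficient 1; the terms
  of higher power have at least two components unless they lose root branches.\<close>

lemma euler_leading:
  assumes "t \<noteq> empty_tree"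
  shows "euler t - (bas t :: _ \<Rightarrow>\<^sub>0 'k::field_char_0) \<in> below (tree_degree t) (root_degree t) 2"
proof -
  have deg: "0 < tree_degree t" using assms by (metis neq0_conv tree_degree_0_iff)
  let ?s = "\<lambda>j. smul (log_coeff j) (T.cpow J j t) :: _ \<Rightarrow>\<^sub>0 'k"
  have "T.cpow J 1 t = (J t :: _ \<Rightarrow>\<^sub>0 'k)" by (simp add: T.conv_eps_right)
  then have 1: "?s 1 = bas t" using assms by (simp add: log_coeff_def T.eps_def)
  have "{..tree_degree t} = {0, 1} \<union> {2..tree_degree t}" using deg by auto
  then have "euler t = (\<Sum>j\<in>{0, 1} \<union> {2..tree_degree t}. ?s j)" by (simp add: euler_def)
  also have "\<dots> = (\<Sum>j\<in>{0, 1}. ?s j) + (\<Sum>j\<in>{2..tree_degree t}. ?s j)" by (rule sum.union_disjoint) auto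
  also have "(\<Sum>j\<in>{0, 1}. ?s j) = ?s 0 + ?s 1" by simp
  also have "\<dots> = bas t" unfolding 1 by (simp add: log_coeff_def)
  finally have "euler t - bas t = (\<Sum>j\<in>{2..tree_degree t}. ?s j)" by simp
  moreover have "?s j \<in> below (tree_degree t) (root_degree t) 2" if "2 \<le> j" for j
    by (intro below_smul below_mono[OF cpow_J_below that])
  ultimately show ?thesis by (auto intro!: below_sum)
qed

text \<open>Each correction term either loses a root branch in a product or replaces one irreducible
  factor by something with at least two components; in both cases it drops strictly below the
  join.\<close>

lemma euler_prod_leading:
  "\<forall>w\<in>set ws. perm_irreducible w \<Longrightarrow>
    euler_prod ws - (bas (phi (backslash_list ws)) :: _ \<Rightarrow>\<^sub>0 'k::field_char_0) \<in>
      below (psize (backslash_list ws)) (root_degree (phi (backslash_list ws))) (Suc (length ws))"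
proof (induction ws)
  case Nil
  then show ?case by (simp add: phi_empty below_0)
next
  case (Cons w ws)
  let ?a = "phi w" and ?b = "phi (backslash_list ws)"
  define g :: "ho_tree \<Rightarrow>\<^sub>0 'k" where "g = euler ?a - bas ?a"
  define g' :: "ho_tree \<Rightarrow>\<^sub>0 'k" where "g' = euler_prod ws - bas ?b"
  let ?n = "psize w" and ?n' = "psize (backslash_list ws)" and ?r = "root_degree ?a" and ?r' = "root_degree ?b"
  let ?k = "length ws"
  have irr: "perm_irreducible w" "\<forall>w\<in>set ws. perm_irreducible w" using Cons.prems by auto
  have "?a \<noteq> empty_tree" using phi_inject[of w perm_empty] perm_irreducible_nonempty[OF irr(1)] by (simp add: phi_empty)
  then have g: "g \<in> below ?n ?r 2" using euler_leading[of ?a, where 'k = 'k] by (simp add: g_def phi_props)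
  have g': "g' \<in> below ?n' ?r' (Suc ?k)" using Cons.IH irr by (simp add: g'_def)
  have a: "(bas ?a :: _ \<Rightarrow>\<^sub>0 'k) \<in> below ?n ?r 1"
    using bas_below[of ?a] by (simp add: phi_props num_components_eq components_of_irreducible[OF irr(1)])
  have b: "(bas ?b :: _ \<Rightarrow>\<^sub>0 'k) \<in> below ?n' ?r' ?k"
    using bas_below[of ?b] by (simp add: phi_props num_components_eq components_backslash_list[OF irr(2)])
  have j: "tree_join ?a ?b = phi (backslash_list (w # ws))" by (simp add: tree_join_phi)
  have "euler_prod (w # ws) = (bas ?a + g) \<odot> (bas ?b + g')" by (simp add: g_def g'_def)
  also have "\<dots> = T_mult ?a ?b + bas ?a \<odot> g' + g \<odot> bas ?b + g \<odot> g'"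
    by (simp add: lin_add[OF lin_bilin_ext_left] lin_add[OF lin_bilin_ext_right])
  finally have "euler_prod (w # ws) - bas (phi (backslash_list (w # ws))) =
      (T_mult ?a ?b - bas (tree_join ?a ?b)) + bas ?a \<odot> g' + g \<odot> bas ?b + g \<odot> g'"
    unfolding j by simp
  moreover have "T_mult ?a ?b - (bas (tree_join ?a ?b) :: _ \<Rightarrow>\<^sub>0 'k) \<in> below (?n + ?n') (?r + ?r') (Suc (Suc ?k))"
    using T_mult_leading[of ?a ?b] by (simp add: phi_props)
  moreover have "bas ?a \<odot> g' \<in> below (?n + ?n') (?r + ?r') (Suc (Suc ?k))"
    using below_mult[OF a g'] by simp
  moreover have "g \<odot> bas ?b \<in> below (?n + ?n') (?r + ?r') (Suc (Suc ?k))"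
    using below_mult[OF g b] by simp
  moreover have "g \<odot> g' \<in> below (?n + ?n') (?r + ?r') (Suc (Suc ?k))"
    by (rule below_mono[OF below_mult[OF g g']]) simp
  ultimately have "euler_prod (w # ws) - (bas (phi (backslash_list (w # ws))) :: _ \<Rightarrow>\<^sub>0 'k) \<in> below (?n + ?n') (?r + ?r') (Suc (Suc ?k))"
    by (simp only: below_add)
  moreover have "root_degree (phi (backslash_list (w # ws))) = ?r + ?r'"
    unfolding j[symmetric] by (rule tree_join_props)
  ultimately show ?case by simp
qed

definition euler_perm :: "perm \<Rightarrow> (ho_tree \<Rightarrow>\<^sub>0 'k::field_char_0)" where
  "euler_perm w = euler_prod (components w)"

lemma euler_perm_backslash: "euler_perm (backslash u v) = euler_perm u \<odot> euler_perm v"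
  by (simp add: euler_perm_def euler_prod_append)

lemma euler_perm_empty: "euler_perm perm_empty = bas empty_tree"
  by (simp add: euler_perm_def)

lemma euler_perm_irreducible: "perm_irreducible w \<Longrightarrow> euler_perm w = euler (phi w)"
  by (simp add: euler_perm_def components_of_irreducible)

lemma euler_perm_leading:
  "euler_perm w - bas (phi w) \<in> below (psize w) (root_degree (phi w)) (Suc (num_components w))"
  using euler_prod_leading[of "components w"] by (simp add: euler_perm_def num_components_eq components_irreducible)

lemma euler_perm_degree: "t \<in> Poly_Mapping.keys (euler_perm w) \<Longrightarrow> tree_degree t = psize w"
proof -
  assume t: "t \<in> Poly_Mapping.keys (euler_perm w :: _ \<Rightarrow>\<^sub>0 'a)"
  have "(euler_perm w :: _ \<Rightarrow>\<^sub>0 'a) = (euler_perm w - bas (phi w)) + bas (phi w)" by simp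
  then have "t \<in> Poly_Mapping.keys (euler_perm w - bas (phi w) :: _ \<Rightarrow>\<^sub>0 'a) \<union> Poly_Mapping.keys (bas (phi w) :: _ \<Rightarrow>\<^sub>0 'a)"
    using t keys_add by (metis subsetD)
  then show ?thesis using euler_perm_leading[of w, where 'a = 'a] by (auto simp: below_def phi_props)
qed

text \<open>The lexicographic comparison within one degree, packed into a natural number. More
  components mean lower rank; the second summand is at most the degree, hence the weight
  \<open>Suc (tree_degree t)\<close> on the first.\<close>

definition tree_rank :: "ho_tree \<Rightarrow> nat" where
  "tree_rank t = root_degree t * Suc (tree_degree t) + (tree_degree t - tree_components t)"

lemma euler_perm_triangular:
  assumes "t \<in> Poly_Mapping.keys (euler_perm w - bas (phi w))"
  shows "tree_rank t < tree_rank (phi w)"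
proof -
  let ?n = "psize w" and ?r = "root_degree (phi w)" and ?k = "num_components w"
  have t: "tree_degree t = ?n" "root_degree t < ?r \<or> root_degree t = ?r \<and> Suc ?k \<le> tree_components t"
    using euler_perm_leading[of w] assms by (auto simp: below_def)
  from t(2) show ?thesis
  proof
    assume "root_degree t < ?r"
    then have "Suc (root_degree t) * Suc ?n \<le> ?r * Suc ?n" by (intro mult_le_mono1) simp
    then show ?thesis by (simp add: tree_rank_def t(1) phi_props)
  next
    assume *: "root_degree t = ?r \<and> Suc ?k \<le> tree_components t"
    then have "?n - tree_components t < ?n - ?k"
      using tree_components_le[of t] t(1) by (intro diff_less_mono2) auto
    then show ?thesis using * by (simp add: tree_rank_def t(1) phi_props)
  qed
qed

text \<open>A map unitriangular relative to \<phi> and the rank \<open>m\<close>. For injectivity, a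
  key of maximal rank in a kernel element survives; for surjectivity, the correction terms have
  smaller rank and are reached by induction. The basis may be infinite.\<close>

lemma bij_lin_ext_triangular:
  fixes f :: "'b \<Rightarrow> ('c \<Rightarrow>\<^sub>0 'k::field)" and m :: "'c \<Rightarrow> nat"
  assumes \<phi>: "bij \<phi>" and tri: "\<And>b c. c \<in> Poly_Mapping.keys (f b - bas (\<phi> b)) \<Longrightarrow> m c < m (\<phi> b)"
  shows "bij (lin_ext smul f)"
proof (rule bijI)
  note lin = lin_lin_ext_smul[of f]
  have tri': "Poly_Mapping.lookup (f b) c = (if c = \<phi> b then 1 else 0)" if "\<not> m c < m (\<phi> b)" for b c
  proof -
    have "Poly_Mapping.lookup (f b - bas (\<phi> b)) c = 0" using tri that by (metis in_keys_iff)
    then show ?thesis by (simp add: lookup_minus lookup_single when_def split: if_splits)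
  qed
  show "inj (lin_ext smul f)"
  proof (rule injI)
    fix x y :: "'b \<Rightarrow>\<^sub>0 'k" assume eq: "lin_ext smul f x = lin_ext smul f y"
    define d where "d = x - y"
    have d0: "lin_ext smul f d = 0" by (simp add: d_def lin_diff[OF lin] eq)
    have "d = 0"
    proof (rule ccontr)
      assume "d \<noteq> 0"
      then have ne: "m ` \<phi> ` Poly_Mapping.keys d \<noteq> {}" by simp
      then have "Max (m ` \<phi> ` Poly_Mapping.keys d) \<in> m ` \<phi> ` Poly_Mapping.keys d" by (intro Max_in) auto
      then obtain b where b: "b \<in> Poly_Mapping.keys d" "Max (m ` \<phi> ` Poly_Mapping.keys d) = m (\<phi> b)" by blast
      have max: "m (\<phi> b') \<le> m (\<phi> b)" if "b' \<in> Poly_Mapping.keys d" for b'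
        using that unfolding b(2)[symmetric] by (intro Max_ge) auto
      have "0 = (\<Sum>b'\<in>Poly_Mapping.keys d. Poly_Mapping.lookup d b' * Poly_Mapping.lookup (f b') (\<phi> b))"
        using arg_cong[OF d0, of "\<lambda>x. Poly_Mapping.lookup x (\<phi> b)"] by (simp add: lin_ext_def lookup_sum)
      also have "\<dots> = (\<Sum>b'\<in>Poly_Mapping.keys d. if b' = b then Poly_Mapping.lookup d b else 0)"
      proof (rule sum.cong[OF refl])
        fix b' assume "b' \<in> Poly_Mapping.keys d"
        then have "\<not> m (\<phi> b) < m (\<phi> b')" using max by (simp add: not_less)
        moreover have "\<phi> b = \<phi> b' \<longleftrightarrow> b' = b" using \<phi> by (auto simp: bij_def inj_def)
        ultimately show "Poly_Mapping.lookup d b' * Poly_Mapping.lookup (f b') (\<phi> b) = (if b' = b then Poly_Mapping.lookup d b else 0)"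
          by (simp add: tri')
      qed
      also have "\<dots> = Poly_Mapping.lookup d b" using b(1) by simp
      finally show False using b(1) by (simp add: in_keys_iff)
    qed
    then show "x = y" by (simp add: d_def)
  qed
  have range_bas: "bas c \<in> range (lin_ext smul f)" for c
  proof (induction "m c" arbitrary: c rule: less_induct)
    case less
    obtain b where b: "c = \<phi> b" using \<phi> by (meson bij_pointE)
    have "\<exists>y. bas c' = lin_ext smul f y" if "c' \<in> Poly_Mapping.keys (f b - bas (\<phi> b))" for c'
      using less[of c'] tri[OF that] b by blast
    then obtain g where g: "\<And>c'. c' \<in> Poly_Mapping.keys (f b - bas (\<phi> b)) \<Longrightarrow> bas c' = lin_ext smul f (g c')"
      by metis
    have "f b - bas (\<phi> b) = lin_ext smul f (\<Sum>c'\<in>Poly_Mapping.keys (f b - bas (\<phi> b)).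
        smul (Poly_Mapping.lookup (f b - bas (\<phi> b)) c') (g c'))"
      unfolding lin_sum[OF lin] lin_scale[OF lin] by (subst bas_expand) (simp add: g)
    then obtain y where "f b - bas (\<phi> b) = lin_ext smul f y" by blast
    then have "bas c = lin_ext smul f (bas b - y)" by (simp add: b lin_diff[OF lin] algebra_simps)
    then show ?case by blast
  qed
  show "surj (lin_ext smul f)"
  unfolding surj_def
  proof (intro allI)
    fix x :: "'c \<Rightarrow>\<^sub>0 'k"
    have "\<forall>c. \<exists>y. bas c = lin_ext smul f y" using range_bas by (auto simp: image_iff)
    then obtain g where g: "\<And>c. bas c = lin_ext smul f (g c)" by (auto dest: choice)
    have "x = lin_ext smul f (\<Sum>c\<in>Poly_Mapping.keys x. smul (Poly_Mapping.lookup x c) (g c))"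
      unfolding lin_sum[OF lin] lin_scale[OF lin] g[symmetric] by (rule bas_expand)
    then show "\<exists>y. x = lin_ext smul f y" by blast
  qed
qed

lemma bij_euler_perm: "bij (lin_ext smul euler_perm)"
  by (rule bij_lin_ext_triangular[OF bij_phi, of _ tree_rank]) (rule euler_perm_triangular)

section \<open>The isomorphism\<close>

lemma keys_in_span_iff:
  "x \<in> smul.span {bas t | t. P t} \<longleftrightarrow> (\<forall>t\<in>Poly_Mapping.keys x. P t)"
proof
  assume "x \<in> smul.span {bas t | t. P t}"
  moreover have "smul.span {bas t | t. P t} \<subseteq> {x. \<forall>t\<in>Poly_Mapping.keys x. P t}"
  proof (rule smul.span_minimal)
    show "smul.subspace {x. \<forall>t\<in>Poly_Mapping.keys x. P t}"
    proof (rule smul.subspaceI)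
      show "x + y \<in> {x. \<forall>t\<in>Poly_Mapping.keys x. P t}"
        if "x \<in> {x. \<forall>t\<in>Poly_Mapping.keys x. P t}" "y \<in> {x. \<forall>t\<in>Poly_Mapping.keys x. P t}" for x y
        using that keys_add[of x y] by blast
    qed (auto simp: in_keys_iff)
  qed auto
  ultimately show "\<forall>t\<in>Poly_Mapping.keys x. P t" by blast
next
  assume *: "\<forall>t\<in>Poly_Mapping.keys x. P t"
  show "x \<in> smul.span {bas t | t. P t}"
    by (subst bas_expand) (intro smul.span_sum smul.span_scale smul.span_base, use * in blast)
qed

text \<open>A linear map sends multilinearity relations to multilinearity relations, so it acts on
  tensors and not merely on their representatives.\<close>

lemma tensor_map_cong:
  fixes f :: "'v::ab_group_add \<Rightarrow> 'w::ab_group_add" and t u :: "('v, 'k::field) tensor"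
  assumes f: "lin s s' f" and "tensor_eq s t u"
  shows "tensor_eq s' (tensor_map f t) (tensor_map f u)"
proof -
  have "smul.span ({bas (xs @ (a + b) # ys) - bas (xs @ a # ys) - bas (xs @ b # ys) |xs a b ys. True} \<union>
        {bas (xs @ s c a # ys) - smul c (bas (xs @ a # ys)) |xs c a ys. True}) \<subseteq> {t. tensor_map f t \<in> tensor_rel s'}"
    unfolding tensor_map_def
  proof (rule smul.span_minimal)
    show "smul.subspace {t. lin_ext smul (\<lambda>l. bas (map f l)) t \<in> tensor_rel s'}"
      by (rule smul.subspaceI)
        (simp_all add: lin_ext_smul_simps smul.subspace_0 smul.subspace_add smul.subspace_scale subspace_tensor_rel)
    show "{bas (xs @ (a + b) # ys) - bas (xs @ a # ys) - bas (xs @ b # ys) |xs a b ys. True} \<union>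
        {bas (xs @ s c a # ys) - smul c (bas (xs @ a # ys)) |xs c a ys. True}
        \<subseteq> {t. lin_ext smul (\<lambda>l. bas (map f l)) t \<in> tensor_rel s'}"
      using tensor_eq_slot_add[of s'] tensor_eq_slot_scale[of s']
      by (auto simp: lin_ext_smul_simps tensor_eq_def diff_diff_eq lin_add[OF f] lin_scale[OF f])
  qed
  then have "tensor_rel s \<subseteq> {t. tensor_map f t \<in> tensor_rel s'}" by (subst tensor_rel_def)
  then show ?thesis using assms(2) by (auto simp: tensor_eq_def tensor_map_def simp flip: lin_ext_smul_simps(4))
qed

abbreviation pair_tensor :: "(ho_tree \<times> ho_tree \<Rightarrow>\<^sub>0 'k::field) \<Rightarrow> (ho_tree \<Rightarrow>\<^sub>0 'k, 'k) tensor" where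
  "pair_tensor \<equiv> lin_ext smul (\<lambda>p. bas [bas (fst p), bas (snd p)])"

lemma comult_eq_pair_tensor: "hcomult H_HO x = pair_tensor (Delta (x :: _ \<Rightarrow>\<^sub>0 'k::field))"
proof -
  have "T_comult = (\<lambda>t. pair_tensor (tree_pairs t) :: (_ \<Rightarrow>\<^sub>0 'k, 'k) tensor)"
    by (intro ext) (simp add: T_comult_restrict_tree tree_pairs_def lin_sum[OF lin_lin_ext_smul])
  then show ?thesis by (simp add: lin_ext_lin[OF lin_lin_ext_smul])
qed

lemma pair_tensor_ten: "tensor_eq smul (pair_tensor (ten x y)) (bas [x, y :: _ \<Rightarrow>\<^sub>0 'k::field])"
proof -
  let ?X = "Poly_Mapping.keys x" and ?Y = "Poly_Mapping.keys y"
  let ?x = "Poly_Mapping.lookup x" and ?y = "Poly_Mapping.lookup y"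
  have "tensor_eq smul (bas ([] @ (\<Sum>a\<in>?X. smul (?x a) (bas a)) # [y])) (\<Sum>a\<in>?X. smul (?x a) (bas ([] @ bas a # [y])))"
    by (rule tensor_eq_slot_sum[OF vector_space_smul]) simp
  then have "tensor_eq smul (bas [x, y]) (\<Sum>a\<in>?X. smul (?x a) (bas [bas a, y]))"
    by (simp flip: bas_expand)
  also have "tensor_eq smul \<dots> (\<Sum>a\<in>?X. smul (?x a) (\<Sum>b\<in>?Y. smul (?y b) (bas [bas a, bas b])))"
  proof (intro tensor_eq_sum tensor_eq_smul)
    fix a
    have "tensor_eq smul (bas ([bas a] @ (\<Sum>b\<in>?Y. smul (?y b) (bas b)) # [])) (\<Sum>b\<in>?Y. smul (?y b) (bas ([bas a] @ bas b # [])))"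
      by (rule tensor_eq_slot_sum[OF vector_space_smul]) simp
    then show "tensor_eq smul (bas [bas a, y]) (\<Sum>b\<in>?Y. smul (?y b) (bas [bas a, bas b]))"
      by (simp flip: bas_expand)
  qed
  also have "(\<Sum>a\<in>?X. smul (?x a) (\<Sum>b\<in>?Y. smul (?y b) (bas [bas a, bas b]))) = pair_tensor (ten x y)"
    unfolding ten_def bilin_ext_def lin_ext_lin[OF lin_lin_ext_smul] by (simp add: lin_ext_def[of _ _ x] lin_ext_def[of _ _ y])
  finally show ?thesis by (rule tensor_eq_sym)
qed

lemma tensor_eq_sum_list:
  "(\<And>i. i \<in> set is \<Longrightarrow> tensor_eq s (f i) (g i)) \<Longrightarrow> tensor_eq s (\<Sum>i\<leftarrow>is. f i) (\<Sum>i\<leftarrow>is. g i)"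
  by (induction "is") (auto intro: tensor_eq_refl tensor_eq_add)

lemma comult_euler_perm:
  "tensor_eq smul (hcomult H_HO (euler_perm w))
    (\<Sum>(p, q)\<leftarrow>unshuffles (components w). bas [euler_perm (backslash_list p), euler_perm (backslash_list q) :: _ \<Rightarrow>\<^sub>0 'k::field_char_0])"
proof -
  have "hcomult H_HO (euler_perm w) =
      (\<Sum>z\<leftarrow>unshuffles (components w). pair_tensor (ten (euler_prod (fst z)) (euler_prod (snd z) :: _ \<Rightarrow>\<^sub>0 'k)))"
    unfolding comult_eq_pair_tensor euler_perm_def Delta_euler_prod
    by (simp add: lin_sum_list[OF lin_lin_ext_smul] case_prod_unfold o_def)
  also have "tensor_eq smul \<dots> (\<Sum>z\<leftarrow>unshuffles (components w). bas [euler_perm (backslash_list (fst z)), euler_perm (backslash_list (snd z))])"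
  proof (rule tensor_eq_sum_list)
    fix z assume "z \<in> set (unshuffles (components w))"
    then have "set (fst z) \<subseteq> set (components w)" "set (snd z) \<subseteq> set (components w)"
      using unshuffles_set[of "fst z" "snd z"] by auto
    then have "components (backslash_list (fst z)) = fst z" "components (backslash_list (snd z)) = snd z"
      using components_irreducible by (auto intro!: components_backslash_list)
    then show "tensor_eq smul (pair_tensor (ten (euler_prod (fst z)) (euler_prod (snd z) :: _ \<Rightarrow>\<^sub>0 'k)))
        (bas [euler_perm (backslash_list (fst z)), euler_perm (backslash_list (snd z))])"
      using pair_tensor_ten[of "euler_prod (fst z)" "euler_prod (snd z)"] by (simp add: euler_perm_def)
  qed
  finally show ?thesis by (simp add: case_prod_unfold)
qed

section \<open>The map \<open>Phi\<close> and its compatibility with the structure\<close>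

definition Phi :: "'k::field_char_0 gr_dual \<Rightarrow> (ho_tree \<Rightarrow>\<^sub>0 'k)" where
  "Phi f = lin_ext smul euler_perm (dual_coeff f)"

lemma lin_Phi: "lin dual_scale smul Phi"
  unfolding Phi_def by (rule lin_comp[OF lin_dual_coeff lin_lin_ext_smul])

lemma Phi_M_dual: "Phi (M_dual w) = euler_perm w"
  by (simp add: Phi_def)

lemma bij_Phi: "bij (Phi :: 'k::field_char_0 gr_dual \<Rightarrow> _)"
proof -
  have *: "(Phi :: 'k gr_dual \<Rightarrow> _) = lin_ext smul euler_perm \<circ> dual_coeff" by (simp add: fun_eq_iff Phi_def)
  show ?thesis unfolding * by (rule bij_comp[OF bij_dual_coeff bij_euler_perm])
qed

lemma Phi_mult: "Phi (dual_mult f g) = Phi f \<odot> Phi g"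
proof -
  have "lin_ext smul euler_perm (lin_ext smul (\<lambda>u. lin_ext smul (\<lambda>v. bas (backslash u v)) y) x) =
      lin_ext smul euler_perm x \<odot> (lin_ext smul euler_perm y :: _ \<Rightarrow>\<^sub>0 'a)" for x y
    unfolding lin_ext_lin[OF lin_lin_ext_smul] lin_ext_lin[OF lin_bilin_ext_left]
    by (simp add: lin_ext_lin[OF lin_bilin_ext_right] euler_perm_backslash)
  then show ?thesis by (simp add: Phi_def dual_mult_eq)
qed

lemma Phi_counit:
  fixes f :: "'k::field_char_0 gr_dual"
  shows "Poly_Mapping.lookup (Phi f) empty_tree = ev f (M_gr perm_empty)"
proof -
  have e: "Poly_Mapping.lookup (euler_perm w :: _ \<Rightarrow>\<^sub>0 'k) empty_tree = (if w = perm_empty then 1 else 0)" for w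
  proof (cases "w = perm_empty")
    case False
    then have "empty_tree \<notin> Poly_Mapping.keys (euler_perm w :: _ \<Rightarrow>\<^sub>0 'k)"
      using euler_perm_degree[of empty_tree w] by auto
    then show ?thesis using False by (simp add: in_keys_iff)
  qed (simp add: euler_perm_empty)
  have "Poly_Mapping.lookup (Phi f) empty_tree = (\<Sum>w\<in>Poly_Mapping.keys (dual_coeff f). if w = perm_empty then ev f (M_gr perm_empty) else 0)"
    by (simp add: Phi_def lin_ext_def lookup_sum e if_distrib cong: if_cong)
  also have "\<dots> = ev f (M_gr perm_empty)" by (simp add: in_keys_iff)
  finally show ?thesis .
qed

lemma Phi_comult:
  fixes f :: "'k::field_char_0 gr_dual"
  shows "tensor_eq smul (tensor_map Phi (dual_comult f)) (hcomult H_HO (Phi f))"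
proof -
  let ?S = "\<lambda>w. \<Sum>z\<leftarrow>unshuffles (components w). bas [euler_perm (backslash_list (fst z)), euler_perm (backslash_list (snd z))]
     :: (ho_tree \<Rightarrow>\<^sub>0 'k, 'k) tensor"
  have lm: "lin smul smul (tensor_map (Phi :: 'k gr_dual \<Rightarrow> _))" unfolding tensor_map_def by (rule lin_lin_ext_smul)
  have lc: "lin smul smul (hcomult (H_HO :: (_ \<Rightarrow>\<^sub>0 'k, 'k) hopf))" by (simp add: lin_lin_ext_smul)
  have "tensor_eq smul (tensor_map Phi (dual_comult f)) (lin_ext smul ?S (dual_coeff f))"
    using tensor_map_cong[OF lin_Phi dual_comult_eq[of f]]
    unfolding lin_ext_lin[OF lm] lin_sum_list[OF lm] case_prod_unfold
    by (simp add: o_def tensor_map_def Phi_M_dual)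
  also have "tensor_eq smul (lin_ext smul ?S (dual_coeff f)) (lin_ext smul (\<lambda>w. hcomult H_HO (euler_perm w)) (dual_coeff f))"
    unfolding lin_ext_def
    by (intro tensor_eq_sum tensor_eq_smul tensor_eq_sym[OF comult_euler_perm[unfolded case_prod_unfold]])
  also have "lin_ext smul (\<lambda>w. hcomult H_HO (euler_perm w)) (dual_coeff f) = hcomult H_HO (Phi f)"
    unfolding Phi_def by (rule lin_ext_lin[OF lc, symmetric])
  finally show ?thesis .
qed

lemma Phi_degree: "(Phi :: 'k::field_char_0 gr_dual \<Rightarrow> _) ` hdeg gr_SSym_dual n = hdeg H_HO n"
proof (intro equalityI subsetI)
  fix x assume "x \<in> (Phi :: 'k gr_dual \<Rightarrow> _) ` hdeg gr_SSym_dual n"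
  then obtain f :: "'k gr_dual" where f: "\<forall>w\<in>Poly_Mapping.keys (dual_coeff f). psize w = n" "x = Phi f"
    by (auto simp: dual_hdeg_iff simp del: gr_SSym_dual_sel)
  show "x \<in> hdeg H_HO n"
    unfolding H_HO_sel keys_in_span_iff f(2) Phi_def
  proof
    fix t assume "t \<in> Poly_Mapping.keys (lin_ext smul euler_perm (dual_coeff f))"
    then obtain w where w: "w \<in> Poly_Mapping.keys (dual_coeff f)"
        "t \<in> Poly_Mapping.keys (euler_perm w :: _ \<Rightarrow>\<^sub>0 'k)"
      using keys_lin_ext[of euler_perm "dual_coeff f"] by blast
    show "tree_degree t = n" using euler_perm_degree[OF w(2)] f(1) w(1) by simp
  qed
next
  fix x assume "x \<in> hdeg (H_HO :: (_ \<Rightarrow>\<^sub>0 'k, 'k) hopf) n"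
  then have x: "\<And>t. t \<in> Poly_Mapping.keys x \<Longrightarrow> tree_degree t = n" by (simp add: keys_in_span_iff)
  obtain f where f: "Phi f = x" using surjD[OF bij_is_surj[OF bij_Phi], of x] by auto
  \<comment> \<open>The degree \<open>n\<close> part of the coefficients of a preimage. Each
    \<open>euler_perm w\<close> is homogeneous of degree \<open>psize w\<close>, so dropping the
    other coefficients does not change the image \<open>x\<close>, which is homogeneous of degree
    \<open>n\<close>.\<close>
  define p where "p = (\<Sum>w | w \<in> Poly_Mapping.keys (dual_coeff f) \<and> psize w = n. smul (Poly_Mapping.lookup (dual_coeff f) w) (bas w))"
  have kp: "psize w = n" if "w \<in> Poly_Mapping.keys p" for w
  proof -
    have "w \<in> (\<Union>v\<in>{w \<in> Poly_Mapping.keys (dual_coeff f). psize w = n}. Poly_Mapping.keys (smul (Poly_Mapping.lookup (dual_coeff f) v) (bas v)))"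
      using that unfolding p_def by (rule subsetD[OF keys_sum])
    then show ?thesis by (auto simp: in_keys_iff lookup_single when_def split: if_splits)
  qed
  have lp: "lin_ext smul euler_perm p = (\<Sum>w | w \<in> Poly_Mapping.keys (dual_coeff f) \<and> psize w = n. smul (Poly_Mapping.lookup (dual_coeff f) w) (euler_perm w))"
    by (simp add: p_def lin_sum[OF lin_lin_ext_smul] lin_scale[OF lin_lin_ext_smul])
  have "lin_ext smul euler_perm p = x"
  proof (rule poly_mapping_eqI)
    fix t
    show "Poly_Mapping.lookup (lin_ext smul euler_perm p) t = Poly_Mapping.lookup x t"
    proof (cases "tree_degree t = n")
      case True
      then have z: "Poly_Mapping.lookup (euler_perm w :: _ \<Rightarrow>\<^sub>0 'k) t = 0" if "psize w \<noteq> n" for w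
        using euler_perm_degree[of t w, where 'a = 'k] that by (auto simp: in_keys_iff)
      have "Poly_Mapping.lookup x t = (\<Sum>w\<in>Poly_Mapping.keys (dual_coeff f). ev f (M_gr w) * Poly_Mapping.lookup (euler_perm w :: _ \<Rightarrow>\<^sub>0 'k) t)"
        by (simp add: f[symmetric] Phi_def lin_ext_def lookup_sum)
      also have "\<dots> = (\<Sum>w | w \<in> Poly_Mapping.keys (dual_coeff f) \<and> psize w = n. ev f (M_gr w) * Poly_Mapping.lookup (euler_perm w :: _ \<Rightarrow>\<^sub>0 'k) t)"
        by (rule sum.mono_neutral_right) (auto simp: z)
      finally show ?thesis by (simp add: lp lookup_sum)
    next
      case False
      have "t \<notin> Poly_Mapping.keys (lin_ext smul euler_perm p)"
      proof
        assume "t \<in> Poly_Mapping.keys (lin_ext smul euler_perm p)"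
        then obtain w where w: "w \<in> Poly_Mapping.keys p" "t \<in> Poly_Mapping.keys (euler_perm w :: _ \<Rightarrow>\<^sub>0 'k)"
          using keys_lin_ext[of euler_perm p] by blast
        then show False using euler_perm_degree[OF w(2)] kp[OF w(1)] False by simp
      qed
      moreover have "t \<notin> Poly_Mapping.keys x" using x False by blast
      ultimately show ?thesis by (simp add: in_keys_iff)
    qed
  qed
  then have "Phi (dual_of p) = x" by (simp add: Phi_def)
  moreover have "dual_of p \<in> hdeg gr_SSym_dual n" unfolding dual_hdeg_iff using kp by simp
  ultimately show "x \<in> Phi ` hdeg gr_SSym_dual n" by blast
qed

lemma graded_hopf_iso_Phi: "graded_hopf_iso gr_SSym_dual H_HO Phi"
  unfolding graded_hopf_iso_def
proof (intro conjI allI)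
  show "Vector_Spaces.linear (hscale gr_SSym_dual) (hscale H_HO) Phi"
    using lin_Phi by (simp add: lin_iff_linear[OF vector_space_dual_scale vector_space_smul])
  show "Phi (hone gr_SSym_dual) = hone H_HO"
    by (simp add: dual_one Phi_M_dual euler_perm_empty)
qed (simp_all add: bij_Phi Phi_mult Phi_counit Phi_comult[unfolded H_HO_sel] Phi_degree del: H_HO_sel(6) gr_SSym_dual_sel(5))

lemma M_dual_backslash: "M_dual (backslash u v) = dual_mult (M_dual u) (M_dual v)"
  by (simp add: dual_mult_eq M_dual_eq)

theorem theorem3p4:
  shows "\<exists>!\<Phi> :: 'k::field_char_0 gr_dual \<Rightarrow> (ho_tree \<Rightarrow>\<^sub>0 'k).
           graded_hopf_iso gr_SSym_dual H_HO \<Phi> \<and>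
           (\<forall>w. perm_irreducible w \<longrightarrow> \<Phi> (M_dual w) = eulerian_idem H_HO (bas (phi w)))"
proof (rule ex1I[of _ Phi])
  show "graded_hopf_iso gr_SSym_dual H_HO Phi \<and>
      (\<forall>w. perm_irreducible w \<longrightarrow> Phi (M_dual w) = eulerian_idem H_HO (bas (phi w)))"
    by (simp add: graded_hopf_iso_Phi Phi_M_dual eulerian_idem_bas euler_perm_irreducible)
next
  fix \<Phi> :: "'k gr_dual \<Rightarrow> (ho_tree \<Rightarrow>\<^sub>0 'k)"
  assume \<Phi>: "graded_hopf_iso gr_SSym_dual H_HO \<Phi> \<and>
      (\<forall>w. perm_irreducible w \<longrightarrow> \<Phi> (M_dual w) = eulerian_idem H_HO (bas (phi w)))"
  have lin: "lin dual_scale smul \<Phi>"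
    using \<Phi> by (simp add: graded_hopf_iso_def lin_iff_linear[OF vector_space_dual_scale vector_space_smul])
  have one: "\<Phi> (M_dual perm_empty) = bas empty_tree" and mult: "\<Phi> (dual_mult f g) = \<Phi> f \<odot> \<Phi> g" for f g
    using \<Phi> by (simp_all add: graded_hopf_iso_def dual_one)
  \<comment> \<open>The dual basis is multiplicative for \<open>backslash\<close>, so the values on
    irreducible permutations and on the unit force the value on every product of components.\<close>
  have "\<Phi> (M_dual (backslash_list ws)) = euler_prod ws" if "\<forall>w\<in>set ws. perm_irreducible w" for ws
    using that by (induction ws) (simp_all add: one M_dual_backslash mult \<Phi> eulerian_idem_bas)
  then have M: "\<Phi> (M_dual w) = Phi (M_dual w)" for w
    unfolding Phi_M_dual euler_perm_def by (metis backslash_list_components components_irreducible)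
  show "\<Phi> = Phi"
  proof
    fix f
    have "\<Phi> (dual_of p) = Phi (dual_of p)" for p
      by (rule lin_eqI[of smul "\<lambda>p. \<Phi> (dual_of p)" "\<lambda>p. Phi (dual_of p)"])
        (use lin_comp[OF lin_dual_of lin] lin_comp[OF lin_dual_of lin_Phi] M in \<open>simp_all add: M_dual_eq\<close>)
    from this[of "dual_coeff f"] show "\<Phi> f = Phi f" by simp
  qed
qed

end
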